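(* Let $A$ be the preprojective algebra of a (non-labelled) connected finite graph $\Delta$ distinct from $\mathrm{A}_1$ and $\mathrm{A}_2$, over a field $\mathbb{F}$. Let $M$ be an $A$-bimodule. (i) The Koszul bimodule complex $K(A)$ of $A$ has length $2$. In particular, $\mathrm{HK}^p(A,M)=\mathrm{HK}_p(A,M)=0$ for any $p>2$. (ii) The graded $\mathrm{HK}^{\bullet}(A)$-bimodules $\mathrm{HK}^{\bullet}(A,M)$ and $\mathrm{HK}_{2-\bullet}(A,M)$ are isomorphic. (iii) The graded $\mathrm{HK}^{\bullet}_{hi}(A)$-bimodules $\mathrm{HK}^{\bullet}_{hi}(A,M)$ and $\mathrm{HK}^{hi}_{2-\bullet}(A,M)$ are isomorphic.
   Context: Preprojective algebra. $\Delta$ is a connected graph with finite vertex and edge sets (loops and multiple edges allowed, no labels). $\mathrm{A}_1$ is one vertex without edge; $\mathrm{A}_2$ is two vertices joined by one edge. Let $Q$ be a quiver with underlying graph $\Delta$; $\mathfrak{s},\mathfrak{t}$ denote source and target. For each $a\in Q_1$ add an arrow $a^*$ with $\mathfrak{s}(a^* )=\mathfrak{t}(a)$, $\mathfrak{t}(a^* )=\mathfrak{s}(a)$, giving the double quiver $\overline{Q}$ with $\overline{Q}_0=Q_0$, $\overline{Q}_1=Q_1\sqcup Q_1^*$; $(-)^*$ is regarded as an involution of $\overline{Q}_1$. Put $\varepsilon(a)=1$ if $a\in Q_1$ and $\varepsilon(a)=-1$ if $a\in Q_1^*$. Paths are written from right to left. Let $k=\mathbb{F}Q_0$ with orthogonal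 idempotents $e_i$ ($i\in Q_0$), $V=\mathbb{F}\overline{Q}_1$ (a $k$-bimodule with $e_jae_i=a$ if $i=\mathfrak{s}(a)$, $j=\mathfrak{t}(a)$, and $0$ otherwise), so that $T_k(V)\cong\mathbb{F}\overline{Q}$. Let $R\subseteq V\otimes_kV$ be spanned by $\sigma_i=\sum_{a\in\overline{Q}_1,\ \mathfrak{t}(a)=i}\varepsilon(a)aa^*$, $i\in Q_0$. Then $A=T_k(V)/(R)$ (up to isomorphism it depends only on $\Delta$). Koszul calculus. $\otimes=\otimes_{\mathbb{F}}$, $A^e=A\otimes A^{op}$, $k^e=k\otimes k$. $A$-bimodules are $\mathbb{F}$-symmetric. Put $W_0=k$, $W_1=V$, $W_p=\bigcap_{i+2+j=p}V^{\otimes_k i}\otimes_kR\otimes_kV^{\otimes_k j}$ for $p\geq2$; an element of $W_p$ is written $x_1\ldots x_p$ (a sum of such products is understood). $K(A)$ is the complex of $A$-bimodules $K(A)_p=A\otimes_kW_p\otimes_kA$ with $d(a\otimes_k x_1\ldots x_p\otimes_k a')=ax_1\otimes_k x_2\ldots x_p\otimes_k a'+(-1)^pa\otimes_k x_1\ldots x_{p-1}\otimes_k x_pa'$. It has length $n$ if $K(A)_n\neq 0$ and $K(A)_p=0$ for $p>n$. For an $A$-bimodule $M$: $\mathrm{HK}_\bullet(A,M)=H_\bullet(M\otimes_{A^e}K(A))\cong H_\bullet(M\otimes_{k^e}W_\bullet,b^K)$ and $\mathrm{HK}^\bullet(A,M)=H^\bullet(\mathrm{Hom}_{A^e}(K(A),M))\cong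 H^\bullet(\mathrm{Hom}_{k^e}(W_\bullet,M),b_K)$, where $b^K(m\otimes x_1\ldots x_p)=mx_1\otimes x_2\ldots x_p+(-1)^px_pm\otimes x_1\ldots x_{p-1}$ and, for $f:W_p\to M$, $b_K(f)(x_1\ldots x_{p+1})=f(x_1\ldots x_p)x_{p+1}-(-1)^px_1f(x_2\ldots x_{p+1})$. Write $\mathrm{HK}^\bullet(A)=\mathrm{HK}^\bullet(A,A)$. For $f:W_p\to P$, $g:W_q\to N$ and $z=m\otimes x_1\ldots x_q\in M\otimes_{k^e}W_q$ ($P,N,M$ bimodules), the Koszul cup and cap products are $(f\smile g)(x_1\ldots x_{p+q})=(-1)^{pq}f(x_1\ldots x_p)\otimes_Ag(x_{p+1}\ldots x_{p+q})$, $f\frown z=(-1)^{(q-p)p}(f(x_{q-p+1}\ldots x_q)\otimes_Am)\otimes x_1\ldots x_{q-p}$, $z\frown f=(-1)^{pq}(m\otimes_Af(x_1\ldots x_p))\otimes x_{p+1}\ldots x_q$ (zero if $p>q$). They pass to (co)homology; $\mathrm{HK}^\bullet(A)$ is a graded algebra under $\smile$, and $\mathrm{HK}^\bullet(A,M)$, $\mathrm{HK}_\bullet(A,M)$ are graded $\mathrm{HK}^\bullet(A)$-bimodules via $\smile$ and $\frown$ respectively. $\mathrm{HK}_{2-\bullet}(A,M)$ has degree $p$ component $\mathrm{HK}_{2-p}(A,M)$. Higher calculus. Let $\mathfrak{e}_A:V\to A$ be the $1$-cocycle $\mathfrak{e}_A(x)=x$, with class $\overline{\mathfrak{e}}_A\in\mathrm{HK}^1(A)$;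 one has $\mathfrak{e}_A\smile\mathfrak{e}_A=0$. $\mathrm{HK}^\bullet_{hi}(A,M)$ is the cohomology of $(\mathrm{HK}^\bullet(A,M),\overline{\mathfrak{e}}_A\smile-)$ and $\mathrm{HK}_\bullet^{hi}(A,M)$ is the homology of $(\mathrm{HK}_\bullet(A,M),\overline{\mathfrak{e}}_A\frown-)$; $\mathrm{HK}^\bullet_{hi}(A)=\mathrm{HK}^\bullet_{hi}(A,A)$. The cup and cap actions induce a graded algebra structure on $\mathrm{HK}^\bullet_{hi}(A)$ and graded $\mathrm{HK}^\bullet_{hi}(A)$-bimodule structures on $\mathrm{HK}^\bullet_{hi}(A,M)$ and $\mathrm{HK}^{hi}_\bullet(A,M)$. *)

theory Defs
  imports
    "HOL-Library.Poly_Mapping"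
    "Graph_Theory.Digraph_Component"
    "HOL-Algebra.QuotRing"
    "HOL-Algebra.Module"
begin

section \<open>Vector spaces, quotients, tensor products and Hom spaces\<close>

text \<open>
  Vector spaces over the field given by the type \<open>'f\<close> are carrier-based, in the record type
  \<open>('f, 'm) module\<close> of HOL-Algebra. For an \<open>'f\<close>-algebra the fields \<open>mult\<close> and \<open>one\<close> are the
  multiplication and the unit; for a mere vector space they are \<open>undefined\<close>.
\<close>

definition field_ring :: "'f::field ring" where
  "field_ring = \<lparr>carrier = UNIV, mult = (*), one = 1, zero = 0, add = (+)\<rparr>"

abbreviation is_vector_space :: "('f::field, 'm, 'z) module_scheme \<Rightarrow> bool" where
  "is_vector_space V \<equiv> Module.module field_ring V"

definition trivial_space :: "('f, 'm, 'z) module_scheme \<Rightarrow> bool" where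
  "trivial_space V \<longleftrightarrow> carrier V = {\<zero>\<^bsub>V\<^esub>}"

definition linear_iso ::
    "('f, 'm, 'y) module_scheme \<Rightarrow> ('f, 'n, 'z) module_scheme \<Rightarrow> ('m \<Rightarrow> 'n) \<Rightarrow> bool" where
  "linear_iso V W h \<longleftrightarrow> bij_betw h (carrier V) (carrier W) \<and>
     (\<forall>x\<in>carrier V. \<forall>y\<in>carrier V. h (x \<oplus>\<^bsub>V\<^esub> y) = h x \<oplus>\<^bsub>W\<^esub> h y) \<and>
     (\<forall>c. \<forall>x\<in>carrier V. h (c \<odot>\<^bsub>V\<^esub> x) = c \<odot>\<^bsub>W\<^esub> h x)"

definition quotient_space :: "('f, 'm, 'z) module_scheme \<Rightarrow> 'm set \<Rightarrow> ('f, 'm set) module" where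
  "quotient_space V U =
     \<lparr>carrier = a_rcosets\<^bsub>V\<^esub> U, mult = undefined, one = undefined, zero = U, add = set_add V,
      smult = (\<lambda>c X. \<Union>x\<in>X. U +>\<^bsub>V\<^esub> (c \<odot>\<^bsub>V\<^esub> x))\<rparr>"

text \<open>The operation on cosets induced by \<open>\<phi>\<close>, in the style of \<^const>\<open>rcoset_mult\<close>;
  \<open>U\<close> is the subspace of the target \<open>V\<close> that is factored out.\<close>

definition induced2 ::
    "('f, 'z, 'y) module_scheme \<Rightarrow> 'z set \<Rightarrow> ('m \<Rightarrow> 'n \<Rightarrow> 'z) \<Rightarrow> 'm set \<Rightarrow> 'n set \<Rightarrow> 'z set" where
  "induced2 V U \<phi> X Y = (\<Union>x\<in>X. \<Union>y\<in>Y. U +>\<^bsub>V\<^esub> \<phi> x y)"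

definition pscale :: "'f::field \<Rightarrow> ('b \<Rightarrow>\<^sub>0 'f) \<Rightarrow> ('b \<Rightarrow>\<^sub>0 'f)" where
  "pscale c u = Poly_Mapping.map ((*) c) u"

abbreviation pspan :: "('b \<Rightarrow>\<^sub>0 'f::field) set \<Rightarrow> ('b \<Rightarrow>\<^sub>0 'f) set" where
  "pspan \<equiv> Modules.module.span pscale"

definition free_space :: "'b set \<Rightarrow> ('f::field, 'b \<Rightarrow>\<^sub>0 'f) module" where
  "free_space B =
     \<lparr>carrier = {u. Poly_Mapping.keys u \<subseteq> B}, mult = undefined, one = undefined,
      zero = 0, add = (+), smult = pscale\<rparr>"

definition lin_ext :: "('f::field, 'm, 'z) module_scheme \<Rightarrow> ('b \<Rightarrow> 'm) \<Rightarrow> ('b \<Rightarrow>\<^sub>0 'f) \<Rightarrow> 'm" where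
  "lin_ext V \<phi> u = (\<Oplus>\<^bsub>V\<^esub>b\<in>Poly_Mapping.keys u. Poly_Mapping.lookup u b \<odot>\<^bsub>V\<^esub> \<phi> b)"

text \<open>
  The tensor product of \<open>X\<close> and \<open>Y\<close> balanced over \<open>S\<close>, where \<open>S\<close> acts on \<open>X\<close> from the right by
  \<open>r\<close> and on \<open>Y\<close> from the left by \<open>l\<close>, is the free vector space on \<open>X \<times> Y\<close> modulo the bilinear
  and balancing relations. For the tensor product over an algebra \<open>k\<^sup>e = k \<otimes> k\<close> or
  \<open>A\<^sup>e = A \<otimes> A\<^sup>o\<^sup>p\<close> it suffices to balance over the elementary tensors, so there \<open>S\<close> is
  \<open>k \<times> k\<close> or \<open>A \<times> A\<close>.
\<close>

definition tensor_rels ::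
    "('f::field, 'x, 'p) module_scheme \<Rightarrow> 's set \<Rightarrow> ('x \<Rightarrow> 's \<Rightarrow> 'x) \<Rightarrow>
     ('f, 'y, 'q) module_scheme \<Rightarrow> ('s \<Rightarrow> 'y \<Rightarrow> 'y) \<Rightarrow> ('x \<times> 'y \<Rightarrow>\<^sub>0 'f) set" where
  "tensor_rels X S r Y l = pspan (
     {Poly_Mapping.single (x \<oplus>\<^bsub>X\<^esub> x', y) 1 - Poly_Mapping.single (x, y) 1 - Poly_Mapping.single (x', y) 1
       | x x' y. x \<in> carrier X \<and> x' \<in> carrier X \<and> y \<in> carrier Y} \<union>
     {Poly_Mapping.single (x, y \<oplus>\<^bsub>Y\<^esub> y') 1 - Poly_Mapping.single (x, y) 1 - Poly_Mapping.single (x, y') 1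
       | x y y'. x \<in> carrier X \<and> y \<in> carrier Y \<and> y' \<in> carrier Y} \<union>
     {Poly_Mapping.single (c \<odot>\<^bsub>X\<^esub> x, y) 1 - Poly_Mapping.single (x, y) c
       | c x y. x \<in> carrier X \<and> y \<in> carrier Y} \<union>
     {Poly_Mapping.single (x, c \<odot>\<^bsub>Y\<^esub> y) 1 - Poly_Mapping.single (x, y) c
       | c x y. x \<in> carrier X \<and> y \<in> carrier Y} \<union>
     {Poly_Mapping.single (r x s, y) 1 - Poly_Mapping.single (x, l s y) 1
       | x s y. x \<in> carrier X \<and> s \<in> S \<and> y \<in> carrier Y})"

definition tensor_space ::
    "('f::field, 'x, 'p) module_scheme \<Rightarrow> 's set \<Rightarrow> ('x \<Rightarrow> 's \<Rightarrow> 'x) \<Rightarrow>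
     ('f, 'y, 'q) module_scheme \<Rightarrow> ('s \<Rightarrow> 'y \<Rightarrow> 'y) \<Rightarrow> ('f, ('x \<times> 'y \<Rightarrow>\<^sub>0 'f) set) module" where
  "tensor_space X S r Y l =
     quotient_space (free_space (carrier X \<times> carrier Y)) (tensor_rels X S r Y l)"

text \<open>\<open>pure N x y\<close> is the class of \<open>(x, y)\<close> when \<open>N\<close> is the zero of the tensor product, that is,
  the span of the relations.\<close>

definition pure :: "('x \<times> 'y \<Rightarrow>\<^sub>0 'f::field) set \<Rightarrow> 'x \<Rightarrow> 'y \<Rightarrow> ('x \<times> 'y \<Rightarrow>\<^sub>0 'f) set" where
  "pure N x y = N +>\<^bsub>free_space UNIV\<^esub> Poly_Mapping.single (x, y) 1"

text \<open>The linear map on a tensor product determined by its values \<open>\<phi> (x, y)\<close> on pure tensors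
  (independent of the chosen representative when \<open>\<phi>\<close> is bilinear and balanced).\<close>

definition tensor_lift ::
    "('f::field, 'm, 'z) module_scheme \<Rightarrow> ('x \<times> 'y \<Rightarrow> 'm) \<Rightarrow> ('x \<times> 'y \<Rightarrow>\<^sub>0 'f) set \<Rightarrow> 'm" where
  "tensor_lift V \<phi> X = lin_ext V \<phi> (SOME u. u \<in> X)"

text \<open>Linear maps compatible with the actions \<open>l\<close>, \<open>l'\<close> of \<open>S\<close>; for bimodule maps \<open>S\<close> consists
  of pairs.\<close>

definition hom_space ::
    "'s set \<Rightarrow> ('f, 'x, 'p) module_scheme \<Rightarrow> ('s \<Rightarrow> 'x \<Rightarrow> 'x) \<Rightarrow>
     ('f, 'y, 'q) module_scheme \<Rightarrow> ('s \<Rightarrow> 'y \<Rightarrow> 'y) \<Rightarrow> ('f, 'x \<Rightarrow> 'y) module" where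
  "hom_space S X l Y l' =
     \<lparr>carrier = {f \<in> carrier X \<rightarrow>\<^sub>E carrier Y.
        (\<forall>x\<in>carrier X. \<forall>x'\<in>carrier X. f (x \<oplus>\<^bsub>X\<^esub> x') = f x \<oplus>\<^bsub>Y\<^esub> f x') \<and>
        (\<forall>c. \<forall>x\<in>carrier X. f (c \<odot>\<^bsub>X\<^esub> x) = c \<odot>\<^bsub>Y\<^esub> f x) \<and>
        (\<forall>s\<in>S. \<forall>x\<in>carrier X. f (l s x) = l' s (f x))},
      mult = undefined, one = undefined,
      zero = (\<lambda>x\<in>carrier X. \<zero>\<^bsub>Y\<^esub>),
      add = (\<lambda>f g. \<lambda>x\<in>carrier X. f x \<oplus>\<^bsub>Y\<^esub> g x),
      smult = (\<lambda>c f. \<lambda>x\<in>carrier X. c \<odot>\<^bsub>Y\<^esub> f x)\<rparr>"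


section \<open>Complexes, bimodules and graded bimodules\<close>

text \<open>All complexes are indexed by the integers; the Koszul complexes below vanish in negative
  degrees. In \<^term>\<open>cohomology\<close> the differential \<open>d p\<close> goes from degree \<open>p\<close> to \<open>p + 1\<close>, in
  \<^term>\<open>homology\<close> from \<open>p\<close> to \<open>p - 1\<close>.\<close>

definition cohomology ::
    "(int \<Rightarrow> ('f, 'm, 'z) module_scheme) \<Rightarrow> (int \<Rightarrow> 'm \<Rightarrow> 'm) \<Rightarrow> int \<Rightarrow> ('f, 'm set) module" where
  "cohomology V d p =
     quotient_space ((V p)\<lparr>carrier := {x \<in> carrier (V p). d p x = \<zero>\<^bsub>V (p + 1)\<^esub>}\<rparr>)
       (d (p - 1) ` carrier (V (p - 1)))"

definition homology ::
    "(int \<Rightarrow> ('f, 'm, 'z) module_scheme) \<Rightarrow> (int \<Rightarrow> 'm \<Rightarrow> 'm) \<Rightarrow> int \<Rightarrow> ('f, 'm set) module" where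
  "homology V d p =
     quotient_space ((V p)\<lparr>carrier := {x \<in> carrier (V p). d p x = \<zero>\<^bsub>V (p - 1)\<^esub>}\<rparr>)
       (d (p + 1) ` carrier (V (p + 1)))"

definition has_length :: "(int \<Rightarrow> ('f, 'm, 'z) module_scheme) \<Rightarrow> int \<Rightarrow> bool" where
  "has_length C n \<longleftrightarrow> \<not> trivial_space (C n) \<and> (\<forall>p>n. trivial_space (C p))"

record ('f, 'a, 'm) bimod = "('f, 'm) module" +
  lact :: "'a \<Rightarrow> 'm \<Rightarrow> 'm"
  ract :: "'m \<Rightarrow> 'a \<Rightarrow> 'm"

text \<open>The two conditions on scalars make the bimodule \<open>'f\<close>-symmetric.\<close>

definition is_bimodule :: "('f::field, 'a, 'z) module_scheme \<Rightarrow> ('f, 'a, 'm, 'y) bimod_scheme \<Rightarrow> bool" where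
  "is_bimodule A M \<longleftrightarrow> is_vector_space M \<and>
     (\<forall>a\<in>carrier A. \<forall>m\<in>carrier M. lact M a m \<in> carrier M \<and> ract M m a \<in> carrier M) \<and>
     (\<forall>a\<in>carrier A. \<forall>m\<in>carrier M. \<forall>n\<in>carrier M.
        lact M a (m \<oplus>\<^bsub>M\<^esub> n) = lact M a m \<oplus>\<^bsub>M\<^esub> lact M a n \<and>
        ract M (m \<oplus>\<^bsub>M\<^esub> n) a = ract M m a \<oplus>\<^bsub>M\<^esub> ract M n a) \<and>
     (\<forall>a\<in>carrier A. \<forall>b\<in>carrier A. \<forall>m\<in>carrier M.
        lact M (a \<oplus>\<^bsub>A\<^esub> b) m = lact M a m \<oplus>\<^bsub>M\<^esub> lact M b m \<and>
        ract M m (a \<oplus>\<^bsub>A\<^esub> b) = ract M m a \<oplus>\<^bsub>M\<^esub> ract M m b \<and>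
        lact M (a \<otimes>\<^bsub>A\<^esub> b) m = lact M a (lact M b m) \<and>
        ract M m (a \<otimes>\<^bsub>A\<^esub> b) = ract M (ract M m a) b \<and>
        ract M (lact M a m) b = lact M a (ract M m b)) \<and>
     (\<forall>m\<in>carrier M. lact M \<one>\<^bsub>A\<^esub> m = m \<and> ract M m \<one>\<^bsub>A\<^esub> = m) \<and>
     (\<forall>c. \<forall>a\<in>carrier A. \<forall>m\<in>carrier M.
        lact M (c \<odot>\<^bsub>A\<^esub> a) m = c \<odot>\<^bsub>M\<^esub> lact M a m \<and>
        ract M m (c \<odot>\<^bsub>A\<^esub> a) = c \<odot>\<^bsub>M\<^esub> ract M m a)"

text \<open>A graded bimodule consists of its components and of the left and right actions of a graded
  algebra: \<open>gleft X p q a x\<close> for \<open>a\<close> of degree \<open>p\<close> and \<open>x\<close> of degree \<open>q\<close>, and \<open>gright X q p x a\<close>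
  likewise; both have degree \<open>p + q\<close>.\<close>

record ('f, 'a, 'h) gbimod =
  gcomp :: "int \<Rightarrow> ('f, 'h) module"
  gleft :: "int \<Rightarrow> int \<Rightarrow> 'a \<Rightarrow> 'h \<Rightarrow> 'h"
  gright :: "int \<Rightarrow> int \<Rightarrow> 'h \<Rightarrow> 'a \<Rightarrow> 'h"

text \<open>\<open>L p\<close> is the degree \<open>p\<close> component of the acting graded algebra.\<close>

definition gbimod_isomorphic ::
    "(int \<Rightarrow> ('f, 'a) module) \<Rightarrow> ('f, 'a, 'x) gbimod \<Rightarrow> ('f, 'a, 'y) gbimod \<Rightarrow> bool" where
  "gbimod_isomorphic L X Y \<longleftrightarrow> (\<exists>\<phi>.
     (\<forall>p. linear_iso (gcomp X p) (gcomp Y p) (\<phi> p)) \<and>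
     (\<forall>p q. \<forall>a\<in>carrier (L p). \<forall>x\<in>carrier (gcomp X q).
        \<phi> (p + q) (gleft X p q a x) = gleft Y p q a (\<phi> q x) \<and>
        \<phi> (q + p) (gright X q p x a) = gright Y q p (\<phi> q x) a))"


section \<open>The preprojective algebra\<close>

text \<open>
  A quiver is a (multi-)digraph \<open>Q\<close> of the Graph-Theory library: \<^const>\<open>tail\<close> is the source and
  \<^const>\<open>head\<close> the target. The graph \<open>\<Delta>\<close> is the underlying undirected graph of \<open>Q\<close>, and
  \<^const>\<open>connected\<close> means connectedness of the underlying graph. The next two predicates say that
  the underlying graph is of type \<open>A\<^sub>1\<close>, resp. \<open>A\<^sub>2\<close>.
\<close>

definition underlying_A1 :: "('v, 'e) pre_digraph \<Rightarrow> bool" where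
  "underlying_A1 Q \<longleftrightarrow> (\<exists>i. verts Q = {i}) \<and> arcs Q = {}"

definition underlying_A2 :: "('v, 'e) pre_digraph \<Rightarrow> bool" where
  "underlying_A2 Q \<longleftrightarrow> (\<exists>i j a. i \<noteq> j \<and> verts Q = {i, j} \<and> arcs Q = {a} \<and>
     {tail Q a, head Q a} = {i, j})"

text \<open>\<open>Inl a\<close> is the arrow \<open>a\<close> of \<open>Q\<close> and \<open>Inr a\<close> is the added arrow \<open>a\<^sup>*\<close>.\<close>

definition double_quiver :: "('v, 'e) pre_digraph \<Rightarrow> ('v, 'e + 'e) pre_digraph" where
  "double_quiver Q =
     \<lparr>verts = verts Q, arcs = arcs Q <+> arcs Q,
      tail = case_sum (tail Q) (head Q), head = case_sum (head Q) (tail Q)\<rparr>"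

definition star :: "'e + 'e \<Rightarrow> 'e + 'e" where
  "star = case_sum Inr Inl"

definition arrow_sign :: "'e + 'e \<Rightarrow> 'f::field" where
  "arrow_sign = case_sum (\<lambda>_. 1) (\<lambda>_. - 1)"

text \<open>
  Paths are written from right to left: \<open>(i, [x\<^sub>1, \<dots>, x\<^sub>p], j)\<close> is the path \<open>x\<^sub>1 \<dots> x\<^sub>p\<close> with
  target \<open>i = target x\<^sub>1\<close> and source \<open>j = source x\<^sub>p\<close>, and \<open>(i, [], i)\<close> is \<open>e\<^sub>i\<close>. The library's
  walks are written in the opposite order.
\<close>

type_synonym ('v, 'a) path = "'v \<times> 'a list \<times> 'v"
type_synonym ('f, 'v, 'e) path_elt = "('v, 'e + 'e) path \<Rightarrow>\<^sub>0 'f"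
type_synonym ('f, 'v, 'e) preproj_elt = "('f, 'v, 'e) path_elt set"

definition paths :: "('v, 'e) pre_digraph \<Rightarrow> nat \<Rightarrow> ('v, 'e + 'e) path set" where
  "paths Q n = {(i, xs, j). pre_digraph.awalk (double_quiver Q) j (rev xs) i \<and> length xs = n}"

definition path_mult ::
    "('f::field, 'v, 'e) path_elt \<Rightarrow> ('f, 'v, 'e) path_elt \<Rightarrow> ('f, 'v, 'e) path_elt" (infixl "\<star>" 70) where
  "u \<star> v = (\<Sum>(i, xs, j)\<in>Poly_Mapping.keys u. \<Sum>(j', ys, l)\<in>Poly_Mapping.keys v.
     if j = j' then Poly_Mapping.single (i, xs @ ys, l)
       (Poly_Mapping.lookup u (i, xs, j) * Poly_Mapping.lookup v (j', ys, l)) else 0)"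

definition path_alg :: "('v, 'e) pre_digraph \<Rightarrow> ('f::field, ('f, 'v, 'e) path_elt) module" where
  "path_alg Q =
     \<lparr>carrier = {u. Poly_Mapping.keys u \<subseteq> (\<Union>n. paths Q n)}, mult = (\<star>),
      one = (\<Sum>i\<in>verts Q. Poly_Mapping.single (i, [], i) 1),
      zero = 0, add = (+), smult = pscale\<rparr>"

text \<open>The tensor algebra of \<open>V\<close> over \<open>k\<close> is identified with the path algebra: \<open>homog Q n\<close> is
  \<open>V\<^bsup>\<otimes>n\<^esup>\<close>, in particular \<open>homog Q 0 = k\<close> and \<open>homog Q 1 = V\<close>.\<close>

definition homog :: "('v, 'e) pre_digraph \<Rightarrow> nat \<Rightarrow> ('f::field, 'v, 'e) path_elt set" where
  "homog Q n = {u. Poly_Mapping.keys u \<subseteq> paths Q n}"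

definition preproj_sigma :: "('v, 'e) pre_digraph \<Rightarrow> 'v \<Rightarrow> ('f::field, 'v, 'e) path_elt" where
  "preproj_sigma Q i = (\<Sum>a\<in>{a \<in> arcs (double_quiver Q). head (double_quiver Q) a = i}.
     Poly_Mapping.single (i, [a, star a], i) (arrow_sign a))"

definition preproj_R :: "('v, 'e) pre_digraph \<Rightarrow> ('f::field, 'v, 'e) path_elt set" where
  "preproj_R Q = pspan (preproj_sigma Q ` verts Q)"

definition preproj_ideal :: "('v, 'e) pre_digraph \<Rightarrow> ('f::field, 'v, 'e) path_elt set" where
  "preproj_ideal Q = Idl\<^bsub>path_alg Q\<^esub> (preproj_R Q)"

definition preproj :: "('v, 'e) pre_digraph \<Rightarrow> ('f::field, ('f, 'v, 'e) preproj_elt) module" where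
  "preproj Q = ring.extend (path_alg Q Quot preproj_ideal Q)
     (module.fields (smult (quotient_space (path_alg Q) (preproj_ideal Q))))"

definition residue_class :: "('v, 'e) pre_digraph \<Rightarrow> ('f::field, 'v, 'e) path_elt \<Rightarrow> ('f, 'v, 'e) preproj_elt" where
  "residue_class Q u = preproj_ideal Q +>\<^bsub>path_alg Q\<^esub> u"

type_synonym ('f, 'v, 'e, 'm) preproj_bimod = "('f, ('f, 'v, 'e) preproj_elt, 'm) bimod"

definition preproj_self ::
    "('v, 'e) pre_digraph \<Rightarrow> ('f::field, 'v, 'e, ('f, 'v, 'e) preproj_elt) preproj_bimod" where
  "preproj_self Q =
     module.extend (preproj Q) (bimod.fields (mult (preproj Q)) (mult (preproj Q)))"


section \<open>The spaces \<open>W\<^sub>p\<close>\<close>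

definition Wset :: "('v, 'e) pre_digraph \<Rightarrow> int \<Rightarrow> ('f::field, 'v, 'e) path_elt set" where
  "Wset Q p =
     (if p < 0 then {0} else if p = 0 then homog Q 0 else if p = 1 then homog Q 1
      else \<Inter>{pspan {u \<star> r \<star> v | u r v. u \<in> homog Q i \<and> r \<in> preproj_R Q \<and> v \<in> homog Q j}
             | i j. int (i + 2 + j) = p})"

definition Wspace :: "('v, 'e) pre_digraph \<Rightarrow> int \<Rightarrow> ('f::field, ('f, 'v, 'e) path_elt) module" where
  "Wspace Q p = (path_alg Q)\<lparr>carrier := Wset Q p\<rparr>"

text \<open>
  For \<open>w = x\<^sub>1 \<dots> x\<^bsub>p+q\<^esub>\<close> in \<open>W\<^bsub>p+q\<^esub>\<close>, \<open>split_sum V p q \<phi> w\<close> is the element of \<open>V\<close> written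
  \<open>\<phi> (x\<^sub>1 \<dots> x\<^sub>p, x\<^bsub>p+1\<^esub> \<dots> x\<^bsub>p+q\<^esub>)\<close> (sum understood): \<open>w\<close> is written as a linear combination
  of products of elements of \<open>W\<^sub>p\<close> and \<open>W\<^sub>q\<close>, which is possible since \<open>W\<^bsub>p+q\<^esub>\<close> is contained in
  the tensor product of \<open>W\<^sub>p\<close> and \<open>W\<^sub>q\<close> over \<open>k\<close>. The result does not depend on the choice
  when \<open>\<phi>\<close> is bilinear and \<open>k\<close>-balanced. The value is zero when \<open>p\<close> or \<open>q\<close> is negative.
\<close>

definition split_sum ::
    "('v, 'e) pre_digraph \<Rightarrow> ('f::field, 'm, 'z) module_scheme \<Rightarrow> int \<Rightarrow> int \<Rightarrow>
     (('f, 'v, 'e) path_elt \<times> ('f, 'v, 'e) path_elt \<Rightarrow> 'm) \<Rightarrow> ('f, 'v, 'e) path_elt \<Rightarrow> 'm" where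
  "split_sum Q V p q \<phi> w =
     (if p < 0 \<or> q < 0 then \<zero>\<^bsub>V\<^esub>
      else lin_ext V \<phi> (SOME s. Poly_Mapping.keys s \<subseteq> Wset Q p \<times> Wset Q q \<and>
        (\<Sum>(u, v)\<in>Poly_Mapping.keys s. pscale (Poly_Mapping.lookup s (u, v)) (u \<star> v)) = w))"


section \<open>The Koszul bimodule complex\<close>

abbreviation kset :: "('v, 'e) pre_digraph \<Rightarrow> ('f::field, 'v, 'e) path_elt set" where
  "kset Q \<equiv> homog Q 0"

text \<open>\<open>A \<otimes>\<^sub>k W\<^sub>p\<close>, then \<open>K(A)\<^sub>p = (A \<otimes>\<^sub>k W\<^sub>p) \<otimes>\<^sub>k A\<close>.\<close>

type_synonym ('f, 'v, 'e) AW_elt = "(('f, 'v, 'e) preproj_elt \<times> ('f, 'v, 'e) path_elt \<Rightarrow>\<^sub>0 'f) set"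
type_synonym ('f, 'v, 'e) koszul_elt =
  "(('f, 'v, 'e) AW_elt \<times> ('f, 'v, 'e) preproj_elt \<Rightarrow>\<^sub>0 'f) set"

definition AW :: "('v, 'e) pre_digraph \<Rightarrow> int \<Rightarrow> ('f::field, ('f, 'v, 'e) AW_elt) module" where
  "AW Q p = tensor_space (preproj Q) (kset Q) (\<lambda>x c. x \<otimes>\<^bsub>preproj Q\<^esub> residue_class Q c) (Wspace Q p) (\<star>)"

definition AW_pure :: "('v, 'e) pre_digraph \<Rightarrow> int \<Rightarrow>
    ('f::field, 'v, 'e) preproj_elt \<Rightarrow> ('f, 'v, 'e) path_elt \<Rightarrow> ('f, 'v, 'e) AW_elt" where
  "AW_pure Q p = pure \<zero>\<^bsub>AW Q p\<^esub>"

definition koszul_space :: "('v, 'e) pre_digraph \<Rightarrow> int \<Rightarrow> ('f::field, ('f, 'v, 'e) koszul_elt) module" where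
  "koszul_space Q p =
     tensor_space (AW Q p) (kset Q) (\<lambda>X c. tensor_lift (AW Q p) (\<lambda>(x, w). AW_pure Q p x (w \<star> c)) X)
       (preproj Q) (\<lambda>c y. residue_class Q c \<otimes>\<^bsub>preproj Q\<^esub> y)"

definition koszul_pure :: "('v, 'e) pre_digraph \<Rightarrow> int \<Rightarrow> ('f::field, 'v, 'e) preproj_elt \<Rightarrow>
    ('f, 'v, 'e) path_elt \<Rightarrow> ('f, 'v, 'e) preproj_elt \<Rightarrow> ('f, 'v, 'e) koszul_elt" where
  "koszul_pure Q p a w a' = pure \<zero>\<^bsub>koszul_space Q p\<^esub> (AW_pure Q p a w) a'"

text \<open>The linear map on \<open>K(A)\<^sub>p\<close> with values \<open>\<phi> a w a'\<close> on \<open>a \<otimes> w \<otimes> a'\<close>.\<close>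

definition koszul_lift :: "('f::field, 'm, 'z) module_scheme \<Rightarrow>
    (('f, 'v, 'e) preproj_elt \<Rightarrow> ('f, 'v, 'e) path_elt \<Rightarrow> ('f, 'v, 'e) preproj_elt \<Rightarrow> 'm) \<Rightarrow>
    ('f, 'v, 'e) koszul_elt \<Rightarrow> 'm" where
  "koszul_lift V \<phi> Z = tensor_lift V (\<lambda>(X, a'). tensor_lift V (\<lambda>(a, w). \<phi> a w a') X) Z"

definition koszul :: "('v, 'e) pre_digraph \<Rightarrow> int \<Rightarrow> ('f::field, 'v, 'e, ('f, 'v, 'e) koszul_elt) preproj_bimod" where
  "koszul Q p = module.extend (koszul_space Q p) (bimod.fields
     (\<lambda>b Z. koszul_lift (koszul_space Q p) (\<lambda>a w a'. koszul_pure Q p (b \<otimes>\<^bsub>preproj Q\<^esub> a) w a') Z)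
     (\<lambda>Z b. koszul_lift (koszul_space Q p) (\<lambda>a w a'. koszul_pure Q p a w (a' \<otimes>\<^bsub>preproj Q\<^esub> b)) Z))"

definition koszul_d :: "('v, 'e) pre_digraph \<Rightarrow> int \<Rightarrow> ('f::field, 'v, 'e) koszul_elt \<Rightarrow> ('f, 'v, 'e) koszul_elt" where
  "koszul_d Q p Z = (let K = koszul_space Q (p - 1) in koszul_lift K (\<lambda>a w a'.
     split_sum Q K 1 (p - 1) (\<lambda>(x, w'). koszul_pure Q (p - 1) (a \<otimes>\<^bsub>preproj Q\<^esub> residue_class Q x) w' a') w \<oplus>\<^bsub>K\<^esub>
     (((-1) powi p) \<odot>\<^bsub>K\<^esub>
       split_sum Q K (p - 1) 1 (\<lambda>(w', x). koszul_pure Q (p - 1) a w' (residue_class Q x \<otimes>\<^bsub>preproj Q\<^esub> a')) w)) Z)"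

text \<open>The actions of an elementary tensor \<open>a \<otimes> b\<close> of \<open>A\<^sup>e\<close> on a bimodule, from the left and from
  the right.\<close>

definition Ae_left :: "('f, 'a, 'm, 'z) bimod_scheme \<Rightarrow> 'a \<times> 'a \<Rightarrow> 'm \<Rightarrow> 'm" where
  "Ae_left M = (\<lambda>(a, b) m. ract M (lact M a m) b)"

definition Ae_right :: "('f, 'a, 'm, 'z) bimod_scheme \<Rightarrow> 'm \<Rightarrow> 'a \<times> 'a \<Rightarrow> 'm" where
  "Ae_right M = (\<lambda>m (a, b). ract M (lact M b m) a)"

text \<open>\<open>H\<^sup>p (Hom\<^bsub>A\<^sup>e\<^esub> (K(A), M))\<close> and \<open>H\<^sub>p (M \<otimes>\<^bsub>A\<^sup>e\<^esub> K(A))\<close>.\<close>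

definition bimod_Hom_cohomology ::
    "('v, 'e) pre_digraph \<Rightarrow> ('f::field, 'v, 'e, 'm) preproj_bimod \<Rightarrow> int \<Rightarrow>
     ('f, (('f, 'v, 'e) koszul_elt \<Rightarrow> 'm) set) module" where
  "bimod_Hom_cohomology Q M = cohomology
     (\<lambda>p. hom_space (carrier (preproj Q) \<times> carrier (preproj Q)) (koszul Q p) (Ae_left (koszul Q p)) M (Ae_left M))
     (\<lambda>p f. \<lambda>Z\<in>carrier (koszul Q (p + 1)). (- ((-1) powi p)) \<odot>\<^bsub>M\<^esub> f (koszul_d Q (p + 1) Z))"

definition bimod_tensor ::
    "('v, 'e) pre_digraph \<Rightarrow> ('f::field, 'v, 'e, 'm) preproj_bimod \<Rightarrow> int \<Rightarrow>
     ('f, ('m \<times> ('f, 'v, 'e) koszul_elt \<Rightarrow>\<^sub>0 'f) set) module" where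
  "bimod_tensor Q M p = tensor_space M (carrier (preproj Q) \<times> carrier (preproj Q)) (Ae_right M)
     (koszul Q p) (Ae_left (koszul Q p))"

definition bimod_tensor_homology ::
    "('v, 'e) pre_digraph \<Rightarrow> ('f::field, 'v, 'e, 'm) preproj_bimod \<Rightarrow> int \<Rightarrow>
     ('f, ('m \<times> ('f, 'v, 'e) koszul_elt \<Rightarrow>\<^sub>0 'f) set set) module" where
  "bimod_tensor_homology Q M = homology (bimod_tensor Q M)
     (\<lambda>p. tensor_lift (bimod_tensor Q M (p - 1)) (\<lambda>(m, Z). pure \<zero>\<^bsub>bimod_tensor Q M (p - 1)\<^esub> m (koszul_d Q p Z)))"


section \<open>Koszul cohomology and homology\<close>

text \<open>
  The products are defined on the isomorphic complexes of \<open>k\<^sup>e\<close>-linear maps \<open>W\<^sub>p \<rightarrow> M\<close> and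
  \<open>M \<otimes>\<^bsub>k\<^sup>e\<^esub> W\<^sub>p\<close>, where \<open>k\<close> acts on \<open>M\<close> through \<open>A\<close>.
\<close>

definition ke_W :: "('f::field, 'v, 'e) path_elt \<times> ('f, 'v, 'e) path_elt \<Rightarrow> ('f, 'v, 'e) path_elt \<Rightarrow> ('f, 'v, 'e) path_elt" where
  "ke_W = (\<lambda>(a, b) w. a \<star> w \<star> b)"

definition cochains ::
    "('v, 'e) pre_digraph \<Rightarrow> ('f::field, 'v, 'e, 'm) preproj_bimod \<Rightarrow> int \<Rightarrow>
     ('f, ('f, 'v, 'e) path_elt \<Rightarrow> 'm) module" where
  "cochains Q M p = hom_space (kset Q \<times> kset Q) (Wspace Q p) ke_W
     M (\<lambda>(a, b). Ae_left M (residue_class Q a, residue_class Q b))"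

definition cochain_d ::
    "('v, 'e) pre_digraph \<Rightarrow> ('f::field, 'v, 'e, 'm) preproj_bimod \<Rightarrow> int \<Rightarrow>
     (('f, 'v, 'e) path_elt \<Rightarrow> 'm) \<Rightarrow> ('f, 'v, 'e) path_elt \<Rightarrow> 'm" where
  "cochain_d Q M p f = (\<lambda>w\<in>Wset Q (p + 1).
     split_sum Q M p 1 (\<lambda>(u, x). ract M (f u) (residue_class Q x)) w \<oplus>\<^bsub>M\<^esub>
     (- ((-1) powi p)) \<odot>\<^bsub>M\<^esub> split_sum Q M 1 p (\<lambda>(x, u). lact M (residue_class Q x) (f u)) w)"

type_synonym ('f, 'v, 'e, 'm) chain = "('m \<times> ('f, 'v, 'e) path_elt \<Rightarrow>\<^sub>0 'f) set"

definition chains ::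
    "('v, 'e) pre_digraph \<Rightarrow> ('f::field, 'v, 'e, 'm) preproj_bimod \<Rightarrow> int \<Rightarrow>
     ('f, ('f, 'v, 'e, 'm) chain) module" where
  "chains Q M p = tensor_space M (kset Q \<times> kset Q)
     (\<lambda>m (a, b). Ae_right M m (residue_class Q a, residue_class Q b)) (Wspace Q p) ke_W"

definition chain_pure :: "('v, 'e) pre_digraph \<Rightarrow> ('f::field, 'v, 'e, 'm) preproj_bimod \<Rightarrow> int \<Rightarrow>
    'm \<Rightarrow> ('f, 'v, 'e) path_elt \<Rightarrow> ('f, 'v, 'e, 'm) chain" where
  "chain_pure Q M p = pure \<zero>\<^bsub>chains Q M p\<^esub>"

definition chain_d ::
    "('v, 'e) pre_digraph \<Rightarrow> ('f::field, 'v, 'e, 'm) preproj_bimod \<Rightarrow> int \<Rightarrow>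
     ('f, 'v, 'e, 'm) chain \<Rightarrow> ('f, 'v, 'e, 'm) chain" where
  "chain_d Q M p z = (let C = chains Q M (p - 1) in tensor_lift C (\<lambda>(m, w).
     split_sum Q C 1 (p - 1) (\<lambda>(x, u). chain_pure Q M (p - 1) (ract M m (residue_class Q x)) u) w \<oplus>\<^bsub>C\<^esub>
     ((-1) powi p) \<odot>\<^bsub>C\<^esub>
       split_sum Q C (p - 1) 1 (\<lambda>(u, x). chain_pure Q M (p - 1) (lact M (residue_class Q x) m) u) w) z)"

type_synonym ('f, 'v, 'e, 'm) HKcoh_elt = "(('f, 'v, 'e) path_elt \<Rightarrow> 'm) set"
type_synonym ('f, 'v, 'e, 'm) HKhom_elt = "('f, 'v, 'e, 'm) chain set"
type_synonym ('f, 'v, 'e) HKalg_elt = "('f, 'v, 'e, ('f, 'v, 'e) preproj_elt) HKcoh_elt"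

definition HKcoh ::
    "('v, 'e) pre_digraph \<Rightarrow> ('f::field, 'v, 'e, 'm) preproj_bimod \<Rightarrow> int \<Rightarrow>
     ('f, ('f, 'v, 'e, 'm) HKcoh_elt) module" where
  "HKcoh Q M = cohomology (cochains Q M) (cochain_d Q M)"

definition HKhom ::
    "('v, 'e) pre_digraph \<Rightarrow> ('f::field, 'v, 'e, 'm) preproj_bimod \<Rightarrow> int \<Rightarrow>
     ('f, ('f, 'v, 'e, 'm) HKhom_elt) module" where
  "HKhom Q M = homology (chains Q M) (chain_d Q M)"


section \<open>Cup and cap products\<close>

text \<open>Only the actions of \<open>HK\<^sup>\<bullet>(A)\<close> are needed, so one factor of each product has values in \<open>A\<close>
  and \<open>A \<otimes>\<^sub>A M\<close>, \<open>M \<otimes>\<^sub>A A\<close> are identified with \<open>M\<close>. Below, \<open>f\<close> is the cochain with values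
  in \<open>A\<close>, of degree \<open>p\<close>, and \<open>g\<close>, \<open>z\<close> have degree \<open>q\<close>.\<close>

definition cup_left ::
    "('v, 'e) pre_digraph \<Rightarrow> ('f::field, 'v, 'e, 'm) preproj_bimod \<Rightarrow> int \<Rightarrow> int \<Rightarrow>
     (('f, 'v, 'e) path_elt \<Rightarrow> ('f, 'v, 'e) preproj_elt) \<Rightarrow> (('f, 'v, 'e) path_elt \<Rightarrow> 'm) \<Rightarrow>
     ('f, 'v, 'e) path_elt \<Rightarrow> 'm" where
  "cup_left Q M p q f g = (\<lambda>w\<in>Wset Q (p + q).
     ((-1) powi (p * q)) \<odot>\<^bsub>M\<^esub> split_sum Q M p q (\<lambda>(u, v). lact M (f u) (g v)) w)"

definition cup_right ::
    "('v, 'e) pre_digraph \<Rightarrow> ('f::field, 'v, 'e, 'm) preproj_bimod \<Rightarrow> int \<Rightarrow> int \<Rightarrow>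
     (('f, 'v, 'e) path_elt \<Rightarrow> 'm) \<Rightarrow> (('f, 'v, 'e) path_elt \<Rightarrow> ('f, 'v, 'e) preproj_elt) \<Rightarrow>
     ('f, 'v, 'e) path_elt \<Rightarrow> 'm" where
  "cup_right Q M q p g f = (\<lambda>w\<in>Wset Q (q + p).
     ((-1) powi (q * p)) \<odot>\<^bsub>M\<^esub> split_sum Q M q p (\<lambda>(u, v). ract M (g u) (f v)) w)"

definition cap_left ::
    "('v, 'e) pre_digraph \<Rightarrow> ('f::field, 'v, 'e, 'm) preproj_bimod \<Rightarrow> int \<Rightarrow> int \<Rightarrow>
     (('f, 'v, 'e) path_elt \<Rightarrow> ('f, 'v, 'e) preproj_elt) \<Rightarrow>
     ('f, 'v, 'e, 'm) chain \<Rightarrow> ('f, 'v, 'e, 'm) chain" where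
  "cap_left Q M p q f z = (let C = chains Q M (q - p) in tensor_lift C (\<lambda>(m, w).
     ((-1) powi ((q - p) * p)) \<odot>\<^bsub>C\<^esub>
       split_sum Q C (q - p) p (\<lambda>(u, v). chain_pure Q M (q - p) (lact M (f v) m) u) w) z)"

definition cap_right ::
    "('v, 'e) pre_digraph \<Rightarrow> ('f::field, 'v, 'e, 'm) preproj_bimod \<Rightarrow> int \<Rightarrow> int \<Rightarrow>
     ('f, 'v, 'e, 'm) chain \<Rightarrow> (('f, 'v, 'e) path_elt \<Rightarrow> ('f, 'v, 'e) preproj_elt) \<Rightarrow>
     ('f, 'v, 'e, 'm) chain" where
  "cap_right Q M q p z f = (let C = chains Q M (q - p) in tensor_lift C (\<lambda>(m, w).
     ((-1) powi (p * q)) \<odot>\<^bsub>C\<^esub>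
       split_sum Q C p (q - p) (\<lambda>(u, v). chain_pure Q M (q - p) (ract M m (f u)) v) w) z)"

definition HKcoh_gbimod ::
    "('v, 'e) pre_digraph \<Rightarrow> ('f::field, 'v, 'e, 'm) preproj_bimod \<Rightarrow>
     ('f, ('f, 'v, 'e) HKalg_elt, ('f, 'v, 'e, 'm) HKcoh_elt) gbimod" where
  "HKcoh_gbimod Q M =
     \<lparr>gcomp = HKcoh Q M,
      gleft = (\<lambda>p q. induced2 (cochains Q M (p + q)) \<zero>\<^bsub>HKcoh Q M (p + q)\<^esub> (cup_left Q M p q)),
      gright = (\<lambda>q p. induced2 (cochains Q M (q + p)) \<zero>\<^bsub>HKcoh Q M (q + p)\<^esub> (cup_right Q M q p))\<rparr>"

text \<open>\<open>HK\<^bsub>2-\<bullet>\<^esub>(A, M)\<close>: the component of degree \<open>q\<close> is \<open>HK\<^bsub>2-q\<^esub>(A, M)\<close>.\<close>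

definition HKhom_gbimod ::
    "('v, 'e) pre_digraph \<Rightarrow> ('f::field, 'v, 'e, 'm) preproj_bimod \<Rightarrow>
     ('f, ('f, 'v, 'e) HKalg_elt, ('f, 'v, 'e, 'm) HKhom_elt) gbimod" where
  "HKhom_gbimod Q M =
     \<lparr>gcomp = (\<lambda>q. HKhom Q M (2 - q)),
      gleft = (\<lambda>p q. induced2 (chains Q M (2 - q - p)) \<zero>\<^bsub>HKhom Q M (2 - q - p)\<^esub> (cap_left Q M p (2 - q))),
      gright = (\<lambda>q p. induced2 (chains Q M (2 - q - p)) \<zero>\<^bsub>HKhom Q M (2 - q - p)\<^esub> (cap_right Q M (2 - q) p))\<rparr>"


section \<open>Higher Koszul calculus\<close>

definition fundamental_class :: "('v, 'e) pre_digraph \<Rightarrow> ('f::field, 'v, 'e) HKalg_elt" where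
  "fundamental_class Q =
     \<zero>\<^bsub>HKcoh Q (preproj_self Q) 1\<^esub> +>\<^bsub>cochains Q (preproj_self Q) 1\<^esub> (\<lambda>x\<in>Wset Q 1. residue_class Q x)"

text \<open>The cohomology of a graded bimodule with respect to the left action of an element \<open>E\<close> of
  degree \<open>1\<close>, with the induced actions. On \<open>HK\<^bsub>2-\<bullet>\<^esub>(A, M)\<close>, the left action of \<open>E\<close> maps
  \<open>HK\<^bsub>2-q\<^esub>\<close> to \<open>HK\<^bsub>2-(q+1)\<^esub>\<close>, so the component of degree \<open>q\<close> of the result is the homology
  at \<open>HK\<^bsub>2-q\<^esub>\<close>.\<close>

definition higher :: "'a \<Rightarrow> ('f, 'a, 'h) gbimod \<Rightarrow> ('f, 'a set, 'h set) gbimod" where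
  "higher E X = (let H = cohomology (gcomp X) (\<lambda>q. gleft X 1 q E) in
     \<lparr>gcomp = H,
      gleft = (\<lambda>p q. induced2 (gcomp X (p + q)) \<zero>\<^bsub>H (p + q)\<^esub> (gleft X p q)),
      gright = (\<lambda>q p. induced2 (gcomp X (q + p)) \<zero>\<^bsub>H (q + p)\<^esub> (gright X q p))\<rparr>)"

definition HKcoh_hi_gbimod ::
    "('v, 'e) pre_digraph \<Rightarrow> ('f::field, 'v, 'e, 'm) preproj_bimod \<Rightarrow>
     ('f, ('f, 'v, 'e) HKalg_elt set, ('f, 'v, 'e, 'm) HKcoh_elt set) gbimod" where
  "HKcoh_hi_gbimod Q M = higher (fundamental_class Q) (HKcoh_gbimod Q M)"

definition HKhom_hi_gbimod ::
    "('v, 'e) pre_digraph \<Rightarrow> ('f::field, 'v, 'e, 'm) preproj_bimod \<Rightarrow>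
     ('f, ('f, 'v, 'e) HKalg_elt set, ('f, 'v, 'e, 'm) HKhom_elt set) gbimod" where
  "HKhom_hi_gbimod Q M = higher (fundamental_class Q) (HKhom_gbimod Q M)"

end

theory Submission
  imports Defs
begin

text \<open>
An element of \<open>W\<^sub>3\<close> only involves paths \<open>t t\<^sup>* t\<close>. If such a path has a nonzero coefficient, then exchanging
one of its two subpaths of length two for another summand of the same \<open>\<sigma>\<^sub>i\<close>, which exists because \<open>\<Delta>\<close> is not
\<open>A\<^sub>2\<close>, gives a path of a different form with a nonzero coefficient. Hence \<open>W\<^sub>p = 0\<close> for \<open>p > 2\<close>. The spaces
\<open>W\<^sub>0\<close>, \<open>W\<^sub>1\<close>, \<open>W\<^sub>2 = R\<close> have the bases \<open>e\<^sub>i\<close>, \<open>a\<close>, \<open>\<sigma>\<^sub>i\<close> (the \<open>\<sigma>\<^sub>i\<close> are nonzero because \<open>\<Delta>\<close> is not \<open>A\<^sub>1\<close>), and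
\<open>e\<^sub>i \<leftrightarrow> \<sigma>\<^sub>i\<close>, \<open>a \<leftrightarrow> \<epsilon>(a) a\<^sup>*\<close> is a duality between \<open>W\<^sub>p\<close> and \<open>W\<^sub>2\<^sub>-\<^sub>p\<close>. It turns a cochain \<open>f : W\<^sub>p \<rightarrow> M\<close> into
a chain \<open>\<theta>(f) \<in> M \<otimes> W\<^sub>2\<^sub>-\<^sub>p\<close>; up to signs this is the cap product of \<open>f\<close> with the fundamental chain
\<open>\<Sum>\<^sub>i e\<^sub>i \<otimes> \<sigma>\<^sub>i\<close>. The map \<open>\<theta>\<close> is bijective and carries cup products to cap products on both sides already for
(co)chains. The differentials and the higher differentials are graded commutators, respectively products,
with the \<open>1\<close>-cocycle \<open>x \<mapsto> x\<close>, so \<open>\<theta>\<close> induces the isomorphisms on ordinary and on higher (co)homology.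
\<close>

text \<open>Two choices are hidden in the objects: \<open>tensor_lift\<close> evaluates at some
  representative of a coset, and \<open>split_sum\<close> at some way of writing an element as a sum
  of products. Nothing can be computed before both are shown harmless. The first is the universal
  property of the tensor product. For the second, coefficients at concatenated paths give a linear
  map on the whole path algebra that agrees with the given balanced map on products; the bases of
  \<open>W p\<close> make these functionals explicit.

  The sign in the duality comes from the relations: exchanging an arrow with its star in a sum over
  all arrows costs a sign, because \<open>arrow_sign (star a) = - arrow_sign a\<close>. This sign is
  what reconciles cup and cap products on the left, while on the right the Koszul signs already
  agree. Since everything lives in degrees 0, 1, 2, few pairs of degrees carry content, and they are
  compared one by one; the differentials are compared directly in degrees 0 and 1. The algebra
  itself may be infinite-dimensional: only the spaces \<open>W p\<close> are dualised, and these
  have finite bases.\<close>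

section \<open>Vector spaces on a carrier\<close>

lemma field_ring_simps [simp]:
  "carrier (field_ring :: 'f::field ring) = UNIV"
  "mult (field_ring :: 'f::field ring) = (*)" "one (field_ring :: 'f::field ring) = 1"
  "zero (field_ring :: 'f::field ring) = 0" "add (field_ring :: 'f::field ring) = (+)"
  by (simp_all add: field_ring_def)

lemma cring_field_ring: "cring (field_ring :: 'f::field ring)"
proof (rule cringI)
  show "abelian_group (field_ring :: 'f::field ring)"
    by (rule abelian_groupI) (auto simp: add.assoc add.commute intro: exI[of _ "- x" for x])
  show "comm_monoid (field_ring :: 'f::field ring)"
    by (rule comm_monoidI) (auto simp: mult.assoc mult.commute)
qed (auto simp: distrib_right)

text \<open>Every element of the type is a scalar, so the module laws are restated without
  membership conditions on scalars; the simplifier can then use them directly.\<close>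

locale vspace =
  fixes V :: "('f::field, 'm, 'z) module_scheme" (structure)
  assumes vs: "is_vector_space V"
begin

sublocale module field_ring V by (rule vs)

lemma smult_in [simp, intro]: "x \<in> carrier V \<Longrightarrow> c \<odot> x \<in> carrier V"
  using smult_closed by simp

lemma smult_distr_left: "x \<in> carrier V \<Longrightarrow> (c + d) \<odot> x = c \<odot> x \<oplus> d \<odot> x"
  using smult_l_distr[of c d x] by simp

lemma smult_distr_right:
  "x \<in> carrier V \<Longrightarrow> y \<in> carrier V \<Longrightarrow> c \<odot> (x \<oplus> y) = c \<odot> x \<oplus> c \<odot> y"
  using smult_r_distr[of c x y] by simp

lemma smult_smult: "x \<in> carrier V \<Longrightarrow> c \<odot> (d \<odot> x) = (c * d) \<odot> x"
  using smult_assoc1[of c d x] by simp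

lemma smult_1 [simp]: "x \<in> carrier V \<Longrightarrow> 1 \<odot> x = x"
  using smult_one[of x] by simp

lemma smult_0_left [simp]: "x \<in> carrier V \<Longrightarrow> 0 \<odot> x = \<zero>"
  using smult_l_null[of x] by simp

lemma smult_0_right [simp]: "c \<odot> \<zero> = \<zero>"
  using smult_r_null[of c] by simp

lemma smult_m1: assumes "x \<in> carrier V" shows "(-1) \<odot> x = \<ominus> x"
proof -
  have "(-1) \<odot> x \<oplus> x = (-1 + 1) \<odot> x"
    using assms by (subst smult_distr_left) auto
  then show ?thesis using assms minus_equality[of "(-1) \<odot> x" x] by simp
qed

lemma finsum_smult: "finite A \<Longrightarrow> g \<in> A \<rightarrow> carrier V \<Longrightarrow> c \<odot> finsum V g A = (\<Oplus>i\<in>A. c \<odot> g i)"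
  using finsum_smult_ldistr[of A c g] by simp

end

text \<open>Additive inverses are supplied as \<open>(-1) \<odot> x\<close>, so that no inverse has
  to be constructed by hand for cosets or functions.\<close>

lemma vspaceI:
  fixes V :: "('f::field, 'm, 'z) module_scheme" (structure)
  assumes "\<And>x y. x \<in> carrier V \<Longrightarrow> y \<in> carrier V \<Longrightarrow> x \<oplus> y \<in> carrier V"
    and "\<zero> \<in> carrier V"
    and "\<And>x y z. x \<in> carrier V \<Longrightarrow> y \<in> carrier V \<Longrightarrow> z \<in> carrier V \<Longrightarrow> (x \<oplus> y) \<oplus> z = x \<oplus> (y \<oplus> z)"
    and "\<And>x y. x \<in> carrier V \<Longrightarrow> y \<in> carrier V \<Longrightarrow> x \<oplus> y = y \<oplus> x"
    and "\<And>x. x \<in> carrier V \<Longrightarrow> \<zero> \<oplus> x = x"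
    and "\<And>c x. x \<in> carrier V \<Longrightarrow> c \<odot> x \<in> carrier V"
    and "\<And>x. x \<in> carrier V \<Longrightarrow> (-1) \<odot> x \<oplus> x = \<zero>"
    and "\<And>c d x. x \<in> carrier V \<Longrightarrow> (c + d) \<odot> x = c \<odot> x \<oplus> d \<odot> x"
    and "\<And>c x y. x \<in> carrier V \<Longrightarrow> y \<in> carrier V \<Longrightarrow> c \<odot> (x \<oplus> y) = c \<odot> x \<oplus> c \<odot> y"
    and "\<And>c d x. x \<in> carrier V \<Longrightarrow> (c * d) \<odot> x = c \<odot> (d \<odot> x)"
    and "\<And>x. x \<in> carrier V \<Longrightarrow> 1 \<odot> x = x"
  shows "vspace V"
proof (rule vspace.intro, rule moduleI)
  show "cring (field_ring :: 'f ring)" by (rule cring_field_ring)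
  show "abelian_group V"
    by (rule abelian_groupI) (use assms in \<open>auto intro!: bexI[of _ "(-1) \<odot> x" for x]\<close>)
qed (use assms in auto)

subsection \<open>Linear maps on spaces of finitely supported functions\<close>

lemma lookup_pscale [simp]: "Poly_Mapping.lookup (pscale c u) k = c * Poly_Mapping.lookup u k"
  by (simp add: pscale_def Poly_Mapping.map.rep_eq when_def)

lemma keys_pscale: "Poly_Mapping.keys (pscale c u) \<subseteq> Poly_Mapping.keys u"
  by (auto simp: in_keys_iff)

lemma pscale_single [simp]: "pscale c (Poly_Mapping.single k d) = Poly_Mapping.single k (c * d)"
  by (rule poly_mapping_eqI) (simp add: lookup_single when_def)

text \<open>Finitely supported functions form a vector space on the whole type. Spans and subspaces
  are therefore taken in the type-based theory, and carriers enter only for quotients, tensor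
  products and Hom spaces.\<close>

interpretation pm: vector_space pscale
  by standard (auto intro!: poly_mapping_eqI simp: lookup_add algebra_simps)

lemma keys_sum_subset: "(\<And>i. i \<in> A \<Longrightarrow> Poly_Mapping.keys (f i) \<subseteq> B) \<Longrightarrow> Poly_Mapping.keys (sum f A) \<subseteq> B"
proof (induction A rule: infinite_finite_induct)
  case (insert x F)
  then show ?case using Poly_Mapping.keys_add[of "f x" "sum f F"] by fastforce
qed auto

lemma subspace_keys: "pm.subspace {u :: 'a \<Rightarrow>\<^sub>0 'f::field. Poly_Mapping.keys u \<subseteq> B}"
proof (rule pm.subspaceI)
  fix x y :: "'a \<Rightarrow>\<^sub>0 'f" and c
  assume "x \<in> {u. Poly_Mapping.keys u \<subseteq> B}" "y \<in> {u. Poly_Mapping.keys u \<subseteq> B}"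
  then show "x + y \<in> {u. Poly_Mapping.keys u \<subseteq> B}" "pscale c x \<in> {u. Poly_Mapping.keys u \<subseteq> B}"
    using Poly_Mapping.keys_add[of x y] keys_pscale[of c x] by auto
qed auto

lemma poly_mapping_sum_keys:
  assumes "finite S" "Poly_Mapping.keys u \<subseteq> S"
  shows "u = (\<Sum>k\<in>S. Poly_Mapping.single k (Poly_Mapping.lookup u k))"
proof (rule poly_mapping_eqI)
  fix k
  have "(\<Sum>i\<in>S. Poly_Mapping.lookup (Poly_Mapping.single i (Poly_Mapping.lookup u i)) k) =
      (if k \<in> S then Poly_Mapping.lookup u k else 0)"
    using assms(1) by (simp add: lookup_single when_def sum.delta)
  then show "Poly_Mapping.lookup u k = Poly_Mapping.lookup (\<Sum>k\<in>S. Poly_Mapping.single k (Poly_Mapping.lookup u k)) k"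
    using assms(2) by (auto simp: lookup_sum in_keys_iff subset_iff)
qed

text \<open>A linear map from a subspace of a type-based space into a carrier-based one. That
  \<open>U\<close> is a subspace and \<open>V\<close> a vector space is part of the notion, so a
  single premise carries all the side conditions.\<close>

definition linear_on :: "('b \<Rightarrow>\<^sub>0 'f::field) set \<Rightarrow> ('f, 'm, 'z) module_scheme \<Rightarrow> (('b \<Rightarrow>\<^sub>0 'f) \<Rightarrow> 'm) \<Rightarrow> bool" where
  "linear_on U V g \<longleftrightarrow> is_vector_space V \<and> pm.subspace U \<and> g \<in> U \<rightarrow> carrier V \<and>
     (\<forall>x\<in>U. \<forall>y\<in>U. g (x + y) = g x \<oplus>\<^bsub>V\<^esub> g y) \<and> (\<forall>c. \<forall>x\<in>U. g (pscale c x) = c \<odot>\<^bsub>V\<^esub> g x)"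

lemma linear_on_closed: "linear_on U V g \<Longrightarrow> x \<in> U \<Longrightarrow> g x \<in> carrier V"
  by (auto simp: linear_on_def)

lemma linear_on_add: "linear_on U V g \<Longrightarrow> x \<in> U \<Longrightarrow> y \<in> U \<Longrightarrow> g (x + y) = g x \<oplus>\<^bsub>V\<^esub> g y"
  by (auto simp: linear_on_def)

lemma linear_on_pscale: "linear_on U V g \<Longrightarrow> x \<in> U \<Longrightarrow> g (pscale c x) = c \<odot>\<^bsub>V\<^esub> g x"
  by (auto simp: linear_on_def)

lemma linear_on_zero: assumes "linear_on U V g" shows "g 0 = \<zero>\<^bsub>V\<^esub>"
proof -
  interpret vspace V using assms by (simp add: linear_on_def vspace_def)
  have "0 \<in> U" using assms pm.subspace_0 by (auto simp: linear_on_def)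
  then show ?thesis using linear_on_pscale[OF assms, of 0 0] linear_on_closed[OF assms, of 0] by simp
qed

lemma linear_on_subset: "linear_on U V g \<Longrightarrow> U' \<subseteq> U \<Longrightarrow> pm.subspace U' \<Longrightarrow> linear_on U' V g"
  unfolding linear_on_def by (meson Pi_anti_mono in_mono Pi_mono subset_iff funcset_mem Pi_I)

lemma linear_on_sum:
  assumes "linear_on U V g" "finite A" "\<And>i. i \<in> A \<Longrightarrow> f i \<in> U"
  shows "g (\<Sum>i\<in>A. f i) = (\<Oplus>\<^bsub>V\<^esub>i\<in>A. g (f i))"
proof -
  interpret vspace V using assms by (simp add: linear_on_def vspace_def)
  have U: "pm.subspace U" using assms by (simp add: linear_on_def)
  show ?thesis using assms(2,3)
  proof (induction A)
    case empty then show ?case using linear_on_zero[OF assms(1)] by simp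
  next
    case (insert x F)
    then have "sum f F \<in> U" by (intro pm.subspace_sum[OF U]) auto
    then show ?case using insert linear_on_add[OF assms(1)] linear_on_closed[OF assms(1)]
      by (simp add: Pi_iff)
  qed
qed

text \<open>The kernel within \<open>U\<close> is a subspace, so relations need to be tested on
  generators only. That the span stays inside \<open>U\<close> comes out of the same
  argument.\<close>

lemma linear_on_span_zero:
  assumes "linear_on U V g" "G \<subseteq> U" "\<And>x. x \<in> G \<Longrightarrow> g x = \<zero>\<^bsub>V\<^esub>" "x \<in> pspan G"
  shows "x \<in> U \<and> g x = \<zero>\<^bsub>V\<^esub>"
proof -
  interpret vspace V using assms by (simp add: linear_on_def vspace_def)
  have U: "pm.subspace U" using assms by (simp add: linear_on_def)
  have "pm.subspace {x \<in> U. g x = \<zero>\<^bsub>V\<^esub>}"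
    using U linear_on_add[OF assms(1)] linear_on_pscale[OF assms(1)] linear_on_zero[OF assms(1)]
    by (auto simp: pm.subspace_def)
  then have "pspan G \<subseteq> {x \<in> U. g x = \<zero>\<^bsub>V\<^esub>}" by (intro pm.span_minimal) (use assms in auto)
  then show ?thesis using assms by auto
qed

text \<open>Coefficients outside the support vanish. Evaluating two arguments over one common finite
  set is what makes additivity of \<open>lin_ext\<close> provable termwise.\<close>

lemma lin_ext_superset:
  assumes "is_vector_space V" "\<phi> \<in> S \<rightarrow> carrier V" "finite S" "Poly_Mapping.keys u \<subseteq> S"
  shows "lin_ext V \<phi> u = (\<Oplus>\<^bsub>V\<^esub>b\<in>S. Poly_Mapping.lookup u b \<odot>\<^bsub>V\<^esub> \<phi> b)"
proof -
  interpret vspace V using assms by (simp add: vspace_def)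
  show ?thesis unfolding lin_ext_def
    by (rule add.finprod_mono_neutral_cong_left) (use assms in \<open>auto simp: in_keys_iff Pi_iff\<close>)
qed

lemma lin_ext_linear_on:
  assumes "is_vector_space V" "\<phi> \<in> B \<rightarrow> carrier V"
  shows "linear_on {u. Poly_Mapping.keys u \<subseteq> B} V (lin_ext V \<phi>)"
proof -
  interpret vspace V using assms by (simp add: vspace_def)
  have closed: "lin_ext V \<phi> u \<in> carrier V" if "Poly_Mapping.keys u \<subseteq> B" for u
    unfolding lin_ext_def using that assms(2) by (auto intro!: finsum_closed)
  moreover have "lin_ext V \<phi> (u + v) = lin_ext V \<phi> u \<oplus>\<^bsub>V\<^esub> lin_ext V \<phi> v"
    if uv: "Poly_Mapping.keys u \<subseteq> B" "Poly_Mapping.keys v \<subseteq> B" for u v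
  proof -
    let ?S = "Poly_Mapping.keys u \<union> Poly_Mapping.keys v"
    have S: "\<phi> \<in> ?S \<rightarrow> carrier V" using assms(2) uv by auto
    then have c: "\<phi> b \<in> carrier V" if "b \<in> ?S" for b using that by blast
    have "lin_ext V \<phi> (u + v) = (\<Oplus>\<^bsub>V\<^esub>b\<in>?S. Poly_Mapping.lookup (u + v) b \<odot>\<^bsub>V\<^esub> \<phi> b)"
      using S Poly_Mapping.keys_add[of u v] by (intro lin_ext_superset assms) auto
    also have "\<dots> = (\<Oplus>\<^bsub>V\<^esub>b\<in>?S. Poly_Mapping.lookup u b \<odot>\<^bsub>V\<^esub> \<phi> b \<oplus>\<^bsub>V\<^esub> Poly_Mapping.lookup v b \<odot>\<^bsub>V\<^esub> \<phi> b)"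
      using c by (intro finsum_cong') (auto simp: lookup_add smult_distr_left)
    also have "\<dots> = (\<Oplus>\<^bsub>V\<^esub>b\<in>?S. Poly_Mapping.lookup u b \<odot>\<^bsub>V\<^esub> \<phi> b) \<oplus>\<^bsub>V\<^esub> (\<Oplus>\<^bsub>V\<^esub>b\<in>?S. Poly_Mapping.lookup v b \<odot>\<^bsub>V\<^esub> \<phi> b)"
      using c by (intro finsum_addf) auto
    also have "\<dots> = lin_ext V \<phi> u \<oplus>\<^bsub>V\<^esub> lin_ext V \<phi> v"
      using S by (subst (1 2) lin_ext_superset[OF assms(1) S]) auto
    finally show ?thesis .
  qed
  moreover have "lin_ext V \<phi> (pscale c u) = c \<odot>\<^bsub>V\<^esub> lin_ext V \<phi> u"
    if u: "Poly_Mapping.keys u \<subseteq> B" for u c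
  proof -
    let ?S = "Poly_Mapping.keys u"
    have S: "\<phi> \<in> ?S \<rightarrow> carrier V" using assms(2) u by auto
    have "lin_ext V \<phi> (pscale c u) = (\<Oplus>\<^bsub>V\<^esub>b\<in>?S. Poly_Mapping.lookup (pscale c u) b \<odot>\<^bsub>V\<^esub> \<phi> b)"
      using S keys_pscale[of c u] by (intro lin_ext_superset assms) auto
    also have "\<dots> = (\<Oplus>\<^bsub>V\<^esub>b\<in>?S. c \<odot>\<^bsub>V\<^esub> (Poly_Mapping.lookup u b \<odot>\<^bsub>V\<^esub> \<phi> b))"
      using S by (intro finsum_cong') (auto simp: smult_smult Pi_iff)
    also have "\<dots> = c \<odot>\<^bsub>V\<^esub> lin_ext V \<phi> u"
      unfolding lin_ext_def using S by (intro finsum_smult[symmetric]) auto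
    finally show ?thesis .
  qed
  ultimately show ?thesis using assms subspace_keys[of B] by (auto simp: linear_on_def)
qed

lemma lin_ext_single:
  assumes "is_vector_space V" "\<phi> b \<in> carrier V"
  shows "lin_ext V \<phi> (Poly_Mapping.single b c) = c \<odot>\<^bsub>V\<^esub> \<phi> b"
proof -
  interpret vspace V using assms by (simp add: vspace_def)
  show ?thesis using assms by (subst lin_ext_superset[of V \<phi> "{b}"]) auto
qed

subsection \<open>Quotients of free spaces\<close>

text \<open>All spaces factored here have \<open>(+)\<close> as their addition, so a coset depends
  only on \<open>N\<close> and not on the surrounding record. One set of lemmas then covers free
  spaces and the path algebra alike.\<close>

definition coset_of :: "('b \<Rightarrow>\<^sub>0 'f::field) set \<Rightarrow> ('b \<Rightarrow>\<^sub>0 'f) \<Rightarrow> ('b \<Rightarrow>\<^sub>0 'f) set" where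
  "coset_of N u = (\<lambda>n. n + u) ` N"

lemma r_coset_plus: "add V = (+) \<Longrightarrow> N +>\<^bsub>V\<^esub> u = coset_of N u"
  by (auto simp: a_r_coset_def' coset_of_def)

lemma set_add_plus: "add V = (+) \<Longrightarrow> X <+>\<^bsub>V\<^esub> Y = {x + y |x y. x \<in> X \<and> y \<in> Y}"
  by (auto simp: set_add_def')

lemma coset_of_eq_iff: "pm.subspace N \<Longrightarrow> coset_of N u = coset_of N v \<longleftrightarrow> u - v \<in> N"
proof
  assume N: "pm.subspace N" and eq: "coset_of N u = coset_of N v"
  have "u \<in> coset_of N u" using N pm.subspace_0 by (force simp: coset_of_def)
  then obtain n where "n \<in> N" "u = n + v" using eq by (auto simp: coset_of_def)
  then show "u - v \<in> N" by simp
next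
  assume N: "pm.subspace N" and d: "u - v \<in> N"
  have "coset_of N u \<subseteq> coset_of N v" if "u - v \<in> N" for u v
  proof
    fix x assume "x \<in> coset_of N u"
    then obtain n where n: "n \<in> N" "x = n + u" by (auto simp: coset_of_def)
    then have "n + (u - v) \<in> N" using N that pm.subspace_add by blast
    moreover have "x = n + (u - v) + v" using n by simp
    ultimately show "x \<in> coset_of N v" unfolding coset_of_def by blast
  qed
  from this[of u v] this[of v u] show "coset_of N u = coset_of N v"
    using d N pm.subspace_neg[of N "u - v"] by auto
qed

lemma in_coset_of_iff: "x \<in> coset_of N u \<longleftrightarrow> x - u \<in> N"
  by (auto simp: coset_of_def image_iff) (metis add.commute diff_add_cancel)

lemma coset_of_0 [simp]: "coset_of N 0 = N" by (simp add: coset_of_def)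

lemma free_space_simps [simp]:
  "carrier (free_space B) = {u. Poly_Mapping.keys u \<subseteq> B}" "add (free_space B) = (+)"
  "zero (free_space B) = 0" "smult (free_space B) = pscale"
  by (simp_all add: free_space_def)

lemma quotient_simps [simp]:
  "zero (quotient_space V N) = N" "add (quotient_space V N) = set_add V"
  by (simp_all add: quotient_space_def)

lemma carrier_quotient_plus:
  "add V = (+) \<Longrightarrow> carrier (quotient_space V N) = coset_of N ` carrier V"
  by (auto simp: quotient_space_def A_RCOSETS_def' r_coset_plus)

lemma coset_of_add:
  assumes "pm.subspace N" "add V = (+)"
  shows "coset_of N u <+>\<^bsub>V\<^esub> coset_of N v = coset_of N (u + v)"
proof -
  have "x + y - (u + v) \<in> N" if "x - u \<in> N" "y - v \<in> N" for x y
    using pm.subspace_add[OF assms(1) that] by (simp add: algebra_simps)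
  moreover have "\<exists>x y. z = x + y \<and> x - u \<in> N \<and> y - v \<in> N" if "z - (u + v) \<in> N" for z
    using that pm.subspace_0[OF assms(1)] by (intro exI[of _ "z - v"] exI[of _ v]) (simp add: algebra_simps)
  ultimately show ?thesis unfolding set_add_plus[OF assms(2)] by (auto simp: in_coset_of_iff)
qed

text \<open>The union in the scalar action of \<open>quotient_space\<close> ranges over equal cosets
  and collapses to one of them.\<close>

lemma coset_of_smult:
  assumes "pm.subspace N" "add V = (+)" "smult V = pscale"
  shows "c \<odot>\<^bsub>quotient_space V N\<^esub> coset_of N u = coset_of N (pscale c u)"
proof -
  have "coset_of N (pscale c x) = coset_of N (pscale c u)" if "x \<in> coset_of N u" for x
    using pm.subspace_scale[OF assms(1), of "x - u" c] that coset_of_eq_iff[OF assms(1)]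
    by (simp add: in_coset_of_iff pm.scale_right_diff_distrib)
  moreover have "u \<in> coset_of N u" using pm.subspace_0[OF assms(1)] by (simp add: in_coset_of_iff)
  ultimately have "(\<Union>x\<in>coset_of N u. coset_of N (pscale c x)) = coset_of N (pscale c u)" by blast
  then show ?thesis using assms(2,3) by (simp add: quotient_space_def r_coset_plus)
qed

lemma quotient_vspace:
  assumes "pm.subspace N" "add V = (+)" "smult V = pscale" "pm.subspace (carrier V)"
  shows "vspace (quotient_space V N)"
proof -
  note s = coset_of_add[OF assms(1,2)] coset_of_smult[OF assms(1-3)] carrier_quotient_plus[OF assms(2)]
  note sub = pm.subspace_add[OF assms(4)] pm.subspace_scale[OF assms(4)] pm.subspace_0[OF assms(4)]
  have Z: "N = coset_of N 0" by simp
  show ?thesis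
  proof (rule vspaceI)
    show "\<zero>\<^bsub>quotient_space V N\<^esub> \<in> carrier (quotient_space V N)"
      using sub(3) Z by (auto simp: s(3) simp del: coset_of_0)
  next
    fix x assume "x \<in> carrier (quotient_space V N)"
    then obtain u where u: "u \<in> carrier V" "x = coset_of N u" by (auto simp: s)
    have "coset_of N 0 <+>\<^bsub>V\<^esub> x = x" "(-1) \<odot>\<^bsub>quotient_space V N\<^esub> x \<oplus>\<^bsub>quotient_space V N\<^esub> x = coset_of N 0"
      unfolding u quotient_simps s by (simp_all add: pm.scale_minus_left)
    then show "\<zero>\<^bsub>quotient_space V N\<^esub> \<oplus>\<^bsub>quotient_space V N\<^esub> x = x"
      "(-1) \<odot>\<^bsub>quotient_space V N\<^esub> x \<oplus>\<^bsub>quotient_space V N\<^esub> x = \<zero>\<^bsub>quotient_space V N\<^esub>"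
      by simp_all
    show "1 \<odot>\<^bsub>quotient_space V N\<^esub> x = x" by (simp add: u s)
    show "c \<odot>\<^bsub>quotient_space V N\<^esub> x \<in> carrier (quotient_space V N)" for c
      using u sub by (simp add: s)
    show "(c + d) \<odot>\<^bsub>quotient_space V N\<^esub> x = c \<odot>\<^bsub>quotient_space V N\<^esub> x \<oplus>\<^bsub>quotient_space V N\<^esub> d \<odot>\<^bsub>quotient_space V N\<^esub> x" for c d
      by (simp add: u s pm.scale_left_distrib)
    show "(c * d) \<odot>\<^bsub>quotient_space V N\<^esub> x = c \<odot>\<^bsub>quotient_space V N\<^esub> (d \<odot>\<^bsub>quotient_space V N\<^esub> x)" for c d
      by (simp add: u s)
    fix y assume "y \<in> carrier (quotient_space V N)"
    then obtain v where v: "v \<in> carrier V" "y = coset_of N v" by (auto simp: s)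
    show "x \<oplus>\<^bsub>quotient_space V N\<^esub> y \<in> carrier (quotient_space V N)"
      using u v sub by (simp add: s)
    show "x \<oplus>\<^bsub>quotient_space V N\<^esub> y = y \<oplus>\<^bsub>quotient_space V N\<^esub> x"
      by (simp add: u v s add.commute)
    show "c \<odot>\<^bsub>quotient_space V N\<^esub> (x \<oplus>\<^bsub>quotient_space V N\<^esub> y) = c \<odot>\<^bsub>quotient_space V N\<^esub> x \<oplus>\<^bsub>quotient_space V N\<^esub> c \<odot>\<^bsub>quotient_space V N\<^esub> y" for c
      by (simp add: u v s pm.scale_right_distrib)
    fix z assume "z \<in> carrier (quotient_space V N)"
    then obtain w where w: "w \<in> carrier V" "z = coset_of N w" by (auto simp: s)
    show "x \<oplus>\<^bsub>quotient_space V N\<^esub> y \<oplus>\<^bsub>quotient_space V N\<^esub> z = x \<oplus>\<^bsub>quotient_space V N\<^esub> (y \<oplus>\<^bsub>quotient_space V N\<^esub> z)"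
      by (simp add: u v w s add.assoc)
  qed
qed

text \<open>This is the value that a biadditive map takes on the first two kinds of relations in
  \<open>tensor_rels\<close>.\<close>

lemma (in vspace) add_diff_diff:
  assumes "a \<in> carrier V" "b \<in> carrier V"
  shows "a \<oplus> b \<ominus> a \<ominus> b = \<zero>"
proof -
  have "a \<oplus> b \<ominus> a \<ominus> b = (a \<oplus> b) \<oplus> (\<ominus> a \<oplus> \<ominus> b)"
    using assms by (simp add: minus_eq a_assoc)
  also have "\<dots> = \<zero>" using assms by (simp add: minus_add[symmetric] r_neg)
  finally show ?thesis .
qed

lemma (in vspace) diff_self: "a \<in> carrier V \<Longrightarrow> a \<ominus> a = \<zero>"
  by (simp add: minus_eq r_neg)

lemma linear_on_diff:
  assumes "linear_on U V g" "x \<in> U" "y \<in> U"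
  shows "g (x - y) = g x \<ominus>\<^bsub>V\<^esub> g y"
proof -
  interpret vspace V using assms by (simp add: linear_on_def vspace_def)
  have U: "pm.subspace U" using assms by (simp add: linear_on_def)
  have e: "x - y = x + pscale (-1) y" by simp
  have "pscale (-1) y \<in> U" using U assms by (rule_tac pm.subspace_scale)
  then have "g (x - y) = g x \<oplus>\<^bsub>V\<^esub> g (pscale (-1) y)"
    unfolding e by (intro linear_on_add[OF assms(1,2)])
  then show ?thesis
    unfolding linear_on_pscale[OF assms(1,3)] by (simp add: smult_m1 linear_on_closed[OF assms(1,3)] minus_eq)
qed

subsection \<open>Tensor products\<close>

text \<open>The input of the universal property: bilinear maps that identify \<open>r x s\<close> in
  the first argument with \<open>l s y\<close> in the second. The map takes pairs in order to fit
  \<open>tensor_lift\<close> and \<open>split_sum\<close>.\<close>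

definition balanced_map ::
    "('f::field, 'x, 'p) module_scheme \<Rightarrow> 's set \<Rightarrow> ('x \<Rightarrow> 's \<Rightarrow> 'x) \<Rightarrow>
     ('f, 'y, 'q) module_scheme \<Rightarrow> ('s \<Rightarrow> 'y \<Rightarrow> 'y) \<Rightarrow> ('f, 'm, 'z) module_scheme \<Rightarrow> ('x \<times> 'y \<Rightarrow> 'm) \<Rightarrow> bool" where
  "balanced_map X S r Y l V \<phi> \<longleftrightarrow> is_vector_space V \<and>
     (\<forall>x\<in>carrier X. \<forall>y\<in>carrier Y. \<phi> (x, y) \<in> carrier V) \<and>
     (\<forall>x\<in>carrier X. \<forall>x'\<in>carrier X. \<forall>y\<in>carrier Y. \<phi> (x \<oplus>\<^bsub>X\<^esub> x', y) = \<phi> (x, y) \<oplus>\<^bsub>V\<^esub> \<phi> (x', y)) \<and>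
     (\<forall>x\<in>carrier X. \<forall>y\<in>carrier Y. \<forall>y'\<in>carrier Y. \<phi> (x, y \<oplus>\<^bsub>Y\<^esub> y') = \<phi> (x, y) \<oplus>\<^bsub>V\<^esub> \<phi> (x, y')) \<and>
     (\<forall>c. \<forall>x\<in>carrier X. \<forall>y\<in>carrier Y. \<phi> (c \<odot>\<^bsub>X\<^esub> x, y) = c \<odot>\<^bsub>V\<^esub> \<phi> (x, y)) \<and>
     (\<forall>c. \<forall>x\<in>carrier X. \<forall>y\<in>carrier Y. \<phi> (x, c \<odot>\<^bsub>Y\<^esub> y) = c \<odot>\<^bsub>V\<^esub> \<phi> (x, y)) \<and>
     (\<forall>x\<in>carrier X. \<forall>s\<in>S. \<forall>y\<in>carrier Y. \<phi> (r x s, y) = \<phi> (x, l s y))"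

lemma balanced_mapD:
  assumes "balanced_map X S r Y l V \<phi>"
  shows "is_vector_space V"
    "x \<in> carrier X \<Longrightarrow> y \<in> carrier Y \<Longrightarrow> \<phi> (x, y) \<in> carrier V"
    "x \<in> carrier X \<Longrightarrow> x' \<in> carrier X \<Longrightarrow> y \<in> carrier Y \<Longrightarrow> \<phi> (x \<oplus>\<^bsub>X\<^esub> x', y) = \<phi> (x, y) \<oplus>\<^bsub>V\<^esub> \<phi> (x', y)"
    "x \<in> carrier X \<Longrightarrow> y \<in> carrier Y \<Longrightarrow> y' \<in> carrier Y \<Longrightarrow> \<phi> (x, y \<oplus>\<^bsub>Y\<^esub> y') = \<phi> (x, y) \<oplus>\<^bsub>V\<^esub> \<phi> (x, y')"
    "x \<in> carrier X \<Longrightarrow> y \<in> carrier Y \<Longrightarrow> \<phi> (c \<odot>\<^bsub>X\<^esub> x, y) = c \<odot>\<^bsub>V\<^esub> \<phi> (x, y)"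
    "x \<in> carrier X \<Longrightarrow> y \<in> carrier Y \<Longrightarrow> \<phi> (x, c \<odot>\<^bsub>Y\<^esub> y) = c \<odot>\<^bsub>V\<^esub> \<phi> (x, y)"
    "x \<in> carrier X \<Longrightarrow> s \<in> S \<Longrightarrow> y \<in> carrier Y \<Longrightarrow> \<phi> (r x s, y) = \<phi> (x, l s y)"
proof -
  note D = assms[unfolded balanced_map_def]
  note D2 = D[THEN conjunct2] note D3 = D2[THEN conjunct2] note D4 = D3[THEN conjunct2]
  note D5 = D4[THEN conjunct2] note D6 = D5[THEN conjunct2] note D7 = D6[THEN conjunct2]
  show "is_vector_space V" by (rule D[THEN conjunct1])
  show "x \<in> carrier X \<Longrightarrow> y \<in> carrier Y \<Longrightarrow> \<phi> (x, y) \<in> carrier V"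
    by (rule D2[THEN conjunct1, rule_format])
  show "x \<in> carrier X \<Longrightarrow> x' \<in> carrier X \<Longrightarrow> y \<in> carrier Y \<Longrightarrow> \<phi> (x \<oplus>\<^bsub>X\<^esub> x', y) = \<phi> (x, y) \<oplus>\<^bsub>V\<^esub> \<phi> (x', y)"
    by (rule D3[THEN conjunct1, rule_format])
  show "x \<in> carrier X \<Longrightarrow> y \<in> carrier Y \<Longrightarrow> y' \<in> carrier Y \<Longrightarrow> \<phi> (x, y \<oplus>\<^bsub>Y\<^esub> y') = \<phi> (x, y) \<oplus>\<^bsub>V\<^esub> \<phi> (x, y')"
    by (rule D4[THEN conjunct1, rule_format])
  show "x \<in> carrier X \<Longrightarrow> y \<in> carrier Y \<Longrightarrow> \<phi> (c \<odot>\<^bsub>X\<^esub> x, y) = c \<odot>\<^bsub>V\<^esub> \<phi> (x, y)"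
    by (rule D5[THEN conjunct1, rule_format])
  show "x \<in> carrier X \<Longrightarrow> y \<in> carrier Y \<Longrightarrow> \<phi> (x, c \<odot>\<^bsub>Y\<^esub> y) = c \<odot>\<^bsub>V\<^esub> \<phi> (x, y)"
    by (rule D6[THEN conjunct1, rule_format])
  show "x \<in> carrier X \<Longrightarrow> s \<in> S \<Longrightarrow> y \<in> carrier Y \<Longrightarrow> \<phi> (r x s, y) = \<phi> (x, l s y)"
    by (rule D7[rule_format])
qed

text \<open>Closure under the two actions keeps the balancing relations inside the free space on
  \<open>carrier X \<times> carrier Y\<close>, where the linear extension of a balanced map is known
  to be linear.\<close>

locale tensor_product = X: vspace X + Y: vspace Y
  for X :: "('f::field, 'x, 'p) module_scheme" and S :: "'s set" and r :: "'x \<Rightarrow> 's \<Rightarrow> 'x"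
    and Y :: "('f, 'y, 'q) module_scheme" and l :: "'s \<Rightarrow> 'y \<Rightarrow> 'y" +
  assumes r_closed: "x \<in> carrier X \<Longrightarrow> s \<in> S \<Longrightarrow> r x s \<in> carrier X"
    and l_closed: "y \<in> carrier Y \<Longrightarrow> s \<in> S \<Longrightarrow> l s y \<in> carrier Y"
begin

abbreviation T :: "('f, ('x \<times> 'y \<Rightarrow>\<^sub>0 'f) set) module" where "T \<equiv> tensor_space X S r Y l"
abbreviation N :: "('x \<times> 'y \<Rightarrow>\<^sub>0 'f) set" where "N \<equiv> tensor_rels X S r Y l"
abbreviation tensor :: "'x \<Rightarrow> 'y \<Rightarrow> ('x \<times> 'y \<Rightarrow>\<^sub>0 'f) set" where "tensor \<equiv> pure \<zero>\<^bsub>T\<^esub>"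

lemma zero_T: "\<zero>\<^bsub>T\<^esub> = N"
  by (simp add: tensor_space_def)

lemma pure_eq: "pure U x y = coset_of U (Poly_Mapping.single (x, y) (1::'f))"
  unfolding pure_def by (rule r_coset_plus) simp

lemma subspace_N: "pm.subspace N"
  unfolding tensor_rels_def by (rule pm.subspace_span)

lemma T_vspace: "vspace T"
  unfolding tensor_space_def by (rule quotient_vspace) (simp_all add: subspace_N subspace_keys)

sublocale T: vspace T by (rule T_vspace)

lemma carrier_T: "carrier T = coset_of N ` {u. Poly_Mapping.keys u \<subseteq> carrier X \<times> carrier Y}"
  unfolding tensor_space_def by (subst carrier_quotient_plus) simp_all

lemma T_add: "coset_of N u \<oplus>\<^bsub>T\<^esub> coset_of N v = coset_of N (u + v)"
  unfolding tensor_space_def by (simp add: coset_of_add subspace_N)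

lemma T_smult: "c \<odot>\<^bsub>T\<^esub> coset_of N u = coset_of N (pscale c u)"
  unfolding tensor_space_def by (rule coset_of_smult) (simp_all add: subspace_N)

lemma tensor_closed [simp]: "x \<in> carrier X \<Longrightarrow> y \<in> carrier Y \<Longrightarrow> tensor x y \<in> carrier T"
  unfolding pure_eq zero_T carrier_T by simp

lemma tensor_add_left:
  assumes "x \<in> carrier X" "x' \<in> carrier X" "y \<in> carrier Y"
  shows "tensor (x \<oplus>\<^bsub>X\<^esub> x') y = tensor x y \<oplus>\<^bsub>T\<^esub> tensor x' y"
proof -
  have "Poly_Mapping.single (x \<oplus>\<^bsub>X\<^esub> x', y) 1 - Poly_Mapping.single (x, y) 1 - Poly_Mapping.single (x', y) 1 \<in> N"
    unfolding tensor_rels_def by (rule pm.span_base) (use assms in blast)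
  then show ?thesis unfolding pure_eq zero_T T_add coset_of_eq_iff[OF subspace_N] by (simp add: diff_diff_eq)
qed

lemma tensor_add_right:
  assumes "x \<in> carrier X" "y \<in> carrier Y" "y' \<in> carrier Y"
  shows "tensor x (y \<oplus>\<^bsub>Y\<^esub> y') = tensor x y \<oplus>\<^bsub>T\<^esub> tensor x y'"
proof -
  have "Poly_Mapping.single (x, y \<oplus>\<^bsub>Y\<^esub> y') 1 - Poly_Mapping.single (x, y) 1 - Poly_Mapping.single (x, y') 1 \<in> N"
    unfolding tensor_rels_def by (rule pm.span_base) (use assms in blast)
  then show ?thesis unfolding pure_eq zero_T T_add coset_of_eq_iff[OF subspace_N] by (simp add: diff_diff_eq)
qed

lemma tensor_smult_left:
  assumes "x \<in> carrier X" "y \<in> carrier Y"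
  shows "tensor (c \<odot>\<^bsub>X\<^esub> x) y = c \<odot>\<^bsub>T\<^esub> tensor x y"
proof -
  have "Poly_Mapping.single (c \<odot>\<^bsub>X\<^esub> x, y) 1 - Poly_Mapping.single (x, y) c \<in> N"
    unfolding tensor_rels_def by (rule pm.span_base) (use assms in blast)
  then show ?thesis unfolding pure_eq zero_T T_smult coset_of_eq_iff[OF subspace_N] by simp
qed

lemma tensor_smult_right:
  assumes "x \<in> carrier X" "y \<in> carrier Y"
  shows "tensor x (c \<odot>\<^bsub>Y\<^esub> y) = c \<odot>\<^bsub>T\<^esub> tensor x y"
proof -
  have "Poly_Mapping.single (x, c \<odot>\<^bsub>Y\<^esub> y) 1 - Poly_Mapping.single (x, y) c \<in> N"
    unfolding tensor_rels_def by (rule pm.span_base) (use assms in blast)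
  then show ?thesis unfolding pure_eq zero_T T_smult coset_of_eq_iff[OF subspace_N] by simp
qed

lemma tensor_balanced:
  assumes "x \<in> carrier X" "s \<in> S" "y \<in> carrier Y"
  shows "tensor (r x s) y = tensor x (l s y)"
proof -
  have "Poly_Mapping.single (r x s, y) 1 - Poly_Mapping.single (x, l s y) 1 \<in> N"
    unfolding tensor_rels_def by (rule pm.span_base) (use assms in blast)
  then show ?thesis unfolding pure_eq zero_T coset_of_eq_iff[OF subspace_N] by simp
qed

lemma tensor_zero_left [simp]: "y \<in> carrier Y \<Longrightarrow> tensor \<zero>\<^bsub>X\<^esub> y = \<zero>\<^bsub>T\<^esub>"
  using tensor_smult_left[of "\<zero>\<^bsub>X\<^esub>" y 0] by simp

lemma tensor_zero_right [simp]: "x \<in> carrier X \<Longrightarrow> tensor x \<zero>\<^bsub>Y\<^esub> = \<zero>\<^bsub>T\<^esub>"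
  using tensor_smult_right[of x "\<zero>\<^bsub>Y\<^esub>" 0] by simp

lemma tensor_finsum_left:
  assumes "finite A" "\<And>i. i \<in> A \<Longrightarrow> f i \<in> carrier X" "y \<in> carrier Y"
  shows "tensor (\<Oplus>\<^bsub>X\<^esub>i\<in>A. f i) y = (\<Oplus>\<^bsub>T\<^esub>i\<in>A. tensor (f i) y)"
  using assms by (induction A) (simp_all add: Pi_iff tensor_add_left)

text \<open>There is no case for scalar multiples because a coefficient can be absorbed into the
  first tensor factor.\<close>

lemma tensor_induct [consumes 1, case_names zero tensor add]:
  assumes "z \<in> carrier T" and zero: "P \<zero>\<^bsub>T\<^esub>"
    and tensor: "\<And>x y. x \<in> carrier X \<Longrightarrow> y \<in> carrier Y \<Longrightarrow> P (tensor x y)"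
    and add: "\<And>a b. a \<in> carrier T \<Longrightarrow> b \<in> carrier T \<Longrightarrow> P a \<Longrightarrow> P b \<Longrightarrow> P (a \<oplus>\<^bsub>T\<^esub> b)"
  shows "P z"
proof -
  obtain u where u: "Poly_Mapping.keys u \<subseteq> carrier X \<times> carrier Y" "z = coset_of N u"
    using assms(1) carrier_T by auto
  let ?f = "\<lambda>k. Poly_Mapping.single k (Poly_Mapping.lookup u k)"
  have "P (coset_of N (sum ?f F))" if "finite F" "F \<subseteq> carrier X \<times> carrier Y" for F
    using that
  proof (induction F)
    case empty
    then show ?case using zero zero_T by simp
  next
    case (insert k F)
    obtain x y where k: "k = (x, y)" "x \<in> carrier X" "y \<in> carrier Y" using insert by auto
    have e: "coset_of N (?f k) = tensor (Poly_Mapping.lookup u k \<odot>\<^bsub>X\<^esub> x) y"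
      using k by (subst tensor_smult_left) (simp_all add: pure_eq zero_T T_smult)
    have "P (coset_of N (?f k) \<oplus>\<^bsub>T\<^esub> coset_of N (sum ?f F))"
    proof (rule add)
      show "P (coset_of N (?f k))" using k unfolding e by (intro tensor) auto
      show "coset_of N (?f k) \<in> carrier T" using k unfolding e by simp
      show "coset_of N (sum ?f F) \<in> carrier T"
        unfolding carrier_T using insert(4) by (intro imageI CollectI keys_sum_subset) auto
      show "P (coset_of N (sum ?f F))" using insert by simp
    qed
    then show ?case using insert by (simp add: T_add)
  qed
  from this[of "Poly_Mapping.keys u"] show ?thesis
    using poly_mapping_sum_keys[of "Poly_Mapping.keys u" u] u by simp
qed

context
  fixes V :: "('f, 'm, 'z) module_scheme" and \<phi> :: "'x \<times> 'y \<Rightarrow> 'm"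
  assumes bal: "balanced_map X S r Y l V \<phi>"
begin

interpretation V: vspace V using bal by (simp add: balanced_map_def vspace_def)

lemma lin_ext_bal_linear: "linear_on {u. Poly_Mapping.keys u \<subseteq> carrier X \<times> carrier Y} V (lin_ext V \<phi>)"
  using bal by (intro lin_ext_linear_on) (auto simp: balanced_map_def)

text \<open>This is the well-definedness half of the universal property: a balanced map kills each
  generator of the relations, hence their span.\<close>

lemma lin_ext_rels: "u \<in> N \<Longrightarrow> Poly_Mapping.keys u \<subseteq> carrier X \<times> carrier Y \<and> lin_ext V \<phi> u = \<zero>\<^bsub>V\<^esub>"
proof -
  let ?U = "{u :: 'x \<times> 'y \<Rightarrow>\<^sub>0 'f. Poly_Mapping.keys u \<subseteq> carrier X \<times> carrier Y}"
  have sub: "u - v \<in> ?U \<and> lin_ext V \<phi> (u - v) = lin_ext V \<phi> u \<ominus>\<^bsub>V\<^esub> lin_ext V \<phi> v" if "u \<in> ?U" "v \<in> ?U" for u v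
    using linear_on_diff[OF lin_ext_bal_linear that] pm.subspace_diff[OF subspace_keys that] by simp
  have single: "Poly_Mapping.single (x, y) c \<in> ?U \<and> lin_ext V \<phi> (Poly_Mapping.single (x, y) c) = c \<odot>\<^bsub>V\<^esub> \<phi> (x, y)"
    if "x \<in> carrier X" "y \<in> carrier Y" for x y c
    using that bal by (subst lin_ext_single) (auto simp: balanced_map_def)
  have cl: "\<phi> (x, y) \<in> carrier V" if "x \<in> carrier X" "y \<in> carrier Y" for x y
    using that bal by (auto simp: balanced_map_def)
  note bal' = balanced_mapD(3-7)[OF bal]
  \<comment> \<open>The generators have two shapes: a difference of two terms (scalars and
    balancing) and of three terms (additivity). \<open>D1\<close> and \<open>D2\<close> evaluate the
    linear extension on each shape.\<close>
  have D1: "Poly_Mapping.single p 1 - Poly_Mapping.single q c \<in> ?U \<and>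
      lin_ext V \<phi> (Poly_Mapping.single p 1 - Poly_Mapping.single q c) = \<phi> p \<ominus>\<^bsub>V\<^esub> c \<odot>\<^bsub>V\<^esub> \<phi> q"
    if "p \<in> carrier X \<times> carrier Y" "q \<in> carrier X \<times> carrier Y" for p q c
    using that sub[of "Poly_Mapping.single p 1" "Poly_Mapping.single q c"] single[of "fst p" "snd p"]
      single[of "fst q" "snd q"] cl[of "fst p" "snd p"] by (simp add: mem_Times_iff)
  have D2: "Poly_Mapping.single p 1 - Poly_Mapping.single q 1 - Poly_Mapping.single q' 1 \<in> ?U \<and>
      lin_ext V \<phi> (Poly_Mapping.single p 1 - Poly_Mapping.single q 1 - Poly_Mapping.single q' 1) = \<phi> p \<ominus>\<^bsub>V\<^esub> \<phi> q \<ominus>\<^bsub>V\<^esub> \<phi> q'"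
    if "p \<in> carrier X \<times> carrier Y" "q \<in> carrier X \<times> carrier Y" "q' \<in> carrier X \<times> carrier Y" for p q q'
    using D1[OF that(1,2), of 1] sub[of "Poly_Mapping.single p 1 - Poly_Mapping.single q 1" "Poly_Mapping.single q' 1"]
      single[of "fst q'" "snd q'"] cl[of "fst q" "snd q"] cl[of "fst q'" "snd q'"] that by (simp add: mem_Times_iff)
  have gen: "x \<in> ?U \<and> lin_ext V \<phi> x = \<zero>\<^bsub>V\<^esub>" if "x \<in>
     {Poly_Mapping.single (x \<oplus>\<^bsub>X\<^esub> x', y) 1 - Poly_Mapping.single (x, y) 1 - Poly_Mapping.single (x', y) 1
       | x x' y. x \<in> carrier X \<and> x' \<in> carrier X \<and> y \<in> carrier Y} \<union>
     {Poly_Mapping.single (x, y \<oplus>\<^bsub>Y\<^esub> y') 1 - Poly_Mapping.single (x, y) 1 - Poly_Mapping.single (x, y') 1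
       | x y y'. x \<in> carrier X \<and> y \<in> carrier Y \<and> y' \<in> carrier Y} \<union>
     {Poly_Mapping.single (c \<odot>\<^bsub>X\<^esub> x, y) 1 - Poly_Mapping.single (x, y) c
       | c x y. x \<in> carrier X \<and> y \<in> carrier Y} \<union>
     {Poly_Mapping.single (x, c \<odot>\<^bsub>Y\<^esub> y) 1 - Poly_Mapping.single (x, y) c
       | c x y. x \<in> carrier X \<and> y \<in> carrier Y} \<union>
     {Poly_Mapping.single (r x s, y) 1 - Poly_Mapping.single (x, l s y) 1
       | x s y. x \<in> carrier X \<and> s \<in> S \<and> y \<in> carrier Y}" for x
    using that
  proof (elim UnE CollectE exE conjE, goal_cases)
    case (1 x x' y)
    then show ?case unfolding 1(1) using D2[of "(x \<oplus>\<^bsub>X\<^esub> x', y)" "(x, y)" "(x', y)"] bal'(1)[of x x' y]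
      by (simp add: V.add_diff_diff cl)
  next
    case (2 x y y')
    then show ?case unfolding 2(1) using D2[of "(x, y \<oplus>\<^bsub>Y\<^esub> y')" "(x, y)" "(x, y')"] bal'(2)[of x y y']
      by (simp add: V.add_diff_diff cl)
  next
    case (3 c x y)
    then show ?case unfolding 3(1) using D1[of "(c \<odot>\<^bsub>X\<^esub> x, y)" "(x, y)" c] bal'(3)[of x y c]
      by (simp add: V.diff_self cl)
  next
    case (4 c x y)
    then show ?case unfolding 4(1) using D1[of "(x, c \<odot>\<^bsub>Y\<^esub> y)" "(x, y)" c] bal'(4)[of x y c]
      by (simp add: V.diff_self cl)
  next
    case (5 x s y)
    then show ?case unfolding 5(1) using D1[of "(r x s, y)" "(x, l s y)" 1] bal'(5)[of x s y] r_closed[of x s] l_closed[of y s]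
      by (simp add: V.diff_self cl)
  qed
  assume "u \<in> N"
  then have "u \<in> ?U \<and> lin_ext V \<phi> u = \<zero>\<^bsub>V\<^esub>"
    unfolding tensor_rels_def
    using linear_on_span_zero[OF lin_ext_bal_linear _ conjunct2[OF gen]] gen by blast
  then show ?thesis by simp
qed

text \<open>The representative chosen inside \<open>tensor_lift\<close> differs from
  \<open>u\<close> by a relation, on which the linear extension vanishes. From here on the choice
  never has to be unfolded again.\<close>

lemma tensor_lift_coset:
  assumes "Poly_Mapping.keys u \<subseteq> carrier X \<times> carrier Y"
  shows "tensor_lift V \<phi> (coset_of N u) = lin_ext V \<phi> u"
proof -
  have "u \<in> coset_of N u" using subspace_N pm.subspace_0 by (simp add: in_coset_of_iff)
  then have "(SOME v. v \<in> coset_of N u) \<in> coset_of N u" (is "?v \<in> _") by (rule someI)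
  then have "?v - u \<in> N" by (simp add: in_coset_of_iff)
  then have n: "Poly_Mapping.keys (?v - u) \<subseteq> carrier X \<times> carrier Y" "lin_ext V \<phi> (?v - u) = \<zero>\<^bsub>V\<^esub>"
    using lin_ext_rels by auto
  then have "lin_ext V \<phi> (?v - u + u) = \<zero>\<^bsub>V\<^esub> \<oplus>\<^bsub>V\<^esub> lin_ext V \<phi> u"
    using assms linear_on_add[OF lin_ext_bal_linear, of "?v - u" u] by simp
  then show ?thesis using assms linear_on_closed[OF lin_ext_bal_linear, of u]
    unfolding tensor_lift_def by simp
qed

lemma tensor_lift_tensor:
  assumes "x \<in> carrier X" "y \<in> carrier Y"
  shows "tensor_lift V \<phi> (tensor x y) = \<phi> (x, y)"
  using assms bal by (simp add: pure_eq zero_T tensor_lift_coset lin_ext_single balanced_map_def)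

lemma tensor_lift_closed: "z \<in> carrier T \<Longrightarrow> tensor_lift V \<phi> z \<in> carrier V"
  using linear_on_closed[OF lin_ext_bal_linear] by (auto simp: carrier_T tensor_lift_coset)

lemma tensor_lift_add:
  assumes "z \<in> carrier T" "w \<in> carrier T"
  shows "tensor_lift V \<phi> (z \<oplus>\<^bsub>T\<^esub> w) = tensor_lift V \<phi> z \<oplus>\<^bsub>V\<^esub> tensor_lift V \<phi> w"
proof -
  obtain u v where u: "Poly_Mapping.keys u \<subseteq> carrier X \<times> carrier Y" "z = coset_of N u"
    and v: "Poly_Mapping.keys v \<subseteq> carrier X \<times> carrier Y" "w = coset_of N v"
    using assms by (auto simp: carrier_T)
  have "Poly_Mapping.keys (u + v) \<subseteq> carrier X \<times> carrier Y"
    using Poly_Mapping.keys_add[of u v] u v by blast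
  then show ?thesis
    unfolding u(2) v(2) T_add using u(1) v(1) linear_on_add[OF lin_ext_bal_linear, of u v]
    by (simp add: tensor_lift_coset)
qed

lemma tensor_lift_smult:
  assumes "z \<in> carrier T"
  shows "tensor_lift V \<phi> (c \<odot>\<^bsub>T\<^esub> z) = c \<odot>\<^bsub>V\<^esub> tensor_lift V \<phi> z"
proof -
  obtain u where u: "Poly_Mapping.keys u \<subseteq> carrier X \<times> carrier Y" "z = coset_of N u"
    using assms by (auto simp: carrier_T)
  have "Poly_Mapping.keys (pscale c u) \<subseteq> carrier X \<times> carrier Y"
    using keys_pscale[of c u] u by blast
  then show ?thesis
    unfolding u(2) T_smult using u(1) linear_on_pscale[OF lin_ext_bal_linear, of u c]
    by (simp add: tensor_lift_coset)
qed

lemma tensor_lift_zero [simp]: "tensor_lift V \<phi> \<zero>\<^bsub>T\<^esub> = \<zero>\<^bsub>V\<^esub>"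
  using tensor_lift_smult[of "\<zero>\<^bsub>T\<^esub>" 0] tensor_lift_closed[of "\<zero>\<^bsub>T\<^esub>"] by simp

lemma tensor_lift_finsum:
  assumes "finite A" "\<And>i. i \<in> A \<Longrightarrow> f i \<in> carrier T"
  shows "tensor_lift V \<phi> (\<Oplus>\<^bsub>T\<^esub>i\<in>A. f i) = (\<Oplus>\<^bsub>V\<^esub>i\<in>A. tensor_lift V \<phi> (f i))"
  using assms by (induction A) (simp_all add: Pi_iff tensor_lift_add tensor_lift_closed)

end

lemma trivial_tensor_right:
  assumes "carrier Y = {\<zero>\<^bsub>Y\<^esub>}"
  shows "carrier T = {\<zero>\<^bsub>T\<^esub>}"
proof -
  have "z = \<zero>\<^bsub>T\<^esub>" if "z \<in> carrier T" for z
    using that by (induction z rule: tensor_induct) (use assms in auto)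
  then show ?thesis by blast
qed

lemma trivial_tensor_left:
  assumes "carrier X = {\<zero>\<^bsub>X\<^esub>}"
  shows "carrier T = {\<zero>\<^bsub>T\<^esub>}"
proof -
  have "z = \<zero>\<^bsub>T\<^esub>" if "z \<in> carrier T" for z
    using that by (induction z rule: tensor_induct) (use assms in auto)
  then show ?thesis by blast
qed

end

subsection \<open>The path algebra\<close>

text \<open>Single terms generate all finitely supported functions additively. Cancellation in the
  codomain supplies the missing value at 0.\<close>

lemma additive_eqI:
  fixes f g :: "('b \<Rightarrow>\<^sub>0 'c::comm_monoid_add) \<Rightarrow> 'd::cancel_comm_monoid_add"
  assumes "\<And>x y. f (x + y) = f x + f y" "\<And>x y. g (x + y) = g x + g y"
    and "\<And>k c. f (Poly_Mapping.single k c) = g (Poly_Mapping.single k c)"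
  shows "f u = g u"
proof -
  have "f 0 + f 0 = 0 + f 0" "g 0 + g 0 = 0 + g 0" using assms(1)[of 0 0] assms(2)[of 0 0] by simp_all
  then have z: "f 0 = 0" "g 0 = 0" by (metis add_right_cancel)+
  have "f (\<Sum>k\<in>S. Poly_Mapping.single k (Poly_Mapping.lookup u k)) = g (\<Sum>k\<in>S. Poly_Mapping.single k (Poly_Mapping.lookup u k))"
    if "finite S" for S
    using that by (induction S) (simp_all add: z assms)
  then show ?thesis
    by (metis finite_keys poly_mapping_sum_keys order_refl)
qed

text \<open>The product of two basis paths with a coefficient. Since it is additive in the
  coefficient, the distinction between composable and non-composable paths disappears from the
  double sums.\<close>

definition path_term :: "('v, 'a) path \<Rightarrow> ('v, 'a) path \<Rightarrow> 'f::field \<Rightarrow> ('v, 'a) path \<Rightarrow>\<^sub>0 'f" where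
  "path_term = (\<lambda>(i, xs, j) (j', ys, l) c. if j = j' then Poly_Mapping.single (i, xs @ ys, l) c else 0)"

lemma path_term_zero [simp]: "path_term p q 0 = 0"
  by (cases p; cases q) (auto simp: path_term_def)

lemma path_term_add: "path_term p q (c + d) = path_term p q c + path_term p q d"
  by (cases p; cases q) (auto simp: path_term_def single_add)

lemma path_term_pscale: "path_term p q (c * d) = pscale c (path_term p q d)"
  by (cases p; cases q) (auto simp: path_term_def)

lemma path_mult_alt:
  "u \<star> v = (\<Sum>p\<in>Poly_Mapping.keys u. \<Sum>q\<in>Poly_Mapping.keys v. path_term p q (Poly_Mapping.lookup u p * Poly_Mapping.lookup v q))"
  unfolding path_mult_def path_term_def by (intro sum.cong refl) (auto split: prod.splits intro!: sum.cong)

lemma path_mult_superset: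
  assumes "finite S" "finite T" "Poly_Mapping.keys u \<subseteq> S" "Poly_Mapping.keys v \<subseteq> T"
  shows "u \<star> v = (\<Sum>p\<in>S. \<Sum>q\<in>T. path_term p q (Poly_Mapping.lookup u p * Poly_Mapping.lookup v q))"
proof -
  have "u \<star> v = (\<Sum>p\<in>Poly_Mapping.keys u. \<Sum>q\<in>T. path_term p q (Poly_Mapping.lookup u p * Poly_Mapping.lookup v q))"
    unfolding path_mult_alt using assms
    by (intro sum.cong refl sum.mono_neutral_left) (auto simp: in_keys_iff)
  also have "\<dots> = (\<Sum>p\<in>S. \<Sum>q\<in>T. path_term p q (Poly_Mapping.lookup u p * Poly_Mapping.lookup v q))"
    using assms by (intro sum.mono_neutral_left) (auto simp: in_keys_iff)
  finally show ?thesis .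
qed

lemma path_mult_add_left: "(u + u') \<star> v = u \<star> v + u' \<star> v"
proof -
  let ?S = "Poly_Mapping.keys u \<union> Poly_Mapping.keys u'"
  have "Poly_Mapping.keys (u + u') \<subseteq> ?S" by (rule Poly_Mapping.keys_add)
  then show ?thesis
    by (subst (1 2 3) path_mult_superset[of ?S "Poly_Mapping.keys v"])
      (auto simp: lookup_add distrib_right path_term_add sum.distrib)
qed

lemma path_mult_add_right: "u \<star> (v + v') = u \<star> v + u \<star> v'"
proof -
  let ?S = "Poly_Mapping.keys v \<union> Poly_Mapping.keys v'"
  have "Poly_Mapping.keys (v + v') \<subseteq> ?S" by (rule Poly_Mapping.keys_add)
  then show ?thesis
    by (subst (1 2 3) path_mult_superset[of "Poly_Mapping.keys u" ?S])
      (auto simp: lookup_add distrib_left path_term_add sum.distrib)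
qed

lemma path_mult_pscale_left: "pscale c u \<star> v = pscale c (u \<star> v)"
proof -
  have "pscale c u \<star> v = (\<Sum>p\<in>Poly_Mapping.keys u. \<Sum>q\<in>Poly_Mapping.keys v. path_term p q (c * (Poly_Mapping.lookup u p * Poly_Mapping.lookup v q)))"
    using keys_pscale[of c u] by (subst path_mult_superset[of "Poly_Mapping.keys u" "Poly_Mapping.keys v"]) (auto simp: mult.assoc)
  then show ?thesis unfolding path_term_pscale path_mult_alt by (simp add: pm.scale_sum_right)
qed

lemma path_mult_pscale_right: "u \<star> pscale c v = pscale c (u \<star> v)"
proof -
  have "u \<star> pscale c v = (\<Sum>p\<in>Poly_Mapping.keys u. \<Sum>q\<in>Poly_Mapping.keys v. path_term p q (c * (Poly_Mapping.lookup u p * Poly_Mapping.lookup v q)))"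
    using keys_pscale[of c v] by (subst path_mult_superset[of "Poly_Mapping.keys u" "Poly_Mapping.keys v"]) (auto simp: mult_ac)
  then show ?thesis unfolding path_term_pscale path_mult_alt by (simp add: pm.scale_sum_right)
qed

lemma path_mult_zero [simp]: "0 \<star> v = 0" "u \<star> 0 = 0"
  by (simp_all add: path_mult_alt)

lemma path_mult_sum_left: "(\<Sum>i\<in>A. f i) \<star> v = (\<Sum>i\<in>A. f i \<star> v)"
  by (induction A rule: infinite_finite_induct) (simp_all add: path_mult_add_left)

lemma path_mult_sum_right: "u \<star> (\<Sum>i\<in>A. f i) = (\<Sum>i\<in>A. u \<star> f i)"
  by (induction A rule: infinite_finite_induct) (simp_all add: path_mult_add_right)

lemma path_mult_single [simp]:
  "Poly_Mapping.single (i, xs, j) c \<star> Poly_Mapping.single (j', ys, l) d =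
     (if j = j' then Poly_Mapping.single (i, xs @ ys, l) (c * d) else 0)"
  by (subst path_mult_superset[of "{(i, xs, j)}" "{(j', ys, l)}"]) (auto simp: path_term_def)

text \<open>Additivity in one argument at a time, from right to left, reduces the claim to three
  basis paths, where it is associativity of concatenation.\<close>

lemma path_mult_assoc: "(u \<star> v) \<star> w = u \<star> ((v :: ('a::field, 'b, 'c) path_elt) \<star> w)"
proof -
  note add = path_mult_add_left path_mult_add_right
  have 1: "(Poly_Mapping.single p c \<star> Poly_Mapping.single q d) \<star> w = Poly_Mapping.single p c \<star> (Poly_Mapping.single q d \<star> w)" for p q c d and w :: "('a, 'b, 'c) path_elt"
  proof (rule additive_eqI[where u = w])
    fix k :: "'b \<times> ('c + 'c) list \<times> 'b" and e :: 'a
    show "(Poly_Mapping.single p c \<star> Poly_Mapping.single q d) \<star> Poly_Mapping.single k e =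
      Poly_Mapping.single p c \<star> (Poly_Mapping.single q d \<star> Poly_Mapping.single k e)"
      by (cases p; cases q; cases k) (simp add: mult.assoc)
  qed (simp_all add: add)
  have 2: "(Poly_Mapping.single p c \<star> v) \<star> w = Poly_Mapping.single p c \<star> (v \<star> w)" for p c and v w :: "('a, 'b, 'c) path_elt"
    by (rule additive_eqI[where u = v]) (simp_all add: add 1)
  show ?thesis by (rule additive_eqI[where u = u]) (simp_all add: add 2)
qed

text \<open>A coefficient of a product is a sum over all factorisations of the path. If the supports
  allow only one factorisation, a single product of coefficients remains. In the applications the
  known length of one factor, or the emptiness of the path, singles it out.\<close>

lemma lookup_path_mult:
  assumes "\<And>xs' j' ys'. (i, xs', j') \<in> Poly_Mapping.keys u \<Longrightarrow> (j', ys', l) \<in> Poly_Mapping.keys v \<Longrightarrow>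
    xs' @ ys' = xs @ ys \<Longrightarrow> xs' = xs \<and> j' = j"
  shows "Poly_Mapping.lookup (u \<star> v) (i, xs @ ys, l) = Poly_Mapping.lookup u (i, xs, j) * Poly_Mapping.lookup v (j, ys, l)"
proof -
  let ?S = "insert (i, xs, j) (Poly_Mapping.keys u)" and ?T = "insert (j, ys, l) (Poly_Mapping.keys v)"
  have term_eq: "Poly_Mapping.lookup (path_term p q (Poly_Mapping.lookup u p * Poly_Mapping.lookup v q)) (i, xs @ ys, l) =
      (if p = (i, xs, j) then if q = (j, ys, l) then Poly_Mapping.lookup u p * Poly_Mapping.lookup v q else 0 else 0)" for p q
  proof -
    obtain i1 xs1 j1 where p: "p = (i1, xs1, j1)" by (cases p)
    obtain j2 ys2 l2 where q: "q = (j2, ys2, l2)" by (cases q)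
    show ?thesis
    proof (cases "Poly_Mapping.lookup u p * Poly_Mapping.lookup v q = 0")
      case False
      then have "p \<in> Poly_Mapping.keys u" "q \<in> Poly_Mapping.keys v" by (auto simp: in_keys_iff)
      then show ?thesis using assms[of xs1 j1 ys2] unfolding p q
        by (auto simp: path_term_def lookup_single when_def)
    next
      case True
      show ?thesis unfolding True by simp
    qed
  qed
  have "Poly_Mapping.lookup (u \<star> v) (i, xs @ ys, l) = (\<Sum>p\<in>?S. \<Sum>q\<in>?T.
      (if p = (i, xs, j) then if q = (j, ys, l) then Poly_Mapping.lookup u p * Poly_Mapping.lookup v q else 0 else 0))"
    by (subst path_mult_superset[of ?S ?T]) (auto simp: lookup_sum term_eq)
  also have "\<dots> = (\<Sum>p\<in>?S. if p = (i, xs, j) then (\<Sum>q\<in>?T. if q = (j, ys, l) then Poly_Mapping.lookup u p * Poly_Mapping.lookup v q else 0) else 0)"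
    by (intro sum.cong refl) auto
  also have "\<dots> = Poly_Mapping.lookup u (i, xs, j) * Poly_Mapping.lookup v (j, ys, l)"
    by (simp add: sum.delta del: sum.insert)
  finally show ?thesis .
qed

lemma keys_path_mult:
  "Poly_Mapping.keys (u \<star> v) \<subseteq> {(i, xs @ ys, l) |i xs j ys l. (i, xs, j) \<in> Poly_Mapping.keys u \<and> (j, ys, l) \<in> Poly_Mapping.keys v}"
  (is "_ \<subseteq> ?B")
  unfolding path_mult_alt
proof (intro keys_sum_subset)
  fix p q assume "p \<in> Poly_Mapping.keys u" "q \<in> Poly_Mapping.keys v"
  then show "Poly_Mapping.keys (path_term p q (Poly_Mapping.lookup u p * Poly_Mapping.lookup v q)) \<subseteq> ?B"
    by (cases p; cases q) (auto simp: path_term_def)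
qed

text \<open>Transfers the structure between records that differ only in the multiplicative fields or
  in an extension, as for \<open>preproj\<close> and its underlying quotient space.\<close>

lemma vspace_cong:
  assumes "vspace V" "carrier W = carrier V" "add W = add V" "zero W = zero V" "smult W = smult V"
  shows "vspace W"
proof -
  interpret vspace V by fact
  show ?thesis
    by (rule vspaceI)
      (use assms(2-) in \<open>simp_all add: a_ac smult_distr_left smult_distr_right smult_smult smult_m1 r_neg\<close>)
qed

section \<open>The double quiver, its path algebra and the preprojective algebra\<close>

lemma star_star [simp]: "star (star a) = a"
  by (cases a) (auto simp: star_def)

lemma arrow_sign_star [simp]: "arrow_sign (star a) = - arrow_sign a"
  by (cases a) (auto simp: star_def arrow_sign_def)

lemma arrow_sign_square [simp]: "arrow_sign a * arrow_sign a = (1::'f::field)"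
  "arrow_sign a * (arrow_sign a * c) = (c::'f::field)"
  by (cases a; simp add: arrow_sign_def)+

lemma arrow_sign_nonzero [simp]: "arrow_sign a \<noteq> (0::'f::field)"
  by (cases a) (auto simp: arrow_sign_def)

lemma star_neq [simp]: "star a \<noteq> a" "a \<noteq> star a"
  by (cases a; auto simp: star_def)+

text \<open>The type token \<open>F\<close> fixes the field, so that the abbreviations below all
  refer to one and the same coefficient type.\<close>

locale quiver = fin_digraph Q for Q :: "('v, 'e) pre_digraph" +
  fixes F :: "'f::field itself"
begin

abbreviation D :: "('v, 'e + 'e) pre_digraph" where "D \<equiv> double_quiver Q"

lemma D_simps: "verts D = verts Q" "arcs D = Sum_Type.Plus (arcs Q) (arcs Q)"
  by (simp_all add: double_quiver_def)

lemma head_star [simp]: "head D (star a) = tail D a" and tail_star [simp]: "tail D (star a) = head D a"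
  by (cases a; simp add: double_quiver_def star_def)+

lemma star_arcs [simp]: "star a \<in> arcs D \<longleftrightarrow> a \<in> arcs D"
  by (cases a) (auto simp: D_simps star_def)

lemma head_D [simp]: "a \<in> arcs D \<Longrightarrow> head D a \<in> verts Q"
  and tail_D [simp]: "a \<in> arcs D \<Longrightarrow> tail D a \<in> verts Q"
  by (cases a; auto simp: double_quiver_def)+

lemma finite_arcs_D [simp]: "finite (arcs D)"
  by (simp add: D_simps)

lemma fin_D: "fin_digraph D"
  by unfold_locales (auto simp: D_simps(1))

sublocale D: fin_digraph D by (rule fin_D)

lemma paths_Nil [simp]: "(i, [], j) \<in> paths Q n \<longleftrightarrow> n = 0 \<and> i = j \<and> i \<in> verts Q"
  by (auto simp: paths_def D.awalk_Nil_iff D_simps(1))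

lemma paths_Cons: "(i, x # xs, j) \<in> paths Q n \<longleftrightarrow>
  (\<exists>m. n = Suc m \<and> x \<in> arcs D \<and> head D x = i \<and> (tail D x, xs, j) \<in> paths Q m)"
  by (auto simp: paths_def D.awalk_Cons_iff D.awalk_Nil_iff D_simps(1))

lemma paths_length: "(i, xs, j) \<in> paths Q n \<Longrightarrow> length xs = n"
  by (simp add: paths_def)

lemma paths_verts: "(i, xs, j) \<in> paths Q n \<Longrightarrow> i \<in> verts Q \<and> j \<in> verts Q"
  by (induction xs arbitrary: i n) (auto simp: paths_Cons)

lemma paths_append: "(i, xs, j) \<in> paths Q m \<Longrightarrow> (j, ys, l) \<in> paths Q n \<Longrightarrow> (i, xs @ ys, l) \<in> paths Q (m + n)"
  by (induction xs arbitrary: i m) (auto simp: paths_Cons)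

text \<open>An empty list of arrows forces source and target to agree, and otherwise the last arrow
  determines the source. So a path is known from its target and its arrows.\<close>

lemma paths_source_unique: "(i, xs, j) \<in> paths Q m \<Longrightarrow> (i, xs, j') \<in> paths Q n \<Longrightarrow> j = j'"
  by (induction xs arbitrary: i m n) (auto simp: paths_Cons)

abbreviation PA :: "('f, ('f, 'v, 'e) path_elt) module" where "PA \<equiv> path_alg Q"
abbreviation H :: "nat \<Rightarrow> ('f, 'v, 'e) path_elt set" where "H \<equiv> homog Q"

lemma PA_simps [simp]: "mult PA = (\<star>)" "zero PA = 0" "add PA = (+)" "smult PA = pscale"
  "one PA = (\<Sum>i\<in>verts Q. Poly_Mapping.single (i, [], i) 1)"
  by (simp_all add: path_alg_def)

lemma carrier_PA: "carrier PA = {u. Poly_Mapping.keys u \<subseteq> (\<Union>n. paths Q n)}"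
  by (simp add: path_alg_def)

lemma H_subset: "H n \<subseteq> carrier PA"
  by (auto simp: homog_def carrier_PA)

lemma subspace_H: "pm.subspace (H n)"
  unfolding homog_def by (rule subspace_keys)

lemma subspace_PA: "pm.subspace (carrier PA)"
  unfolding carrier_PA by (rule subspace_keys)

lemma H_mult:
  assumes "u \<in> H m" "v \<in> H n"
  shows "u \<star> v \<in> H (m + n)"
proof -
  have "q \<in> paths Q (m + n)" if q: "q \<in> Poly_Mapping.keys (u \<star> v)" for q
  proof -
    obtain i xs j ys l where q': "q = (i, xs @ ys, l)" "(i, xs, j) \<in> Poly_Mapping.keys u" "(j, ys, l) \<in> Poly_Mapping.keys v"
      using keys_path_mult[of u v] q by auto
    then have "(i, xs, j) \<in> paths Q m" "(j, ys, l) \<in> paths Q n" using assms by (auto simp: homog_def)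
    then show ?thesis unfolding q'(1) by (rule paths_append)
  qed
  then show ?thesis by (auto simp: homog_def)
qed

lemma PA_mult:
  assumes "u \<in> carrier PA" "v \<in> carrier PA"
  shows "u \<star> v \<in> carrier PA"
proof -
  have "q \<in> (\<Union>n. paths Q n)" if q: "q \<in> Poly_Mapping.keys (u \<star> v)" for q
  proof -
    obtain i xs j ys l where q': "q = (i, xs @ ys, l)" "(i, xs, j) \<in> Poly_Mapping.keys u" "(j, ys, l) \<in> Poly_Mapping.keys v"
      using keys_path_mult[of u v] q by auto
    have "(i, xs, j) \<in> (\<Union>n. paths Q n)" "(j, ys, l) \<in> (\<Union>n. paths Q n)"
      using assms q'(2,3) unfolding carrier_PA by blast+
    then obtain m n where "(i, xs, j) \<in> paths Q m" "(j, ys, l) \<in> paths Q n" by blast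
    then have "(i, xs @ ys, l) \<in> paths Q (m + n)" by (rule paths_append)
    then show ?thesis unfolding q'(1) by blast
  qed
  then show ?thesis by (auto simp: carrier_PA)
qed

definition unit :: "('f, 'v, 'e) path_elt" where "unit = (\<Sum>i\<in>verts Q. Poly_Mapping.single (i, [], i) 1)"

definition idem :: "'v \<Rightarrow> ('f, 'v, 'e) path_elt" where "idem i = Poly_Mapping.single (i, [], i) 1"

lemma idem_H: "i \<in> verts Q \<Longrightarrow> idem i \<in> H 0"
  by (simp add: idem_def homog_def)

lemma unit_sum: "unit = (\<Sum>i\<in>verts Q. idem i)"
  by (simp add: unit_def idem_def)

lemma unit_H: "unit \<in> H 0"
  unfolding unit_sum by (rule pm.subspace_sum[OF subspace_H]) (rule idem_H)

lemma unit_PA: "unit \<in> carrier PA"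
  using unit_H H_subset[of 0] by blast

lemma unit_left: assumes "u \<in> carrier PA" shows "unit \<star> u = u"
proof -
  have "unit \<star> Poly_Mapping.single k c = Poly_Mapping.single k c" if "k \<in> Poly_Mapping.keys u" for k c
  proof -
    obtain i xs j where k: "k = (i, xs, j)" by (cases k)
    then have "i \<in> verts Q" using that assms paths_verts by (fastforce simp: carrier_PA)
    moreover have "unit \<star> Poly_Mapping.single k c = (\<Sum>i'\<in>verts Q. if i' = i then Poly_Mapping.single (i, xs, j) c else 0)"
      unfolding unit_def path_mult_sum_left k by (intro sum.cong) auto
    ultimately show ?thesis using k by simp
  qed
  then show ?thesis
    by (subst (1 2) poly_mapping_sum_keys[of "Poly_Mapping.keys u" u]) (auto simp: path_mult_sum_right)
qed

lemma unit_right: assumes "u \<in> carrier PA" shows "u \<star> unit = u"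
proof -
  have "Poly_Mapping.single k c \<star> unit = Poly_Mapping.single k c" if "k \<in> Poly_Mapping.keys u" for k c
  proof -
    obtain i xs j where k: "k = (i, xs, j)" by (cases k)
    then have "j \<in> verts Q" using that assms paths_verts by (fastforce simp: carrier_PA)
    moreover have "Poly_Mapping.single k c \<star> unit = (\<Sum>j'\<in>verts Q. if j' = j then Poly_Mapping.single (i, xs, j) c else 0)"
      unfolding unit_def path_mult_sum_right k by (intro sum.cong) auto
    ultimately show ?thesis using k by simp
  qed
  then show ?thesis
    by (subst (1 2) poly_mapping_sum_keys[of "Poly_Mapping.keys u" u]) (auto simp: path_mult_sum_left)
qed

lemma ring_PA: "ring PA"
proof (rule ringI)
  show "abelian_group PA"
  proof (rule abelian_groupI)
    fix x assume "x \<in> carrier PA"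
    then have "- x \<in> carrier PA" by (rule pm.subspace_neg[OF subspace_PA])
    then show "\<exists>y\<in>carrier PA. y \<oplus>\<^bsub>PA\<^esub> x = \<zero>\<^bsub>PA\<^esub>" by (intro bexI[of _ "- x"]) simp_all
  qed (simp_all add: pm.subspace_add[OF subspace_PA] pm.subspace_0[OF subspace_PA] add.assoc add.commute)
  show "monoid PA"
    by (rule monoidI)
      (simp_all add: PA_mult path_mult_assoc unit_left unit_right unit_PA flip: unit_def)
qed (simp_all add: path_mult_add_left path_mult_add_right)

sublocale PA: ring PA by (rule ring_PA)

abbreviation I :: "('f, 'v, 'e) path_elt set" where "I \<equiv> preproj_ideal Q"
abbreviation A :: "('f, ('f, 'v, 'e) preproj_elt) module" where "A \<equiv> preproj Q"
abbreviation \<sigma> :: "'v \<Rightarrow> ('f, 'v, 'e) path_elt" where "\<sigma> \<equiv> preproj_sigma Q"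

lemma sigma_H: "\<sigma> i \<in> H 2"
  unfolding preproj_sigma_def
  by (rule pm.subspace_sum[OF subspace_H]) (auto simp: homog_def paths_Cons numeral_2_eq_2)

lemma R_subset: "preproj_R Q \<subseteq> H 2"
  unfolding preproj_R_def by (rule pm.span_minimal) (auto simp: sigma_H subspace_H)

lemma ideal_I: "ideal I PA"
  unfolding preproj_ideal_def using R_subset H_subset by (intro PA.genideal_ideal) blast

sublocale I: ideal I PA by (rule ideal_I)

lemma I_subset: "I \<subseteq> carrier PA"
  using I.a_subset .

lemma subspace_I: "pm.subspace I"
proof (rule pm.subspaceI)
  show "0 \<in> I" using I.zero_closed by simp
  show "x + y \<in> I" if "x \<in> I" "y \<in> I" for x y using I.a_closed[OF that] by simp
  show "pscale c x \<in> I" if "x \<in> I" for c x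
  proof -
    \<comment> \<open>A ring ideal knows nothing of scalars; multiplication by a scalar is rewritten
      as multiplication by that multiple of the unit.\<close>
    have "pscale c x = pscale c unit \<star> x"
      using that I_subset by (auto simp: path_mult_pscale_left unit_left)
    moreover have "pscale c unit \<in> carrier PA"
      using pm.subspace_scale[OF subspace_PA] unit_H H_subset by blast
    ultimately show ?thesis using I.I_l_closed[OF that, of "pscale c unit"] by simp
  qed
qed

abbreviation rc :: "('f, 'v, 'e) path_elt \<Rightarrow> ('f, 'v, 'e) preproj_elt" where "rc \<equiv> residue_class Q"

lemma rc_eq: "rc u = coset_of I u"
  unfolding residue_class_def by (rule r_coset_plus) simp

lemma A_fields:
  "carrier A = carrier (PA Quot I)" "mult A = mult (PA Quot I)" "one A = one (PA Quot I)"
  "zero A = zero (PA Quot I)" "add A = add (PA Quot I)" "smult A = smult (quotient_space PA I)"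
  by (simp_all add: preproj_def ring.extend_def module.fields_def)

lemma A_quotient:
  "carrier A = carrier (quotient_space PA I)" "add A = add (quotient_space PA I)"
  "zero A = zero (quotient_space PA I)" "smult A = smult (quotient_space PA I)"
  by (simp_all add: A_fields FactRing_def) (simp add: quotient_space_def)

lemma carrier_A: "carrier A = rc ` carrier PA"
  unfolding A_quotient rc_eq by (rule carrier_quotient_plus) simp

lemma rc_closed [simp]: "u \<in> carrier PA \<Longrightarrow> rc u \<in> carrier A"
  by (simp add: carrier_A)

lemma rc_add: "rc (u + v) = rc u \<oplus>\<^bsub>A\<^esub> rc v"
  unfolding A_quotient rc_eq quotient_simps by (rule coset_of_add[symmetric]) (simp_all add: subspace_I)

lemma rc_pscale: "rc (pscale c u) = c \<odot>\<^bsub>A\<^esub> rc u"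
  unfolding A_quotient rc_eq by (rule coset_of_smult[symmetric]) (simp_all add: subspace_I)

lemma rc_mult: "u \<in> carrier PA \<Longrightarrow> v \<in> carrier PA \<Longrightarrow> rc (u \<star> v) = rc u \<otimes>\<^bsub>A\<^esub> rc v"
  using I.rcoset_mult_add[of u v] by (simp add: residue_class_def A_fields FactRing_def)

lemma rc_unit: "rc unit = \<one>\<^bsub>A\<^esub>"
  by (simp add: residue_class_def A_fields FactRing_def unit_def)

lemma vspace_A: "vspace A"
  by (rule vspace_cong[OF quotient_vspace[OF subspace_I]]) (simp_all add: A_quotient[unfolded quotient_simps] subspace_PA)

sublocale A: vspace A by (rule vspace_A)

lemma ring_A: "monoid A" "x \<in> carrier A \<Longrightarrow> y \<in> carrier A \<Longrightarrow> z \<in> carrier A \<Longrightarrow> (x \<oplus>\<^bsub>A\<^esub> y) \<otimes>\<^bsub>A\<^esub> z = x \<otimes>\<^bsub>A\<^esub> z \<oplus>\<^bsub>A\<^esub> y \<otimes>\<^bsub>A\<^esub> z"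
  "x \<in> carrier A \<Longrightarrow> y \<in> carrier A \<Longrightarrow> z \<in> carrier A \<Longrightarrow> z \<otimes>\<^bsub>A\<^esub> (x \<oplus>\<^bsub>A\<^esub> y) = z \<otimes>\<^bsub>A\<^esub> x \<oplus>\<^bsub>A\<^esub> z \<otimes>\<^bsub>A\<^esub> y"
proof -
  interpret q: ring "PA Quot I" by (rule I.quotient_is_ring)
  show "monoid A" by (rule monoidI) (simp_all add: A_fields q.m_assoc)
  show "x \<in> carrier A \<Longrightarrow> y \<in> carrier A \<Longrightarrow> z \<in> carrier A \<Longrightarrow> (x \<oplus>\<^bsub>A\<^esub> y) \<otimes>\<^bsub>A\<^esub> z = x \<otimes>\<^bsub>A\<^esub> z \<oplus>\<^bsub>A\<^esub> y \<otimes>\<^bsub>A\<^esub> z"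
    "x \<in> carrier A \<Longrightarrow> y \<in> carrier A \<Longrightarrow> z \<in> carrier A \<Longrightarrow> z \<otimes>\<^bsub>A\<^esub> (x \<oplus>\<^bsub>A\<^esub> y) = z \<otimes>\<^bsub>A\<^esub> x \<oplus>\<^bsub>A\<^esub> z \<otimes>\<^bsub>A\<^esub> y"
    by (simp_all add: A_fields q.l_distr q.r_distr)
qed

lemma A_smult_mult:
  assumes "x \<in> carrier A" "y \<in> carrier A"
  shows "(c \<odot>\<^bsub>A\<^esub> x) \<otimes>\<^bsub>A\<^esub> y = c \<odot>\<^bsub>A\<^esub> (x \<otimes>\<^bsub>A\<^esub> y)" "x \<otimes>\<^bsub>A\<^esub> (c \<odot>\<^bsub>A\<^esub> y) = c \<odot>\<^bsub>A\<^esub> (x \<otimes>\<^bsub>A\<^esub> y)"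
proof -
  obtain u v where u: "u \<in> carrier PA" "x = rc u" and v: "v \<in> carrier PA" "y = rc v"
    using assms by (auto simp: carrier_A)
  have "pscale c u \<in> carrier PA" "pscale c v \<in> carrier PA" using u v pm.subspace_scale[OF subspace_PA] by auto
  then show "(c \<odot>\<^bsub>A\<^esub> x) \<otimes>\<^bsub>A\<^esub> y = c \<odot>\<^bsub>A\<^esub> (x \<otimes>\<^bsub>A\<^esub> y)" "x \<otimes>\<^bsub>A\<^esub> (c \<odot>\<^bsub>A\<^esub> y) = c \<odot>\<^bsub>A\<^esub> (x \<otimes>\<^bsub>A\<^esub> y)"
    unfolding u v using u(1) v(1)
    by (simp_all add: rc_pscale[symmetric] rc_mult[symmetric] path_mult_pscale_left path_mult_pscale_right)
qed

lemma self_bimodule: "is_bimodule A (preproj_self Q :: ('f, 'v, 'e, ('f, 'v, 'e) preproj_elt) preproj_bimod)"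
proof -
  interpret m: monoid A by (rule ring_A)
  have f: "carrier (preproj_self Q) = carrier A" "add (preproj_self Q) = add A" "zero (preproj_self Q) = zero A"
    "smult (preproj_self Q) = smult A" "lact (preproj_self Q) = mult A" "ract (preproj_self Q) = mult A"
    by (simp_all add: preproj_self_def module.extend_def bimod.fields_def)
  have "vspace (preproj_self Q :: ('f, 'v, 'e, ('f, 'v, 'e) preproj_elt) preproj_bimod)"
    by (rule vspace_cong[OF vspace_A]) (simp_all add: f)
  then show ?thesis
    by (auto simp: is_bimodule_def vspace_def f ring_A(2,3) A_smult_mult m.m_assoc)
qed

text \<open>Elements without terms of length 0 form an ideal, and it contains the quadratic
  relations. Consequently the coefficients at trivial paths are well defined on \<open>A\<close>,
  which later detects a nonzero tensor.\<close>

lemma I_lookup: assumes "u \<in> I" shows "Poly_Mapping.lookup u (i, [], j) = 0"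
proof -
  let ?J = "{u \<in> carrier PA. \<forall>i j. Poly_Mapping.lookup u (i, [], j) = 0}"
  have lk: "Poly_Mapping.lookup (x \<star> y) (i, [], j) = Poly_Mapping.lookup x (i, [], i) * Poly_Mapping.lookup y (i, [], j)"
    if "x \<in> carrier PA" for x y i j
    using lookup_path_mult[of i x j y "[]" "[]" i] that by (fastforce simp: carrier_PA)
  have lk': "Poly_Mapping.lookup (x \<star> y) (i, [], j) = 0" if "x \<in> carrier PA" "y \<in> ?J" for x y i j
    using that lk by simp
  have "ideal ?J PA"
  proof (rule idealI[OF ring_PA])
    show "subgroup ?J (add_monoid PA)"
    proof (rule PA.add.subgroupI)
      fix a assume a: "a \<in> ?J"
      have "\<ominus>\<^bsub>PA\<^esub> a = - a"
        using a pm.subspace_neg[OF subspace_PA, of a] PA.minus_equality[of "- a" a] by simp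
      then show "\<ominus>\<^bsub>PA\<^esub> a \<in> ?J" using a pm.subspace_neg[OF subspace_PA, of a] by simp
    qed (use pm.subspace_0[OF subspace_PA] pm.subspace_add[OF subspace_PA] in \<open>auto simp: lookup_add\<close>)
  qed (auto simp: PA_mult lk)
  moreover have "preproj_R Q \<subseteq> ?J"
  proof -
    have "Poly_Mapping.lookup u (i, [], j) = 0" if "u \<in> H 2" for u i j
      using that by (force simp: homog_def in_keys_iff)
    then show ?thesis using R_subset H_subset by blast
  qed
  ultimately have "I \<subseteq> ?J" unfolding preproj_ideal_def by (rule PA.genideal_minimal)
  then show ?thesis using assms by auto
qed

end

subsection \<open>Connected graphs\<close>

context quiver
begin

text \<open>The double quiver has every edge in both directions, so being closed under its arrows is
  being closed under the symmetric reachability that defines connectedness.\<close>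

lemma connected_closed_set:
  assumes "Digraph_Component.connected Q" "S \<subseteq> verts Q" "i \<in> S"
    and "\<And>a. a \<in> arcs D \<Longrightarrow> tail D a \<in> S \<Longrightarrow> head D a \<in> S"
  shows "S = verts Q"
proof -
  have "v \<in> S" if "v \<in> verts Q" for v
  proof -
    have "i \<rightarrow>\<^sup>*\<^bsub>with_proj (mk_symmetric Q)\<^esub> v"
      using assms that unfolding connected_def strongly_connected_def by auto
    then have "(i, v) \<in> (arcs_ends (with_proj (mk_symmetric Q)))\<^sup>*"
      unfolding reachable_def by (rule rtrancl_on_rtranclI)
    then show ?thesis
    proof induction
      case (step y z)
      then obtain e where e: "e \<in> arcs Q" "(y, z) = (tail Q e, head Q e) \<or> (y, z) = (head Q e, tail Q e)"
        by (auto simp: parcs_mk_symmetric)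
      then have "Inl e \<in> arcs D" "Inr e \<in> arcs D" by (auto simp: D_simps)
      then show ?case using e assms(4)[of "Inl e"] assms(4)[of "Inr e"] step by (auto simp: double_quiver_def)
    qed (use assms in simp)
  qed
  then show ?thesis using assms(2) by auto
qed

text \<open>By the involution, a vertex without incoming arrows has no outgoing ones either. It
  would be a connected component by itself, and the graph would be a single vertex.\<close>

lemma incoming_arrow:
  assumes "Digraph_Component.connected Q" "\<not> underlying_A1 Q" "i \<in> verts Q"
  shows "\<exists>a\<in>arcs D. head D a = i"
proof (rule ccontr)
  assume none: "\<not> (\<exists>a\<in>arcs D. head D a = i)"
  have "{i} = verts Q"
  proof (rule connected_closed_set[OF assms(1)])
    fix a assume "a \<in> arcs D" "tail D a \<in> {i}"
    then have "star a \<in> arcs D" "head D (star a) = i" by auto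
    then show "head D a \<in> {i}" using none by blast
  qed (use assms in auto)
  moreover have "arcs Q = {}"
  proof (rule ccontr)
    assume "arcs Q \<noteq> {}"
    then obtain e where "Inl e \<in> arcs D" by (auto simp: D_simps)
    then show False using none head_D[of "Inl e"] \<open>{i} = verts Q\<close> by blast
  qed
  ultimately show False using assms(2) by (auto simp: underlying_A1_def)
qed

text \<open>If no other arrow ends at either end of \<open>a\<close>, then its two ends are closed
  under all arrows, and the graph consists of this one edge. The two alternatives correspond to the
  two exchanges made in the proof of \<open>W_gt2\<close>.\<close>

lemma second_arrow:
  assumes "Digraph_Component.connected Q" "\<not> underlying_A2 Q" "a \<in> arcs D"
  shows "\<exists>b\<in>arcs D. (b \<noteq> a \<and> head D b = head D a) \<or> (b \<noteq> star a \<and> head D b = tail D a)"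
proof (rule ccontr)
  assume none: "\<not> ?thesis"
  let ?S = "{head D a, tail D a}"
  have S: "b = a \<or> b = star a" if "b \<in> arcs D" "head D b \<in> ?S" for b
    using none that by blast
  have "?S = verts Q"
  proof (rule connected_closed_set[OF assms(1)])
    fix b assume b: "b \<in> arcs D" "tail D b \<in> ?S"
    then have "star b = a \<or> star b = star a" by (intro S) auto
    then have "b = star a \<or> b = a" by (metis star_star)
    then show "head D b \<in> ?S" by auto
  qed (use assms in auto)
  \<comment> \<open>For a loop, \<open>star a\<close> would already be a second arrow with the same
    head.\<close>
  moreover have "head D a \<noteq> tail D a"
    using none assms(3) star_neq[of a] by (metis head_star star_arcs)
  moreover obtain e where e: "a = Inl e \<or> a = Inr e" by (cases a) auto
  moreover have "arcs Q = {e}"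
  proof -
    have "c = e" if "c \<in> arcs Q" for c
    proof -
      have "Inl c \<in> arcs D" using that by (auto simp: D_simps)
      moreover from this have "head D (Inl c) \<in> ?S" using \<open>?S = verts Q\<close> head_D by blast
      ultimately have "Inl c = a \<or> Inl c = star a" by (rule S)
      then show ?thesis using e by (auto simp: star_def)
    qed
    moreover have "e \<in> arcs Q" using assms(3) e by (auto simp: D_simps)
    ultimately show ?thesis by blast
  qed
  moreover have "{tail Q e, head Q e} = ?S" using e by (auto simp: double_quiver_def)
  ultimately show False using assms(2) unfolding underlying_A2_def by metis
qed

subsection \<open>The spaces \<open>W\<^sub>p\<close>\<close>

lemma lookup_H0_mult:
  assumes "u \<in> H 0"
  shows "Poly_Mapping.lookup (u \<star> w) (i, xs, j) = Poly_Mapping.lookup u (i, [], i) * Poly_Mapping.lookup w (i, xs, j)"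
proof -
  have "Poly_Mapping.lookup (u \<star> w) (i, [] @ xs, j) = Poly_Mapping.lookup u (i, [], i) * Poly_Mapping.lookup w (i, xs, j)"
  proof (rule lookup_path_mult)
    fix xs' j' ys' assume "(i, xs', j') \<in> Poly_Mapping.keys u"
    then have "(i, xs', j') \<in> paths Q 0" using assms by (auto simp: homog_def)
    then show "xs' = [] \<and> j' = i" using paths_length[of i xs' j' 0] by auto
  qed
  then show ?thesis by simp
qed

lemma lookup_mult_H0:
  assumes "u \<in> H 0"
  shows "Poly_Mapping.lookup (w \<star> u) (i, xs, j) = Poly_Mapping.lookup w (i, xs, j) * Poly_Mapping.lookup u (j, [], j)"
proof -
  have "Poly_Mapping.lookup (w \<star> u) (i, xs @ [], j) = Poly_Mapping.lookup w (i, xs, j) * Poly_Mapping.lookup u (j, [], j)"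
  proof (rule lookup_path_mult)
    fix xs' j' ys' assume "(j', ys', j) \<in> Poly_Mapping.keys u" "xs' @ ys' = xs @ []"
    then have "(j', ys', j) \<in> paths Q 0" using assms by (auto simp: homog_def)
    then show "xs' = xs \<and> j' = j" using paths_length[of j' ys' j 0] \<open>xs' @ ys' = xs @ []\<close> by auto
  qed
  then show ?thesis by simp
qed

text \<open>A path of the support determines its summand through its first letter, which is what
  \<open>hd (fst (snd k))\<close> extracts. So no two summands interfere, whatever the
  characteristic.\<close>

lemma lookup_sigma:
  "Poly_Mapping.lookup (\<sigma> i) k = (if \<exists>a. a \<in> arcs D \<and> head D a = i \<and> k = (i, [a, star a], i) then arrow_sign (hd (fst (snd k))) else 0)"
proof -
  let ?S = "{a \<in> arcs D. head D a = i}"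
  have fin: "finite ?S" by simp
  have "Poly_Mapping.lookup (\<sigma> i) k = (\<Sum>a\<in>?S. if a = hd (fst (snd k)) then if k = (i, [a, star a], i) then arrow_sign a else 0 else 0)"
    unfolding preproj_sigma_def lookup_sum by (intro sum.cong refl) (auto simp: lookup_single when_def)
  also have "\<dots> = (if hd (fst (snd k)) \<in> ?S then if k = (i, [hd (fst (snd k)), star (hd (fst (snd k)))], i) then arrow_sign (hd (fst (snd k))) else 0 else 0)"
    using fin by (simp add: sum.delta')
  also have "\<dots> = (if \<exists>a. a \<in> arcs D \<and> head D a = i \<and> k = (i, [a, star a], i) then arrow_sign (hd (fst (snd k))) else 0)"
    by (cases k) auto
  finally show ?thesis .
qed

lemma lookup_sigma_nonzero:
  assumes "Poly_Mapping.lookup (\<sigma> i) (j, xs, l) \<noteq> 0"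
  shows "j = i \<and> l = i \<and> (\<exists>a\<in>arcs D. head D a = i \<and> xs = [a, star a])"
proof (rule ccontr)
  assume "\<not> ?thesis"
  then have "\<not> (\<exists>a. a \<in> arcs D \<and> head D a = i \<and> (j, xs, l) = (i, [a, star a], i))" by blast
  then show False using assms unfolding lookup_sigma by (simp only: if_False) simp
qed

lemma lookup_sigma_eq:
  assumes "a \<in> arcs D" "head D a = i"
  shows "Poly_Mapping.lookup (\<sigma> i) (i, [a, star a], i) = arrow_sign a"
proof -
  have "\<exists>b. b \<in> arcs D \<and> head D b = i \<and> (i, [a, star a], i) = (i, [b, star b], i)" using assms by blast
  then show ?thesis unfolding lookup_sigma by (simp only: if_True) simp
qed

lemma sigma_H0_left: assumes "u \<in> H 0" shows "u \<star> \<sigma> i = pscale (Poly_Mapping.lookup u (i, [], i)) (\<sigma> i)"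
proof (rule poly_mapping_eqI)
  fix k :: "('v, 'e + 'e) path"
  obtain j xs l where k: "k = (j, xs, l)" by (cases k)
  show "Poly_Mapping.lookup (u \<star> \<sigma> i) k = Poly_Mapping.lookup (pscale (Poly_Mapping.lookup u (i, [], i)) (\<sigma> i)) k"
    using lookup_sigma_nonzero[of i j xs l]
    by (cases "Poly_Mapping.lookup (\<sigma> i) k = 0") (simp_all add: k lookup_H0_mult[OF assms])
qed

lemma sigma_H0_right: assumes "u \<in> H 0" shows "\<sigma> i \<star> u = pscale (Poly_Mapping.lookup u (i, [], i)) (\<sigma> i)"
proof (rule poly_mapping_eqI)
  fix k :: "('v, 'e + 'e) path"
  obtain j xs l where k: "k = (j, xs, l)" by (cases k)
  show "Poly_Mapping.lookup (\<sigma> i \<star> u) k = Poly_Mapping.lookup (pscale (Poly_Mapping.lookup u (i, [], i)) (\<sigma> i)) k"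
    using lookup_sigma_nonzero[of i j xs l]
    by (cases "Poly_Mapping.lookup (\<sigma> i) k = 0") (simp_all add: k lookup_mult_H0[OF assms])
qed

abbreviation R :: "('f, 'v, 'e) path_elt set" where "R \<equiv> preproj_R Q"

lemma subspace_R: "pm.subspace R"
  unfolding preproj_R_def by (rule pm.subspace_span)

lemma sigma_R: "i \<in> verts Q \<Longrightarrow> \<sigma> i \<in> R"
  unfolding preproj_R_def by (rule pm.span_base) auto

text \<open>Each \<open>\<sigma> i\<close> is a combination of closed paths at \<open>i\<close>, so
  \<open>k\<close> acts on it from either side through a scalar. Hence \<open>R\<close> is a
  \<open>k\<close>-subbimodule.\<close>

lemma R_H0_closed:
  assumes "u \<in> H 0" "r \<in> R"
  shows "u \<star> r \<in> R" "r \<star> u \<in> R"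
proof -
  have "R \<subseteq> {r. u \<star> r \<in> R}" unfolding preproj_R_def
  proof (rule pm.span_minimal)
    show "pm.subspace {r. u \<star> r \<in> pspan (\<sigma> ` verts Q)}"
      using subspace_R unfolding preproj_R_def
      by (auto simp: pm.subspace_def path_mult_add_right path_mult_pscale_right)
  qed (use pm.subspace_scale[OF subspace_R] sigma_R assms(1) in \<open>auto simp: sigma_H0_left preproj_R_def[symmetric]\<close>)
  then show "u \<star> r \<in> R" using assms by blast
  have "R \<subseteq> {r. r \<star> u \<in> R}" unfolding preproj_R_def
  proof (rule pm.span_minimal)
    show "pm.subspace {r. r \<star> u \<in> pspan (\<sigma> ` verts Q)}"
      using subspace_R unfolding preproj_R_def
      by (auto simp: pm.subspace_def path_mult_add_left path_mult_pscale_left)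
  qed (use pm.subspace_scale[OF subspace_R] sigma_R assms(1) in \<open>auto simp: sigma_H0_right preproj_R_def[symmetric]\<close>)
  then show "r \<star> u \<in> R" using assms by blast
qed

abbreviation W :: "int \<Rightarrow> ('f, 'v, 'e) path_elt set" where "W \<equiv> Wset Q"

text \<open>Under the identification of the tensor algebra with the path algebra this is
  \<open>V^m \<otimes> R \<otimes> V^n\<close>, tensored over \<open>k\<close>.\<close>

definition relpart :: "nat \<Rightarrow> nat \<Rightarrow> ('f, 'v, 'e) path_elt set" where
  "relpart m n = pspan {u \<star> r \<star> v | u r v. u \<in> homog Q m \<and> r \<in> preproj_R Q \<and> v \<in> homog Q n}"

lemma W_ge2: "p \<ge> 2 \<Longrightarrow> W p = \<Inter>{relpart i j | i j. int (i + 2 + j) = p}"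
  by (simp add: Wset_def relpart_def)

lemma W_0: "W 0 = H 0" and W_1: "W 1 = H 1" and W_neg: "p < 0 \<Longrightarrow> W p = {0}"
  by (simp_all add: Wset_def)

lemma W_2: "W 2 = R"
proof -
  have "int (i + 2 + j) = 2 \<longleftrightarrow> i = 0 \<and> j = 0" for i j :: nat by linarith
  then have "W 2 = relpart 0 0" by (simp add: W_ge2)
  also have "\<dots> = R"
  proof
    show "relpart 0 0 \<subseteq> R" unfolding relpart_def
      by (rule pm.span_minimal) (auto simp: subspace_R R_H0_closed)
    show "R \<subseteq> relpart 0 0"
    proof
      fix r assume r: "r \<in> R"
      then have "r \<in> carrier PA" using R_subset H_subset by blast
      \<comment> \<open>Padding with the unit, which lies in \<open>homog Q 0\<close>, turns a
        relation into a generator of \<open>relpart 0 0\<close>.\<close>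
      then have "r = unit \<star> r \<star> unit" by (simp add: unit_left unit_right)
      then show "r \<in> relpart 0 0"
        unfolding relpart_def using r unit_H by (intro pm.span_base) blast
    qed
  qed
  finally show ?thesis .
qed

lemma subspace_W: "pm.subspace (W p)"
proof -
  have "pm.subspace (relpart i j)" for i j unfolding relpart_def by (rule pm.subspace_span)
  then have "pm.subspace (\<Inter>{relpart i j | i j. int (i + 2 + j) = p})"
    by (intro pm.subspace_Inter) auto
  moreover have "pm.subspace ({0} :: ('f, 'v, 'e) path_elt set)" by (rule pm.subspace_single_0)
  moreover have "p \<ge> 2 \<or> p < 0 \<or> p = 0 \<or> p = 1" by linarith
  ultimately show ?thesis using subspace_H[of 0] subspace_H[of 1] W_ge2[of p] W_0 W_1 W_neg[of p]
    by (elim disjE) (simp_all only:)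
qed

lemma relpart_H: "relpart m n \<subseteq> H (m + 2 + n)"
  unfolding relpart_def
proof (rule pm.span_minimal[OF _ subspace_H], clarify)
  fix u r v assume a: "u \<in> H m" "r \<in> R" "v \<in> H n"
  then have "r \<in> H 2" using R_subset by blast
  then show "u \<star> r \<star> v \<in> H (m + 2 + n)" using a by (intro H_mult)
qed

text \<open>Both conditions are linear and hold for every \<open>\<sigma> k\<close>. The second says
  that the coefficients at \<open>x \<cdot> star x\<close>, corrected by the sign of
  \<open>x\<close>, agree for all arrows \<open>x\<close> with the same head: summands of one
  \<open>\<sigma>\<close> may be exchanged without losing a nonzero coefficient.\<close>

lemma R_form: 
  assumes "r \<in> R"
  shows "Poly_Mapping.lookup r (i, xs, j) \<noteq> 0 \<Longrightarrow> i = j \<and> (\<exists>x\<in>arcs D. xs = [x, star x] \<and> head D x = i)"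
    and "x \<in> arcs D \<Longrightarrow> y \<in> arcs D \<Longrightarrow> head D x = i \<Longrightarrow> head D y = i \<Longrightarrow>
      arrow_sign x * Poly_Mapping.lookup r (i, [x, star x], i) = arrow_sign y * Poly_Mapping.lookup r (i, [y, star y], i)"
proof -
  have "R \<subseteq> {r. Poly_Mapping.lookup r (i, xs, j) \<noteq> 0 \<longrightarrow> i = j \<and> (\<exists>x\<in>arcs D. xs = [x, star x] \<and> head D x = i)}"
    (is "_ \<subseteq> ?T") unfolding preproj_R_def
  proof (rule pm.span_minimal)
    show "pm.subspace ?T" unfolding pm.subspace_def by (auto simp: lookup_add)
  qed (use lookup_sigma_nonzero in blast)
  then show "Poly_Mapping.lookup r (i, xs, j) \<noteq> 0 \<Longrightarrow> i = j \<and> (\<exists>x\<in>arcs D. xs = [x, star x] \<and> head D x = i)"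
    using assms by blast
next
  assume xy: "x \<in> arcs D" "y \<in> arcs D" "head D x = i" "head D y = i"
  have "R \<subseteq> {r. arrow_sign x * Poly_Mapping.lookup r (i, [x, star x], i) = arrow_sign y * Poly_Mapping.lookup r (i, [y, star y], i)}"
    (is "_ \<subseteq> ?T") unfolding preproj_R_def
  proof (rule pm.span_minimal)
    show "pm.subspace ?T" unfolding pm.subspace_def by (auto simp: lookup_add distrib_left mult.left_commute)
  next
    have "arrow_sign x * Poly_Mapping.lookup (\<sigma> k) (i, [x, star x], i) = arrow_sign y * Poly_Mapping.lookup (\<sigma> k) (i, [y, star y], i)" for k
    proof (cases "k = i")
      case True
      then show ?thesis using xy by (simp add: lookup_sigma_eq)
    next
      case False
      then have "Poly_Mapping.lookup (\<sigma> k) (i, xs, i) = 0" for xs using lookup_sigma_nonzero by blast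
      then show ?thesis by simp
    qed
    then show "\<sigma> ` verts Q \<subseteq> ?T" by blast
  qed
  then show "arrow_sign x * Poly_Mapping.lookup r (i, [x, star x], i) = arrow_sign y * Poly_Mapping.lookup r (i, [y, star y], i)"
    using assms by blast
qed

lemma lookup_R_mult:
  assumes "r \<in> R"
  shows "Poly_Mapping.lookup (r \<star> v) (i, x # y # zs, j) = Poly_Mapping.lookup r (i, [x, y], i) * Poly_Mapping.lookup v (i, zs, j)"
proof -
  have "Poly_Mapping.lookup (r \<star> v) (i, [x, y] @ zs, j) = Poly_Mapping.lookup r (i, [x, y], i) * Poly_Mapping.lookup v (i, zs, j)"
  proof (rule lookup_path_mult)
    fix xs' j' ys' assume "(i, xs', j') \<in> Poly_Mapping.keys r" "xs' @ ys' = [x, y] @ zs"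
    then show "xs' = [x, y] \<and> j' = i" using R_form(1)[OF assms, of i xs' j'] by (auto simp: in_keys_iff)
  qed
  then show ?thesis by simp
qed

lemma lookup_H1_mult:
  assumes "u \<in> H 1"
  shows "Poly_Mapping.lookup (u \<star> v) (i, x # zs, j) = Poly_Mapping.lookup u (i, [x], tail D x) * Poly_Mapping.lookup v (tail D x, zs, j)"
proof -
  have "Poly_Mapping.lookup (u \<star> v) (i, [x] @ zs, j) = Poly_Mapping.lookup u (i, [x], tail D x) * Poly_Mapping.lookup v (tail D x, zs, j)"
  proof (rule lookup_path_mult)
    fix xs' j' ys' assume "(i, xs', j') \<in> Poly_Mapping.keys u" and e: "xs' @ ys' = [x] @ zs"
    then have p: "(i, xs', j') \<in> paths Q 1" using assms by (auto simp: homog_def)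
    then show "xs' = [x] \<and> j' = tail D x" using paths_length[OF p] e by (cases xs') (auto simp: paths_Cons)
  qed
  then show ?thesis by simp
qed

text \<open>\<open>R_form\<close> read at the first two letters. Both conditions are linear, so they
  are checked on products \<open>u \<star> r \<star> v\<close>, where the coefficient splits off the
  factor from \<open>r\<close>.\<close>

lemma relpart_0_form:
  assumes "w \<in> relpart 0 n"
  shows "Poly_Mapping.lookup w (i, x # y # zs, j) \<noteq> 0 \<Longrightarrow> y = star x"
    and "x \<in> arcs D \<Longrightarrow> y \<in> arcs D \<Longrightarrow> head D x = i \<Longrightarrow> head D y = i \<Longrightarrow>
      arrow_sign x * Poly_Mapping.lookup w (i, x # star x # zs, j) = arrow_sign y * Poly_Mapping.lookup w (i, y # star y # zs, j)"
proof -
  have "relpart 0 n \<subseteq> {w. Poly_Mapping.lookup w (i, x # y # zs, j) \<noteq> 0 \<longrightarrow> y = star x}" (is "_ \<subseteq> ?T")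
    unfolding relpart_def
  proof (rule pm.span_minimal, clarify)
    fix u r v assume a: "u \<in> H 0" "r \<in> R" "Poly_Mapping.lookup (u \<star> r \<star> v) (i, x # y # zs, j) \<noteq> 0"
    then have "Poly_Mapping.lookup (u \<star> r) (i, [x, y], i) \<noteq> 0"
      using lookup_R_mult[OF R_H0_closed(1)[OF a(1,2)]] by auto
    then show "y = star x" using R_form(1)[OF R_H0_closed(1)[OF a(1,2)]] by fastforce
  next
    show "pm.subspace ?T" unfolding pm.subspace_def by (auto simp: lookup_add)
  qed
  then show "Poly_Mapping.lookup w (i, x # y # zs, j) \<noteq> 0 \<Longrightarrow> y = star x" using assms by blast
next
  assume xy: "x \<in> arcs D" "y \<in> arcs D" "head D x = i" "head D y = i"
  have "relpart 0 n \<subseteq> {w. arrow_sign x * Poly_Mapping.lookup w (i, x # star x # zs, j) = arrow_sign y * Poly_Mapping.lookup w (i, y # star y # zs, j)}" (is "_ \<subseteq> ?T")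
    unfolding relpart_def
  proof (rule pm.span_minimal, clarify)
    fix u r v assume a: "u \<in> H 0" "r \<in> R"
    note r = R_H0_closed(1)[OF a]
    have "arrow_sign x * Poly_Mapping.lookup (u \<star> r) (i, [x, star x], i) * Poly_Mapping.lookup v (i, zs, j) =
      arrow_sign y * Poly_Mapping.lookup (u \<star> r) (i, [y, star y], i) * Poly_Mapping.lookup v (i, zs, j)"
      using R_form(2)[OF r xy] by simp
    then show "arrow_sign x * Poly_Mapping.lookup (u \<star> r \<star> v) (i, x # star x # zs, j) = arrow_sign y * Poly_Mapping.lookup (u \<star> r \<star> v) (i, y # star y # zs, j)"
      unfolding lookup_R_mult[OF r] by (simp add: mult.assoc)
  next
    show "pm.subspace ?T" unfolding pm.subspace_def by (auto simp: lookup_add distrib_left mult.left_commute)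
  qed
  then show "arrow_sign x * Poly_Mapping.lookup w (i, x # star x # zs, j) = arrow_sign y * Poly_Mapping.lookup w (i, y # star y # zs, j)"
    using assms by blast
qed

text \<open>The same conditions one letter further to the right. The leading arrow \<open>t\<close>
  contributes only a common factor, and its tail is the vertex at which the relation sits.\<close>

lemma relpart_1_form:
  assumes "w \<in> relpart 1 n"
  shows "Poly_Mapping.lookup w (i, t # x # y # zs, j) \<noteq> 0 \<Longrightarrow> y = star x"
    and "x \<in> arcs D \<Longrightarrow> y \<in> arcs D \<Longrightarrow> head D x = tail D t \<Longrightarrow> head D y = tail D t \<Longrightarrow>
      arrow_sign x * Poly_Mapping.lookup w (i, t # x # star x # zs, j) = arrow_sign y * Poly_Mapping.lookup w (i, t # y # star y # zs, j)"
proof -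
  have "relpart 1 n \<subseteq> {w. Poly_Mapping.lookup w (i, t # x # y # zs, j) \<noteq> 0 \<longrightarrow> y = star x}" (is "_ \<subseteq> ?T")
    unfolding relpart_def
  proof (rule pm.span_minimal, clarify)
    fix u r v assume a: "u \<in> H 1" "r \<in> R" "Poly_Mapping.lookup (u \<star> r \<star> v) (i, t # x # y # zs, j) \<noteq> 0"
    then have "Poly_Mapping.lookup r (tail D t, [x, y], tail D t) \<noteq> 0"
      using lookup_R_mult[OF a(2)] lookup_H1_mult[OF a(1)] by (auto simp: path_mult_assoc)
    then show "y = star x" using R_form(1)[OF a(2)] by fastforce
  next
    show "pm.subspace ?T" unfolding pm.subspace_def by (auto simp: lookup_add)
  qed
  then show "Poly_Mapping.lookup w (i, t # x # y # zs, j) \<noteq> 0 \<Longrightarrow> y = star x" using assms by blast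
next
  assume xy: "x \<in> arcs D" "y \<in> arcs D" "head D x = tail D t" "head D y = tail D t"
  have "relpart 1 n \<subseteq> {w. arrow_sign x * Poly_Mapping.lookup w (i, t # x # star x # zs, j) = arrow_sign y * Poly_Mapping.lookup w (i, t # y # star y # zs, j)}" (is "_ \<subseteq> ?T")
    unfolding relpart_def
  proof (rule pm.span_minimal, clarify)
    fix u r v assume a: "u \<in> H 1" "r \<in> R"
    show "arrow_sign x * Poly_Mapping.lookup (u \<star> r \<star> v) (i, t # x # star x # zs, j) = arrow_sign y * Poly_Mapping.lookup (u \<star> r \<star> v) (i, t # y # star y # zs, j)"
      unfolding path_mult_assoc lookup_H1_mult[OF a(1)] lookup_R_mult[OF a(2)]
      using R_form(2)[OF a(2) xy] by (simp add: mult.left_commute)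
  next
    show "pm.subspace ?T" unfolding pm.subspace_def by (auto simp: lookup_add distrib_left mult.left_commute)
  qed
  then show "arrow_sign x * Poly_Mapping.lookup w (i, t # x # star x # zs, j) = arrow_sign y * Poly_Mapping.lookup w (i, t # y # star y # zs, j)"
    using assms by blast
qed

end

section \<open>Vanishing of \<open>W p\<close> above degree 2\<close>

locale koszul_quiver = quiver Q F for Q :: "('v, 'e) pre_digraph" and F :: "'f::field itself" +
  assumes connected: "Digraph_Component.connected Q"
    and not_A1: "\<not> underlying_A1 Q"
    and not_A2: "\<not> underlying_A2 Q"
begin

text \<open>The exchange argument involves the first three letters only and carries the rest along,
  so it settles all degrees above 2 at once instead of reducing them to degree 3.\<close>

lemma W_gt2: assumes "p > 2" shows "W p = {0}"
proof -
  obtain n where n: "p = int (3 + n)" using assms that[of "nat (p - 3)"] by simp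
  have "w = 0" if w: "w \<in> W p" for w
  proof (rule ccontr)
    assume "w \<noteq> 0"
    \<comment> \<open>Of all the conditions defining \<open>W p\<close>, the two at the first and at
      the second position already contradict each other on a nonzero element.\<close>
    have w0: "w \<in> relpart 0 (1 + n)" and w1: "w \<in> relpart 1 n"
      using w assms by (subst (asm) W_ge2; force simp: n)+
    have wH: "w \<in> H (3 + n)" using relpart_H[of 1 n] w1 by (auto simp: eval_nat_numeral)
    obtain k where "k \<in> Poly_Mapping.keys w" using \<open>w \<noteq> 0\<close> by (metis ex_in_conv keys_eq_empty)
    moreover obtain i xs j where k: "k = (i, xs, j)" by (cases k)
    ultimately have nz: "Poly_Mapping.lookup w (i, xs, j) \<noteq> 0" and path: "(i, xs, j) \<in> paths Q (3 + n)"
      using wH by (auto simp: homog_def in_keys_iff)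
    then have "length xs = 3 + n" by (simp add: paths_length)
    then obtain t x y zs where xs: "xs = t # x # y # zs" by (auto simp: eval_nat_numeral length_Suc_conv)
    have t: "t \<in> arcs D" "head D t = i" using path by (auto simp: xs paths_Cons)
    have x: "x = star t" using relpart_0_form(1)[OF w0] nz xs by blast
    have "y = star x" using relpart_1_form(1)[OF w1] nz xs by blast
    then have nz': "Poly_Mapping.lookup w (i, t # star t # t # zs, j) \<noteq> 0" using nz xs x by simp
    obtain b where b: "b \<in> arcs D" and "(b \<noteq> t \<and> head D b = head D t) \<or> (b \<noteq> star t \<and> head D b = tail D t)"
      using second_arrow[OF connected not_A2 t(1)] by blast
    then show False
    proof (elim disjE conjE)
      \<comment> \<open>Exchanging the first two letters produces \<open>b, star b, t\<close>, and
        the condition at the second position then forces \<open>t = b\<close>.\<close>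
      assume b': "b \<noteq> t" "head D b = head D t"
      have "Poly_Mapping.lookup w (i, b # star b # t # zs, j) \<noteq> 0"
        using relpart_0_form(2)[OF w0 b t(1), of i "t # zs" j] b' t nz' by auto
      then have "t = star (star b)" by (rule relpart_1_form(1)[OF w1])
      then show False using b' by simp
    next
      \<comment> \<open>Exchanging the second and third letters produces
        \<open>t, b, star b\<close>, and the condition at the first position then forces
        \<open>b = star t\<close>.\<close>
      assume b': "b \<noteq> star t" "head D b = tail D t"
      have "Poly_Mapping.lookup w (i, t # b # star b # zs, j) \<noteq> 0"
        using relpart_1_form(2)[OF w1 b, of "star t" t i zs j] b' t nz' by auto
      then have "b = star t" by (rule relpart_0_form(1)[OF w0])
      then show False using b' by simp
    qed
  qed
  then show ?thesis using pm.subspace_0[OF subspace_W] by blast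
qed

end

lemma linear_on_finsum:
  assumes "finite A" "is_vector_space V" "pm.subspace U" "\<And>i. i \<in> A \<Longrightarrow> linear_on U V (g i)"
  shows "linear_on U V (\<lambda>x. \<Oplus>\<^bsub>V\<^esub>i\<in>A. g i x)"
proof -
  interpret vspace V using assms by (simp add: vspace_def)
  show ?thesis using assms(1,4)
  proof (induction A)
    case empty
    then show ?case using assms by (simp add: linear_on_def)
  next
    case (insert a A)
    let ?G = "\<lambda>x. \<Oplus>\<^bsub>V\<^esub>i\<in>A. g i x"
    have lG: "linear_on U V ?G" and lg: "linear_on U V (g a)" using insert by auto
    have c: "g i x \<in> carrier V" if "i \<in> insert a A" "x \<in> U" for i x
      using insert that linear_on_closed by blast
    have e: "(\<Oplus>\<^bsub>V\<^esub>i\<in>insert a A. g i x) = g a x \<oplus>\<^bsub>V\<^esub> ?G x" if "x \<in> U" for x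
      using insert(1,2) c that by (intro finsum_insert) auto
    have U: "x + y \<in> U" "pscale k x \<in> U" if "x \<in> U" "y \<in> U" for x y k
      using assms(3) that pm.subspace_add pm.subspace_scale by blast+
    show ?case unfolding linear_on_def
      using assms(2,3) linear_on_closed[OF lG] linear_on_closed[OF lg]
      by (auto simp: e U linear_on_add[OF lG] linear_on_add[OF lg] linear_on_pscale[OF lG] linear_on_pscale[OF lg]
          smult_distr_right a_ac)
  qed
qed

lemma linear_on_lookup:
  assumes "is_vector_space V" "m \<in> carrier V"
  shows "linear_on UNIV V (\<lambda>w. (c * Poly_Mapping.lookup w k) \<odot>\<^bsub>V\<^esub> m)"
proof -
  interpret vspace V using assms by (simp add: vspace_def)
  show ?thesis using assms
    by (auto simp: linear_on_def lookup_add distrib_left smult_distr_left smult_smult mult.left_commute pm.subspace_UNIV)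
qed

text \<open>Identifies the carrier-based sum with the ordinary one, so that a sum of path products
  becomes an instance of \<open>lin_ext\<close>.\<close>

lemma finsum_free: "finite A \<Longrightarrow> finsum (free_space UNIV) f A = sum f A"
proof (induction A rule: finite_induct)
  case empty
  interpret vspace "free_space UNIV :: ('c::field, 'b \<Rightarrow>\<^sub>0 'c) module"
    by (rule vspaceI) (auto simp: algebra_simps pm.scale_left_distrib pm.scale_right_distrib)
  show ?case by simp
next
  case (insert x F)
  interpret vspace "free_space UNIV :: ('c::field, 'b \<Rightarrow>\<^sub>0 'c) module"
    by (rule vspaceI) (auto simp: algebra_simps pm.scale_left_distrib pm.scale_right_distrib)
  show ?case using insert by simp
qed

lemma vspace_free: "vspace (free_space UNIV :: ('c::field, 'b \<Rightarrow>\<^sub>0 'c) module)"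
  by (rule vspaceI) (auto simp: algebra_simps pm.scale_left_distrib pm.scale_right_distrib)

context koszul_quiver
begin

subsection \<open>Bases of the spaces \<open>W\<^sub>p\<close>\<close>

text \<open>An arbitrary reference arrow ending at \<open>i\<close>. The coefficient at the path
  formed from it and its star shows the multiple of \<open>\<sigma> i\<close> contained in an
  element of \<open>R\<close>.\<close>

definition incoming :: "'v \<Rightarrow> 'e + 'e" where
  "incoming i = (SOME a. a \<in> arcs D \<and> head D a = i)"

lemma incoming: "i \<in> verts Q \<Longrightarrow> incoming i \<in> arcs D" "i \<in> verts Q \<Longrightarrow> head D (incoming i) = i"
  using someI_ex[of "\<lambda>a. a \<in> arcs D \<and> head D a = i"] incoming_arrow[OF connected not_A1, of i]
  unfolding incoming_def by blast+

definition arrow :: "'e + 'e \<Rightarrow> ('f, 'v, 'e) path_elt" where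
  "arrow a = Poly_Mapping.single (head D a, [a], tail D a) 1"

text \<open>Degrees 0 and 2 are both indexed by vertices and degree 1 by arrows. With this common
  type the duality between \<open>W p\<close> and \<open>W (2 - p)\<close> becomes an involution of
  indices.\<close>

definition Ix :: "int \<Rightarrow> ('v + 'e + 'e) set" where
  "Ix p = (if p = 0 \<or> p = 2 then Inl ` verts Q else if p = 1 then Inr ` arcs D else {})"

definition tg :: "'v + 'e + 'e \<Rightarrow> 'v" where "tg = case_sum (\<lambda>i. i) (head D)"
definition sc :: "'v + 'e + 'e \<Rightarrow> 'v" where "sc = case_sum (\<lambda>i. i) (tail D)"

definition bas :: "int \<Rightarrow> 'v + 'e + 'e \<Rightarrow> ('f, 'v, 'e) path_elt" where
  "bas p = case_sum (\<lambda>i. if p = 2 then \<sigma> i else idem i) arrow"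

text \<open>The coordinate of \<open>w\<close> at the basis element \<open>bas p \<iota>\<close> is, up to sign, the coefficient of \<open>w\<close> at
  the path \<open>mark p \<iota>\<close>.\<close>

definition mark :: "int \<Rightarrow> 'v + 'e + 'e \<Rightarrow> ('e + 'e) list" where
  "mark p = case_sum (\<lambda>i. if p = 2 then [incoming i, star (incoming i)] else []) (\<lambda>a. [a])"

text \<open>The coefficient of \<open>\<sigma> i\<close> at its marked path is the sign of the
  reference arrow. A sign is its own inverse, so multiplying by it normalises the
  coordinate.\<close>

definition mark_sign :: "int \<Rightarrow> 'v + 'e + 'e \<Rightarrow> 'f" where
  "mark_sign p = case_sum (\<lambda>i. if p = 2 then arrow_sign (incoming i) else 1) (\<lambda>_. 1)"

definition co :: "int \<Rightarrow> 'v + 'e + 'e \<Rightarrow> ('f, 'v, 'e) path_elt \<Rightarrow> 'f" where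
  "co p \<iota> w = mark_sign p \<iota> * Poly_Mapping.lookup w (tg \<iota>, mark p \<iota>, sc \<iota>)"

lemma Ix_cases [consumes 1, case_names 0 1 2]:
  assumes "\<iota> \<in> Ix p"
  obtains i where "p = 0" "\<iota> = Inl i" "i \<in> verts Q"
    | a where "p = 1" "\<iota> = Inr a" "a \<in> arcs D"
    | i where "p = 2" "\<iota> = Inl i" "i \<in> verts Q"
  using assms by (auto simp: Ix_def split: if_splits)

lemma finite_Ix [simp]: "finite (Ix p)"
  by (simp add: Ix_def)

lemma Ix_verts: "\<iota> \<in> Ix p \<Longrightarrow> tg \<iota> \<in> verts Q \<and> sc \<iota> \<in> verts Q"
  by (erule Ix_cases) (auto simp: tg_def sc_def)

lemma arrow_H: "a \<in> arcs D \<Longrightarrow> arrow a \<in> H 1"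
  by (simp add: arrow_def homog_def paths_Cons)

lemma bas_W: "\<iota> \<in> Ix p \<Longrightarrow> bas p \<iota> \<in> W p"
  by (erule Ix_cases) (simp_all add: bas_def W_0 W_1[simplified] W_2 idem_H arrow_H[simplified] sigma_R)

lemma mark_path: "\<iota> \<in> Ix p \<Longrightarrow> (tg \<iota>, mark p \<iota>, sc \<iota>) \<in> paths Q (nat p)"
  by (erule Ix_cases) (auto simp: tg_def sc_def mark_def paths_Cons incoming numeral_2_eq_2)

lemma length_mark: "\<iota> \<in> Ix p \<Longrightarrow> length (mark p \<iota>) = nat p"
  using mark_path paths_length by blast

lemma co_add: "co p \<iota> (x + y) = co p \<iota> x + co p \<iota> y" and co_pscale: "co p \<iota> (pscale c x) = c * co p \<iota> x"
  and co_zero [simp]: "co p \<iota> 0 = 0"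
  by (simp_all add: co_def lookup_add distrib_left)

lemma co_left: "u \<in> H 0 \<Longrightarrow> co p \<iota> (u \<star> w) = Poly_Mapping.lookup u (tg \<iota>, [], tg \<iota>) * co p \<iota> w"
  by (simp add: co_def lookup_H0_mult)

lemma co_right: "u \<in> H 0 \<Longrightarrow> co p \<iota> (w \<star> u) = Poly_Mapping.lookup u (sc \<iota>, [], sc \<iota>) * co p \<iota> w"
  by (simp add: co_def lookup_mult_H0)

lemma co_bas: assumes "\<iota> \<in> Ix p" "\<kappa> \<in> Ix p" shows "co p \<iota> (bas p \<kappa>) = (if \<iota> = \<kappa> then 1 else 0)"
  using assms(1)
proof (cases rule: Ix_cases)
  case (0 i)
  then show ?thesis using assms(2)
    by (auto simp: Ix_def co_def bas_def mark_def mark_sign_def tg_def sc_def idem_def lookup_single when_def split: if_splits)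
next
  case (1 a)
  then show ?thesis using assms(2)
    by (auto simp: Ix_def co_def bas_def mark_def mark_sign_def tg_def sc_def arrow_def lookup_single when_def split: if_splits)
next
  case (2 i)
  then obtain j where j: "\<kappa> = Inl j" using assms(2) by (auto simp: Ix_def)
  show ?thesis
  proof (cases "i = j")
    case True
    then show ?thesis using 2 j
      by (simp add: co_def bas_def mark_def mark_sign_def tg_def sc_def lookup_sigma_eq incoming)
  next
    case False
    then have "Poly_Mapping.lookup (\<sigma> j) (i, xs, i) = 0" for xs using lookup_sigma_nonzero by blast
    then show ?thesis using 2 j False by (simp add: co_def bas_def mark_def mark_sign_def tg_def sc_def)
  qed
qed

text \<open>Together with \<open>co_bas\<close> this makes \<open>bas p\<close> a basis with
  coordinates \<open>co p\<close>. In degrees 0 and 1 it is the expansion into paths, in degree 2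
  the identity is linear in \<open>w\<close> and is checked on the \<open>\<sigma> i\<close>, and
  elsewhere \<open>W p\<close> is zero while \<open>Ix p\<close> is empty.\<close>

lemma bas_expand:
  assumes "w \<in> W p"
  shows "w = (\<Sum>\<iota>\<in>Ix p. pscale (co p \<iota> w) (bas p \<iota>))"
proof -
  consider "p < 0 \<or> p > 2" | "p = 0" | "p = 1" | "p = 2" by linarith
  then show ?thesis
  proof cases
    case 1
    then show ?thesis using assms W_neg[of p] W_gt2[of p] by auto
  next
    case 2
    have "Poly_Mapping.keys w \<subseteq> (\<lambda>i. (i, [], i)) ` verts Q"
    proof
      fix k assume "k \<in> Poly_Mapping.keys w"
      then have "k \<in> paths Q 0" using assms 2 by (auto simp: W_0 homog_def)
      moreover obtain i xs j where k: "k = (i, xs, j)" by (cases k)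
      ultimately show "k \<in> (\<lambda>i. (i, [], i)) ` verts Q" using paths_length[of i xs j 0] by auto
    qed
    then have "w = (\<Sum>k\<in>(\<lambda>i. (i, [], i)) ` verts Q. Poly_Mapping.single k (Poly_Mapping.lookup w k))"
      by (intro poly_mapping_sum_keys) auto
    also have "\<dots> = (\<Sum>i\<in>verts Q. Poly_Mapping.single (i, [], i) (Poly_Mapping.lookup w (i, [], i)))"
      by (subst sum.reindex) (auto simp: inj_on_def)
    also have "\<dots> = (\<Sum>\<iota>\<in>Ix p. pscale (co p \<iota> w) (bas p \<iota>))" using 2
      by (simp add: Ix_def sum.reindex co_def bas_def mark_def mark_sign_def tg_def sc_def idem_def)
    finally show ?thesis .
  next
    case 3
    let ?f = "\<lambda>a. (head D a, [a], tail D a)"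
    have "Poly_Mapping.keys w \<subseteq> ?f ` arcs D"
    proof
      fix k assume "k \<in> Poly_Mapping.keys w"
      then have "k \<in> paths Q 1" using assms 3 W_1 by (auto simp: homog_def)
      moreover obtain i xs j where k: "k = (i, xs, j)" by (cases k)
      moreover from calculation obtain a where "xs = [a]"
        using paths_length[of i xs j 1] by (auto simp: length_Suc_conv)
      ultimately show "k \<in> ?f ` arcs D" by (auto simp: paths_Cons)
    qed
    then have "w = (\<Sum>k\<in>?f ` arcs D. Poly_Mapping.single k (Poly_Mapping.lookup w k))"
      by (intro poly_mapping_sum_keys) auto
    also have "\<dots> = (\<Sum>a\<in>arcs D. Poly_Mapping.single (?f a) (Poly_Mapping.lookup w (?f a)))"
      by (subst sum.reindex) (auto simp: inj_on_def)
    also have "\<dots> = (\<Sum>\<iota>\<in>Ix p. pscale (co p \<iota> w) (bas p \<iota>))" using 3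
      by (simp add: Ix_def sum.reindex co_def bas_def mark_def mark_sign_def tg_def sc_def arrow_def)
    finally show ?thesis .
  next
    case 4
    have "R \<subseteq> {w. w = (\<Sum>\<iota>\<in>Ix 2. pscale (co 2 \<iota> w) (bas 2 \<iota>))}" (is "_ \<subseteq> ?T")
      unfolding preproj_R_def
    proof (rule pm.span_minimal)
      have "0 \<in> ?T" by simp
      moreover have "x + y \<in> ?T" if "x \<in> ?T" "y \<in> ?T" for x y
      proof -
        have "x = (\<Sum>\<iota>\<in>Ix 2. pscale (co 2 \<iota> x) (bas 2 \<iota>))" "y = (\<Sum>\<iota>\<in>Ix 2. pscale (co 2 \<iota> y) (bas 2 \<iota>))"
          using that by auto
        then have "x + y = (\<Sum>\<iota>\<in>Ix 2. pscale (co 2 \<iota> x) (bas 2 \<iota>)) + (\<Sum>\<iota>\<in>Ix 2. pscale (co 2 \<iota> y) (bas 2 \<iota>))"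
          by presburger
        also have "\<dots> = (\<Sum>\<iota>\<in>Ix 2. pscale (co 2 \<iota> (x + y)) (bas 2 \<iota>))"
          by (simp only: co_add pm.scale_left_distrib sum.distrib)
        finally show ?thesis by blast
      qed
      moreover have "pscale c x \<in> ?T" if "x \<in> ?T" for c x
      proof -
        have "x = (\<Sum>\<iota>\<in>Ix 2. pscale (co 2 \<iota> x) (bas 2 \<iota>))" using that by auto
        then have "pscale c x = pscale c (\<Sum>\<iota>\<in>Ix 2. pscale (co 2 \<iota> x) (bas 2 \<iota>))" by presburger
        also have "\<dots> = (\<Sum>\<iota>\<in>Ix 2. pscale (co 2 \<iota> (pscale c x)) (bas 2 \<iota>))"
          by (simp only: co_pscale pm.scale_sum_right pm.scale_scale)
        finally show ?thesis by blast
      qed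
      ultimately show "pm.subspace ?T" by (intro pm.subspaceI)
      show "\<sigma> ` verts Q \<subseteq> ?T"
      proof clarify
        fix i assume i: "i \<in> verts Q"
        then have I: "Inl i \<in> Ix 2" and b: "\<sigma> i = bas 2 (Inl i)" by (auto simp: Ix_def bas_def)
        have "(\<Sum>\<iota>\<in>Ix 2. pscale (co 2 \<iota> (\<sigma> i)) (bas 2 \<iota>)) = (\<Sum>\<iota>\<in>Ix 2. if \<iota> = Inl i then bas 2 \<iota> else 0)"
          unfolding b using I by (intro sum.cong) (auto simp: co_bas)
        then show "\<sigma> i = (\<Sum>\<iota>\<in>Ix 2. pscale (co 2 \<iota> (\<sigma> i)) (bas 2 \<iota>))"
          using I by (simp add: b)
      qed
    qed
    then show ?thesis using assms 4 W_2 by auto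
  qed
qed

lemma bas_left: "\<iota> \<in> Ix p \<Longrightarrow> u \<in> H 0 \<Longrightarrow> u \<star> bas p \<iota> = pscale (Poly_Mapping.lookup u (tg \<iota>, [], tg \<iota>)) (bas p \<iota>)"
  by (erule Ix_cases; rule poly_mapping_eqI; rename_tac k; case_tac k)
    (auto simp: bas_def tg_def sigma_H0_left lookup_H0_mult idem_def arrow_def lookup_single when_def)

lemma bas_right: "\<iota> \<in> Ix p \<Longrightarrow> u \<in> H 0 \<Longrightarrow> bas p \<iota> \<star> u = pscale (Poly_Mapping.lookup u (sc \<iota>, [], sc \<iota>)) (bas p \<iota>)"
  by (erule Ix_cases; rule poly_mapping_eqI; rename_tac k; case_tac k)
    (auto simp: bas_def sc_def sigma_H0_right lookup_mult_H0 idem_def arrow_def lookup_single when_def)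

lemma W_H0_closed: assumes "w \<in> W p" "u \<in> H 0" shows "u \<star> w \<in> W p" "w \<star> u \<in> W p"
proof -
  have "u \<star> (\<Sum>\<iota>\<in>Ix p. pscale (co p \<iota> w) (bas p \<iota>)) \<in> W p" "(\<Sum>\<iota>\<in>Ix p. pscale (co p \<iota> w) (bas p \<iota>)) \<star> u \<in> W p"
    unfolding path_mult_sum_right path_mult_sum_left path_mult_pscale_right path_mult_pscale_left
    by (auto intro!: pm.subspace_sum[OF subspace_W] pm.subspace_scale[OF subspace_W] simp: bas_left bas_right assms bas_W)
  then show "u \<star> w \<in> W p" "w \<star> u \<in> W p" using bas_expand[OF assms(1)] by simp_all
qed

lemma W_H: "w \<in> W p \<Longrightarrow> w \<in> H (nat p)"
proof -
  assume w: "w \<in> W p"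
  consider "p < 0 \<or> p > 2" | "p = 0" | "p = 1" | "p = 2" by linarith
  then show ?thesis
    using w W_neg[of p] W_gt2[of p] W_0 W_1 W_2 R_subset pm.subspace_0[OF subspace_H]
    by cases auto
qed

lemma W_PA: "w \<in> W p \<Longrightarrow> w \<in> carrier PA"
  using W_H H_subset by blast

lemma idem_mult_bas: "\<iota> \<in> Ix p \<Longrightarrow> idem i \<star> bas p \<iota> = (if i = tg \<iota> then bas p \<iota> else 0)"
  "\<iota> \<in> Ix p \<Longrightarrow> bas p \<iota> \<star> idem i = (if i = sc \<iota> then bas p \<iota> else 0)"
proof -
  assume \<iota>: "\<iota> \<in> Ix p"
  show "idem i \<star> bas p \<iota> = (if i = tg \<iota> then bas p \<iota> else 0)"
  proof (cases "i \<in> verts Q")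
    case True
    then show ?thesis using bas_left[OF \<iota> idem_H[OF True]] by (auto simp: idem_def lookup_single when_def)
  next
    case False
    \<comment> \<open>For \<open>i\<close> outside \<open>verts Q\<close> the element
      \<open>idem i\<close> does not lie in \<open>homog Q 0\<close>. Inserting the idempotent at
      the target reduces the claim to a product of two different idempotents.\<close>
    have "bas p \<iota> = idem (tg \<iota>) \<star> bas p \<iota>"
      using \<iota> Ix_verts[OF \<iota>] by (simp add: bas_left idem_H) (simp add: idem_def)
    then have "idem i \<star> bas p \<iota> = (idem i \<star> idem (tg \<iota>)) \<star> bas p \<iota>"
      by (simp add: path_mult_assoc)
    then show ?thesis using False Ix_verts[OF \<iota>] by (auto simp: idem_def)
  qed
  show "bas p \<iota> \<star> idem i = (if i = sc \<iota> then bas p \<iota> else 0)"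
  proof (cases "i \<in> verts Q")
    case True
    then show ?thesis using bas_right[OF \<iota> idem_H[OF True]] by (auto simp: idem_def lookup_single when_def)
  next
    case False
    have "bas p \<iota> = bas p \<iota> \<star> idem (sc \<iota>)"
      using \<iota> Ix_verts[OF \<iota>] by (simp add: bas_right idem_H) (simp add: idem_def)
    then have "bas p \<iota> \<star> idem i = bas p \<iota> \<star> (idem (sc \<iota>) \<star> idem i)"
      by (metis path_mult_assoc)
    then show ?thesis using False Ix_verts[OF \<iota>] by (auto simp: idem_def)
  qed
qed

lemma Wspace_simps [simp]: "carrier (Wspace Q p) = W p" "add (Wspace Q p) = (+)" "zero (Wspace Q p) = 0"
  "smult (Wspace Q p) = (pscale :: 'f \<Rightarrow> _)"
  by (simp_all add: Wspace_def path_alg_def)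

lemma vspace_W: "vspace (Wspace Q p :: ('f, ('f, 'v, 'e) path_elt) module)"
  using pm.subspace_add[OF subspace_W] pm.subspace_0[OF subspace_W] pm.subspace_scale[OF subspace_W]
  by (intro vspaceI) (simp_all add: add_ac pm.scale_left_distrib pm.scale_right_distrib)

lemma linear_eq_bas:
  assumes "linear_on (W p) V f" "linear_on (W p) V g" "\<And>\<iota>. \<iota> \<in> Ix p \<Longrightarrow> f (bas p \<iota>) = g (bas p \<iota>)" "w \<in> W p"
  shows "f w = g w"
proof -
  interpret V: vspace V using assms by (simp add: linear_on_def vspace_def)
  have b: "pscale (co p \<iota> w) (bas p \<iota>) \<in> W p" if "\<iota> \<in> Ix p" for \<iota>
    using that by (intro pm.subspace_scale[OF subspace_W] bas_W)
  have "f w = f (\<Sum>\<iota>\<in>Ix p. pscale (co p \<iota> w) (bas p \<iota>))" using bas_expand[OF assms(4)] by simp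
  also have "\<dots> = (\<Oplus>\<^bsub>V\<^esub>\<iota>\<in>Ix p. f (pscale (co p \<iota> w) (bas p \<iota>)))"
    using b by (intro linear_on_sum[OF assms(1)]) auto
  also have "\<dots> = (\<Oplus>\<^bsub>V\<^esub>\<iota>\<in>Ix p. g (pscale (co p \<iota> w) (bas p \<iota>)))"
    using b assms(3) linear_on_closed[OF assms(2)] bas_W
    by (intro V.finsum_cong') (auto simp: linear_on_pscale[OF assms(1)] linear_on_pscale[OF assms(2)])
  also have "\<dots> = g (\<Sum>\<iota>\<in>Ix p. pscale (co p \<iota> w) (bas p \<iota>))"
    using b by (intro linear_on_sum[OF assms(2), symmetric]) auto
  also have "\<dots> = g w" using bas_expand[OF assms(4)] by simp
  finally show ?thesis .
qed

subsection \<open>Splitting elements of \<open>W\<^sub>p\<^sub>+\<^sub>q\<close>\<close>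

text \<open>The coordinate of \<open>w\<close> at the tensor of two basis elements, read from the
  coefficient at the concatenated marked paths. It is defined for every \<open>w\<close> in the path
  algebra, whether or not \<open>w\<close> has been split.\<close>

definition split_coeff :: "int \<Rightarrow> int \<Rightarrow> 'v + 'e + 'e \<Rightarrow> 'v + 'e + 'e \<Rightarrow> ('f, 'v, 'e) path_elt \<Rightarrow> 'f" where
  "split_coeff p q \<iota> \<kappa> w = (if sc \<iota> = tg \<kappa> then mark_sign p \<iota> * mark_sign q \<kappa> else 0) *
     Poly_Mapping.lookup w (tg \<iota>, mark p \<iota> @ mark q \<kappa>, sc \<kappa>)"

text \<open>A linear map on the whole path algebra that is given by a formula free of choices and,
  by \<open>split_map_mult\<close>, agrees with \<open>\<phi>\<close> on products. Every computation
  with \<open>split_sum\<close> goes through it.\<close>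

definition split_map :: "('f, 'm, 'z) module_scheme \<Rightarrow> int \<Rightarrow> int \<Rightarrow>
    (('f, 'v, 'e) path_elt \<times> ('f, 'v, 'e) path_elt \<Rightarrow> 'm) \<Rightarrow> ('f, 'v, 'e) path_elt \<Rightarrow> 'm" where
  "split_map V p q \<phi> w = (\<Oplus>\<^bsub>V\<^esub>\<iota>\<in>Ix p. \<Oplus>\<^bsub>V\<^esub>\<kappa>\<in>Ix q. split_coeff p q \<iota> \<kappa> w \<odot>\<^bsub>V\<^esub> \<phi> (bas p \<iota>, bas q \<kappa>))"

abbreviation bal :: "int \<Rightarrow> int \<Rightarrow> ('f, 'm, 'z) module_scheme \<Rightarrow>
    (('f, 'v, 'e) path_elt \<times> ('f, 'v, 'e) path_elt \<Rightarrow> 'm) \<Rightarrow> bool" where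
  "bal p q V \<phi> \<equiv> balanced_map (Wspace Q p) (H 0) (\<star>) (Wspace Q q) (\<star>) V \<phi>"

text \<open>All paths in the support of \<open>u\<close> have length \<open>p\<close>, which fixes
  where the concatenated path is cut; the arrows of the left part then determine its source.\<close>

lemma split_coeff_mult:
  assumes "\<iota> \<in> Ix p" "\<kappa> \<in> Ix q" "u \<in> W p" "v \<in> W q" "sc \<iota> = tg \<kappa>"
  shows "split_coeff p q \<iota> \<kappa> (u \<star> v) = co p \<iota> u * co q \<kappa> v"
proof -
  have "Poly_Mapping.lookup (u \<star> v) (tg \<iota>, mark p \<iota> @ mark q \<kappa>, sc \<kappa>) =
      Poly_Mapping.lookup u (tg \<iota>, mark p \<iota>, sc \<iota>) * Poly_Mapping.lookup v (sc \<iota>, mark q \<kappa>, sc \<kappa>)"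
  proof (rule lookup_path_mult)
    fix xs' j' ys' assume k: "(tg \<iota>, xs', j') \<in> Poly_Mapping.keys u" and e: "xs' @ ys' = mark p \<iota> @ mark q \<kappa>"
    have p: "(tg \<iota>, xs', j') \<in> paths Q (nat p)" using k W_H[OF assms(3)] by (auto simp: homog_def)
    then have "length xs' = length (mark p \<iota>)" using length_mark[OF assms(1)] paths_length by metis
    then have "xs' = mark p \<iota>" using e by simp
    then show "xs' = mark p \<iota> \<and> j' = sc \<iota>" using p mark_path[OF assms(1)] paths_source_unique by blast
  qed
  then show ?thesis using assms(5) by (simp add: split_coeff_def co_def)
qed

lemma linear_on_split_map:
  assumes "bal p q V \<phi>"
  shows "linear_on UNIV V (split_map V p q \<phi>)"
  unfolding split_map_def split_coeff_def
  using balanced_mapD(1,2)[OF assms] bas_W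
  by (intro linear_on_finsum linear_on_lookup) (auto simp: pm.subspace_UNIV)

lemma bal_linear:
  assumes "bal p q V \<phi>"
  shows "v \<in> W q \<Longrightarrow> linear_on (W p) V (\<lambda>u. \<phi> (u, v))" "u \<in> W p \<Longrightarrow> linear_on (W q) V (\<lambda>v. \<phi> (u, v))"
  using balanced_mapD(1-6)[OF assms] by (auto simp: linear_on_def subspace_W)

lemma split_map_mult:
  assumes b: "bal p q V \<phi>" and "u \<in> W p" "v \<in> W q"
  shows "split_map V p q \<phi> (u \<star> v) = \<phi> (u, v)"
proof -
  interpret V: vspace V using balanced_mapD(1)[OF b] by (simp add: vspace_def)
  have cl: "\<phi> (x, y) \<in> carrier V" if "x \<in> W p" "y \<in> W q" for x y
    using balanced_mapD(2)[OF b] that by simp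
  have sc: "pscale c (bas p' \<iota>) \<in> W p'" if "\<iota> \<in> Ix p'" for c p' \<iota>
    using that by (intro pm.subspace_scale[OF subspace_W] bas_W)
  \<comment> \<open>Pairs of basis elements that cannot be composed do not appear in
    \<open>split_coeff\<close>. They contribute nothing either: moving the idempotent at the source
    across the tensor sign kills the second factor.\<close>
  have z: "\<phi> (bas p \<iota>, bas q \<kappa>) = \<zero>\<^bsub>V\<^esub>" if "\<iota> \<in> Ix p" "\<kappa> \<in> Ix q" "sc \<iota> \<noteq> tg \<kappa>" for \<iota> \<kappa>
  proof -
    have "\<phi> (bas p \<iota> \<star> idem (sc \<iota>), bas q \<kappa>) = \<phi> (bas p \<iota>, idem (sc \<iota>) \<star> bas q \<kappa>)"
      using that bas_W Ix_verts idem_H by (intro balanced_mapD(7)[OF b]) auto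
    then show ?thesis using that linear_on_zero[OF bal_linear(2)[OF b bas_W]] by (simp add: idem_mult_bas)
  qed
  have inner: "\<phi> (bas p \<iota>, v) = (\<Oplus>\<^bsub>V\<^esub>\<kappa>\<in>Ix q. co q \<kappa> v \<odot>\<^bsub>V\<^esub> \<phi> (bas p \<iota>, bas q \<kappa>))" if \<iota>: "\<iota> \<in> Ix p" for \<iota>
  proof -
    have "\<phi> (bas p \<iota>, v) = \<phi> (bas p \<iota>, \<Sum>\<kappa>\<in>Ix q. pscale (co q \<kappa> v) (bas q \<kappa>))"
      using bas_expand[OF assms(3)] by simp
    also have "\<dots> = (\<Oplus>\<^bsub>V\<^esub>\<kappa>\<in>Ix q. \<phi> (bas p \<iota>, pscale (co q \<kappa> v) (bas q \<kappa>)))"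
      using sc by (intro linear_on_sum[OF bal_linear(2)[OF b bas_W[OF \<iota>]]]) auto
    also have "\<dots> = (\<Oplus>\<^bsub>V\<^esub>\<kappa>\<in>Ix q. co q \<kappa> v \<odot>\<^bsub>V\<^esub> \<phi> (bas p \<iota>, bas q \<kappa>))"
      using cl bas_W \<iota> by (intro V.finsum_cong') (auto simp: linear_on_pscale[OF bal_linear(2)[OF b bas_W[OF \<iota>]]])
    finally show ?thesis .
  qed
  have "\<phi> (u, v) = \<phi> (\<Sum>\<iota>\<in>Ix p. pscale (co p \<iota> u) (bas p \<iota>), v)"
    using bas_expand[OF assms(2)] by simp
  also have "\<dots> = (\<Oplus>\<^bsub>V\<^esub>\<iota>\<in>Ix p. \<phi> (pscale (co p \<iota> u) (bas p \<iota>), v))"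
    using sc by (intro linear_on_sum[OF bal_linear(1)[OF b assms(3)]]) auto
  also have "\<dots> = (\<Oplus>\<^bsub>V\<^esub>\<iota>\<in>Ix p. \<Oplus>\<^bsub>V\<^esub>\<kappa>\<in>Ix q. split_coeff p q \<iota> \<kappa> (u \<star> v) \<odot>\<^bsub>V\<^esub> \<phi> (bas p \<iota>, bas q \<kappa>))"
  proof (rule V.finsum_cong')
    fix \<iota> assume \<iota>: "\<iota> \<in> Ix p"
    have "\<phi> (pscale (co p \<iota> u) (bas p \<iota>), v) = co p \<iota> u \<odot>\<^bsub>V\<^esub> (\<Oplus>\<^bsub>V\<^esub>\<kappa>\<in>Ix q. co q \<kappa> v \<odot>\<^bsub>V\<^esub> \<phi> (bas p \<iota>, bas q \<kappa>))"
      by (simp add: linear_on_pscale[OF bal_linear(1)[OF b assms(3)] bas_W[OF \<iota>]] inner[OF \<iota>])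
    also have "\<dots> = (\<Oplus>\<^bsub>V\<^esub>\<kappa>\<in>Ix q. co p \<iota> u \<odot>\<^bsub>V\<^esub> (co q \<kappa> v \<odot>\<^bsub>V\<^esub> \<phi> (bas p \<iota>, bas q \<kappa>)))"
      using cl bas_W \<iota> by (intro V.finsum_smult) auto
    also have "\<dots> = (\<Oplus>\<^bsub>V\<^esub>\<kappa>\<in>Ix q. split_coeff p q \<iota> \<kappa> (u \<star> v) \<odot>\<^bsub>V\<^esub> \<phi> (bas p \<iota>, bas q \<kappa>))"
    proof (rule V.finsum_cong')
      fix \<kappa> assume \<kappa>: "\<kappa> \<in> Ix q"
      show "co p \<iota> u \<odot>\<^bsub>V\<^esub> (co q \<kappa> v \<odot>\<^bsub>V\<^esub> \<phi> (bas p \<iota>, bas q \<kappa>)) = split_coeff p q \<iota> \<kappa> (u \<star> v) \<odot>\<^bsub>V\<^esub> \<phi> (bas p \<iota>, bas q \<kappa>)"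
      proof (cases "sc \<iota> = tg \<kappa>")
        case True
        then show ?thesis using cl bas_W \<iota> \<kappa> by (simp add: split_coeff_mult assms V.smult_smult)
      next
        case False
        then show ?thesis using z[OF \<iota> \<kappa>] by simp
      qed
    qed (use cl bas_W \<iota> in auto)
    finally show "\<phi> (pscale (co p \<iota> u) (bas p \<iota>), v) = (\<Oplus>\<^bsub>V\<^esub>\<kappa>\<in>Ix q. split_coeff p q \<iota> \<kappa> (u \<star> v) \<odot>\<^bsub>V\<^esub> \<phi> (bas p \<iota>, bas q \<kappa>))" .
  qed (use cl bas_W in auto)
  finally show ?thesis by (simp add: split_map_def)
qed

text \<open>Since \<open>split_map\<close> is linear and known on products, every way of writing
  \<open>w\<close> through products from \<open>W p\<close> and \<open>W q\<close> leads to the same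
  value. This applies to the given representation, which shows that the choice in
  \<open>split_sum\<close> is possible, and to the chosen one.\<close>

lemma split_sum_rep:
  assumes b: "bal p q V \<phi>" and "p \<ge> 0" "q \<ge> 0" and K: "finite K" "\<And>k. k \<in> K \<Longrightarrow> u k \<in> W p" "\<And>k. k \<in> K \<Longrightarrow> v k \<in> W q"
    and w: "w = (\<Sum>k\<in>K. pscale (c k) (u k \<star> v k))"
  shows "split_sum Q V p q \<phi> w = split_map V p q \<phi> w"
    "split_sum Q V p q \<phi> w = (\<Oplus>\<^bsub>V\<^esub>k\<in>K. c k \<odot>\<^bsub>V\<^esub> \<phi> (u k, v k))"
proof -
  interpret V: vspace V using balanced_mapD(1)[OF b] by (simp add: vspace_def)
  interpret Fr: vspace "free_space UNIV :: ('f, ('f, 'v, 'e) path_elt) module" by (rule vspace_free)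
  let ?Fr = "free_space UNIV :: ('f, ('f, 'v, 'e) path_elt) module"
  let ?G = "\<lambda>s. \<Sum>(u, v)\<in>Poly_Mapping.keys s. pscale (Poly_Mapping.lookup s (u, v)) (u \<star> v)"
  have cl: "\<phi> (x, y) \<in> carrier V" if "x \<in> W p" "y \<in> W q" for x y
    using balanced_mapD(2)[OF b] that by simp
  note lin = linear_on_split_map[OF b]
  have G: "?G s = lin_ext ?Fr (\<lambda>(u, v). u \<star> v) s" for s
    unfolding lin_ext_def by (subst finsum_free) (auto intro!: sum.cong split: prod.splits)
  have Glin: "linear_on {s. Poly_Mapping.keys s \<subseteq> UNIV} ?Fr (lin_ext ?Fr (\<lambda>(u, v). u \<star> v))"
    by (rule lin_ext_linear_on) (auto simp: Fr.vs)
  let ?P = "\<lambda>s. Poly_Mapping.keys s \<subseteq> W p \<times> W q \<and> ?G s = w"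
  have val: "lin_ext V \<phi> s = split_map V p q \<phi> w" if s: "?P s" for s
  proof -
    have "split_map V p q \<phi> w = split_map V p q \<phi> (\<Sum>k\<in>Poly_Mapping.keys s. pscale (Poly_Mapping.lookup s k) (fst k \<star> snd k))"
      using s by (simp add: case_prod_beta)
    also have "\<dots> = (\<Oplus>\<^bsub>V\<^esub>k\<in>Poly_Mapping.keys s. split_map V p q \<phi> (pscale (Poly_Mapping.lookup s k) (fst k \<star> snd k)))"
      by (rule linear_on_sum[OF lin]) auto
    also have "\<dots> = (\<Oplus>\<^bsub>V\<^esub>k\<in>Poly_Mapping.keys s. Poly_Mapping.lookup s k \<odot>\<^bsub>V\<^esub> \<phi> k)"
    proof (rule V.finsum_cong')
      fix k assume "k \<in> Poly_Mapping.keys s"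
      then have k: "fst k \<in> W p" "snd k \<in> W q" using s by auto
      show "split_map V p q \<phi> (pscale (Poly_Mapping.lookup s k) (fst k \<star> snd k)) = Poly_Mapping.lookup s k \<odot>\<^bsub>V\<^esub> \<phi> k"
        by (simp add: linear_on_pscale[OF lin] split_map_mult[OF b k])
    qed (use cl s in auto)
    finally show ?thesis by (simp add: lin_ext_def)
  qed
  have "?P (\<Sum>k\<in>K. Poly_Mapping.single (u k, v k) (c k))"
  proof
    show "Poly_Mapping.keys (\<Sum>k\<in>K. Poly_Mapping.single (u k, v k) (c k)) \<subseteq> W p \<times> W q"
      by (rule keys_sum_subset) (auto simp: K)
    have "?G (\<Sum>k\<in>K. Poly_Mapping.single (u k, v k) (c k)) = (\<Sum>k\<in>K. lin_ext ?Fr (\<lambda>(u, v). u \<star> v) (Poly_Mapping.single (u k, v k) (c k)))"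
      unfolding G by (subst linear_on_sum[OF Glin K(1)]) (auto simp: finsum_free K(1))
    also have "\<dots> = w" unfolding w by (intro sum.cong refl) (simp add: lin_ext_single[OF Fr.vs])
    finally show "?G (\<Sum>k\<in>K. Poly_Mapping.single (u k, v k) (c k)) = w" .
  qed
  then have "?P (SOME s. ?P s)" by (rule someI)
  then have "lin_ext V \<phi> (SOME s. ?P s) = split_map V p q \<phi> w" by (rule val)
  then show e: "split_sum Q V p q \<phi> w = split_map V p q \<phi> w"
    unfolding split_sum_def using assms(2,3) by simp
  have "split_map V p q \<phi> w = (\<Oplus>\<^bsub>V\<^esub>k\<in>K. split_map V p q \<phi> (pscale (c k) (u k \<star> v k)))"
    unfolding w by (rule linear_on_sum[OF lin K(1)]) auto
  also have "\<dots> = (\<Oplus>\<^bsub>V\<^esub>k\<in>K. c k \<odot>\<^bsub>V\<^esub> \<phi> (u k, v k))"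
    using cl K by (intro V.finsum_cong') (auto simp: linear_on_pscale[OF lin] split_map_mult[OF b])
  finally show "split_sum Q V p q \<phi> w = (\<Oplus>\<^bsub>V\<^esub>k\<in>K. c k \<odot>\<^bsub>V\<^esub> \<phi> (u k, v k))" using e by simp
qed

lemma unit_W: "unit \<in> W 0" by (simp add: W_0 unit_H)

lemma sigma_arrows: "\<sigma> i = (\<Sum>a\<in>{a \<in> arcs D. head D a = i}. pscale (arrow_sign a) (arrow a \<star> arrow (star a)))"
  unfolding preproj_sigma_def by (intro sum.cong) (auto simp: arrow_def)

lemma arrow_W: "a \<in> arcs D \<Longrightarrow> arrow a \<in> W 1"
  using W_1 arrow_H by simp

lemma split_sum_right_unit:
  assumes "bal p 0 V \<phi>" "p \<ge> 0" "w \<in> W p"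
  shows "split_sum Q V p 0 \<phi> w = \<phi> (w, unit)"
proof -
  interpret V: vspace V using balanced_mapD(1)[OF assms(1)] by (simp add: vspace_def)
  show ?thesis
    using split_sum_rep(2)[OF assms(1,2), of "{()}" "\<lambda>_. w" "\<lambda>_. unit" w "\<lambda>_. 1"] assms(3) unit_W
      balanced_mapD(2)[OF assms(1), of w unit] W_PA[OF assms(3)]
    by (simp add: unit_right)
qed

lemma split_sum_left_unit:
  assumes "bal 0 p V \<phi>" "p \<ge> 0" "w \<in> W p"
  shows "split_sum Q V 0 p \<phi> w = \<phi> (unit, w)"
proof -
  interpret V: vspace V using balanced_mapD(1)[OF assms(1)] by (simp add: vspace_def)
  show ?thesis
    using split_sum_rep(2)[OF assms(1) _ assms(2), of "{()}" "\<lambda>_. unit" "\<lambda>_. w" w "\<lambda>_. 1"] assms(3) unit_W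
      balanced_mapD(2)[OF assms(1), of unit w] W_PA[OF assms(3)]
    by (simp add: unit_left)
qed

lemma split_sum_sigma:
  assumes "bal 1 1 V \<phi>"
  shows "split_sum Q V 1 1 \<phi> (\<sigma> i) = (\<Oplus>\<^bsub>V\<^esub>a\<in>{a \<in> arcs D. head D a = i}. arrow_sign a \<odot>\<^bsub>V\<^esub> \<phi> (arrow a, arrow (star a)))"
  by (rule split_sum_rep(2)[OF assms]) (auto simp: sigma_arrows arrow_W)

text \<open>It suffices that every element of \<open>W (p + q)\<close> can be split. One uses the
  unit if a degree is 0, the expression of \<open>\<sigma> i\<close> through arrows in degrees (1,
  1), and \<open>W_gt2\<close> otherwise. For a negative degree \<open>split_sum\<close> is zero by
  convention.\<close>

lemma linear_on_split_sum:
  assumes b: "bal p q V \<phi>"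
  shows "linear_on (W (p + q)) V (split_sum Q V p q \<phi>)"
proof -
  interpret V: vspace V using balanced_mapD(1)[OF b] by (simp add: vspace_def)
  show ?thesis
  proof (cases "p < 0 \<or> q < 0")
    case True
    then have "split_sum Q V p q \<phi> = (\<lambda>w. \<zero>\<^bsub>V\<^esub>)" by (auto simp: split_sum_def)
    then show ?thesis using V.vs by (simp add: linear_on_def subspace_W)
  next
    case False
    have "split_sum Q V p q \<phi> w = split_map V p q \<phi> w" if w: "w \<in> W (p + q)" for w
    proof -
      consider "p = 0" | "q = 0" | "p = 1 \<and> q = 1" | "p + q > 2" using False by linarith
      then show ?thesis
      proof cases
        case 1
        then show ?thesis using split_sum_rep(1)[OF b, of "{()}" "\<lambda>_. unit" "\<lambda>_. w" w "\<lambda>_. 1"] False w unit_W W_PA[OF w]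
          by (simp add: unit_left)
      next
        case 2
        then show ?thesis using split_sum_rep(1)[OF b, of "{()}" "\<lambda>_. w" "\<lambda>_. unit" w "\<lambda>_. 1"] False w unit_W W_PA[OF w]
          by (simp add: unit_right)
      next
        case 3
        have w2: "w \<in> W 2" using w 3 by simp
        have "w = (\<Sum>i\<in>verts Q. pscale (co 2 (Inl i) w) (\<sigma> i))"
          by (subst bas_expand[OF w2]) (simp add: Ix_def sum.reindex bas_def)
        also have "\<dots> = (\<Sum>i\<in>verts Q. \<Sum>a\<in>{a \<in> arcs D. head D a = i}. pscale (co 2 (Inl (head D a)) w * arrow_sign a) (arrow a \<star> arrow (star a)))"
          unfolding sigma_arrows pm.scale_sum_right by (intro sum.cong) auto
        also have "\<dots> = (\<Sum>a\<in>arcs D. pscale (co 2 (Inl (head D a)) w * arrow_sign a) (arrow a \<star> arrow (star a)))"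
          by (rule sum.group) auto
        finally show ?thesis
          using 3 by (intro split_sum_rep(1)[OF b, of "arcs D" arrow "\<lambda>a. arrow (star a)"]) (auto simp: arrow_W[simplified])
      next
        case 4
        then have "w = 0" using w W_gt2 by auto
        then show ?thesis using split_sum_rep(1)[OF b, of "{}"] False by simp
      qed
    qed
    moreover have "linear_on (W (p + q)) V (split_map V p q \<phi>)"
      by (rule linear_on_subset[OF linear_on_split_map[OF b]]) (auto simp: subspace_W)
    ultimately show ?thesis unfolding linear_on_def
      using pm.subspace_add[OF subspace_W[of "p + q"]] pm.subspace_scale[OF subspace_W[of "p + q"]]
      by (simp add: Pi_iff)
  qed
qed

lemma split_sum_zero:
  assumes "bal p q V \<phi>" shows "split_sum Q V p q \<phi> 0 = \<zero>\<^bsub>V\<^esub>"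
  using linear_on_zero[OF linear_on_split_sum[OF assms]] .

end

lemma linear_on_compose_add:
  assumes "linear_on U V f" "linear_on U V g"
  shows "linear_on U V (\<lambda>x. f x \<oplus>\<^bsub>V\<^esub> g x)"
proof -
  interpret V: vspace V using assms by (simp add: linear_on_def vspace_def)
  show ?thesis unfolding linear_on_def
    using assms(1)[unfolded linear_on_def] linear_on_closed[OF assms(1)] linear_on_closed[OF assms(2)]
    by (simp add: linear_on_add[OF assms(1)] linear_on_add[OF assms(2)] linear_on_pscale[OF assms(1)] linear_on_pscale[OF assms(2)]
        V.smult_distr_right V.a_ac)
qed

lemma linear_on_compose_smult:
  assumes "linear_on U V f"
  shows "linear_on U V (\<lambda>x. c \<odot>\<^bsub>V\<^esub> f x)"
proof -
  interpret V: vspace V using assms by (simp add: linear_on_def vspace_def)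
  show ?thesis unfolding linear_on_def
    using assms(1)[unfolded linear_on_def] linear_on_closed[OF assms(1)]
    by (simp add: linear_on_add[OF assms(1)] linear_on_pscale[OF assms(1)] V.smult_distr_right V.smult_smult mult.commute)
qed

lemma linear_on_compose_mult:
  assumes "linear_on UNIV V f"
  shows "linear_on UNIV V (\<lambda>x. f (x \<star> b))" "linear_on UNIV V (\<lambda>x. f (b \<star> x))"
  using assms by (simp_all add: linear_on_def path_mult_add_left path_mult_pscale_left path_mult_add_right path_mult_pscale_right Pi_iff)

lemma linear_on_zero_map: "is_vector_space V \<Longrightarrow> pm.subspace U \<Longrightarrow> linear_on U V (\<lambda>x. \<zero>\<^bsub>V\<^esub>)"
proof -
  assume "is_vector_space V" "pm.subspace U"
  then interpret V: vspace V by (simp add: vspace_def)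
  show ?thesis using \<open>pm.subspace U\<close> V.vs by (simp add: linear_on_def)
qed

context koszul_quiver
begin

text \<open>On \<open>W (p + q)\<close>, \<open>split_sum\<close> equals any linear map of the path
  algebra that restricts to \<open>\<phi>\<close> on products. Identities between values of
  \<open>split_sum\<close> thereby reduce to identities between values of
  \<open>\<phi>\<close>.\<close>

lemma split_ext:
  assumes b: "bal p q V \<phi>" and g: "linear_on UNIV V g" "\<And>u v. u \<in> W p \<Longrightarrow> v \<in> W q \<Longrightarrow> g (u \<star> v) = \<phi> (u, v)"
    and w: "w \<in> W (p + q)" and "p \<ge> 0" "q \<ge> 0"
  shows "split_sum Q V p q \<phi> w = g w"
proof -
  interpret V: vspace V using balanced_mapD(1)[OF b] by (simp add: vspace_def)
  have fin: "split_sum Q V p q \<phi> w = g w"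
    if K: "finite K" "\<And>k. k \<in> K \<Longrightarrow> u k \<in> W p" "\<And>k. k \<in> K \<Longrightarrow> v k \<in> W q"
      and w: "w = (\<Sum>k\<in>K. pscale (c k) (u k \<star> v k))" for K :: "('v + 'e + 'e) set" and u v c
  proof -
    have "g w = (\<Oplus>\<^bsub>V\<^esub>k\<in>K. g (pscale (c k) (u k \<star> v k)))"
      unfolding w by (rule linear_on_sum[OF g(1) K(1)]) auto
    also have "\<dots> = (\<Oplus>\<^bsub>V\<^esub>k\<in>K. c k \<odot>\<^bsub>V\<^esub> \<phi> (u k, v k))"
      using K balanced_mapD(2)[OF b] by (intro V.finsum_cong') (auto simp: linear_on_pscale[OF g(1)] g(2))
    also have "\<dots> = split_sum Q V p q \<phi> w"
      by (rule split_sum_rep(2)[OF b assms(5,6) that, symmetric])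
    finally show ?thesis by simp
  qed
  consider "p = 0" | "q = 0" | "p = 1 \<and> q = 1" | "p + q > 2" using assms(5,6) by linarith
  then show ?thesis
  proof cases
    case 1
    \<comment> \<open>\<open>{Inl undefined}\<close> merely serves as a one-element index set of the
      type on which \<open>fin\<close> is stated.\<close>
    then show ?thesis using fin[of "{Inl undefined}" "\<lambda>_. unit" "\<lambda>_. w" "\<lambda>_. 1"] w unit_W W_PA[OF w]
      by (simp add: unit_left)
  next
    case 2
    then show ?thesis using fin[of "{Inl undefined}" "\<lambda>_. w" "\<lambda>_. unit" "\<lambda>_. 1"] w unit_W W_PA[OF w]
      by (simp add: unit_right)
  next
    case 3
    have w2: "w \<in> W 2" using w 3 by simp
    have "w = (\<Sum>i\<in>verts Q. pscale (co 2 (Inl i) w) (\<sigma> i))"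
      by (subst bas_expand[OF w2]) (simp add: Ix_def sum.reindex bas_def)
    also have "\<dots> = (\<Sum>i\<in>verts Q. \<Sum>a\<in>{a \<in> arcs D. head D a = i}. pscale (co 2 (Inl (head D a)) w * arrow_sign a) (arrow a \<star> arrow (star a)))"
      unfolding sigma_arrows pm.scale_sum_right by (intro sum.cong) auto
    also have "\<dots> = (\<Sum>a\<in>arcs D. pscale (co 2 (Inl (head D a)) w * arrow_sign a) (arrow a \<star> arrow (star a)))"
      by (rule sum.group) auto
    also have "\<dots> = (\<Sum>k\<in>Inr ` arcs D. pscale (co 2 (Inl (head D (projr k))) w * arrow_sign (projr k)) (arrow (projr k) \<star> arrow (star (projr k))))"
      by (simp add: sum.reindex)
    finally show ?thesis
      using 3 by (intro fin[of "Inr ` arcs D"]) (auto simp: arrow_W[simplified])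
  next
    case 4
    then have "w = 0" using w W_gt2 by auto
    then show ?thesis using fin[of "{}"] by simp
  qed
qed

lemma split_sum_add:
  assumes "bal p q V \<phi>" "bal p q V \<phi>'" "bal p q V \<psi>" "w \<in> W (p + q)"
    and "\<And>u v. u \<in> W p \<Longrightarrow> v \<in> W q \<Longrightarrow> \<psi> (u, v) = \<phi> (u, v) \<oplus>\<^bsub>V\<^esub> \<phi>' (u, v)"
  shows "split_sum Q V p q \<psi> w = split_sum Q V p q \<phi> w \<oplus>\<^bsub>V\<^esub> split_sum Q V p q \<phi>' w"
proof -
  interpret V: vspace V using balanced_mapD(1)[OF assms(1)] by (simp add: vspace_def)
  show ?thesis
  proof (cases "p < 0 \<or> q < 0")
    case True
    then show ?thesis by (auto simp: split_sum_def)
  next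
    case False
    then have pq: "p \<ge> 0" "q \<ge> 0" by auto
    have "split_sum Q V p q \<psi> w = split_map V p q \<phi> w \<oplus>\<^bsub>V\<^esub> split_map V p q \<phi>' w"
      by (rule split_ext[OF assms(3) linear_on_compose_add[OF linear_on_split_map[OF assms(1)] linear_on_split_map[OF assms(2)]] _ assms(4) pq])
        (simp add: split_map_mult[OF assms(1)] split_map_mult[OF assms(2)] assms(5))
    also have "split_map V p q \<phi> w = split_sum Q V p q \<phi> w"
      by (rule split_ext[OF assms(1) linear_on_split_map[OF assms(1)] _ assms(4) pq, symmetric])
        (simp add: split_map_mult[OF assms(1)])
    also have "split_map V p q \<phi>' w = split_sum Q V p q \<phi>' w"
      by (rule split_ext[OF assms(2) linear_on_split_map[OF assms(2)] _ assms(4) pq, symmetric])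
        (simp add: split_map_mult[OF assms(2)])
    finally show ?thesis .
  qed
qed

lemma split_sum_smult:
  assumes "bal p q V \<phi>" "bal p q V \<psi>" "w \<in> W (p + q)"
    and "\<And>u v. u \<in> W p \<Longrightarrow> v \<in> W q \<Longrightarrow> \<psi> (u, v) = c \<odot>\<^bsub>V\<^esub> \<phi> (u, v)"
  shows "split_sum Q V p q \<psi> w = c \<odot>\<^bsub>V\<^esub> split_sum Q V p q \<phi> w"
proof -
  interpret V: vspace V using balanced_mapD(1)[OF assms(1)] by (simp add: vspace_def)
  show ?thesis
  proof (cases "p < 0 \<or> q < 0")
    case True
    then show ?thesis by (auto simp: split_sum_def)
  next
    case False
    then have pq: "p \<ge> 0" "q \<ge> 0" by auto
    have "split_sum Q V p q \<psi> w = c \<odot>\<^bsub>V\<^esub> split_map V p q \<phi> w"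
      by (rule split_ext[OF assms(2) linear_on_compose_smult[OF linear_on_split_map[OF assms(1)]] _ assms(3) pq])
        (simp add: split_map_mult[OF assms(1)] assms(4))
    also have "split_map V p q \<phi> w = split_sum Q V p q \<phi> w"
      by (rule split_ext[OF assms(1) linear_on_split_map[OF assms(1)] _ assms(3) pq, symmetric])
        (simp add: split_map_mult[OF assms(1)])
    finally show ?thesis .
  qed
qed

text \<open>The linear map \<open>w \<mapsto> split_map V p q \<phi> (w \<star> b)\<close> extends
  \<open>\<psi>\<close>, because multiplication by \<open>b\<close> affects only the second factor
  of a product.\<close>

lemma split_sum_mult_right:
  assumes "bal p q V \<phi>" "bal p q V \<psi>" "w \<in> W (p + q)" "b \<in> H 0"
    and "\<And>u v. u \<in> W p \<Longrightarrow> v \<in> W q \<Longrightarrow> \<psi> (u, v) = \<phi> (u, v \<star> b)"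
  shows "split_sum Q V p q \<psi> w = split_sum Q V p q \<phi> (w \<star> b)"
proof (cases "p < 0 \<or> q < 0")
  case True
  then show ?thesis by (auto simp: split_sum_def)
next
  case False
  then have pq: "p \<ge> 0" "q \<ge> 0" by auto
  have "split_sum Q V p q \<psi> w = split_map V p q \<phi> (w \<star> b)"
    by (rule split_ext[OF assms(2) linear_on_compose_mult(1)[OF linear_on_split_map[OF assms(1)]] _ assms(3) pq])
      (simp add: path_mult_assoc split_map_mult[OF assms(1)] assms(4,5) W_H0_closed)
  also have "\<dots> = split_sum Q V p q \<phi> (w \<star> b)"
    by (rule split_ext[OF assms(1) linear_on_split_map[OF assms(1)] _ _ pq, symmetric])
      (simp_all add: split_map_mult[OF assms(1)] W_H0_closed assms)
  finally show ?thesis .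
qed

lemma split_sum_mult_left:
  assumes "bal p q V \<phi>" "bal p q V \<psi>" "w \<in> W (p + q)" "a \<in> H 0"
    and "\<And>u v. u \<in> W p \<Longrightarrow> v \<in> W q \<Longrightarrow> \<psi> (u, v) = \<phi> (a \<star> u, v)"
  shows "split_sum Q V p q \<psi> w = split_sum Q V p q \<phi> (a \<star> w)"
proof (cases "p < 0 \<or> q < 0")
  case True
  then show ?thesis by (auto simp: split_sum_def)
next
  case False
  then have pq: "p \<ge> 0" "q \<ge> 0" by auto
  have "split_sum Q V p q \<psi> w = split_map V p q \<phi> (a \<star> w)"
    by (rule split_ext[OF assms(2) linear_on_compose_mult(2)[OF linear_on_split_map[OF assms(1)]] _ assms(3) pq])
      (simp add: path_mult_assoc[symmetric] split_map_mult[OF assms(1)] assms(4,5) W_H0_closed)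
  also have "\<dots> = split_sum Q V p q \<phi> (a \<star> w)"
    by (rule split_ext[OF assms(1) linear_on_split_map[OF assms(1)] _ _ pq, symmetric])
      (simp_all add: split_map_mult[OF assms(1)] W_H0_closed assms)
  finally show ?thesis .
qed

end

locale koszul_bimodule = koszul_quiver Q F for Q :: "('v, 'e) pre_digraph" and F :: "'f::field itself" +
  fixes M :: "('f, 'v, 'e, 'm) preproj_bimod"
  assumes bimodule: "is_bimodule (preproj Q) M"
begin

subsection \<open>Cochains\<close>

lemma vspace_M: "vspace M"
  using bimodule by (simp add: is_bimodule_def vspace_def)

sublocale M: vspace M by (rule vspace_M)

lemma lact_closed [simp]: "a \<in> carrier A \<Longrightarrow> m \<in> carrier M \<Longrightarrow> lact M a m \<in> carrier M"
  and ract_closed [simp]: "a \<in> carrier A \<Longrightarrow> m \<in> carrier M \<Longrightarrow> ract M m a \<in> carrier M"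
  and lact_add: "a \<in> carrier A \<Longrightarrow> m \<in> carrier M \<Longrightarrow> n \<in> carrier M \<Longrightarrow> lact M a (m \<oplus>\<^bsub>M\<^esub> n) = lact M a m \<oplus>\<^bsub>M\<^esub> lact M a n"
  and ract_add: "a \<in> carrier A \<Longrightarrow> m \<in> carrier M \<Longrightarrow> n \<in> carrier M \<Longrightarrow> ract M (m \<oplus>\<^bsub>M\<^esub> n) a = ract M m a \<oplus>\<^bsub>M\<^esub> ract M n a"
  and lact_add_scalar: "a \<in> carrier A \<Longrightarrow> b \<in> carrier A \<Longrightarrow> m \<in> carrier M \<Longrightarrow> lact M (a \<oplus>\<^bsub>A\<^esub> b) m = lact M a m \<oplus>\<^bsub>M\<^esub> lact M b m"
  and ract_add_scalar: "a \<in> carrier A \<Longrightarrow> b \<in> carrier A \<Longrightarrow> m \<in> carrier M \<Longrightarrow> ract M m (a \<oplus>\<^bsub>A\<^esub> b) = ract M m a \<oplus>\<^bsub>M\<^esub> ract M m b"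
  and lact_mult: "a \<in> carrier A \<Longrightarrow> b \<in> carrier A \<Longrightarrow> m \<in> carrier M \<Longrightarrow> lact M (a \<otimes>\<^bsub>A\<^esub> b) m = lact M a (lact M b m)"
  and ract_mult: "a \<in> carrier A \<Longrightarrow> b \<in> carrier A \<Longrightarrow> m \<in> carrier M \<Longrightarrow> ract M m (a \<otimes>\<^bsub>A\<^esub> b) = ract M (ract M m a) b"
  and ract_lact: "a \<in> carrier A \<Longrightarrow> b \<in> carrier A \<Longrightarrow> m \<in> carrier M \<Longrightarrow> ract M (lact M a m) b = lact M a (ract M m b)"
  and lact_one: "m \<in> carrier M \<Longrightarrow> lact M \<one>\<^bsub>A\<^esub> m = m" and ract_one: "m \<in> carrier M \<Longrightarrow> ract M m \<one>\<^bsub>A\<^esub> = m"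
  and lact_smult_scalar: "a \<in> carrier A \<Longrightarrow> m \<in> carrier M \<Longrightarrow> lact M (c \<odot>\<^bsub>A\<^esub> a) m = c \<odot>\<^bsub>M\<^esub> lact M a m"
  and ract_smult_scalar: "a \<in> carrier A \<Longrightarrow> m \<in> carrier M \<Longrightarrow> ract M m (c \<odot>\<^bsub>A\<^esub> a) = c \<odot>\<^bsub>M\<^esub> ract M m a"
  using bimodule by (simp_all add: is_bimodule_def)

lemma one_A [simp]: "\<one>\<^bsub>A\<^esub> \<in> carrier A"
  unfolding rc_unit[symmetric] using unit_PA by simp

text \<open>\<open>is_bimodule\<close> states compatibility with scalars in the algebra argument. A
  scalar on the module side is turned into the action of the corresponding multiple of the unit of
  \<open>A\<close>.\<close>

lemma lact_smult:
  assumes "a \<in> carrier A" "m \<in> carrier M"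
  shows "lact M a (c \<odot>\<^bsub>M\<^esub> m) = c \<odot>\<^bsub>M\<^esub> lact M a m"
proof -
  interpret m: monoid A by (rule ring_A)
  have "lact M a (c \<odot>\<^bsub>M\<^esub> m) = lact M (a \<otimes>\<^bsub>A\<^esub> (c \<odot>\<^bsub>A\<^esub> \<one>\<^bsub>A\<^esub>)) m"
    using assms by (simp add: lact_mult lact_smult_scalar lact_one)
  also have "a \<otimes>\<^bsub>A\<^esub> (c \<odot>\<^bsub>A\<^esub> \<one>\<^bsub>A\<^esub>) = c \<odot>\<^bsub>A\<^esub> a" using assms by (simp add: A_smult_mult)
  finally show ?thesis using assms by (simp add: lact_smult_scalar)
qed

lemma ract_smult:
  assumes "a \<in> carrier A" "m \<in> carrier M"
  shows "ract M (c \<odot>\<^bsub>M\<^esub> m) a = c \<odot>\<^bsub>M\<^esub> ract M m a"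
proof -
  interpret m: monoid A by (rule ring_A)
  have "ract M (c \<odot>\<^bsub>M\<^esub> m) a = ract M m ((c \<odot>\<^bsub>A\<^esub> \<one>\<^bsub>A\<^esub>) \<otimes>\<^bsub>A\<^esub> a)"
    using assms by (simp add: ract_mult ract_smult_scalar ract_one)
  also have "(c \<odot>\<^bsub>A\<^esub> \<one>\<^bsub>A\<^esub>) \<otimes>\<^bsub>A\<^esub> a = c \<odot>\<^bsub>A\<^esub> a" using assms by (simp add: A_smult_mult)
  finally show ?thesis using assms by (simp add: ract_smult_scalar)
qed

lemma rc_H0 [simp]: "a \<in> H 0 \<Longrightarrow> rc a \<in> carrier A"
  by (rule rc_closed) (rule subsetD[OF H_subset])

text \<open>\<open>k\<close>-bilinear maps without the extensionality condition of
  \<open>cochains\<close>, so that plain lambda terms qualify and \<open>restrict\<close> is applied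
  only at the end.\<close>

definition coch :: "int \<Rightarrow> (('f, 'v, 'e) path_elt \<Rightarrow> 'm) \<Rightarrow> bool" where
  "coch p f \<longleftrightarrow> linear_on (W p) M f \<and>
     (\<forall>a\<in>H 0. \<forall>w\<in>W p. f (a \<star> w) = lact M (rc a) (f w) \<and> f (w \<star> a) = ract M (f w) (rc a))"

lemma coch_linear: "coch p f \<Longrightarrow> linear_on (W p) M f"
  and coch_left: "coch p f \<Longrightarrow> a \<in> H 0 \<Longrightarrow> w \<in> W p \<Longrightarrow> f (a \<star> w) = lact M (rc a) (f w)"
  and coch_right: "coch p f \<Longrightarrow> a \<in> H 0 \<Longrightarrow> w \<in> W p \<Longrightarrow> f (w \<star> a) = ract M (f w) (rc a)"
  by (auto simp: coch_def)

lemma coch_closed [simp]: "coch p f \<Longrightarrow> w \<in> W p \<Longrightarrow> f w \<in> carrier M"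
  using coch_linear linear_on_closed by blast

lemma coch_bas_left: "coch p f \<Longrightarrow> \<iota> \<in> Ix p \<Longrightarrow> lact M (rc (idem (tg \<iota>))) (f (bas p \<iota>)) = f (bas p \<iota>)"
  using coch_left[of p f "idem (tg \<iota>)" "bas p \<iota>"] Ix_verts idem_H by (auto simp: idem_mult_bas bas_W)

lemma coch_bas_right: "coch p f \<Longrightarrow> \<iota> \<in> Ix p \<Longrightarrow> ract M (f (bas p \<iota>)) (rc (idem (sc \<iota>))) = f (bas p \<iota>)"
  using coch_right[of p f "idem (sc \<iota>)" "bas p \<iota>"] Ix_verts idem_H by (auto simp: idem_mult_bas bas_W)

text \<open>The action of elementary tensors splits into a left and a right part by inserting the
  unit for the other factor.\<close>

lemma cochains_iff: "f \<in> carrier (cochains Q M p) \<longleftrightarrow> coch p f \<and> f \<in> extensional (W p)"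
proof
  assume f: "f \<in> carrier (cochains Q M p)"
  then have e: "f \<in> extensional (W p)" and c: "\<And>w. w \<in> W p \<Longrightarrow> f w \<in> carrier M"
    and l: "linear_on (W p) M f"
    by (auto simp: cochains_def hom_space_def linear_on_def subspace_W M.vs PiE_def)
  have s: "f (a \<star> w \<star> b) = ract M (lact M (rc a) (f w)) (rc b)" if "a \<in> H 0" "b \<in> H 0" "w \<in> W p" for a b w
    using f that by (auto simp: cochains_def hom_space_def ke_W_def Ae_left_def)
  have "f (a \<star> w) = lact M (rc a) (f w) \<and> f (w \<star> a) = ract M (f w) (rc a)" if "a \<in> H 0" "w \<in> W p" for a w
    using s[OF that(1) unit_H that(2)] s[OF unit_H that(1,2)] that c[OF that(2)] W_PA[OF that(2)] W_PA[OF W_H0_closed(1)[OF that(2,1)]]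
    by (simp add: rc_unit unit_right unit_left lact_one ract_one)
  then show "coch p f \<and> f \<in> extensional (W p)" using l e by (simp add: coch_def)
next
  assume "coch p f \<and> f \<in> extensional (W p)"
  then have f: "coch p f" and e: "f \<in> extensional (W p)" by auto
  show "f \<in> carrier (cochains Q M p)"
    unfolding cochains_def hom_space_def
    using e coch_closed[OF f] coch_left[OF f] coch_right[OF f] linear_on_add[OF coch_linear[OF f]]
      linear_on_pscale[OF coch_linear[OF f]] W_H0_closed
    by (auto simp: PiE_def ke_W_def Ae_left_def)
qed

lemma coch_restrict: "coch p f \<Longrightarrow> restrict f (W p) \<in> carrier (cochains Q M p)"
  using pm.subspace_add[OF subspace_W[of p]] pm.subspace_scale[OF subspace_W[of p]]
  by (auto simp: cochains_iff coch_def linear_on_def W_H0_closed)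

lemma cochains_simps:
  "add (cochains Q M p) = (\<lambda>f g. \<lambda>w\<in>W p. f w \<oplus>\<^bsub>M\<^esub> g w)"
  "smult (cochains Q M p) = (\<lambda>c f. \<lambda>w\<in>W p. c \<odot>\<^bsub>M\<^esub> f w)"
  "zero (cochains Q M p) = (\<lambda>w\<in>W p. \<zero>\<^bsub>M\<^esub>)"
  by (simp_all add: cochains_def hom_space_def)

lemma coch_add: "coch p f \<Longrightarrow> coch p g \<Longrightarrow> coch p (\<lambda>w. f w \<oplus>\<^bsub>M\<^esub> g w)"
  by (simp add: coch_def linear_on_compose_add linear_on_closed[of "W p" M] lact_add ract_add)

lemma coch_smult: "coch p f \<Longrightarrow> coch p (\<lambda>w. c \<odot>\<^bsub>M\<^esub> f w)"
  by (simp add: coch_def linear_on_compose_smult linear_on_closed[of "W p" M] lact_smult ract_smult)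

lemma coch_zero: "coch p (\<lambda>w. \<zero>\<^bsub>M\<^esub>)"
  unfolding coch_def
  using lact_smult[of _ "\<zero>\<^bsub>M\<^esub>" 0] ract_smult[of _ "\<zero>\<^bsub>M\<^esub>" 0]
  by (auto simp: linear_on_zero_map M.vs subspace_W)

lemma vspace_cochains: "vspace (cochains Q M p)"
proof (rule vspaceI, unfold cochains_simps)
  fix x y assume x: "x \<in> carrier (cochains Q M p)" and y: "y \<in> carrier (cochains Q M p)"
  then have cx: "coch p x" and cy: "coch p y" and ex: "x \<in> extensional (W p)" "y \<in> extensional (W p)" by (auto simp: cochains_iff)
  note c = coch_closed[OF cx] coch_closed[OF cy]
  show "(\<lambda>w\<in>W p. x w \<oplus>\<^bsub>M\<^esub> y w) \<in> carrier (cochains Q M p)" by (rule coch_restrict[OF coch_add[OF cx cy]])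
  show "(\<lambda>w\<in>W p. x w \<oplus>\<^bsub>M\<^esub> y w) = (\<lambda>w\<in>W p. y w \<oplus>\<^bsub>M\<^esub> x w)" using c by (auto simp: M.a_comm)
  show "(\<lambda>w\<in>W p. b \<odot>\<^bsub>M\<^esub> (\<lambda>w\<in>W p. x w \<oplus>\<^bsub>M\<^esub> y w) w) = (\<lambda>w\<in>W p. (\<lambda>w\<in>W p. b \<odot>\<^bsub>M\<^esub> x w) w \<oplus>\<^bsub>M\<^esub> (\<lambda>w\<in>W p. b \<odot>\<^bsub>M\<^esub> y w) w)" for b
    using c by (auto simp: M.smult_distr_right)
next
  fix x y z assume "x \<in> carrier (cochains Q M p)" "y \<in> carrier (cochains Q M p)" "z \<in> carrier (cochains Q M p)"
  then have "coch p x" "coch p y" "coch p z" by (auto simp: cochains_iff)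
  then show "(\<lambda>w\<in>W p. (\<lambda>w\<in>W p. x w \<oplus>\<^bsub>M\<^esub> y w) w \<oplus>\<^bsub>M\<^esub> z w) = (\<lambda>w\<in>W p. x w \<oplus>\<^bsub>M\<^esub> (\<lambda>w\<in>W p. y w \<oplus>\<^bsub>M\<^esub> z w) w)"
    by (auto simp: M.a_assoc)
next
  fix x assume x: "x \<in> carrier (cochains Q M p)"
  then have cx: "coch p x" and ex: "x \<in> extensional (W p)" by (auto simp: cochains_iff)
  note c = coch_closed[OF cx]
  show "(\<lambda>w\<in>W p. (\<lambda>w\<in>W p. \<zero>\<^bsub>M\<^esub>) w \<oplus>\<^bsub>M\<^esub> x w) = x" using c ex by (auto simp: fun_eq_iff extensional_def)
  show "(\<lambda>w\<in>W p. b \<odot>\<^bsub>M\<^esub> x w) \<in> carrier (cochains Q M p)" for b by (rule coch_restrict[OF coch_smult[OF cx]])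
  show "(\<lambda>w\<in>W p. (\<lambda>w\<in>W p. - 1 \<odot>\<^bsub>M\<^esub> x w) w \<oplus>\<^bsub>M\<^esub> x w) = (\<lambda>w\<in>W p. \<zero>\<^bsub>M\<^esub>)"
    using c by (auto simp: M.smult_m1 M.l_neg)
  show "(\<lambda>w\<in>W p. (a + b) \<odot>\<^bsub>M\<^esub> x w) = (\<lambda>w\<in>W p. (\<lambda>w\<in>W p. a \<odot>\<^bsub>M\<^esub> x w) w \<oplus>\<^bsub>M\<^esub> (\<lambda>w\<in>W p. b \<odot>\<^bsub>M\<^esub> x w) w)" for a b
    using c by (auto simp: M.smult_distr_left)
  show "(\<lambda>w\<in>W p. (a * b) \<odot>\<^bsub>M\<^esub> x w) = (\<lambda>w\<in>W p. a \<odot>\<^bsub>M\<^esub> (\<lambda>w\<in>W p. b \<odot>\<^bsub>M\<^esub> x w) w)" for a b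
    using c by (auto simp: M.smult_smult)
  show "(\<lambda>w\<in>W p. 1 \<odot>\<^bsub>M\<^esub> x w) = x" using c ex by (auto simp: fun_eq_iff extensional_def)
next
  show "(\<lambda>w\<in>W p. \<zero>\<^bsub>M\<^esub>) \<in> carrier (cochains Q M p)" by (rule coch_restrict[OF coch_zero])
qed

lemma cochains_eqI:
  assumes "f \<in> carrier (cochains Q M p)" "g \<in> carrier (cochains Q M p)" "\<And>\<iota>. \<iota> \<in> Ix p \<Longrightarrow> f (bas p \<iota>) = g (bas p \<iota>)"
  shows "f = g"
proof
  fix w
  show "f w = g w"
  proof (cases "w \<in> W p")
    case True
    then show ?thesis using assms True by (intro linear_eq_bas[of p M f g w]) (simp_all add: cochains_iff coch_linear)
  next
    case False
    then show ?thesis using assms by (auto simp: cochains_iff extensional_def)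
  qed
qed

section \<open>Cochains with values in the algebra, and cup products\<close>

text \<open>The counterpart of \<open>coch\<close> with values in \<open>A\<close>, phrased by the
  ring multiplication so that it is available in the locale that fixes \<open>M\<close>.
  \<open>cochains_self_acoch\<close> links it to the bimodule \<open>preproj_self\<close>.\<close>

definition acoch :: "int \<Rightarrow> (('f, 'v, 'e) path_elt \<Rightarrow> ('f, 'v, 'e) preproj_elt) \<Rightarrow> bool" where
  "acoch p f \<longleftrightarrow> linear_on (W p) A f \<and>
     (\<forall>a\<in>H 0. \<forall>w\<in>W p. f (a \<star> w) = rc a \<otimes>\<^bsub>A\<^esub> f w \<and> f (w \<star> a) = f w \<otimes>\<^bsub>A\<^esub> rc a)"

lemma acoch_linear: "acoch p f \<Longrightarrow> linear_on (W p) A f"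
  and acoch_left: "acoch p f \<Longrightarrow> a \<in> H 0 \<Longrightarrow> w \<in> W p \<Longrightarrow> f (a \<star> w) = rc a \<otimes>\<^bsub>A\<^esub> f w"
  and acoch_right: "acoch p f \<Longrightarrow> a \<in> H 0 \<Longrightarrow> w \<in> W p \<Longrightarrow> f (w \<star> a) = f w \<otimes>\<^bsub>A\<^esub> rc a"
  by (auto simp: acoch_def)

lemma acoch_closed [simp]: "acoch p f \<Longrightarrow> w \<in> W p \<Longrightarrow> f w \<in> carrier A"
  using acoch_linear linear_on_closed by blast

text \<open>In degree 1 this is the fundamental cocycle. Both Koszul differentials are built from
  it, so closure and well-definedness for them are special cases of the statements on
  products.\<close>

lemma acoch_rc: "acoch p rc"
  by (auto simp: acoch_def linear_on_def A.vs subspace_W rc_add rc_pscale W_PA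
      intro!: rc_mult dest: subsetD[OF H_subset])

lemma bal_lact:
  assumes "acoch p f" "coch q g"
  shows "bal p q M (\<lambda>(u, v). lact M (f u) (g v))"
  unfolding balanced_map_def using assms
  by (simp add: M.vs linear_on_add[OF acoch_linear[OF assms(1)]] linear_on_add[OF coch_linear[OF assms(2)]]
      linear_on_pscale[OF acoch_linear[OF assms(1)]] linear_on_pscale[OF coch_linear[OF assms(2)]]
      lact_add lact_add_scalar lact_smult lact_smult_scalar acoch_right[OF assms(1)] coch_left[OF assms(2)] lact_mult)

lemma bal_ract:
  assumes "acoch p f" "coch q g"
  shows "bal q p M (\<lambda>(u, v). ract M (g u) (f v))"
  unfolding balanced_map_def using assms
  by (simp add: M.vs linear_on_add[OF acoch_linear[OF assms(1)]] linear_on_add[OF coch_linear[OF assms(2)]]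
      linear_on_pscale[OF acoch_linear[OF assms(1)]] linear_on_pscale[OF coch_linear[OF assms(2)]]
      ract_add ract_add_scalar ract_smult ract_smult_scalar acoch_left[OF assms(1)] coch_right[OF assms(2)] ract_mult)

text \<open>An element of \<open>k\<close> acting from the left is moved into the first factor, one
  acting from the right into the second. The maps modified in this way are again balanced, so
  \<open>split_ext\<close> identifies their values with the action on
  \<open>split_map\<close>.\<close>

lemma coch_split_lact:
  assumes f: "acoch p f" and g: "coch q g"
  shows "coch (p + q) (split_sum Q M p q (\<lambda>(u, v). lact M (f u) (g v)))"
proof (cases "p < 0 \<or> q < 0")
  case True
  then have "split_sum Q M p q (\<lambda>(u, v). lact M (f u) (g v)) = (\<lambda>w. \<zero>\<^bsub>M\<^esub>)" by (auto simp: split_sum_def)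
  then show ?thesis using coch_zero by simp
next
  case False
  then have pq: "p \<ge> 0" "q \<ge> 0" by auto
  note b = bal_lact[OF f g]
  let ?S = "split_map M p q (\<lambda>(u, v). lact M (f u) (g v))"
  have S: "split_sum Q M p q (\<lambda>(u, v). lact M (f u) (g v)) w = ?S w" if "w \<in> W (p + q)" for w
    by (rule split_ext[OF b linear_on_split_map[OF b] _ that pq]) (simp add: split_map_mult[OF b])
  have act: "linear_on UNIV M (\<lambda>w. lact M (rc a) (?S w))" "linear_on UNIV M (\<lambda>w. ract M (?S w) (rc a))" if "a \<in> H 0" for a
    using linear_on_split_map[OF b] that by (auto simp: linear_on_def lact_add ract_add lact_smult ract_smult Pi_iff)
  have bl: "bal p q M (\<lambda>(u, v). lact M (f (a \<star> u)) (g v))" if a: "a \<in> H 0" for a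
    using f g a unfolding balanced_map_def
    by (simp add: M.vs path_mult_add_right path_mult_pscale_right linear_on_add[OF acoch_linear[OF f]] linear_on_add[OF coch_linear[OF g]]
      linear_on_pscale[OF acoch_linear[OF f]] linear_on_pscale[OF coch_linear[OF g]] W_H0_closed path_mult_assoc[symmetric]
      lact_add lact_add_scalar lact_smult lact_smult_scalar acoch_right[OF f] coch_left[OF g] lact_mult)
  have br: "bal p q M (\<lambda>(u, v). lact M (f u) (g (v \<star> a)))" if a: "a \<in> H 0" for a
    using f g a unfolding balanced_map_def
    by (simp add: M.vs path_mult_add_left path_mult_pscale_left linear_on_add[OF acoch_linear[OF f]] linear_on_add[OF coch_linear[OF g]]
      linear_on_pscale[OF acoch_linear[OF f]] linear_on_pscale[OF coch_linear[OF g]] W_H0_closed path_mult_assoc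
      lact_add lact_add_scalar lact_smult lact_smult_scalar acoch_right[OF f] coch_left[OF g] lact_mult)
  show ?thesis unfolding coch_def
  proof (intro conjI ballI linear_on_split_sum[OF b])
    fix a w assume a: "a \<in> H 0" and w: "w \<in> W (p + q)"
    have "split_sum Q M p q (\<lambda>(u, v). lact M (f u) (g v)) (a \<star> w) = split_sum Q M p q (\<lambda>(u, v). lact M (f (a \<star> u)) (g v)) w"
      by (rule split_sum_mult_left[OF b bl[OF a] w a, symmetric]) simp
    also have "\<dots> = lact M (rc a) (?S w)"
      by (rule split_ext[OF bl[OF a] act(1)[OF a] _ w pq]) (simp add: split_map_mult[OF b] acoch_left[OF f a] lact_mult[OF rc_H0[OF a] acoch_closed[OF f] coch_closed[OF g]])
    finally show "split_sum Q M p q (\<lambda>(u, v). lact M (f u) (g v)) (a \<star> w) = lact M (rc a) (split_sum Q M p q (\<lambda>(u, v). lact M (f u) (g v)) w)"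
      using S[OF w] by simp
    have "split_sum Q M p q (\<lambda>(u, v). lact M (f u) (g v)) (w \<star> a) = split_sum Q M p q (\<lambda>(u, v). lact M (f u) (g (v \<star> a))) w"
      by (rule split_sum_mult_right[OF b br[OF a] w a, symmetric]) simp
    also have "\<dots> = ract M (?S w) (rc a)"
      by (rule split_ext[OF br[OF a] act(2)[OF a] _ w pq]) (simp add: split_map_mult[OF b] coch_right[OF g a] ract_lact[OF acoch_closed[OF f] rc_H0[OF a] coch_closed[OF g]])
    finally show "split_sum Q M p q (\<lambda>(u, v). lact M (f u) (g v)) (w \<star> a) = ract M (split_sum Q M p q (\<lambda>(u, v). lact M (f u) (g v)) w) (rc a)"
      using S[OF w] by simp
  qed
qed

lemma coch_split_ract:
  assumes f: "acoch p f" and g: "coch q g"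
  shows "coch (q + p) (split_sum Q M q p (\<lambda>(u, v). ract M (g u) (f v)))"
proof (cases "p < 0 \<or> q < 0")
  case True
  then have "split_sum Q M q p (\<lambda>(u, v). ract M (g u) (f v)) = (\<lambda>w. \<zero>\<^bsub>M\<^esub>)" by (auto simp: split_sum_def)
  then show ?thesis using coch_zero by simp
next
  case False
  then have pq: "q \<ge> 0" "p \<ge> 0" by auto
  note b = bal_ract[OF f g]
  let ?S = "split_map M q p (\<lambda>(u, v). ract M (g u) (f v))"
  have S: "split_sum Q M q p (\<lambda>(u, v). ract M (g u) (f v)) w = ?S w" if "w \<in> W (q + p)" for w
    by (rule split_ext[OF b linear_on_split_map[OF b] _ that pq]) (simp add: split_map_mult[OF b])
  have act: "linear_on UNIV M (\<lambda>w. lact M (rc a) (?S w))" "linear_on UNIV M (\<lambda>w. ract M (?S w) (rc a))" if "a \<in> H 0" for a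
    using linear_on_split_map[OF b] that by (auto simp: linear_on_def lact_add ract_add lact_smult ract_smult Pi_iff)
  have bl: "bal q p M (\<lambda>(u, v). ract M (g (a \<star> u)) (f v))" if a: "a \<in> H 0" for a
    using f g a unfolding balanced_map_def
    by (simp add: M.vs path_mult_add_right path_mult_pscale_right linear_on_add[OF acoch_linear[OF f]] linear_on_add[OF coch_linear[OF g]]
      linear_on_pscale[OF acoch_linear[OF f]] linear_on_pscale[OF coch_linear[OF g]] W_H0_closed path_mult_assoc[symmetric]
      ract_add ract_add_scalar ract_smult ract_smult_scalar acoch_left[OF f] coch_right[OF g] ract_mult)
  have br: "bal q p M (\<lambda>(u, v). ract M (g u) (f (v \<star> a)))" if a: "a \<in> H 0" for a
    using f g a unfolding balanced_map_def
    by (simp add: M.vs path_mult_add_left path_mult_pscale_left linear_on_add[OF acoch_linear[OF f]] linear_on_add[OF coch_linear[OF g]]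
      linear_on_pscale[OF acoch_linear[OF f]] linear_on_pscale[OF coch_linear[OF g]] W_H0_closed path_mult_assoc
      ract_add ract_add_scalar ract_smult ract_smult_scalar acoch_left[OF f] coch_right[OF g] ract_mult)
  show ?thesis unfolding coch_def
  proof (intro conjI ballI linear_on_split_sum[OF b])
    fix a w assume a: "a \<in> H 0" and w: "w \<in> W (q + p)"
    have "split_sum Q M q p (\<lambda>(u, v). ract M (g u) (f v)) (a \<star> w) = split_sum Q M q p (\<lambda>(u, v). ract M (g (a \<star> u)) (f v)) w"
      by (rule split_sum_mult_left[OF b bl[OF a] w a, symmetric]) simp
    also have "\<dots> = lact M (rc a) (?S w)"
      by (rule split_ext[OF bl[OF a] act(1)[OF a] _ w pq]) (simp add: split_map_mult[OF b] coch_left[OF g a] ract_lact[OF rc_H0[OF a] acoch_closed[OF f] coch_closed[OF g]])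
    finally show "split_sum Q M q p (\<lambda>(u, v). ract M (g u) (f v)) (a \<star> w) = lact M (rc a) (split_sum Q M q p (\<lambda>(u, v). ract M (g u) (f v)) w)"
      using S[OF w] by simp
    have "split_sum Q M q p (\<lambda>(u, v). ract M (g u) (f v)) (w \<star> a) = split_sum Q M q p (\<lambda>(u, v). ract M (g u) (f (v \<star> a))) w"
      by (rule split_sum_mult_right[OF b br[OF a] w a, symmetric]) simp
    also have "\<dots> = ract M (?S w) (rc a)"
      by (rule split_ext[OF br[OF a] act(2)[OF a] _ w pq]) (simp add: split_map_mult[OF b] acoch_right[OF f a] ract_mult[OF acoch_closed[OF f] rc_H0[OF a] coch_closed[OF g]])
    finally show "split_sum Q M q p (\<lambda>(u, v). ract M (g u) (f v)) (w \<star> a) = ract M (split_sum Q M q p (\<lambda>(u, v). ract M (g u) (f v)) w) (rc a)"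
      using S[OF w] by simp
  qed
qed

lemma cochain_d_in_cochains:
  assumes f: "coch p f"
  shows "cochain_d Q M p f \<in> carrier (cochains Q M (p + 1))"
  unfolding cochain_d_def
  using coch_split_ract[OF acoch_rc f, of 1] coch_split_lact[OF acoch_rc f, of 1]
  by (intro coch_restrict coch_add coch_smult) (simp_all add: add.commute)

lemma cochain_d_closed: "f \<in> carrier (cochains Q M p) \<Longrightarrow> cochain_d Q M p f \<in> carrier (cochains Q M (p + 1))"
  by (rule cochain_d_in_cochains) (simp add: cochains_iff)

lemma cup_left_closed:
  assumes "acoch p f" "g \<in> carrier (cochains Q M q)"
  shows "cup_left Q M p q f g \<in> carrier (cochains Q M (p + q))"
  unfolding cup_left_def using coch_split_lact[OF assms(1)] assms(2)
  by (intro coch_restrict coch_smult) (simp add: cochains_iff)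

lemma cup_right_closed:
  assumes "acoch p f" "g \<in> carrier (cochains Q M q)"
  shows "cup_right Q M q p g f \<in> carrier (cochains Q M (q + p))"
  unfolding cup_right_def using coch_split_ract[OF assms(1)] assms(2)
  by (intro coch_restrict coch_smult) (simp add: cochains_iff)

end

context vspace
begin

text \<open>Used to merge a sum over vertices and the arrows ending there into a sum over all
  arrows.\<close>

lemma finsum_group:
  assumes "finite S" "finite T" "g ` S \<subseteq> T" "\<And>s. s \<in> S \<Longrightarrow> f s \<in> carrier V"
  shows "(\<Oplus>t\<in>T. \<Oplus>s\<in>{s \<in> S. g s = t}. f s) = (\<Oplus>s\<in>S. f s)"
proof -
  have "(\<Oplus>s\<in>\<Union>((\<lambda>t. {s \<in> S. g s = t}) ` T). f s) = (\<Oplus>t\<in>T. \<Oplus>s\<in>{s \<in> S. g s = t}. f s)"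
    using assms by (intro add.finprod_UN_disjoint) (auto simp: pairwise_def disjnt_def)
  moreover have "\<Union>((\<lambda>t. {s \<in> S. g s = t}) ` T) = S" using assms(3) by auto
  ultimately show ?thesis by simp
qed

lemma finsum_reindex':
  assumes "inj_on h S" "\<And>s. s \<in> S \<Longrightarrow> f (h s) \<in> carrier V"
  shows "(\<Oplus>t\<in>h ` S. f t) = (\<Oplus>s\<in>S. f (h s))"
  using assms by (intro finsum_reindex) auto

lemma finsum_delta:
  assumes "finite S" "i \<in> S" "\<And>j. j \<in> S \<Longrightarrow> f j \<in> carrier V"
  shows "(\<Oplus>j\<in>S. (if j = i then 1 else 0) \<odot> f j) = f i"
proof -
  have "(\<Oplus>j\<in>S. (if j = i then 1 else 0) \<odot> f j) = (\<Oplus>j\<in>S. if i = j then f j else \<zero>)"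
    using assms by (intro finsum_cong') auto
  then show ?thesis using add.finprod_singleton[of i S f] assms by (simp add: Pi_iff)
qed

end

context koszul_bimodule
begin

subsection \<open>Chains\<close>

abbreviation C :: "int \<Rightarrow> ('f, ('f, 'v, 'e, 'm) chain) module" where "C \<equiv> chains Q M"
abbreviation ch :: "int \<Rightarrow> 'm \<Rightarrow> ('f, 'v, 'e) path_elt \<Rightarrow> ('f, 'v, 'e, 'm) chain" where "ch \<equiv> chain_pure Q M"

abbreviation cbal :: "int \<Rightarrow> ('f, 'n, 'z) module_scheme \<Rightarrow> ('m \<times> ('f, 'v, 'e) path_elt \<Rightarrow> 'n) \<Rightarrow> bool" where
  "cbal p V \<phi> \<equiv> balanced_map M (H 0 \<times> H 0) (\<lambda>m (a, b). Ae_right M m (rc a, rc b)) (Wspace Q p) ke_W V \<phi>"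

lemma chains_tensor_product:
  "tensor_product M (H 0 \<times> H 0) (\<lambda>m (a, b). Ae_right M m (rc a, rc b)) (Wspace Q p) ke_W"
  by (intro tensor_product.intro vspace_M vspace_W tensor_product_axioms.intro)
    (auto simp: Ae_right_def ke_W_def W_H0_closed)

lemma vspace_C: "vspace (C p)"
  unfolding chains_def by (rule tensor_product.T_vspace[OF chains_tensor_product])

sublocale C: vspace "C p" for p by (rule vspace_C)

lemma ch_closed [simp]: "m \<in> carrier M \<Longrightarrow> w \<in> W p \<Longrightarrow> ch p m w \<in> carrier (C p)"
  unfolding chain_pure_def chains_def by (rule tensor_product.tensor_closed[OF chains_tensor_product]) simp_all

lemma ch_add_left: "m \<in> carrier M \<Longrightarrow> n \<in> carrier M \<Longrightarrow> w \<in> W p \<Longrightarrow> ch p (m \<oplus>\<^bsub>M\<^esub> n) w = ch p m w \<oplus>\<^bsub>C p\<^esub> ch p n w"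
  unfolding chain_pure_def chains_def by (rule tensor_product.tensor_add_left[OF chains_tensor_product]) simp_all

lemma ch_smult_left: "m \<in> carrier M \<Longrightarrow> w \<in> W p \<Longrightarrow> ch p (c \<odot>\<^bsub>M\<^esub> m) w = c \<odot>\<^bsub>C p\<^esub> ch p m w"
  unfolding chain_pure_def chains_def by (rule tensor_product.tensor_smult_left[OF chains_tensor_product]) simp_all

lemma ch_linear: "m \<in> carrier M \<Longrightarrow> linear_on (W p) (C p) (ch p m)"
  unfolding linear_on_def using C.vs[of p]
    tensor_product.tensor_add_right[OF chains_tensor_product, of m _ p] tensor_product.tensor_smult_right[OF chains_tensor_product, of m _ p]
  by (auto simp: subspace_W chain_pure_def[symmetric] chains_def[symmetric])

text \<open>Tensoring over \<open>k^e\<close> closes a circle: what acts on \<open>m\<close> from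
  the left passes to the right end of \<open>w\<close>, and what acts from the right passes to its
  left end.\<close>

lemma ch_balanced:
  assumes "m \<in> carrier M" "w \<in> W p" "a \<in> H 0" "b \<in> H 0"
  shows "ch p (ract M (lact M (rc b) m) (rc a)) w = ch p m (a \<star> w \<star> b)"
  using tensor_product.tensor_balanced[OF chains_tensor_product, of m "(a, b)" w p] assms
  by (simp add: chain_pure_def chains_def Ae_right_def ke_W_def)

lemma ch_ract: assumes "m \<in> carrier M" "w \<in> W p" "a \<in> H 0" shows "ch p (ract M m (rc a)) w = ch p m (a \<star> w)"
  using ch_balanced[OF assms unit_H] assms W_PA[OF W_H0_closed(1)[OF assms(2,3)]]
  by (simp add: rc_unit lact_one unit_right)

lemma ch_lact: assumes "m \<in> carrier M" "w \<in> W p" "b \<in> H 0" shows "ch p (lact M (rc b) m) w = ch p m (w \<star> b)"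
  using ch_balanced[OF assms(1,2) unit_H assms(3)] assms W_PA[OF assms(2)] rc_H0[OF assms(3)]
  by (simp add: rc_unit ract_one unit_left)

lemma ch_finsum_left:
  assumes "finite S" "\<And>i. i \<in> S \<Longrightarrow> f i \<in> carrier M" "w \<in> W p"
  shows "ch p (\<Oplus>\<^bsub>M\<^esub>i\<in>S. f i) w = (\<Oplus>\<^bsub>C p\<^esub>i\<in>S. ch p (f i) w)"
  unfolding chain_pure_def chains_def
  using assms by (intro tensor_product.tensor_finsum_left[OF chains_tensor_product]) simp_all

lemma ch_zero_left: "w \<in> W p \<Longrightarrow> ch p \<zero>\<^bsub>M\<^esub> w = \<zero>\<^bsub>C p\<^esub>"
  using ch_smult_left[of "\<zero>\<^bsub>M\<^esub>" w p 0] by simp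

lemma chains_induct [consumes 1, case_names zero pure add]:
  assumes "z \<in> carrier (C p)" "P \<zero>\<^bsub>C p\<^esub>"
    and "\<And>m w. m \<in> carrier M \<Longrightarrow> w \<in> W p \<Longrightarrow> P (ch p m w)"
    and "\<And>x y. x \<in> carrier (C p) \<Longrightarrow> y \<in> carrier (C p) \<Longrightarrow> P x \<Longrightarrow> P y \<Longrightarrow> P (x \<oplus>\<^bsub>C p\<^esub> y)"
  shows "P z"
  using tensor_product.tensor_induct[OF chains_tensor_product, of z p P] assms
  by (simp add: chain_pure_def chains_def)

lemma chains_trivial: "p < 0 \<or> p > 2 \<Longrightarrow> carrier (C p) = {\<zero>\<^bsub>C p\<^esub>}"
  unfolding chains_def using W_neg[of p] W_gt2[of p]
  by (intro tensor_product.trivial_tensor_right[OF chains_tensor_product]) auto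

lemma chain_lift:
  assumes "cbal p V \<phi>"
  shows "m \<in> carrier M \<Longrightarrow> w \<in> W p \<Longrightarrow> tensor_lift V \<phi> (ch p m w) = \<phi> (m, w)"
    "z \<in> carrier (C p) \<Longrightarrow> tensor_lift V \<phi> z \<in> carrier V"
    "x \<in> carrier (C p) \<Longrightarrow> y \<in> carrier (C p) \<Longrightarrow> tensor_lift V \<phi> (x \<oplus>\<^bsub>C p\<^esub> y) = tensor_lift V \<phi> x \<oplus>\<^bsub>V\<^esub> tensor_lift V \<phi> y"
    "z \<in> carrier (C p) \<Longrightarrow> tensor_lift V \<phi> (c \<odot>\<^bsub>C p\<^esub> z) = c \<odot>\<^bsub>V\<^esub> tensor_lift V \<phi> z"
    "tensor_lift V \<phi> \<zero>\<^bsub>C p\<^esub> = \<zero>\<^bsub>V\<^esub>"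
    "finite S \<Longrightarrow> (\<And>i. i \<in> S \<Longrightarrow> g i \<in> carrier (C p)) \<Longrightarrow> tensor_lift V \<phi> (\<Oplus>\<^bsub>C p\<^esub>i\<in>S. g i) = (\<Oplus>\<^bsub>V\<^esub>i\<in>S. tensor_lift V \<phi> (g i))"
proof -
  note tp = chains_tensor_product[of p]
  show "m \<in> carrier M \<Longrightarrow> w \<in> W p \<Longrightarrow> tensor_lift V \<phi> (ch p m w) = \<phi> (m, w)"
    unfolding chain_pure_def chains_def by (rule tensor_product.tensor_lift_tensor[OF tp assms]) simp_all
  show "z \<in> carrier (C p) \<Longrightarrow> tensor_lift V \<phi> z \<in> carrier V"
    unfolding chains_def by (rule tensor_product.tensor_lift_closed[OF tp assms])
  show "x \<in> carrier (C p) \<Longrightarrow> y \<in> carrier (C p) \<Longrightarrow> tensor_lift V \<phi> (x \<oplus>\<^bsub>C p\<^esub> y) = tensor_lift V \<phi> x \<oplus>\<^bsub>V\<^esub> tensor_lift V \<phi> y"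
    unfolding chains_def by (rule tensor_product.tensor_lift_add[OF tp assms])
  show "z \<in> carrier (C p) \<Longrightarrow> tensor_lift V \<phi> (c \<odot>\<^bsub>C p\<^esub> z) = c \<odot>\<^bsub>V\<^esub> tensor_lift V \<phi> z"
    unfolding chains_def by (rule tensor_product.tensor_lift_smult[OF tp assms])
  show "tensor_lift V \<phi> \<zero>\<^bsub>C p\<^esub> = \<zero>\<^bsub>V\<^esub>"
    unfolding chains_def by (rule tensor_product.tensor_lift_zero[OF tp assms])
  show "finite S \<Longrightarrow> (\<And>i. i \<in> S \<Longrightarrow> g i \<in> carrier (C p)) \<Longrightarrow> tensor_lift V \<phi> (\<Oplus>\<^bsub>C p\<^esub>i\<in>S. g i) = (\<Oplus>\<^bsub>V\<^esub>i\<in>S. tensor_lift V \<phi> (g i))"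
    unfolding chains_def by (rule tensor_product.tensor_lift_finsum[OF tp assms])
qed

text \<open>Balancing over pairs follows from balancing on each side separately; the one-sided
  conditions are the ones that can be checked conveniently.\<close>

lemma cbalI:
  assumes "is_vector_space V"
    and "\<And>m. m \<in> carrier M \<Longrightarrow> linear_on (W p) V (\<lambda>w. \<phi> (m, w))"
    and "\<And>m n w. m \<in> carrier M \<Longrightarrow> n \<in> carrier M \<Longrightarrow> w \<in> W p \<Longrightarrow> \<phi> (m \<oplus>\<^bsub>M\<^esub> n, w) = \<phi> (m, w) \<oplus>\<^bsub>V\<^esub> \<phi> (n, w)"
    and "\<And>c m w. m \<in> carrier M \<Longrightarrow> w \<in> W p \<Longrightarrow> \<phi> (c \<odot>\<^bsub>M\<^esub> m, w) = c \<odot>\<^bsub>V\<^esub> \<phi> (m, w)"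
    and "\<And>b m w. m \<in> carrier M \<Longrightarrow> w \<in> W p \<Longrightarrow> b \<in> H 0 \<Longrightarrow> \<phi> (lact M (rc b) m, w) = \<phi> (m, w \<star> b)"
    and "\<And>a m w. m \<in> carrier M \<Longrightarrow> w \<in> W p \<Longrightarrow> a \<in> H 0 \<Longrightarrow> \<phi> (ract M m (rc a), w) = \<phi> (m, a \<star> w)"
  shows "cbal p V \<phi>"
  unfolding balanced_map_def
proof (intro conjI ballI allI)
  fix m s and w :: "('f, 'v, 'e) path_elt"
  assume m: "m \<in> carrier M" and s: "s \<in> H 0 \<times> H 0" and w: "w \<in> carrier (Wspace Q p)"
  obtain a b where ab: "s = (a, b)" "a \<in> H 0" "b \<in> H 0" using s by auto
  have "\<phi> (ract M (lact M (rc b) m) (rc a), w) = \<phi> (lact M (rc b) m, a \<star> w)"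
    using m w ab rc_H0[OF ab(3)] by (intro assms(6)) auto
  also have "\<dots> = \<phi> (m, a \<star> w \<star> b)" using m w ab by (intro assms(5)) (auto simp: W_H0_closed)
  finally show "\<phi> ((case s of (a, b) \<Rightarrow> Ae_right M m (rc a, rc b)), w) = \<phi> (m, ke_W s w)"
    by (simp add: ab(1) Ae_right_def ke_W_def)
qed (use assms(1,3,4) linear_on_closed[OF assms(2)] linear_on_add[OF assms(2)] linear_on_pscale[OF assms(2)] in auto)

text \<open>Collects what a family of balanced maps depending on \<open>m\<close> must satisfy for
  \<open>m \<otimes> w \<mapsto> split_sum\<close> to be well defined on chains. Both cap products
  are instances, with \<open>c\<close> taking up the Koszul sign.\<close>

lemma cbal_split:
  assumes b: "\<And>m. m \<in> carrier M \<Longrightarrow> bal r p V (\<phi> m)"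
    and add: "\<And>m n u v. m \<in> carrier M \<Longrightarrow> n \<in> carrier M \<Longrightarrow> u \<in> W r \<Longrightarrow> v \<in> W p \<Longrightarrow> \<phi> (m \<oplus>\<^bsub>M\<^esub> n) (u, v) = \<phi> m (u, v) \<oplus>\<^bsub>V\<^esub> \<phi> n (u, v)"
    and smult: "\<And>c m u v. m \<in> carrier M \<Longrightarrow> u \<in> W r \<Longrightarrow> v \<in> W p \<Longrightarrow> \<phi> (c \<odot>\<^bsub>M\<^esub> m) (u, v) = c \<odot>\<^bsub>V\<^esub> \<phi> m (u, v)"
    and lact: "\<And>b m u v. m \<in> carrier M \<Longrightarrow> b \<in> H 0 \<Longrightarrow> u \<in> W r \<Longrightarrow> v \<in> W p \<Longrightarrow> \<phi> (lact M (rc b) m) (u, v) = \<phi> m (u, v \<star> b)"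
    and ract: "\<And>a m u v. m \<in> carrier M \<Longrightarrow> a \<in> H 0 \<Longrightarrow> u \<in> W r \<Longrightarrow> v \<in> W p \<Longrightarrow> \<phi> (ract M m (rc a)) (u, v) = \<phi> m (a \<star> u, v)"
  shows "cbal (r + p) V (\<lambda>(m, w). c \<odot>\<^bsub>V\<^esub> split_sum Q V r p (\<phi> m) w)"
proof -
  interpret V: vspace V using balanced_mapD(1)[OF b[OF M.zero_closed]] by (simp add: vspace_def)
  note cl = linear_on_closed[OF linear_on_split_sum[OF b]]
  show ?thesis
  proof (rule cbalI, simp_all only: split)
    show "is_vector_space V" by (rule V.vs)
    show "linear_on (W (r + p)) V (\<lambda>w. c \<odot>\<^bsub>V\<^esub> split_sum Q V r p (\<phi> m) w)" if "m \<in> carrier M" for m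
      by (intro linear_on_compose_smult linear_on_split_sum b that)
    fix m w assume m: "m \<in> carrier M" and w: "w \<in> W (r + p)"
    show "c \<odot>\<^bsub>V\<^esub> split_sum Q V r p (\<phi> (m \<oplus>\<^bsub>M\<^esub> n)) w = c \<odot>\<^bsub>V\<^esub> split_sum Q V r p (\<phi> m) w \<oplus>\<^bsub>V\<^esub> c \<odot>\<^bsub>V\<^esub> split_sum Q V r p (\<phi> n) w"
      if n: "n \<in> carrier M" for n
      using m n w by (subst split_sum_add[OF b[OF m] b[OF n] b w add]) (simp_all add: V.smult_distr_right cl)
    show "c \<odot>\<^bsub>V\<^esub> split_sum Q V r p (\<phi> (d \<odot>\<^bsub>M\<^esub> m)) w = d \<odot>\<^bsub>V\<^esub> (c \<odot>\<^bsub>V\<^esub> split_sum Q V r p (\<phi> m) w)" for d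
      using m w by (subst split_sum_smult[OF b[OF m] b w smult]) (simp_all add: V.smult_smult cl mult.commute)
    show "c \<odot>\<^bsub>V\<^esub> split_sum Q V r p (\<phi> (lact M (rc x) m)) w = c \<odot>\<^bsub>V\<^esub> split_sum Q V r p (\<phi> m) (w \<star> x)" if x: "x \<in> H 0" for x
      using m w rc_H0[OF x] by (subst split_sum_mult_right[OF b[OF m] b w x lact]) (simp_all add: x)
    show "c \<odot>\<^bsub>V\<^esub> split_sum Q V r p (\<phi> (ract M m (rc x))) w = c \<odot>\<^bsub>V\<^esub> split_sum Q V r p (\<phi> m) (x \<star> w)" if x: "x \<in> H 0" for x
      using m w rc_H0[OF x] by (subst split_sum_mult_left[OF b[OF m] b w x ract]) (simp_all add: x)
  qed
qed

lemma cbal_add: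
  assumes "cbal p V \<phi>" "cbal p V \<psi>"
  shows "cbal p V (\<lambda>(m, w). \<phi> (m, w) \<oplus>\<^bsub>V\<^esub> \<psi> (m, w))"
proof -
  interpret V: vspace V using balanced_mapD(1)[OF assms(1)] by (simp add: vspace_def)
  note D = balanced_mapD[OF assms(1)] and E = balanced_mapD[OF assms(2)]
  have r: "m \<in> carrier M \<Longrightarrow> s \<in> H 0 \<times> H 0 \<Longrightarrow> (case s of (a, b) \<Rightarrow> Ae_right M m (rc a, rc b)) \<in> carrier M" for m s
    by (auto simp: Ae_right_def)
  show ?thesis unfolding balanced_map_def split
    by (intro conjI ballI allI; (simp only: D E)?)
      (use D(1,2) E(2) D(2)[of _ "_ \<star> _"] in \<open>simp_all add: V.a_ac V.smult_distr_right\<close>)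
qed

section \<open>Cap products and the chain differential on tensors\<close>

lemma bal_cap_left:
  assumes "acoch p f" "m \<in> carrier M"
  shows "bal r p (C r) (\<lambda>(u, v). ch r (lact M (f v) m) u)"
  unfolding balanced_map_def split
proof (intro conjI ballI allI)
  fix u v s :: "('f, 'v, 'e) path_elt"
  assume a: "u \<in> carrier (Wspace Q r)" "s \<in> H 0" "v \<in> carrier (Wspace Q p)"
  have "ch r (lact M (f v) m) (u \<star> s) = ch r (lact M (rc s) (lact M (f v) m)) u"
    using a assms acoch_closed[OF assms(1)] by (subst ch_lact) auto
  also have "lact M (rc s) (lact M (f v) m) = lact M (f (s \<star> v)) m"
    using a assms by (simp add: lact_mult[OF rc_H0[OF a(2)] acoch_closed[OF assms(1)]] acoch_left)
  finally show "ch r (lact M (f v) m) (u \<star> s) = ch r (lact M (f (s \<star> v)) m) u" .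
qed (use assms acoch_closed[OF assms(1)] linear_on_add[OF ch_linear] linear_on_pscale[OF ch_linear]
  linear_on_add[OF acoch_linear[OF assms(1)]] linear_on_pscale[OF acoch_linear[OF assms(1)]] in
  \<open>simp_all add: C.vs lact_add_scalar lact_smult_scalar ch_add_left ch_smult_left\<close>)

lemma bal_cap_right:
  assumes "acoch p f" "m \<in> carrier M"
  shows "bal p r (C r) (\<lambda>(u, v). ch r (ract M m (f u)) v)"
  unfolding balanced_map_def split
proof (intro conjI ballI allI)
  fix u v s :: "('f, 'v, 'e) path_elt"
  assume a: "u \<in> carrier (Wspace Q p)" "s \<in> H 0" "v \<in> carrier (Wspace Q r)"
  have "ch r (ract M m (f u)) (s \<star> v) = ch r (ract M (ract M m (f u)) (rc s)) v"
    using a assms acoch_closed[OF assms(1)] by (subst ch_ract) auto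
  also have "ract M (ract M m (f u)) (rc s) = ract M m (f (u \<star> s))"
    using a assms by (simp add: ract_mult[OF acoch_closed[OF assms(1)] rc_H0[OF a(2)]] acoch_right)
  finally show "ch r (ract M m (f (u \<star> s))) v = ch r (ract M m (f u)) (s \<star> v)" by simp
qed (use assms acoch_closed[OF assms(1)] linear_on_add[OF ch_linear] linear_on_pscale[OF ch_linear]
  linear_on_add[OF acoch_linear[OF assms(1)]] linear_on_pscale[OF acoch_linear[OF assms(1)]] in
  \<open>simp_all add: C.vs ract_add_scalar ract_smult_scalar ch_add_left ch_smult_left\<close>)

lemma cbal_cap_left:
  assumes f: "acoch p f"
  shows "cbal (r + p) (C r) (\<lambda>(m, w). c \<odot>\<^bsub>C r\<^esub> split_sum Q (C r) r p (\<lambda>(u, v). ch r (lact M (f v) m) u) w)"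
proof (rule cbal_split[where \<phi> = "\<lambda>m (u, v). ch r (lact M (f v) m) u"], unfold split)
  note cl = acoch_closed[OF f]
  show "bal r p (C r) (\<lambda>(u, v). ch r (lact M (f v) m) u)" if "m \<in> carrier M" for m
    by (rule bal_cap_left[OF f that])
  fix m u v assume m: "m \<in> carrier M" and uv: "u \<in> W r" "v \<in> W p"
  show "ch r (lact M (f v) (m \<oplus>\<^bsub>M\<^esub> n)) u = ch r (lact M (f v) m) u \<oplus>\<^bsub>C r\<^esub> ch r (lact M (f v) n) u" if "n \<in> carrier M" for n
    using m uv that cl by (simp add: lact_add ch_add_left)
  show "ch r (lact M (f v) (c \<odot>\<^bsub>M\<^esub> m)) u = c \<odot>\<^bsub>C r\<^esub> ch r (lact M (f v) m) u" for c
    using m uv cl by (simp add: lact_smult ch_smult_left)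
  fix b assume b: "b \<in> H 0"
  show "ch r (lact M (f v) (lact M (rc b) m)) u = ch r (lact M (f (v \<star> b)) m) u"
    using uv by (simp add: acoch_right[OF f b] lact_mult[OF cl rc_H0[OF b] m])
  show "ch r (lact M (f v) (ract M m (rc b))) u = ch r (lact M (f v) m) (b \<star> u)"
    using uv b m cl by (simp add: ract_lact[OF cl rc_H0[OF b] m, symmetric] ch_ract)
qed

lemma cbal_cap_right:
  assumes f: "acoch p f"
  shows "cbal (p + r) (C r) (\<lambda>(m, w). c \<odot>\<^bsub>C r\<^esub> split_sum Q (C r) p r (\<lambda>(u, v). ch r (ract M m (f u)) v) w)"
proof (rule cbal_split[where \<phi> = "\<lambda>m (u, v). ch r (ract M m (f u)) v"], unfold split)
  note cl = acoch_closed[OF f]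
  show "bal p r (C r) (\<lambda>(u, v). ch r (ract M m (f u)) v)" if "m \<in> carrier M" for m
    by (rule bal_cap_right[OF f that])
  fix m u v assume m: "m \<in> carrier M" and uv: "u \<in> W p" "v \<in> W r"
  show "ch r (ract M (m \<oplus>\<^bsub>M\<^esub> n) (f u)) v = ch r (ract M m (f u)) v \<oplus>\<^bsub>C r\<^esub> ch r (ract M n (f u)) v" if "n \<in> carrier M" for n
    using m uv that cl by (simp add: ract_add ch_add_left)
  show "ch r (ract M (c \<odot>\<^bsub>M\<^esub> m) (f u)) v = c \<odot>\<^bsub>C r\<^esub> ch r (ract M m (f u)) v" for c
    using m uv cl by (simp add: ract_smult ch_smult_left)
  fix b assume b: "b \<in> H 0"
  show "ch r (ract M (lact M (rc b) m) (f u)) v = ch r (ract M m (f u)) (v \<star> b)"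
    using uv b m cl by (simp add: ract_lact[OF rc_H0[OF b] cl m] ch_lact)
  show "ch r (ract M (ract M m (rc b)) (f u)) v = ch r (ract M m (f (b \<star> u))) v"
    using uv by (simp add: acoch_left[OF f b] ract_mult[OF rc_H0[OF b] cl m])
qed

text \<open>The existential gives the long formula a short name: its balancedness, its lift and its
  values can then be used together without displaying it.\<close>

lemma cap_left_map:
  assumes "acoch p f"
  shows "\<exists>\<phi>. cbal q (C (q - p)) \<phi> \<and> cap_left Q M p q f = tensor_lift (C (q - p)) \<phi> \<and>
    \<phi> = (\<lambda>(m, w). ((-1) powi ((q - p) * p)) \<odot>\<^bsub>C (q - p)\<^esub>
       split_sum Q (C (q - p)) (q - p) p (\<lambda>(u, v). ch (q - p) (lact M (f v) m) u) w)"
  using cbal_cap_left[OF assms, of "q - p" "(-1) powi ((q - p) * p)"]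
  by (intro exI conjI refl) (simp_all add: cap_left_def[abs_def] Let_def)

lemma cap_right_map:
  assumes "acoch p f"
  shows "\<exists>\<phi>. cbal q (C (q - p)) \<phi> \<and> (\<lambda>z. cap_right Q M q p z f) = tensor_lift (C (q - p)) \<phi> \<and>
    \<phi> = (\<lambda>(m, w). ((-1) powi (p * q)) \<odot>\<^bsub>C (q - p)\<^esub>
       split_sum Q (C (q - p)) p (q - p) (\<lambda>(u, v). ch (q - p) (ract M m (f u)) v) w)"
  using cbal_cap_right[OF assms, of "q - p" "(-1) powi (p * q)"]
  by (intro exI conjI refl) (simp_all add: cap_right_def Let_def)

lemma chain_d_map:
  "\<exists>\<phi>. cbal p (C (p - 1)) \<phi> \<and> chain_d Q M p = tensor_lift (C (p - 1)) \<phi> \<and>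
    \<phi> = (\<lambda>(m, w). split_sum Q (C (p - 1)) 1 (p - 1) (\<lambda>(x, u). ch (p - 1) (ract M m (rc x)) u) w \<oplus>\<^bsub>C (p - 1)\<^esub>
      ((-1) powi p) \<odot>\<^bsub>C (p - 1)\<^esub> split_sum Q (C (p - 1)) (p - 1) 1 (\<lambda>(u, x). ch (p - 1) (lact M (rc x) m) u) w)"
    (is "\<exists>\<phi>. _ \<phi> \<and> _ \<and> \<phi> = ?\<phi>")
proof -
  let ?r = "p - 1"
  \<comment> \<open>Both terms of the differential are cap-type maps with the cocycle
    \<open>rc\<close>. The factor 1 matches the first term to \<open>cbal_cap_right\<close>;
    \<open>s\<close> removes it, and \<open>eq\<close> carries balancedness over to the original
    formula.\<close>
  let ?f = "\<lambda>(m, w). 1 \<odot>\<^bsub>C ?r\<^esub> split_sum Q (C ?r) 1 ?r (\<lambda>(x, u). ch ?r (ract M m (rc x)) u) w"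
  let ?g = "\<lambda>(m, w). ((-1) powi p) \<odot>\<^bsub>C ?r\<^esub> split_sum Q (C ?r) ?r 1 (\<lambda>(u, x). ch ?r (lact M (rc x) m) u) w"
  have f: "cbal p (C ?r) ?f" using cbal_cap_right[OF acoch_rc[of 1], of ?r 1] by simp
  have g: "cbal p (C ?r) ?g" using cbal_cap_left[OF acoch_rc[of 1], of ?r "(-1) powi p"] by simp
  have s: "1 \<odot>\<^bsub>C ?r\<^esub> split_sum Q (C ?r) 1 ?r (\<lambda>(x, u). ch ?r (ract M m (rc x)) u) w = split_sum Q (C ?r) 1 ?r (\<lambda>(x, u). ch ?r (ract M m (rc x)) u) w"
    if "m \<in> carrier M" "w \<in> W p" for m w
    using linear_on_closed[OF linear_on_split_sum[OF bal_cap_right[OF acoch_rc[of 1] that(1), of ?r]], of w] that by simp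
  have "balanced_map M (H 0 \<times> H 0) (\<lambda>m (a, b). Ae_right M m (rc a, rc b)) (Wspace Q p) ke_W (C ?r) ?\<phi>"
  proof -
    have r: "(case s of (a, b) \<Rightarrow> Ae_right M m (rc a, rc b)) \<in> carrier M" if "m \<in> carrier M" "s \<in> H 0 \<times> H 0" for m s
      using that by (auto simp: Ae_right_def)
    have k: "ke_W s w \<in> W p" if "w \<in> W p" "s \<in> H 0 \<times> H 0" for w s
      using that by (auto simp: ke_W_def W_H0_closed)
    have ws: "x + y \<in> W p" "pscale c x \<in> W p" if "x \<in> W p" "y \<in> W p" for x y c
      using that pm.subspace_add[OF subspace_W] pm.subspace_scale[OF subspace_W] by auto
    have eq: "?\<phi> (m, w) = (\<lambda>(m, w). ?f (m, w) \<oplus>\<^bsub>C ?r\<^esub> ?g (m, w)) (m, w)" if "m \<in> carrier M" "w \<in> W p" for m w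
      using s[OF that] by simp
    note D = balanced_mapD[OF cbal_add[OF f g]]
    show ?thesis
      unfolding balanced_map_def
    proof (intro conjI ballI allI)
      show "is_vector_space (C ?r)" by (rule C.vs)
    next
      fix m and w :: "('f, 'v, 'e) path_elt"
      assume m: "m \<in> carrier M" "w \<in> carrier (Wspace Q p)"
      then have w: "w \<in> W p" by simp
      show "?\<phi> (m, w) \<in> carrier (C ?r)" unfolding eq[OF m(1) w] by (rule D(2)[OF m])
      show "?\<phi> (m \<oplus>\<^bsub>M\<^esub> n, w) = ?\<phi> (m, w) \<oplus>\<^bsub>C ?r\<^esub> ?\<phi> (n, w)" if "n \<in> carrier M" for n
        unfolding eq[OF m(1) w] eq[OF that w] eq[OF M.a_closed[OF m(1) that] w] by (rule D(3)[OF m(1) that m(2)])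
      show "?\<phi> (m, w \<oplus>\<^bsub>Wspace Q p\<^esub> w') = ?\<phi> (m, w) \<oplus>\<^bsub>C ?r\<^esub> ?\<phi> (m, w')" if w': "w' \<in> carrier (Wspace Q p)" for w'
      proof -
        have "w' \<in> W p" "w \<oplus>\<^bsub>Wspace Q p\<^esub> w' \<in> W p" using ws w w' by auto
        then show ?thesis unfolding eq[OF m(1) w] eq[OF m(1) \<open>w' \<in> W p\<close>] eq[OF m(1) \<open>w \<oplus>\<^bsub>Wspace Q p\<^esub> w' \<in> W p\<close>] by (rule_tac D(4)[OF m w'])
      qed
      show "?\<phi> (c \<odot>\<^bsub>M\<^esub> m, w) = c \<odot>\<^bsub>C ?r\<^esub> ?\<phi> (m, w)" for c
        unfolding eq[OF m(1) w] eq[OF M.smult_in[OF m(1)] w] by (rule D(5)[OF m])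
      show "?\<phi> (m, c \<odot>\<^bsub>Wspace Q p\<^esub> w) = c \<odot>\<^bsub>C ?r\<^esub> ?\<phi> (m, w)" for c
      proof -
        have "c \<odot>\<^bsub>Wspace Q p\<^esub> w \<in> W p" using ws w by auto
        then show ?thesis unfolding eq[OF m(1) w] eq[OF m(1) \<open>c \<odot>\<^bsub>Wspace Q p\<^esub> w \<in> W p\<close>] by (rule_tac D(6)[OF m])
      qed
      show "?\<phi> ((case s' of (a, b) \<Rightarrow> Ae_right M m (rc a, rc b)), w) = ?\<phi> (m, ke_W s' w)" if s': "s' \<in> H 0 \<times> H 0" for s'
        unfolding eq[OF r[OF m(1) s'] w] eq[OF m(1) k[OF w s']] by (rule D(7)[OF m(1) s' m(2)])
    qed
  qed
  then show ?thesis
    by (intro exI conjI refl) (simp_all add: chain_d_def[abs_def] Let_def)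
qed

lemma cap_left_closed:
  assumes "acoch p f" "z \<in> carrier (C q)"
  shows "cap_left Q M p q f z \<in> carrier (C (q - p))"
proof -
  obtain \<phi> where \<phi>: "cbal q (C (q - p)) \<phi>" "cap_left Q M p q f = tensor_lift (C (q - p)) \<phi>"
    using cap_left_map[OF assms(1), of q] by (elim exE conjE)
  show ?thesis unfolding \<phi>(2) by (rule chain_lift(2)[OF \<phi>(1) assms(2)])
qed

lemma cap_right_closed:
  assumes "acoch p f" "z \<in> carrier (C q)"
  shows "cap_right Q M q p z f \<in> carrier (C (q - p))"
proof -
  obtain \<phi> where \<phi>: "cbal q (C (q - p)) \<phi>" "(\<lambda>z. cap_right Q M q p z f) = tensor_lift (C (q - p)) \<phi>"
    using cap_right_map[OF assms(1), of q] by (elim exE conjE)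
  show ?thesis using fun_cong[OF \<phi>(2), of z] chain_lift(2)[OF \<phi>(1) assms(2)] by simp
qed

lemma chain_d_closed:
  assumes "z \<in> carrier (C p)"
  shows "chain_d Q M p z \<in> carrier (C (p - 1))"
proof -
  obtain \<phi> where \<phi>: "cbal p (C (p - 1)) \<phi>" "chain_d Q M p = tensor_lift (C (p - 1)) \<phi>"
    using chain_d_map[of p] by (elim exE conjE)
  show ?thesis unfolding \<phi>(2) by (rule chain_lift(2)[OF \<phi>(1) assms])
qed

lemma chain_d_zero: "chain_d Q M p \<zero>\<^bsub>C p\<^esub> = \<zero>\<^bsub>C (p - 1)\<^esub>"
proof -
  obtain \<phi> where \<phi>: "cbal p (C (p - 1)) \<phi>" "chain_d Q M p = tensor_lift (C (p - 1)) \<phi>"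
    using chain_d_map[of p] by (elim exE conjE)
  show ?thesis unfolding \<phi>(2) by (rule chain_lift(5)[OF \<phi>(1)])
qed

lemma cap_left_finsum:
  assumes "acoch p f" "finite S" "\<And>i. i \<in> S \<Longrightarrow> m i \<in> carrier M" "\<And>i. i \<in> S \<Longrightarrow> w i \<in> W q"
  shows "cap_left Q M p q f (\<Oplus>\<^bsub>C q\<^esub>i\<in>S. ch q (m i) (w i)) = (\<Oplus>\<^bsub>C (q - p)\<^esub>i\<in>S. ((-1) powi ((q - p) * p)) \<odot>\<^bsub>C (q - p)\<^esub>
       split_sum Q (C (q - p)) (q - p) p (\<lambda>(u, v). ch (q - p) (lact M (f v) (m i)) u) (w i))"
proof -
  obtain \<phi> where \<phi>: "cbal q (C (q - p)) \<phi>" "cap_left Q M p q f = tensor_lift (C (q - p)) \<phi>"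
    "\<phi> = (\<lambda>(m, w). ((-1) powi ((q - p) * p)) \<odot>\<^bsub>C (q - p)\<^esub>
       split_sum Q (C (q - p)) (q - p) p (\<lambda>(u, v). ch (q - p) (lact M (f v) m) u) w)"
    using cap_left_map[OF assms(1), of q] by (elim exE conjE)
  have "cap_left Q M p q f (\<Oplus>\<^bsub>C q\<^esub>i\<in>S. ch q (m i) (w i)) = (\<Oplus>\<^bsub>C (q - p)\<^esub>i\<in>S. tensor_lift (C (q - p)) \<phi> (ch q (m i) (w i)))"
    unfolding \<phi>(2) using assms by (intro chain_lift(6)[OF \<phi>(1)]) auto
  also have "\<dots> = (\<Oplus>\<^bsub>C (q - p)\<^esub>i\<in>S. \<phi> (m i, w i))"
    using assms balanced_mapD(2)[OF \<phi>(1)] by (intro C.finsum_cong') (auto simp: chain_lift(1)[OF \<phi>(1)])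
  finally show ?thesis by (simp add: \<phi>(3))
qed

lemma cap_right_finsum:
  assumes "acoch p f" "finite S" "\<And>i. i \<in> S \<Longrightarrow> m i \<in> carrier M" "\<And>i. i \<in> S \<Longrightarrow> w i \<in> W q"
  shows "cap_right Q M q p (\<Oplus>\<^bsub>C q\<^esub>i\<in>S. ch q (m i) (w i)) f = (\<Oplus>\<^bsub>C (q - p)\<^esub>i\<in>S. ((-1) powi (p * q)) \<odot>\<^bsub>C (q - p)\<^esub>
       split_sum Q (C (q - p)) p (q - p) (\<lambda>(u, v). ch (q - p) (ract M (m i) (f u)) v) (w i))"
proof -
  obtain \<phi> where \<phi>: "cbal q (C (q - p)) \<phi>" "(\<lambda>z. cap_right Q M q p z f) = tensor_lift (C (q - p)) \<phi>"
    "\<phi> = (\<lambda>(m, w). ((-1) powi (p * q)) \<odot>\<^bsub>C (q - p)\<^esub>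
       split_sum Q (C (q - p)) p (q - p) (\<lambda>(u, v). ch (q - p) (ract M m (f u)) v) w)"
    using cap_right_map[OF assms(1), of q] by (elim exE conjE)
  have "cap_right Q M q p (\<Oplus>\<^bsub>C q\<^esub>i\<in>S. ch q (m i) (w i)) f = (\<Oplus>\<^bsub>C (q - p)\<^esub>i\<in>S. tensor_lift (C (q - p)) \<phi> (ch q (m i) (w i)))"
    using fun_cong[OF \<phi>(2), of "\<Oplus>\<^bsub>C q\<^esub>i\<in>S. ch q (m i) (w i)"] chain_lift(6)[OF \<phi>(1) assms(2), of "\<lambda>i. ch q (m i) (w i)"] assms by simp
  also have "\<dots> = (\<Oplus>\<^bsub>C (q - p)\<^esub>i\<in>S. \<phi> (m i, w i))"
    using assms balanced_mapD(2)[OF \<phi>(1)] by (intro C.finsum_cong') (auto simp: chain_lift(1)[OF \<phi>(1)])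
  finally show ?thesis by (simp add: \<phi>(3))
qed

lemma chain_d_finsum:
  assumes "finite S" "\<And>i. i \<in> S \<Longrightarrow> m i \<in> carrier M" "\<And>i. i \<in> S \<Longrightarrow> w i \<in> W p"
  shows "chain_d Q M p (\<Oplus>\<^bsub>C p\<^esub>i\<in>S. ch p (m i) (w i)) = (\<Oplus>\<^bsub>C (p - 1)\<^esub>i\<in>S.
      split_sum Q (C (p - 1)) 1 (p - 1) (\<lambda>(x, u). ch (p - 1) (ract M (m i) (rc x)) u) (w i) \<oplus>\<^bsub>C (p - 1)\<^esub>
      ((-1) powi p) \<odot>\<^bsub>C (p - 1)\<^esub> split_sum Q (C (p - 1)) (p - 1) 1 (\<lambda>(u, x). ch (p - 1) (lact M (rc x) (m i)) u) (w i))"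
proof -
  obtain \<phi> where \<phi>: "cbal p (C (p - 1)) \<phi>" "chain_d Q M p = tensor_lift (C (p - 1)) \<phi>"
    "\<phi> = (\<lambda>(m, w). split_sum Q (C (p - 1)) 1 (p - 1) (\<lambda>(x, u). ch (p - 1) (ract M m (rc x)) u) w \<oplus>\<^bsub>C (p - 1)\<^esub>
      ((-1) powi p) \<odot>\<^bsub>C (p - 1)\<^esub> split_sum Q (C (p - 1)) (p - 1) 1 (\<lambda>(u, x). ch (p - 1) (lact M (rc x) m) u) w)"
    using chain_d_map[of p] by (elim exE conjE)
  have "chain_d Q M p (\<Oplus>\<^bsub>C p\<^esub>i\<in>S. ch p (m i) (w i)) = (\<Oplus>\<^bsub>C (p - 1)\<^esub>i\<in>S. tensor_lift (C (p - 1)) \<phi> (ch p (m i) (w i)))"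
    unfolding \<phi>(2) using assms by (intro chain_lift(6)[OF \<phi>(1)]) auto
  also have "\<dots> = (\<Oplus>\<^bsub>C (p - 1)\<^esub>i\<in>S. \<phi> (m i, w i))"
    using assms balanced_mapD(2)[OF \<phi>(1)] by (intro C.finsum_cong') (auto simp: chain_lift(1)[OF \<phi>(1)])
  finally show ?thesis by (simp add: \<phi>(3))
qed

end

context koszul_bimodule
begin

subsection \<open>The duality map\<close>

definition dual :: "'v + 'e + 'e \<Rightarrow> 'v + 'e + 'e" where "dual = map_sum id star"

text \<open>The coefficient of \<open>bas p \<iota> \<star> bas (2 - p) (dual \<iota>)\<close> in
  the relations: \<open>arrow_sign a\<close> for an arrow, and 1 where the relation
  \<open>\<sigma> i\<close> stands next to an idempotent.\<close>

definition index_sign :: "'v + 'e + 'e \<Rightarrow> 'f" where "index_sign = case_sum (\<lambda>_. 1) arrow_sign"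

lemma dual_Ix: "\<iota> \<in> Ix p \<Longrightarrow> dual \<iota> \<in> Ix (2 - p)"
  by (erule Ix_cases) (auto simp: Ix_def dual_def)

lemma dual_dual [simp]: "dual (dual \<iota>) = \<iota>"
  by (cases \<iota>) (simp_all add: dual_def)

lemma tg_dual [simp]: "tg (dual \<iota>) = sc \<iota>" and sc_dual [simp]: "sc (dual \<iota>) = tg \<iota>"
  by (cases \<iota>; simp add: dual_def tg_def sc_def)+

lemma dual_image: "dual ` Ix p = Ix (2 - p)"
proof
  show "dual ` Ix p \<subseteq> Ix (2 - p)" using dual_Ix by blast
  show "Ix (2 - p) \<subseteq> dual ` Ix p"
  proof
    fix \<kappa> assume "\<kappa> \<in> Ix (2 - p)"
    then have "dual \<kappa> \<in> Ix p" using dual_Ix[of \<kappa> "2 - p"] by simp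
    then show "\<kappa> \<in> dual ` Ix p" by (metis dual_dual image_eqI)
  qed
qed

lemma inj_dual: "inj_on dual S"
  by (metis dual_dual inj_onI)

lemma index_sign_square [simp]: "index_sign \<iota> * index_sign \<iota> = 1"
  by (cases \<iota>) (simp_all add: index_sign_def)

text \<open>Each \<open>\<sigma> i\<close> is cut after its first \<open>p\<close> letters;
  \<open>f\<close> is applied to the left piece and the right piece is kept. For
  \<open>p = 0\<close> and \<open>p = 2\<close> the cut separates \<open>\<sigma> i\<close> from
  \<open>idem i\<close>.\<close>

definition theta :: "int \<Rightarrow> (('f, 'v, 'e) path_elt \<Rightarrow> 'm) \<Rightarrow> ('f, 'v, 'e, 'm) chain" where
  "theta p f = (\<Oplus>\<^bsub>C (2 - p)\<^esub>\<iota>\<in>Ix p. ch (2 - p) (index_sign \<iota> \<odot>\<^bsub>M\<^esub> f (bas p \<iota>)) (bas (2 - p) (dual \<iota>)))"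

lemma theta_term: "coch p f \<Longrightarrow> \<iota> \<in> Ix p \<Longrightarrow> ch (2 - p) (index_sign \<iota> \<odot>\<^bsub>M\<^esub> f (bas p \<iota>)) (bas (2 - p) (dual \<iota>)) \<in> carrier (C (2 - p))"
  by (simp add: bas_W dual_Ix)

lemma theta_closed: "coch p f \<Longrightarrow> theta p f \<in> carrier (C (2 - p))"
  unfolding theta_def by (intro C.finsum_closed) (auto simp: theta_term)

lemma theta_cong: "(\<And>\<iota>. \<iota> \<in> Ix p \<Longrightarrow> f (bas p \<iota>) = g (bas p \<iota>)) \<Longrightarrow> coch p g \<Longrightarrow> theta p f = theta p g"
  unfolding theta_def by (intro C.finsum_cong') (auto simp: theta_term)

lemma theta_restrict: "coch p f \<Longrightarrow> theta p (restrict f (W p)) = theta p f"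
  by (rule theta_cong) (simp_all add: bas_W)

lemma theta_add:
  assumes "coch p f" "coch p g"
  shows "theta p (\<lambda>w\<in>W p. f w \<oplus>\<^bsub>M\<^esub> g w) = theta p f \<oplus>\<^bsub>C (2 - p)\<^esub> theta p g"
proof -
  have "theta p (\<lambda>w\<in>W p. f w \<oplus>\<^bsub>M\<^esub> g w) = (\<Oplus>\<^bsub>C (2 - p)\<^esub>\<iota>\<in>Ix p.
      ch (2 - p) (index_sign \<iota> \<odot>\<^bsub>M\<^esub> f (bas p \<iota>)) (bas (2 - p) (dual \<iota>)) \<oplus>\<^bsub>C (2 - p)\<^esub> ch (2 - p) (index_sign \<iota> \<odot>\<^bsub>M\<^esub> g (bas p \<iota>)) (bas (2 - p) (dual \<iota>)))"
    unfolding theta_def using assms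
    by (intro C.finsum_cong') (auto simp: bas_W dual_Ix M.smult_distr_right ch_add_left)
  also have "\<dots> = theta p f \<oplus>\<^bsub>C (2 - p)\<^esub> theta p g"
    unfolding theta_def using assms by (intro C.finsum_addf) (auto simp: theta_term)
  finally show ?thesis .
qed

lemma theta_smult:
  assumes "coch p f"
  shows "theta p (\<lambda>w\<in>W p. c \<odot>\<^bsub>M\<^esub> f w) = c \<odot>\<^bsub>C (2 - p)\<^esub> theta p f"
proof -
  have "theta p (\<lambda>w\<in>W p. c \<odot>\<^bsub>M\<^esub> f w) = (\<Oplus>\<^bsub>C (2 - p)\<^esub>\<iota>\<in>Ix p.
      c \<odot>\<^bsub>C (2 - p)\<^esub> ch (2 - p) (index_sign \<iota> \<odot>\<^bsub>M\<^esub> f (bas p \<iota>)) (bas (2 - p) (dual \<iota>)))"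
    unfolding theta_def using assms
    by (intro C.finsum_cong') (auto simp: bas_W dual_Ix M.smult_smult ch_smult_left C.smult_smult mult.commute)
  also have "\<dots> = c \<odot>\<^bsub>C (2 - p)\<^esub> theta p f"
    unfolding theta_def using assms by (intro C.finsum_smult[symmetric]) (auto simp: theta_term)
  finally show ?thesis .
qed

text \<open>The Peirce component between the idempotents at target and source. A cochain can send
  \<open>bas p \<iota>\<close> nowhere else, and in a chain on
  \<open>bas (2 - p) (dual \<iota>)\<close> only this component of the coefficient matters.\<close>

definition corner :: "'v + 'e + 'e \<Rightarrow> 'm \<Rightarrow> 'm" where
  "corner \<iota> m = ract M (lact M (rc (idem (tg \<iota>))) m) (rc (idem (sc \<iota>)))"

lemma rc_idem [simp]: "i \<in> verts Q \<Longrightarrow> rc (idem i) \<in> carrier A"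
  by (intro rc_H0 idem_H)

lemma corner_closed [simp]: "\<iota> \<in> Ix p \<Longrightarrow> m \<in> carrier M \<Longrightarrow> corner \<iota> m \<in> carrier M"
  by (auto simp: corner_def dest!: Ix_verts)

lemma corner_add: "\<iota> \<in> Ix p \<Longrightarrow> m \<in> carrier M \<Longrightarrow> n \<in> carrier M \<Longrightarrow> corner \<iota> (m \<oplus>\<^bsub>M\<^esub> n) = corner \<iota> m \<oplus>\<^bsub>M\<^esub> corner \<iota> n"
  by (auto simp: corner_def lact_add ract_add dest!: Ix_verts)

lemma corner_smult: "\<iota> \<in> Ix p \<Longrightarrow> m \<in> carrier M \<Longrightarrow> corner \<iota> (c \<odot>\<^bsub>M\<^esub> m) = c \<odot>\<^bsub>M\<^esub> corner \<iota> m"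
  by (auto simp: corner_def lact_smult ract_smult dest!: Ix_verts)

lemma idem_H0: assumes "i \<in> verts Q" "b \<in> H 0"
  shows "idem i \<star> b = pscale (Poly_Mapping.lookup b (i, [], i)) (idem i)" "b \<star> idem i = pscale (Poly_Mapping.lookup b (i, [], i)) (idem i)"
proof -
  have I: "Inl i \<in> Ix 0" using assms by (simp add: Ix_def)
  show "idem i \<star> b = pscale (Poly_Mapping.lookup b (i, [], i)) (idem i)" "b \<star> idem i = pscale (Poly_Mapping.lookup b (i, [], i)) (idem i)"
    using bas_right[OF I assms(2)] bas_left[OF I assms(2)] by (simp_all add: bas_def sc_def tg_def)
qed

lemma idem_lookup: "Poly_Mapping.lookup (idem i) (i, [], i) = 1"
  by (simp add: idem_def)

lemma H0_PA: "a \<in> H 0 \<Longrightarrow> a \<in> carrier PA"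
  by (rule subsetD[OF H_subset])

lemma corner_lact:
  assumes "\<iota> \<in> Ix p" "m \<in> carrier M" "b \<in> H 0"
  shows "corner \<iota> (lact M (rc b) m) = Poly_Mapping.lookup b (tg \<iota>, [], tg \<iota>) \<odot>\<^bsub>M\<^esub> corner \<iota> m"
proof -
  have v: "tg \<iota> \<in> verts Q" "sc \<iota> \<in> verts Q" using Ix_verts[OF assms(1)] by auto
  have "lact M (rc (idem (tg \<iota>))) (lact M (rc b) m) = lact M (rc (idem (tg \<iota>) \<star> b)) m"
    using v assms by (simp add: rc_mult H0_PA idem_H lact_mult[OF rc_idem rc_H0])
  also have "\<dots> = Poly_Mapping.lookup b (tg \<iota>, [], tg \<iota>) \<odot>\<^bsub>M\<^esub> lact M (rc (idem (tg \<iota>))) m"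
    using v assms by (simp add: idem_H0 rc_pscale lact_smult_scalar)
  finally show ?thesis using v assms by (simp add: corner_def ract_smult)
qed

lemma corner_ract:
  assumes "\<iota> \<in> Ix p" "m \<in> carrier M" "a \<in> H 0"
  shows "corner \<iota> (ract M m (rc a)) = Poly_Mapping.lookup a (sc \<iota>, [], sc \<iota>) \<odot>\<^bsub>M\<^esub> corner \<iota> m"
proof -
  have v: "tg \<iota> \<in> verts Q" "sc \<iota> \<in> verts Q" using Ix_verts[OF assms(1)] by auto
  let ?n = "lact M (rc (idem (tg \<iota>))) m"
  have n: "?n \<in> carrier M" using v assms by simp
  have "corner \<iota> (ract M m (rc a)) = ract M (ract M ?n (rc a)) (rc (idem (sc \<iota>)))"
    unfolding corner_def using v assms by (simp add: ract_lact[OF rc_idem rc_H0])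
  also have "\<dots> = ract M ?n (rc (a \<star> idem (sc \<iota>)))"
    using v assms n by (simp add: rc_mult H0_PA idem_H ract_mult[OF rc_H0 rc_idem])
  also have "\<dots> = Poly_Mapping.lookup a (sc \<iota>, [], sc \<iota>) \<odot>\<^bsub>M\<^esub> corner \<iota> m"
    using v assms n by (simp add: idem_H0 rc_pscale ract_smult_scalar corner_def)
  finally show ?thesis .
qed

lemma corner_corner: assumes "\<iota> \<in> Ix p" "m \<in> carrier M"
  shows "corner \<iota> (corner \<iota> m) = corner \<iota> m"
proof -
  have v: "tg \<iota> \<in> verts Q" "sc \<iota> \<in> verts Q" using Ix_verts[OF assms(1)] by auto
  note cl = corner_closed[OF assms(1)]
  have "corner \<iota> (corner \<iota> m) = corner \<iota> (lact M (rc (idem (tg \<iota>))) m)"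
    unfolding corner_def[of \<iota> m] using assms v by (subst corner_ract[OF assms(1)]) (simp_all add: idem_H idem_lookup cl)
  also have "\<dots> = corner \<iota> m"
    using assms v by (subst corner_lact[OF assms(1)]) (simp_all add: idem_H idem_lookup cl)
  finally show ?thesis .
qed

lemma corner_coch: "coch p f \<Longrightarrow> \<iota> \<in> Ix p \<Longrightarrow> corner \<iota> (f (bas p \<iota>)) = f (bas p \<iota>)"
  by (simp add: corner_def coch_bas_left coch_bas_right)

text \<open>A coordinate on chains with values in \<open>M\<close>. Projecting to the corner is what
  makes the underlying map balanced over \<open>k^e\<close>: the left and right actions of
  \<open>k\<close> on \<open>m\<close> become the scalars by which \<open>k\<close> acts on
  \<open>w\<close>.\<close>

definition coefficient :: "int \<Rightarrow> 'v + 'e + 'e \<Rightarrow> ('f, 'v, 'e, 'm) chain \<Rightarrow> 'm" where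
  "coefficient p \<iota> = tensor_lift M (\<lambda>(m, w). co (2 - p) (dual \<iota>) w \<odot>\<^bsub>M\<^esub> corner \<iota> m)"

lemma cbal_coefficient:
  assumes "\<iota> \<in> Ix p"
  shows "cbal (2 - p) M (\<lambda>(m, w). co (2 - p) (dual \<iota>) w \<odot>\<^bsub>M\<^esub> corner \<iota> m)"
proof (rule cbalI, simp_all only: split)
  fix m assume m: "m \<in> carrier M"
  show "linear_on (W (2 - p)) M (\<lambda>w. co (2 - p) (dual \<iota>) w \<odot>\<^bsub>M\<^esub> corner \<iota> m)"
    using assms m by (auto simp: linear_on_def M.vs subspace_W co_add co_pscale M.smult_distr_left M.smult_smult)
qed (use assms in \<open>simp_all add: M.vs corner_add corner_smult corner_lact corner_ract co_left co_right M.smult_distr_right M.smult_smult mult.commute\<close>)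

lemmas coefficient_lift = chain_lift[OF cbal_coefficient, folded coefficient_def]

lemma coefficient_corner:
  assumes "\<iota> \<in> Ix p" "z \<in> carrier (C (2 - p))"
  shows "corner \<iota> (coefficient p \<iota> z) = coefficient p \<iota> z"
  using assms(2)
proof (induction z rule: chains_induct)
  case zero
  then show ?case using assms(1) corner_smult[OF assms(1), of "\<zero>\<^bsub>M\<^esub>" 0] by (simp add: coefficient_lift(5))
next
  case (pure m w)
  then show ?case using assms(1) by (simp add: coefficient_lift(1) corner_smult corner_corner)
next
  case (add x y)
  then show ?case using assms(1) by (simp add: coefficient_lift(2,3) corner_add)
qed

text \<open>Cochain values already lie in their corners, so the projection in
  \<open>coefficient\<close> leaves them unchanged. As the sign is invertible, this yields
  injectivity of \<open>theta\<close>.\<close>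

lemma coefficient_theta:
  assumes "coch p f" "\<iota> \<in> Ix p"
  shows "coefficient p \<iota> (theta p f) = index_sign \<iota> \<odot>\<^bsub>M\<^esub> f (bas p \<iota>)"
proof -
  have "coefficient p \<iota> (theta p f) = (\<Oplus>\<^bsub>M\<^esub>\<kappa>\<in>Ix p. coefficient p \<iota> (ch (2 - p) (index_sign \<kappa> \<odot>\<^bsub>M\<^esub> f (bas p \<kappa>)) (bas (2 - p) (dual \<kappa>))))"
    unfolding theta_def using assms by (intro coefficient_lift(6)) (auto simp: theta_term)
  also have "\<dots> = (\<Oplus>\<^bsub>M\<^esub>\<kappa>\<in>Ix p. (if \<kappa> = \<iota> then 1 else 0) \<odot>\<^bsub>M\<^esub> (index_sign \<kappa> \<odot>\<^bsub>M\<^esub> f (bas p \<kappa>)))"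
  proof (rule M.finsum_cong')
    fix \<kappa> assume \<kappa>: "\<kappa> \<in> Ix p"
    have d: "dual \<iota> = dual \<kappa> \<longleftrightarrow> \<kappa> = \<iota>" by (metis dual_dual)
    have fc: "f (bas p \<kappa>) \<in> carrier M" using assms \<kappa> by (simp add: bas_W)
    have "coefficient p \<iota> (ch (2 - p) (index_sign \<kappa> \<odot>\<^bsub>M\<^esub> f (bas p \<kappa>)) (bas (2 - p) (dual \<kappa>))) =
        (if \<kappa> = \<iota> then 1 else 0) \<odot>\<^bsub>M\<^esub> corner \<iota> (index_sign \<kappa> \<odot>\<^bsub>M\<^esub> f (bas p \<kappa>))"
      using assms \<kappa> fc by (simp add: coefficient_lift(1) bas_W dual_Ix co_bas d)
    then show "coefficient p \<iota> (ch (2 - p) (index_sign \<kappa> \<odot>\<^bsub>M\<^esub> f (bas p \<kappa>)) (bas (2 - p) (dual \<kappa>))) =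
        (if \<kappa> = \<iota> then 1 else 0) \<odot>\<^bsub>M\<^esub> (index_sign \<kappa> \<odot>\<^bsub>M\<^esub> f (bas p \<kappa>))"
      using assms \<kappa> fc by (auto simp: corner_smult corner_coch)
  qed (use assms in \<open>auto simp: bas_W\<close>)
  also have "\<dots> = index_sign \<iota> \<odot>\<^bsub>M\<^esub> f (bas p \<iota>)"
    using assms by (intro M.finsum_delta) (auto simp: bas_W)
  finally show ?thesis .
qed

text \<open>Expanding \<open>w\<close> in the basis of \<open>W (2 - p)\<close> brings a pure chain
  into this shape, and both sides are additive. This is the source of surjectivity of
  \<open>theta\<close>.\<close>

lemma reconstruct:
  assumes "z \<in> carrier (C (2 - p))"
  shows "(\<Oplus>\<^bsub>C (2 - p)\<^esub>\<iota>\<in>Ix p. ch (2 - p) (coefficient p \<iota> z) (bas (2 - p) (dual \<iota>))) = z"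
  using assms
proof (induction z rule: chains_induct)
  case zero
  have "(\<Oplus>\<^bsub>C (2 - p)\<^esub>\<iota>\<in>Ix p. ch (2 - p) (coefficient p \<iota> \<zero>\<^bsub>C (2 - p)\<^esub>) (bas (2 - p) (dual \<iota>))) = (\<Oplus>\<^bsub>C (2 - p)\<^esub>\<iota>\<in>Ix p. \<zero>\<^bsub>C (2 - p)\<^esub>)"
    by (intro C.finsum_cong') (auto simp: coefficient_lift(5) ch_zero_left bas_W dual_Ix)
  then show ?case by simp
next
  case (pure m w)
  have cl: "coefficient p \<iota> (ch (2 - p) m w) \<in> carrier M" if "\<iota> \<in> Ix p" for \<iota>
    using that pure by (simp add: coefficient_lift(2))
  have "(\<Oplus>\<^bsub>C (2 - p)\<^esub>\<iota>\<in>Ix p. ch (2 - p) (coefficient p \<iota> (ch (2 - p) m w)) (bas (2 - p) (dual \<iota>))) =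
      (\<Oplus>\<^bsub>C (2 - p)\<^esub>\<iota>\<in>Ix p. ch (2 - p) m (pscale (co (2 - p) (dual \<iota>) w) (bas (2 - p) (dual \<iota>))))"
  proof (rule C.finsum_cong')
    fix \<iota> assume \<iota>: "\<iota> \<in> Ix p"
    note b = bas_W[OF dual_Ix[OF \<iota>]] and v = Ix_verts[OF \<iota>]
    \<comment> \<open>The idempotents of the corner move across the tensor sign and are absorbed by
      the basis element, since \<open>dual\<close> interchanges source and target.\<close>
    have "ch (2 - p) (corner \<iota> m) (bas (2 - p) (dual \<iota>)) = ch (2 - p) m (bas (2 - p) (dual \<iota>))"
      unfolding corner_def using pure b v dual_Ix[OF \<iota>] by (subst ch_balanced) (simp_all add: idem_H idem_mult_bas)
    then show "ch (2 - p) (coefficient p \<iota> (ch (2 - p) m w)) (bas (2 - p) (dual \<iota>)) =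
        ch (2 - p) m (pscale (co (2 - p) (dual \<iota>) w) (bas (2 - p) (dual \<iota>)))"
      using pure \<iota> b by (simp add: coefficient_lift(1) ch_smult_left linear_on_pscale[OF ch_linear])
  qed (use pure pm.subspace_scale[OF subspace_W] bas_W dual_Ix in auto)
  also have "\<dots> = (\<Oplus>\<^bsub>C (2 - p)\<^esub>\<kappa>\<in>dual ` Ix p. ch (2 - p) m (pscale (co (2 - p) \<kappa> w) (bas (2 - p) \<kappa>)))"
    using pure pm.subspace_scale[OF subspace_W] bas_W dual_Ix
    by (intro C.finsum_reindex'[symmetric] inj_dual) auto
  also have "\<dots> = ch (2 - p) m (\<Sum>\<kappa>\<in>Ix (2 - p). pscale (co (2 - p) \<kappa> w) (bas (2 - p) \<kappa>))"
    unfolding dual_image using pure pm.subspace_scale[OF subspace_W] bas_W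
    by (intro linear_on_sum[OF ch_linear, symmetric]) auto
  also have "\<dots> = ch (2 - p) m w" using bas_expand[OF pure(2)] by simp
  finally show ?case .
next
  case (add x y)
  have "(\<Oplus>\<^bsub>C (2 - p)\<^esub>\<iota>\<in>Ix p. ch (2 - p) (coefficient p \<iota> (x \<oplus>\<^bsub>C (2 - p)\<^esub> y)) (bas (2 - p) (dual \<iota>))) =
      (\<Oplus>\<^bsub>C (2 - p)\<^esub>\<iota>\<in>Ix p. ch (2 - p) (coefficient p \<iota> x) (bas (2 - p) (dual \<iota>)) \<oplus>\<^bsub>C (2 - p)\<^esub> ch (2 - p) (coefficient p \<iota> y) (bas (2 - p) (dual \<iota>)))"
    using add by (intro C.finsum_cong') (auto simp: coefficient_lift(2,3) ch_add_left bas_W dual_Ix)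
  also have "\<dots> = (\<Oplus>\<^bsub>C (2 - p)\<^esub>\<iota>\<in>Ix p. ch (2 - p) (coefficient p \<iota> x) (bas (2 - p) (dual \<iota>))) \<oplus>\<^bsub>C (2 - p)\<^esub>
      (\<Oplus>\<^bsub>C (2 - p)\<^esub>\<iota>\<in>Ix p. ch (2 - p) (coefficient p \<iota> y) (bas (2 - p) (dual \<iota>)))"
    using add by (intro C.finsum_addf) (auto simp: coefficient_lift(2) bas_W dual_Ix)
  finally show ?case using add by simp
qed

text \<open>The coordinate of a chain is used as the value on a basis element; the index sign recurs
  because it is its own inverse.\<close>

definition theta_inv :: "int \<Rightarrow> ('f, 'v, 'e, 'm) chain \<Rightarrow> ('f, 'v, 'e) path_elt \<Rightarrow> 'm" where
  "theta_inv p z = (\<lambda>u. \<Oplus>\<^bsub>M\<^esub>\<iota>\<in>Ix p. co p \<iota> u \<odot>\<^bsub>M\<^esub> (index_sign \<iota> \<odot>\<^bsub>M\<^esub> coefficient p \<iota> z))"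

lemma theta_inv_bas:
  assumes "z \<in> carrier (C (2 - p))" "\<kappa> \<in> Ix p"
  shows "theta_inv p z (bas p \<kappa>) = index_sign \<kappa> \<odot>\<^bsub>M\<^esub> coefficient p \<kappa> z"
proof -
  have "theta_inv p z (bas p \<kappa>) = (\<Oplus>\<^bsub>M\<^esub>\<iota>\<in>Ix p. (if \<iota> = \<kappa> then 1 else 0) \<odot>\<^bsub>M\<^esub> (index_sign \<iota> \<odot>\<^bsub>M\<^esub> coefficient p \<iota> z))"
    unfolding theta_inv_def using assms by (intro M.finsum_cong') (auto simp: co_bas coefficient_lift(2))
  also have "\<dots> = index_sign \<kappa> \<odot>\<^bsub>M\<^esub> coefficient p \<kappa> z"
    using assms by (intro M.finsum_delta) (auto simp: coefficient_lift(2))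
  finally show ?thesis .
qed

text \<open>It is enough to test \<open>k\<close>-linearity on the basis. There the value lies in
  its corner, so an element of \<open>k\<close> acts on it by the same scalar as on the basis
  element.\<close>

lemma coch_theta_inv:
  assumes z: "z \<in> carrier (C (2 - p))"
  shows "coch p (theta_inv p z)"
proof -
  have lin: "linear_on (W p) M (theta_inv p z)"
    unfolding theta_inv_def
  proof (rule linear_on_finsum)
    fix \<iota> assume "\<iota> \<in> Ix p"
    then show "linear_on (W p) M (\<lambda>u. co p \<iota> u \<odot>\<^bsub>M\<^esub> (index_sign \<iota> \<odot>\<^bsub>M\<^esub> coefficient p \<iota> z))"
      using z by (auto simp: linear_on_def M.vs subspace_W co_add co_pscale M.smult_distr_left M.smult_smult coefficient_lift(2) mult.assoc distrib_right)
  qed (simp_all add: M.vs subspace_W)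
  show ?thesis unfolding coch_def
  proof (intro conjI lin ballI)
    fix a w assume a: "a \<in> H 0" and w: "w \<in> W p"
    note cl = linear_on_closed[OF lin]
    show "theta_inv p z (a \<star> w) = lact M (rc a) (theta_inv p z w)"
    proof (rule linear_eq_bas[where p = p and w = w and V = M, OF _ _ _ w])
      show "linear_on (W p) M (\<lambda>w. theta_inv p z (a \<star> w))"
        using lin a by (auto simp: linear_on_def path_mult_add_right path_mult_pscale_right W_H0_closed Pi_iff)
      show "linear_on (W p) M (\<lambda>w. lact M (rc a) (theta_inv p z w))"
        using lin rc_H0[OF a] by (auto simp: linear_on_def lact_add lact_smult Pi_iff)
      fix \<iota> assume \<iota>: "\<iota> \<in> Ix p"
      let ?x = "index_sign \<iota> \<odot>\<^bsub>M\<^esub> coefficient p \<iota> z"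
      have c: "coefficient p \<iota> z \<in> carrier M" using z \<iota> by (simp add: coefficient_lift(2))
      have x: "?x = corner \<iota> ?x" "?x \<in> carrier M" using z \<iota> c by (simp_all add: corner_smult coefficient_corner)
      have v: "tg \<iota> \<in> verts Q" "sc \<iota> \<in> verts Q" using Ix_verts[OF \<iota>] by auto
      have e: "lact M (rc (idem (tg \<iota>))) ?x = ?x"
      proof -
        let ?n = "ract M ?x (rc (idem (sc \<iota>)))"
        have n: "?n \<in> carrier M" using x v by simp
        have e1: "?x = lact M (rc (idem (tg \<iota>))) ?n" using x v by (simp add: corner_def ract_lact[OF rc_idem rc_idem])
        have "lact M (rc (idem (tg \<iota>))) (lact M (rc (idem (tg \<iota>))) ?n) = lact M (rc (idem (tg \<iota>) \<star> idem (tg \<iota>))) ?n"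
          using v n by (simp add: rc_mult H0_PA idem_H lact_mult[OF rc_idem rc_idem])
        also have "idem (tg \<iota>) \<star> idem (tg \<iota>) = idem (tg \<iota>)" by (simp add: idem_def)
        finally show ?thesis using e1 by simp
      qed
      have "lact M (rc a) ?x = lact M (rc (a \<star> idem (tg \<iota>))) ?x"
        using v x e a by (simp add: rc_mult H0_PA idem_H lact_mult[OF rc_H0 rc_idem])
      also have "\<dots> = Poly_Mapping.lookup a (tg \<iota>, [], tg \<iota>) \<odot>\<^bsub>M\<^esub> ?x"
        using v x e a by (simp add: idem_H0 rc_pscale lact_smult_scalar)
      finally show "theta_inv p z (a \<star> bas p \<iota>) = lact M (rc a) (theta_inv p z (bas p \<iota>))"
        using \<iota> a by (simp add: bas_left linear_on_pscale[OF lin] bas_W theta_inv_bas[OF z])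
    qed
    show "theta_inv p z (w \<star> a) = ract M (theta_inv p z w) (rc a)"
    proof (rule linear_eq_bas[where p = p and w = w and V = M, OF _ _ _ w])
      show "linear_on (W p) M (\<lambda>w. theta_inv p z (w \<star> a))"
        using lin a by (auto simp: linear_on_def path_mult_add_left path_mult_pscale_left W_H0_closed Pi_iff)
      show "linear_on (W p) M (\<lambda>w. ract M (theta_inv p z w) (rc a))"
        using lin rc_H0[OF a] by (auto simp: linear_on_def ract_add ract_smult Pi_iff)
      fix \<iota> assume \<iota>: "\<iota> \<in> Ix p"
      let ?x = "index_sign \<iota> \<odot>\<^bsub>M\<^esub> coefficient p \<iota> z"
      have c: "coefficient p \<iota> z \<in> carrier M" using z \<iota> by (simp add: coefficient_lift(2))
      have x: "?x = corner \<iota> ?x" "?x \<in> carrier M" using z \<iota> c by (simp_all add: corner_smult coefficient_corner)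
      have v: "tg \<iota> \<in> verts Q" "sc \<iota> \<in> verts Q" using Ix_verts[OF \<iota>] by auto
      have e: "ract M ?x (rc (idem (sc \<iota>))) = ?x"
      proof -
        let ?n = "lact M (rc (idem (tg \<iota>))) ?x"
        have n: "?n \<in> carrier M" using x v by simp
        have e1: "?x = ract M ?n (rc (idem (sc \<iota>)))" using x v by (simp add: corner_def)
        have "ract M (ract M ?n (rc (idem (sc \<iota>)))) (rc (idem (sc \<iota>))) = ract M ?n (rc (idem (sc \<iota>) \<star> idem (sc \<iota>)))"
          using v n by (simp add: rc_mult H0_PA idem_H ract_mult[OF rc_idem rc_idem])
        also have "idem (sc \<iota>) \<star> idem (sc \<iota>) = idem (sc \<iota>)" by (simp add: idem_def)
        finally show ?thesis using e1 by simp
      qed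
      have "ract M ?x (rc a) = ract M ?x (rc (idem (sc \<iota>) \<star> a))"
        using v x e a by (simp add: rc_mult H0_PA idem_H ract_mult[OF rc_idem rc_H0])
      also have "\<dots> = Poly_Mapping.lookup a (sc \<iota>, [], sc \<iota>) \<odot>\<^bsub>M\<^esub> ?x"
        using v x e a by (simp add: idem_H0 rc_pscale ract_smult_scalar)
      finally show "theta_inv p z (bas p \<iota> \<star> a) = ract M (theta_inv p z (bas p \<iota>)) (rc a)"
        using \<iota> a by (simp add: bas_right linear_on_pscale[OF lin] bas_W theta_inv_bas[OF z])
    qed
  qed
qed

lemma theta_theta_inv:
  assumes z: "z \<in> carrier (C (2 - p))"
  shows "theta p (theta_inv p z) = z"
proof -
  have "theta p (theta_inv p z) = (\<Oplus>\<^bsub>C (2 - p)\<^esub>\<iota>\<in>Ix p. ch (2 - p) (coefficient p \<iota> z) (bas (2 - p) (dual \<iota>)))"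
    unfolding theta_def using z
    by (intro C.finsum_cong') (auto simp: theta_inv_bas M.smult_smult coefficient_lift(2) bas_W dual_Ix)
  then show ?thesis using reconstruct[OF z] by simp
qed

lemma theta_bij: "bij_betw (theta p) (carrier (cochains Q M p)) (carrier (C (2 - p)))"
  unfolding bij_betw_def
proof
  show "inj_on (theta p) (carrier (cochains Q M p))"
  proof (rule inj_onI)
    fix f g assume f: "f \<in> carrier (cochains Q M p)" and g: "g \<in> carrier (cochains Q M p)" and eq: "theta p f = theta p g"
    show "f = g"
    proof (rule cochains_eqI[OF f g])
      fix \<iota> assume \<iota>: "\<iota> \<in> Ix p"
      have cf: "coch p f" "coch p g" using f g by (auto simp: cochains_iff)
      then have "index_sign \<iota> \<odot>\<^bsub>M\<^esub> f (bas p \<iota>) = index_sign \<iota> \<odot>\<^bsub>M\<^esub> g (bas p \<iota>)"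
        using coefficient_theta[of p _ \<iota>] eq \<iota> by metis
      then have "index_sign \<iota> \<odot>\<^bsub>M\<^esub> (index_sign \<iota> \<odot>\<^bsub>M\<^esub> f (bas p \<iota>)) = index_sign \<iota> \<odot>\<^bsub>M\<^esub> (index_sign \<iota> \<odot>\<^bsub>M\<^esub> g (bas p \<iota>))" by simp
      then show "f (bas p \<iota>) = g (bas p \<iota>)" using cf \<iota> by (simp add: M.smult_smult bas_W)
    qed
  qed
  show "theta p ` carrier (cochains Q M p) = carrier (C (2 - p))"
  proof
    show "theta p ` carrier (cochains Q M p) \<subseteq> carrier (C (2 - p))"
      by (auto simp: cochains_iff theta_closed)
    show "carrier (C (2 - p)) \<subseteq> theta p ` carrier (cochains Q M p)"
    proof
      fix z assume z: "z \<in> carrier (C (2 - p))"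
      have "theta p (restrict (theta_inv p z) (W p)) = z"
        using theta_restrict[OF coch_theta_inv[OF z]] theta_theta_inv[OF z] by simp
      then show "z \<in> theta p ` carrier (cochains Q M p)"
        using coch_restrict[OF coch_theta_inv[OF z]] by force
    qed
  qed
qed

end

section \<open>The duality in each degree, and cup and cap products from the left\<close>

context koszul_bimodule
begin

lemma finsum_arcs_group:
  assumes "vspace V" "\<And>a. a \<in> arcs D \<Longrightarrow> X a \<in> carrier V"
  shows "(\<Oplus>\<^bsub>V\<^esub>i\<in>verts Q. \<Oplus>\<^bsub>V\<^esub>a\<in>{a \<in> arcs D. head D a = i}. X a) = (\<Oplus>\<^bsub>V\<^esub>a\<in>arcs D. X a)"
  using assms by (intro vspace.finsum_group) auto

text \<open>Reindexing by the involution. Summands carrying \<open>arrow_sign a\<close> change sign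
  under it, and all sign corrections below arise in this way.\<close>

lemma finsum_arcs_star:
  assumes "vspace V" "\<And>a. a \<in> arcs D \<Longrightarrow> X a \<in> carrier V"
  shows "(\<Oplus>\<^bsub>V\<^esub>a\<in>arcs D. X a) = (\<Oplus>\<^bsub>V\<^esub>a\<in>arcs D. X (star a))"
proof -
  have "star ` arcs D = arcs D"
  proof
    show "arcs D \<subseteq> star ` arcs D"
    proof
      fix a assume "a \<in> arcs D"
      then have "star a \<in> arcs D" "a = star (star a)" by simp_all
      then show "a \<in> star ` arcs D" by blast
    qed
  qed auto
  moreover have "inj_on star (arcs D)" by (metis inj_onI star_star)
  ultimately show ?thesis
    using vspace.finsum_reindex'[OF assms(1), of star "arcs D" X] assms(2) by simp
qed

lemma theta_0:
  assumes "coch 0 f"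
  shows "theta 0 f = (\<Oplus>\<^bsub>C 2\<^esub>i\<in>verts Q. ch 2 (f (idem i)) (\<sigma> i))"
proof -
  let ?t = "\<lambda>\<iota>. ch 2 (index_sign \<iota> \<odot>\<^bsub>M\<^esub> f (bas 0 \<iota>)) (bas 2 (dual \<iota>))"
  have "theta 0 f = (\<Oplus>\<^bsub>C 2\<^esub>\<iota>\<in>Inl ` verts Q. ?t \<iota>)" by (simp add: theta_def Ix_def)
  also have "\<dots> = (\<Oplus>\<^bsub>C 2\<^esub>i\<in>verts Q. ?t (Inl i))"
    using theta_term[OF assms] by (intro C.finsum_reindex') (auto simp: Ix_def)
  also have "\<dots> = (\<Oplus>\<^bsub>C 2\<^esub>i\<in>verts Q. ch 2 (f (idem i)) (\<sigma> i))"
    using assms by (intro C.finsum_cong') (auto simp: index_sign_def dual_def bas_def idem_H W_0 W_2 sigma_R)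
  finally show ?thesis .
qed

lemma theta_1:
  assumes "coch 1 f"
  shows "theta 1 f = (\<Oplus>\<^bsub>C 1\<^esub>a\<in>arcs D. ch 1 (arrow_sign a \<odot>\<^bsub>M\<^esub> f (arrow a)) (arrow (star a)))"
proof -
  let ?t = "\<lambda>\<iota>. ch 1 (index_sign \<iota> \<odot>\<^bsub>M\<^esub> f (bas 1 \<iota>)) (bas 1 (dual \<iota>))"
  have "theta 1 f = (\<Oplus>\<^bsub>C 1\<^esub>\<iota>\<in>Inr ` arcs D. ?t \<iota>)" by (simp add: theta_def Ix_def)
  also have "\<dots> = (\<Oplus>\<^bsub>C 1\<^esub>a\<in>arcs D. ?t (Inr a))"
    using theta_term[OF assms] by (intro C.finsum_reindex') (auto simp: Ix_def)
  also have "\<dots> = (\<Oplus>\<^bsub>C 1\<^esub>a\<in>arcs D. ch 1 (arrow_sign a \<odot>\<^bsub>M\<^esub> f (arrow a)) (arrow (star a)))"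
    using assms by (intro C.finsum_cong') (auto simp: index_sign_def dual_def bas_def arrow_W)
  finally show ?thesis .
qed

lemma theta_2:
  assumes "coch 2 f"
  shows "theta 2 f = (\<Oplus>\<^bsub>C 0\<^esub>i\<in>verts Q. ch 0 (f (\<sigma> i)) (idem i))"
proof -
  let ?t = "\<lambda>\<iota>. ch 0 (index_sign \<iota> \<odot>\<^bsub>M\<^esub> f (bas 2 \<iota>)) (bas 0 (dual \<iota>))"
  have "theta 2 f = (\<Oplus>\<^bsub>C 0\<^esub>\<iota>\<in>Inl ` verts Q. ?t \<iota>)" by (simp add: theta_def Ix_def)
  also have "\<dots> = (\<Oplus>\<^bsub>C 0\<^esub>i\<in>verts Q. ?t (Inl i))"
    using theta_term[OF assms] by (intro C.finsum_reindex') (auto simp: Ix_def)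
  also have "\<dots> = (\<Oplus>\<^bsub>C 0\<^esub>i\<in>verts Q. ch 0 (f (\<sigma> i)) (idem i))"
    using assms by (intro C.finsum_cong') (auto simp: index_sign_def dual_def bas_def idem_H W_0 W_2 sigma_R)
  finally show ?thesis .
qed

lemma idem_W: "i \<in> verts Q \<Longrightarrow> idem i \<in> W 0"
  by (simp add: W_0 idem_H)

lemma sigma_W: "i \<in> verts Q \<Longrightarrow> \<sigma> i \<in> W 2"
  by (simp add: W_2 sigma_R)

lemma arrow_idem: "idem (head D a) \<star> arrow a = arrow a" "arrow a \<star> idem (tail D a) = arrow a"
  by (simp_all add: idem_def arrow_def)

lemma sigma_idem: "i \<in> verts Q \<Longrightarrow> idem i \<star> \<sigma> i = \<sigma> i" "i \<in> verts Q \<Longrightarrow> \<sigma> i \<star> idem i = \<sigma> i"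
  by (simp_all add: sigma_H0_left sigma_H0_right idem_H idem_lookup)

text \<open>A cochain of degree 0 is determined by its value at \<open>unit\<close>, which commutes
  with \<open>k\<close>. So its value at an idempotent may be cut from the left or from the
  right.\<close>

lemma coch_0_idem: assumes "coch 0 g" "i \<in> verts Q"
  shows "g (idem i) = lact M (rc (idem i)) (g unit)" "g (idem i) = ract M (g unit) (rc (idem i))"
  using coch_left[OF assms(1) idem_H[OF assms(2)] unit_W] coch_right[OF assms(1) idem_H[OF assms(2)] unit_W]
    unit_right[OF H0_PA[OF idem_H[OF assms(2)]]] unit_left[OF H0_PA[OF idem_H[OF assms(2)]]] by simp_all

text \<open>The idempotent at \<open>i\<close> is already contained in \<open>f w\<close>. This
  reconciles \<open>theta\<close>, which sees the values at \<open>idem i\<close>, with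
  \<open>split_sum\<close>, which splits off \<open>unit\<close>.\<close>

lemma lact_coch_0:
  assumes f: "acoch p f" and g: "coch 0 g" and w: "w \<in> W p" "i \<in> verts Q" "w \<star> idem i = w"
  shows "lact M (f w) (g (idem i)) = lact M (f w) (g unit)"
proof -
  have "lact M (f w) (g (idem i)) = lact M (f w \<otimes>\<^bsub>A\<^esub> rc (idem i)) (g unit)"
    using w coch_closed[OF g unit_W] by (simp add: coch_0_idem(1)[OF g] lact_mult[OF acoch_closed[OF f] rc_idem])
  also have "f w \<otimes>\<^bsub>A\<^esub> rc (idem i) = f w"
    using acoch_right[OF f idem_H[OF w(2)] w(1)] w(3) by simp
  finally show ?thesis .
qed

lemma ract_coch_0:
  assumes f: "acoch p f" and g: "coch 0 g" and w: "w \<in> W p" "i \<in> verts Q" "idem i \<star> w = w"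
  shows "ract M (g (idem i)) (f w) = ract M (g unit) (f w)"
proof -
  have "ract M (g (idem i)) (f w) = ract M (g unit) (rc (idem i) \<otimes>\<^bsub>A\<^esub> f w)"
    using w coch_closed[OF g unit_W] by (simp add: coch_0_idem(2)[OF g] ract_mult[OF rc_idem acoch_closed[OF f]])
  also have "rc (idem i) \<otimes>\<^bsub>A\<^esub> f w = f w"
    using acoch_left[OF f idem_H[OF w(2)] w(1)] w(3) by simp
  finally show ?thesis .
qed

text \<open>The counterpart for chains of degree 0: splitting off a factor produces
  \<open>unit\<close>, whereas \<open>theta 2\<close> is written with \<open>idem i\<close>.\<close>

lemma ch_unit:
  assumes "x \<in> carrier M" "i \<in> verts Q" "ract M x (rc (idem i)) = x"
  shows "ch 0 x unit = ch 0 x (idem i)"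
  using ch_ract[OF assms(1) unit_W idem_H[OF assms(2)]] assms(3) unit_right[OF H0_PA[OF idem_H[OF assms(2)]]] by simp

lemma ract_lact_idem:
  assumes f: "acoch p f" and g: "coch q g" and "u \<in> W p" and w: "w \<in> W q" "i \<in> verts Q" "w \<star> idem i = w"
  shows "ract M (lact M (f u) (g w)) (rc (idem i)) = lact M (f u) (g w)"
proof -
  have "ract M (g w) (rc (idem i)) = g w"
    using coch_right[OF g idem_H[OF w(2)] w(1)] w(3) by simp
  then show ?thesis using assms by (simp add: ract_lact[OF acoch_closed[OF f] rc_idem coch_closed[OF g]])
qed

lemma ract_ract_idem:
  assumes f: "acoch p f" and "x \<in> carrier M" and w: "w \<in> W p" "i \<in> verts Q" "w \<star> idem i = w"
  shows "ract M (ract M x (f w)) (rc (idem i)) = ract M x (f w)"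
  using ract_mult[OF acoch_closed[OF f w(1)] rc_idem[OF w(2)] assms(2)] acoch_right[OF f idem_H[OF w(2)] w(1)] w(3) by simp

text \<open>For a factor of degree 0 all signs are trivial and both products multiply the values by
  \<open>f unit\<close>, so the sums agree term by term in every degree \<open>q\<close>.\<close>

lemma theta_cup_left_0:
  assumes f: "acoch 0 f" and g: "g \<in> carrier (cochains Q M q)" and q: "0 \<le> q" "q \<le> 2"
  shows "theta q (cup_left Q M 0 q f g) = cap_left Q M 0 (2 - q) f (theta q g)"
proof -
  have cg: "coch q g" using g by (simp add: cochains_iff)
  have cc: "coch q (cup_left Q M 0 q f g)" using cup_left_closed[OF f g] by (simp add: cochains_iff)
  have val: "cup_left Q M 0 q f g w = ((-1) powi (0 * q)) \<odot>\<^bsub>M\<^esub> split_sum Q M 0 q (\<lambda>(u, v). lact M (f u) (g v)) w"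
    if "w \<in> W q" for w using that by (simp add: cup_left_def)
  have fu: "f unit \<in> carrier A" using acoch_closed[OF f unit_W] .
  have gb: "g (bas q \<iota>) \<in> carrier M" if "\<iota> \<in> Ix q" for \<iota> using coch_closed[OF cg bas_W[OF that]] .
  have db: "bas (2 - q) (dual \<iota>) \<in> W (2 - q)" if "\<iota> \<in> Ix q" for \<iota> using bas_W[OF dual_Ix[OF that]] .
  have v: "cup_left Q M 0 q f g (bas q \<iota>) = lact M (f unit) (g (bas q \<iota>))" if "\<iota> \<in> Ix q" for \<iota>
    using split_sum_left_unit[OF bal_lact[OF f cg] q(1) bas_W[OF that]] that fu gb by (simp add: val bas_W)
  have "cap_left Q M 0 (2 - q) f (theta q g) = (\<Oplus>\<^bsub>C (2 - q - 0)\<^esub>\<iota>\<in>Ix q. ((-1) powi ((2 - q - 0) * 0)) \<odot>\<^bsub>C (2 - q - 0)\<^esub>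
     split_sum Q (C (2 - q - 0)) (2 - q - 0) 0 (\<lambda>(u, v). ch (2 - q - 0) (lact M (f v) (index_sign \<iota> \<odot>\<^bsub>M\<^esub> g (bas q \<iota>))) u) (bas (2 - q) (dual \<iota>)))"
    unfolding theta_def by (rule cap_left_finsum[OF f]) (use gb db in auto)
  also have "\<dots> = (\<Oplus>\<^bsub>C (2 - q)\<^esub>\<iota>\<in>Ix q. ch (2 - q) (index_sign \<iota> \<odot>\<^bsub>M\<^esub> lact M (f unit) (g (bas q \<iota>))) (bas (2 - q) (dual \<iota>)))"
  proof (simp only: mult_zero_right diff_0_right power_int_0_right, rule C.finsum_cong')
    fix \<iota> assume \<iota>: "\<iota> \<in> Ix q"
    have m: "index_sign \<iota> \<odot>\<^bsub>M\<^esub> g (bas q \<iota>) \<in> carrier M" using gb[OF \<iota>] by simp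
    have "split_sum Q (C (2 - q)) (2 - q) 0 (\<lambda>(u, v). ch (2 - q) (lact M (f v) (index_sign \<iota> \<odot>\<^bsub>M\<^esub> g (bas q \<iota>))) u) (bas (2 - q) (dual \<iota>)) =
      ch (2 - q) (lact M (f unit) (index_sign \<iota> \<odot>\<^bsub>M\<^esub> g (bas q \<iota>))) (bas (2 - q) (dual \<iota>))"
      using split_sum_right_unit[OF bal_cap_left[OF f m] _ db[OF \<iota>]] q by simp
    then show "1 \<odot>\<^bsub>C (2 - q)\<^esub> split_sum Q (C (2 - q)) (2 - q) 0 (\<lambda>(u, v). ch (2 - q) (lact M (f v) (index_sign \<iota> \<odot>\<^bsub>M\<^esub> g (bas q \<iota>))) u) (bas (2 - q) (dual \<iota>)) =
      ch (2 - q) (index_sign \<iota> \<odot>\<^bsub>M\<^esub> lact M (f unit) (g (bas q \<iota>))) (bas (2 - q) (dual \<iota>))"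
      using fu gb db \<iota> by (simp add: lact_smult)
  qed (use fu gb db in auto)
  also have "\<dots> = theta q (cup_left Q M 0 q f g)"
    unfolding theta_def using fu gb db by (intro C.finsum_cong') (auto simp: v)
  finally show ?thesis by simp
qed

text \<open>The cap product pairs \<open>f\<close> with the last letter and carries the sign -1,
  while the cup product evaluates \<open>f\<close> at the arrow itself. Exchanging each arrow with
  its star cures both differences.\<close>

lemma theta_cup_left_1_0:
  assumes f: "acoch 1 f" and g: "g \<in> carrier (cochains Q M 0)"
  shows "theta 1 (cup_left Q M 1 0 f g) = cap_left Q M 1 2 f (theta 0 g)"
proof -
  have cg: "coch 0 g" using g by (simp add: cochains_iff)
  have cc: "coch 1 (cup_left Q M 1 0 f g)" using cup_left_closed[OF f g] by (simp add: cochains_iff)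
  have val: "cup_left Q M 1 0 f g w = ((-1) powi (1 * 0)) \<odot>\<^bsub>M\<^esub> split_sum Q M 1 0 (\<lambda>(u, v). lact M (f u) (g v)) w"
    if "w \<in> W 1" for w using that by (simp add: cup_left_def)
  note f1 = f and g0 = cg
  have fa: "f (arrow a) \<in> carrier A" if "a \<in> arcs D" for a using acoch_closed[OF f1] arrow_W that by simp
  have gi: "g (idem i) \<in> carrier M" if "i \<in> verts Q" for i using coch_closed[OF g0] idem_W that by simp
  have gu: "g unit \<in> carrier M" using coch_closed[OF g0] unit_W by simp
  have aW: "arrow a \<in> W 1" "arrow (star a) \<in> W 1" if "a \<in> arcs D" for a using arrow_W that by simp_all
  have v: "cup_left Q M 1 0 f g (arrow a) = lact M (f (arrow a)) (g unit)" if "a \<in> arcs D" for a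
    using split_sum_right_unit[OF bal_lact[OF f1 g0] _ arrow_W[OF that]] that fa gu by (simp add: val arrow_W)
  have "cap_left Q M 1 2 f (theta 0 g) = (\<Oplus>\<^bsub>C 1\<^esub>i\<in>verts Q. (-1) \<odot>\<^bsub>C 1\<^esub>
     split_sum Q (C 1) 1 1 (\<lambda>(u, v). ch 1 (lact M (f v) (g (idem i))) u) (\<sigma> i))"
    using theta_0[OF g0] cap_left_finsum[OF f1, of "verts Q" "\<lambda>i. g (idem i)" \<sigma> 2] gi sigma_W by simp
  also have "\<dots> = (\<Oplus>\<^bsub>C 1\<^esub>i\<in>verts Q. \<Oplus>\<^bsub>C 1\<^esub>a\<in>{a \<in> arcs D. head D a = i}. (- arrow_sign a) \<odot>\<^bsub>C 1\<^esub> ch 1 (lact M (f (arrow (star a))) (g unit)) (arrow a))"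
  proof (rule C.finsum_cong')
    fix i assume i: "i \<in> verts Q"
    have "split_sum Q (C 1) 1 1 (\<lambda>(u, v). ch 1 (lact M (f v) (g (idem i))) u) (\<sigma> i) =
        (\<Oplus>\<^bsub>C 1\<^esub>a\<in>{a \<in> arcs D. head D a = i}. arrow_sign a \<odot>\<^bsub>C 1\<^esub> ch 1 (lact M (f (arrow (star a))) (g (idem i))) (arrow a))"
      using split_sum_sigma[OF bal_cap_left[OF f1 gi[OF i]], of i] by simp
    then have "(-1) \<odot>\<^bsub>C 1\<^esub> split_sum Q (C 1) 1 1 (\<lambda>(u, v). ch 1 (lact M (f v) (g (idem i))) u) (\<sigma> i) =
        (\<Oplus>\<^bsub>C 1\<^esub>a\<in>{a \<in> arcs D. head D a = i}. (-1) \<odot>\<^bsub>C 1\<^esub> (arrow_sign a \<odot>\<^bsub>C 1\<^esub> ch 1 (lact M (f (arrow (star a))) (g (idem i))) (arrow a)))"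
      using fa gi[OF i] aW by (simp add: C.finsum_smult Pi_iff)
    also have "\<dots> = (\<Oplus>\<^bsub>C 1\<^esub>a\<in>{a \<in> arcs D. head D a = i}. (- arrow_sign a) \<odot>\<^bsub>C 1\<^esub> ch 1 (lact M (f (arrow (star a))) (g unit)) (arrow a))"
    proof (rule C.finsum_cong')
      fix a assume a: "a \<in> {a \<in> arcs D. head D a = i}"
      have "lact M (f (arrow (star a))) (g (idem i)) = lact M (f (arrow (star a))) (g unit)"
        using a i aW arrow_idem(2)[of "star a"] by (intro lact_coch_0[OF f1 g0]) auto
      then show "(-1) \<odot>\<^bsub>C 1\<^esub> (arrow_sign a \<odot>\<^bsub>C 1\<^esub> ch 1 (lact M (f (arrow (star a))) (g (idem i))) (arrow a)) =
          (- arrow_sign a) \<odot>\<^bsub>C 1\<^esub> ch 1 (lact M (f (arrow (star a))) (g unit)) (arrow a)"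
        using a fa gu aW by (simp add: C.smult_smult)
    qed (use fa gu aW in auto)
    finally show "(-1) \<odot>\<^bsub>C 1\<^esub> split_sum Q (C 1) 1 1 (\<lambda>(u, v). ch 1 (lact M (f v) (g (idem i))) u) (\<sigma> i) =
      (\<Oplus>\<^bsub>C 1\<^esub>a\<in>{a \<in> arcs D. head D a = i}. (- arrow_sign a) \<odot>\<^bsub>C 1\<^esub> ch 1 (lact M (f (arrow (star a))) (g unit)) (arrow a))" .
  qed (use fa gu aW in \<open>auto intro!: C.finsum_closed\<close>)
  also have "\<dots> = (\<Oplus>\<^bsub>C 1\<^esub>a\<in>arcs D. (- arrow_sign a) \<odot>\<^bsub>C 1\<^esub> ch 1 (lact M (f (arrow (star a))) (g unit)) (arrow a))"
    using fa gu aW by (intro finsum_arcs_group vspace_C) auto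
  also have "\<dots> = (\<Oplus>\<^bsub>C 1\<^esub>a\<in>arcs D. arrow_sign a \<odot>\<^bsub>C 1\<^esub> ch 1 (lact M (f (arrow a)) (g unit)) (arrow (star a)))"
    using fa gu aW by (subst finsum_arcs_star[OF vspace_C]) auto
  also have "\<dots> = theta 1 (cup_left Q M 1 0 f g)"
    using cc fa gu aW by (simp add: theta_1) (intro C.finsum_cong', auto simp: v ch_smult_left)
  finally show ?thesis by simp
qed

text \<open>Here \<open>f\<close> consumes the whole relation and the signs are trivial. What is
  left is to replace \<open>unit\<close> by \<open>idem i\<close>, in the chain and in the argument
  of \<open>g\<close>.\<close>

lemma theta_cup_left_2_0:
  assumes f: "acoch 2 f" and g: "g \<in> carrier (cochains Q M 0)"
  shows "theta 2 (cup_left Q M 2 0 f g) = cap_left Q M 2 2 f (theta 0 g)"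
proof -
  have cg: "coch 0 g" using g by (simp add: cochains_iff)
  have cc: "coch 2 (cup_left Q M 2 0 f g)" using cup_left_closed[OF f g] by (simp add: cochains_iff)
  have val: "cup_left Q M 2 0 f g w = ((-1) powi (2 * 0)) \<odot>\<^bsub>M\<^esub> split_sum Q M 2 0 (\<lambda>(u, v). lact M (f u) (g v)) w"
    if "w \<in> W 2" for w using that by (simp add: cup_left_def)
  note f1 = f and g0 = cg
  have fs: "f (\<sigma> i) \<in> carrier A" if "i \<in> verts Q" for i using acoch_closed[OF f1] sigma_W that by simp
  have gi: "g (idem i) \<in> carrier M" if "i \<in> verts Q" for i using coch_closed[OF g0] idem_W that by simp
  have gu: "g unit \<in> carrier M" using coch_closed[OF g0] unit_W by simp
  have v: "cup_left Q M 2 0 f g (\<sigma> i) = lact M (f (\<sigma> i)) (g unit)" if "i \<in> verts Q" for i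
    using split_sum_right_unit[OF bal_lact[OF f1 g0] _ sigma_W[OF that]] that fs gu by (simp add: val sigma_W)
  have "cap_left Q M 2 2 f (theta 0 g) = (\<Oplus>\<^bsub>C 0\<^esub>i\<in>verts Q. 1 \<odot>\<^bsub>C 0\<^esub>
     split_sum Q (C 0) 0 2 (\<lambda>(u, v). ch 0 (lact M (f v) (g (idem i))) u) (\<sigma> i))"
    using theta_0[OF g0] cap_left_finsum[OF f1, of "verts Q" "\<lambda>i. g (idem i)" \<sigma> 2] gi sigma_W by simp
  also have "\<dots> = (\<Oplus>\<^bsub>C 0\<^esub>i\<in>verts Q. ch 0 (lact M (f (\<sigma> i)) (g unit)) (idem i))"
  proof (rule C.finsum_cong')
    fix i assume i: "i \<in> verts Q"
    have "split_sum Q (C 0) 0 2 (\<lambda>(u, v). ch 0 (lact M (f v) (g (idem i))) u) (\<sigma> i) = ch 0 (lact M (f (\<sigma> i)) (g (idem i))) unit"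
      using split_sum_left_unit[OF bal_cap_left[OF f1 gi[OF i]] _ sigma_W[OF i]] by simp
    also have "\<dots> = ch 0 (lact M (f (\<sigma> i)) (g (idem i))) (idem i)"
      using i fs gi idem_W sigma_W by (intro ch_unit ract_lact_idem[OF f1 g0]) (auto simp: idem_def)
    also have "lact M (f (\<sigma> i)) (g (idem i)) = lact M (f (\<sigma> i)) (g unit)"
      using i sigma_W sigma_idem by (intro lact_coch_0[OF f1 g0]) auto
    finally show "1 \<odot>\<^bsub>C 0\<^esub> split_sum Q (C 0) 0 2 (\<lambda>(u, v). ch 0 (lact M (f v) (g (idem i))) u) (\<sigma> i) = ch 0 (lact M (f (\<sigma> i)) (g unit)) (idem i)"
      using i fs gu idem_W by simp
  qed (use fs gu idem_W in auto)
  also have "\<dots> = theta 2 (cup_left Q M 2 0 f g)"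
    using cc fs gu idem_W by (simp add: theta_2) (intro C.finsum_cong', auto simp: v)
  finally show ?thesis by simp
qed

text \<open>The cup product has the sign -1 and the cap product has none; the reindexing by
  \<open>star\<close> accounts for the difference and puts the arguments of \<open>f\<close> and
  \<open>g\<close> in the right places.\<close>

lemma theta_cup_left_1_1:
  assumes f: "acoch 1 f" and g: "g \<in> carrier (cochains Q M 1)"
  shows "theta 2 (cup_left Q M 1 1 f g) = cap_left Q M 1 1 f (theta 1 g)"
proof -
  have cg: "coch 1 g" using g by (simp add: cochains_iff)
  have cc: "coch 2 (cup_left Q M 1 1 f g)" using cup_left_closed[OF f g] by (simp add: cochains_iff)
  have val: "cup_left Q M 1 1 f g w = ((-1) powi (1 * 1)) \<odot>\<^bsub>M\<^esub> split_sum Q M 1 1 (\<lambda>(u, v). lact M (f u) (g v)) w"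
    if "w \<in> W 2" for w using that by (simp add: cup_left_def)
  note f1 = f and g1 = cg
  have fa: "f (arrow a) \<in> carrier A" if "a \<in> arcs D" for a using acoch_closed[OF f1] arrow_W that by simp
  have ga: "g (arrow a) \<in> carrier M" if "a \<in> arcs D" for a using coch_closed[OF g1] arrow_W that by simp
  have aW: "arrow a \<in> W 1" "arrow (star a) \<in> W 1" if "a \<in> arcs D" for a using arrow_W that by simp_all
  let ?X = "\<lambda>a. lact M (f (arrow a)) (g (arrow (star a)))"
  have X: "?X a \<in> carrier M" if "a \<in> arcs D" for a using fa ga that by simp
  have v: "cup_left Q M 1 1 f g (\<sigma> i) = (\<Oplus>\<^bsub>M\<^esub>a\<in>{a \<in> arcs D. head D a = i}. (- arrow_sign a) \<odot>\<^bsub>M\<^esub> ?X a)" if i: "i \<in> verts Q" for i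
  proof -
    have "cup_left Q M 1 1 f g (\<sigma> i) = (-1) \<odot>\<^bsub>M\<^esub> (\<Oplus>\<^bsub>M\<^esub>a\<in>{a \<in> arcs D. head D a = i}. arrow_sign a \<odot>\<^bsub>M\<^esub> ?X a)"
      using split_sum_sigma[OF bal_lact[OF f1 g1], of i] sigma_W[OF i] by (simp add: val)
    also have "\<dots> = (\<Oplus>\<^bsub>M\<^esub>a\<in>{a \<in> arcs D. head D a = i}. (-1) \<odot>\<^bsub>M\<^esub> (arrow_sign a \<odot>\<^bsub>M\<^esub> ?X a))"
      using X by (intro M.finsum_smult) auto
    also have "\<dots> = (\<Oplus>\<^bsub>M\<^esub>a\<in>{a \<in> arcs D. head D a = i}. (- arrow_sign a) \<odot>\<^bsub>M\<^esub> ?X a)"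
      using X by (intro M.finsum_cong') (auto simp: M.smult_smult)
    finally show ?thesis .
  qed
  have "theta 2 (cup_left Q M 1 1 f g) = (\<Oplus>\<^bsub>C 0\<^esub>i\<in>verts Q. \<Oplus>\<^bsub>C 0\<^esub>a\<in>{a \<in> arcs D. head D a = i}. (- arrow_sign a) \<odot>\<^bsub>C 0\<^esub> ch 0 (?X a) unit)"
  proof (simp only: theta_2[OF cc], rule C.finsum_cong')
    fix i assume i: "i \<in> verts Q"
    have "ch 0 (cup_left Q M 1 1 f g (\<sigma> i)) (idem i) = (\<Oplus>\<^bsub>C 0\<^esub>a\<in>{a \<in> arcs D. head D a = i}. ch 0 ((- arrow_sign a) \<odot>\<^bsub>M\<^esub> ?X a) (idem i))"
      unfolding v[OF i] using X idem_W[OF i] by (intro ch_finsum_left) auto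
    also have "\<dots> = (\<Oplus>\<^bsub>C 0\<^esub>a\<in>{a \<in> arcs D. head D a = i}. (- arrow_sign a) \<odot>\<^bsub>C 0\<^esub> ch 0 (?X a) unit)"
    proof (rule C.finsum_cong')
      fix a assume a: "a \<in> {a \<in> arcs D. head D a = i}"
      have "ch 0 (?X a) unit = ch 0 (?X a) (idem i)"
        using a i X aW arrow_idem(2)[of "star a"] by (intro ch_unit ract_lact_idem[OF f1 g1]) auto
      then show "ch 0 ((- arrow_sign a) \<odot>\<^bsub>M\<^esub> ?X a) (idem i) = (- arrow_sign a) \<odot>\<^bsub>C 0\<^esub> ch 0 (?X a) unit"
        using a X idem_W[OF i] by (simp add: ch_smult_left)
    qed (use X unit_W in auto)
    finally show "ch 0 (cup_left Q M 1 1 f g (\<sigma> i)) (idem i) = (\<Oplus>\<^bsub>C 0\<^esub>a\<in>{a \<in> arcs D. head D a = i}. (- arrow_sign a) \<odot>\<^bsub>C 0\<^esub> ch 0 (?X a) unit)"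
      by simp
  qed (use X unit_W in \<open>auto intro!: C.finsum_closed\<close>)
  also have "\<dots> = (\<Oplus>\<^bsub>C 0\<^esub>a\<in>arcs D. (- arrow_sign a) \<odot>\<^bsub>C 0\<^esub> ch 0 (?X a) unit)"
    using X unit_W by (intro finsum_arcs_group vspace_C) auto
  also have "\<dots> = (\<Oplus>\<^bsub>C 0\<^esub>a\<in>arcs D. arrow_sign a \<odot>\<^bsub>C 0\<^esub> ch 0 (?X (star a)) unit)"
    using X unit_W by (subst finsum_arcs_star[OF vspace_C]) auto
  also have "\<dots> = (\<Oplus>\<^bsub>C 0\<^esub>a\<in>arcs D. 1 \<odot>\<^bsub>C 0\<^esub> split_sum Q (C 0) 0 1 (\<lambda>(u, v). ch 0 (lact M (f v) (arrow_sign a \<odot>\<^bsub>M\<^esub> g (arrow a))) u) (arrow (star a)))"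
  proof (rule C.finsum_cong')
    fix a assume a: "a \<in> arcs D"
    have m: "arrow_sign a \<odot>\<^bsub>M\<^esub> g (arrow a) \<in> carrier M" using ga a by simp
    have "split_sum Q (C 0) 0 1 (\<lambda>(u, v). ch 0 (lact M (f v) (arrow_sign a \<odot>\<^bsub>M\<^esub> g (arrow a))) u) (arrow (star a)) =
        ch 0 (lact M (f (arrow (star a))) (arrow_sign a \<odot>\<^bsub>M\<^esub> g (arrow a))) unit"
      using split_sum_left_unit[OF bal_cap_left[OF f1 m] _ aW(2)[OF a]] by simp
    then show "arrow_sign a \<odot>\<^bsub>C 0\<^esub> ch 0 (?X (star a)) unit = 1 \<odot>\<^bsub>C 0\<^esub> split_sum Q (C 0) 0 1 (\<lambda>(u, v). ch 0 (lact M (f v) (arrow_sign a \<odot>\<^bsub>M\<^esub> g (arrow a))) u) (arrow (star a))"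
      using a fa ga unit_W by (simp add: lact_smult ch_smult_left)
  next
    have "split_sum Q (C 0) 0 1 (\<lambda>(u, v). ch 0 (lact M (f v) (arrow_sign a \<odot>\<^bsub>M\<^esub> g (arrow a))) u) (arrow (star a)) \<in> carrier (C 0)" if a: "a \<in> arcs D" for a
    proof -
      have m: "arrow_sign a \<odot>\<^bsub>M\<^esub> g (arrow a) \<in> carrier M" using ga a by simp
      show ?thesis using linear_on_closed[OF linear_on_split_sum[OF bal_cap_left[OF f1 m, of 0]], of "arrow (star a)"] aW(2)[OF a] by simp
    qed
    then show "(\<lambda>a. 1 \<odot>\<^bsub>C 0\<^esub> split_sum Q (C 0) 0 1 (\<lambda>(u, v). ch 0 (lact M (f v) (arrow_sign a \<odot>\<^bsub>M\<^esub> g (arrow a))) u) (arrow (star a))) \<in> arcs D \<rightarrow> carrier (C 0)"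
      by auto
  qed simp
  also have "\<dots> = cap_left Q M 1 1 f (theta 1 g)"
    using theta_1[OF g1] cap_left_finsum[OF f1, of "arcs D" "\<lambda>a. arrow_sign a \<odot>\<^bsub>M\<^esub> g (arrow a)" "\<lambda>a. arrow (star a)" 1] ga aW by simp
  finally show ?thesis by simp
qed

text \<open>If the total degree leaves 0, 1, 2, the target is zero. If a single degree is negative,
  both sides vanish, by the convention in \<open>split_sum\<close> or because \<open>theta\<close>
  has an empty index set. The remaining pairs are those treated above.\<close>

lemma theta_cup_left:
  assumes f: "acoch p f" and g: "g \<in> carrier (cochains Q M q)"
  shows "theta (p + q) (cup_left Q M p q f g) = cap_left Q M p (2 - q) f (theta q g)"
proof -
  have cg: "coch q g" using g by (simp add: cochains_iff)
  note cup = cup_left_closed[OF f g]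
  have cc: "coch (p + q) (cup_left Q M p q f g)" using cup by (simp add: cochains_iff)
  have cap: "cap_left Q M p (2 - q) f (theta q g) \<in> carrier (C (2 - (p + q)))"
    using cap_left_closed[OF f theta_closed[OF cg]] by (simp add: algebra_simps)
  have val: "cup_left Q M p q f g w = ((-1) powi (p * q)) \<odot>\<^bsub>M\<^esub> split_sum Q M p q (\<lambda>(u, v). lact M (f u) (g v)) w"
    if "w \<in> W (p + q)" for w using that by (simp add: cup_left_def)
  have fin: "finite (Ix q)" "\<And>\<iota>. \<iota> \<in> Ix q \<Longrightarrow> index_sign \<iota> \<odot>\<^bsub>M\<^esub> g (bas q \<iota>) \<in> carrier M"
    "\<And>\<iota>. \<iota> \<in> Ix q \<Longrightarrow> bas (2 - q) (dual \<iota>) \<in> W (2 - q)"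
    using cg by (simp_all add: bas_W dual_Ix)
  have capsum: "cap_left Q M p (2 - q) f (theta q g) = (\<Oplus>\<^bsub>C (2 - q - p)\<^esub>\<iota>\<in>Ix q. ((-1) powi ((2 - q - p) * p)) \<odot>\<^bsub>C (2 - q - p)\<^esub>
       split_sum Q (C (2 - q - p)) (2 - q - p) p (\<lambda>(u, v). ch (2 - q - p) (lact M (f v) (index_sign \<iota> \<odot>\<^bsub>M\<^esub> g (bas q \<iota>))) u) (bas (2 - q) (dual \<iota>)))"
    unfolding theta_def by (rule cap_left_finsum[OF f]) (use fin in auto)
  consider "p + q < 0 \<or> p + q > 2" | "p < 0" "0 \<le> p + q" | "q < 0" "0 \<le> p + q" | "p = 0" "0 \<le> q" "q \<le> 2"
    | "p = 1" "q = 0" | "p = 2" "q = 0" | "p = 1" "q = 1" by linarith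
  then show ?thesis
  proof cases
    case 1
    then have "carrier (C (2 - (p + q))) = {\<zero>\<^bsub>C (2 - (p + q))\<^esub>}" by (intro chains_trivial) auto
    then show ?thesis using cap theta_closed[OF cc] by simp
  next
    case 2
    have "theta (p + q) (cup_left Q M p q f g) = theta (p + q) (\<lambda>w. \<zero>\<^bsub>M\<^esub>)"
      using 2 by (intro theta_cong coch_zero) (simp add: val bas_W split_sum_def)
    also have "\<dots> = \<zero>\<^bsub>C (2 - (p + q))\<^esub>"
      using theta_smult[OF coch_zero, of "p + q" 0] theta_restrict[OF coch_zero, of "p + q"] theta_closed[OF coch_zero, of "p + q"] by simp
    also have "\<dots> = cap_left Q M p (2 - q) f (theta q g)"
    proof -
      have "cap_left Q M p (2 - q) f (theta q g) = (\<Oplus>\<^bsub>C (2 - q - p)\<^esub>\<iota>\<in>Ix q. \<zero>\<^bsub>C (2 - q - p)\<^esub>)"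
        unfolding capsum using 2
        by (intro C.finsum_cong') (auto simp: split_sum_def)
      then show ?thesis by (simp add: algebra_simps)
    qed
    finally show ?thesis .
  next
    case 3
    have "theta (p + q) (cup_left Q M p q f g) = theta (p + q) (\<lambda>w. \<zero>\<^bsub>M\<^esub>)"
      using 3 by (intro theta_cong coch_zero) (simp add: val bas_W split_sum_def)
    also have "\<dots> = \<zero>\<^bsub>C (2 - (p + q))\<^esub>"
      using theta_smult[OF coch_zero, of "p + q" 0] theta_restrict[OF coch_zero, of "p + q"] theta_closed[OF coch_zero, of "p + q"] by simp
    also have "\<dots> = cap_left Q M p (2 - q) f (theta q g)"
    proof -
      have "Ix q = {}" using 3 by (simp add: Ix_def)
      then show ?thesis
        using cap_left_finsum[OF f, of "{}" "\<lambda>_. \<zero>\<^bsub>M\<^esub>" "\<lambda>_. 0 :: ('f, 'v, 'e) path_elt" "2 - q"]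
        by (simp add: theta_def algebra_simps)
    qed
    finally show ?thesis .
  next
    case 4
    then show ?thesis using theta_cup_left_0 f g by simp
  next
    case 5
    then show ?thesis using theta_cup_left_1_0 f g by simp
  next
    case 6
    then show ?thesis using theta_cup_left_2_0 f g by simp
  next
    case 7
    then show ?thesis using theta_cup_left_1_1 f g by simp
  qed
qed

end

section \<open>Cup and cap products from the right\<close>

context koszul_bimodule
begin

lemma theta_cup_right_0:
  assumes f: "acoch 0 f" and g: "g \<in> carrier (cochains Q M q)" and q: "0 \<le> q" "q \<le> 2"
  shows "theta q (cup_right Q M q 0 g f) = cap_right Q M (2 - q) 0 (theta q g) f"
proof -
  have cg: "coch q g" using g by (simp add: cochains_iff)
  have cc: "coch q (cup_right Q M q 0 g f)" using cup_right_closed[OF f g] by (simp add: cochains_iff)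
  have val: "cup_right Q M q 0 g f w = ((-1) powi (q * 0)) \<odot>\<^bsub>M\<^esub> split_sum Q M q 0 (\<lambda>(u, v). ract M (g u) (f v)) w"
    if "w \<in> W q" for w using that by (simp add: cup_right_def)
  have fu: "f unit \<in> carrier A" using acoch_closed[OF f unit_W] .
  have gb: "g (bas q \<iota>) \<in> carrier M" if "\<iota> \<in> Ix q" for \<iota> using coch_closed[OF cg bas_W[OF that]] .
  have db: "bas (2 - q) (dual \<iota>) \<in> W (2 - q)" if "\<iota> \<in> Ix q" for \<iota> using bas_W[OF dual_Ix[OF that]] .
  have v: "cup_right Q M q 0 g f (bas q \<iota>) = ract M (g (bas q \<iota>)) (f unit)" if "\<iota> \<in> Ix q" for \<iota>
    using split_sum_right_unit[OF bal_ract[OF f cg] q(1) bas_W[OF that]] that fu gb by (simp add: val bas_W)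
  have "cap_right Q M (2 - q) 0 (theta q g) f = (\<Oplus>\<^bsub>C (2 - q - 0)\<^esub>\<iota>\<in>Ix q. ((-1) powi (0 * (2 - q))) \<odot>\<^bsub>C (2 - q - 0)\<^esub>
     split_sum Q (C (2 - q - 0)) 0 (2 - q - 0) (\<lambda>(u, v). ch (2 - q - 0) (ract M (index_sign \<iota> \<odot>\<^bsub>M\<^esub> g (bas q \<iota>)) (f u)) v) (bas (2 - q) (dual \<iota>)))"
    unfolding theta_def by (rule cap_right_finsum[OF f]) (use gb db in auto)
  also have "\<dots> = (\<Oplus>\<^bsub>C (2 - q)\<^esub>\<iota>\<in>Ix q. ch (2 - q) (index_sign \<iota> \<odot>\<^bsub>M\<^esub> ract M (g (bas q \<iota>)) (f unit)) (bas (2 - q) (dual \<iota>)))"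
  proof (simp only: mult_zero_left diff_0_right power_int_0_right, rule C.finsum_cong')
    fix \<iota> assume \<iota>: "\<iota> \<in> Ix q"
    have m: "index_sign \<iota> \<odot>\<^bsub>M\<^esub> g (bas q \<iota>) \<in> carrier M" using gb[OF \<iota>] by simp
    have "split_sum Q (C (2 - q)) 0 (2 - q) (\<lambda>(u, v). ch (2 - q) (ract M (index_sign \<iota> \<odot>\<^bsub>M\<^esub> g (bas q \<iota>)) (f u)) v) (bas (2 - q) (dual \<iota>)) =
      ch (2 - q) (ract M (index_sign \<iota> \<odot>\<^bsub>M\<^esub> g (bas q \<iota>)) (f unit)) (bas (2 - q) (dual \<iota>))"
      using split_sum_left_unit[OF bal_cap_right[OF f m] _ db[OF \<iota>]] q by simp
    then show "1 \<odot>\<^bsub>C (2 - q)\<^esub> split_sum Q (C (2 - q)) 0 (2 - q) (\<lambda>(u, v). ch (2 - q) (ract M (index_sign \<iota> \<odot>\<^bsub>M\<^esub> g (bas q \<iota>)) (f u)) v) (bas (2 - q) (dual \<iota>)) =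
      ch (2 - q) (index_sign \<iota> \<odot>\<^bsub>M\<^esub> ract M (g (bas q \<iota>)) (f unit)) (bas (2 - q) (dual \<iota>))"
      using fu gb db \<iota> by (simp add: ract_smult)
  qed (use fu gb db in auto)
  also have "\<dots> = theta q (cup_right Q M q 0 g f)"
    unfolding theta_def using fu gb db by (intro C.finsum_cong') (auto simp: v)
  finally show ?thesis by simp
qed

text \<open>From the right, \<open>f\<close> meets the first letter of \<open>\<sigma> i\<close> in
  the cap product, as \<open>theta\<close> itself does. The sums agree without reindexing, and the
  cap sign is even.\<close>

lemma theta_cup_right_1_0:
  assumes f: "acoch 1 f" and g: "g \<in> carrier (cochains Q M 0)"
  shows "theta 1 (cup_right Q M 0 1 g f) = cap_right Q M 2 1 (theta 0 g) f"
proof -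
  have cg: "coch 0 g" using g by (simp add: cochains_iff)
  have cc: "coch 1 (cup_right Q M 0 1 g f)" using cup_right_closed[OF f g] by (simp add: cochains_iff)
  have val: "cup_right Q M 0 1 g f w = ((-1) powi (0 * 1)) \<odot>\<^bsub>M\<^esub> split_sum Q M 0 1 (\<lambda>(u, v). ract M (g u) (f v)) w"
    if "w \<in> W 1" for w using that by (simp add: cup_right_def)
  have fa: "f (arrow a) \<in> carrier A" if "a \<in> arcs D" for a using acoch_closed[OF f] arrow_W that by simp
  have gi: "g (idem i) \<in> carrier M" if "i \<in> verts Q" for i using coch_closed[OF cg] idem_W that by simp
  have gu: "g unit \<in> carrier M" using coch_closed[OF cg] unit_W by simp
  have aW: "arrow a \<in> W 1" "arrow (star a) \<in> W 1" if "a \<in> arcs D" for a using arrow_W that by simp_all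
  have v: "cup_right Q M 0 1 g f (arrow a) = ract M (g unit) (f (arrow a))" if "a \<in> arcs D" for a
    using split_sum_left_unit[OF bal_ract[OF f cg] _ arrow_W[OF that]] that fa gu by (simp add: val arrow_W)
  have "cap_right Q M 2 1 (theta 0 g) f = (\<Oplus>\<^bsub>C 1\<^esub>i\<in>verts Q. 1 \<odot>\<^bsub>C 1\<^esub>
     split_sum Q (C 1) 1 1 (\<lambda>(u, v). ch 1 (ract M (g (idem i)) (f u)) v) (\<sigma> i))"
    using theta_0[OF cg] cap_right_finsum[OF f, of "verts Q" "\<lambda>i. g (idem i)" \<sigma> 2] gi sigma_W by simp
  also have "\<dots> = (\<Oplus>\<^bsub>C 1\<^esub>i\<in>verts Q. \<Oplus>\<^bsub>C 1\<^esub>a\<in>{a \<in> arcs D. head D a = i}. arrow_sign a \<odot>\<^bsub>C 1\<^esub> ch 1 (ract M (g unit) (f (arrow a))) (arrow (star a)))"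
  proof (rule C.finsum_cong')
    fix i assume i: "i \<in> verts Q"
    have "split_sum Q (C 1) 1 1 (\<lambda>(u, v). ch 1 (ract M (g (idem i)) (f u)) v) (\<sigma> i) =
        (\<Oplus>\<^bsub>C 1\<^esub>a\<in>{a \<in> arcs D. head D a = i}. arrow_sign a \<odot>\<^bsub>C 1\<^esub> ch 1 (ract M (g (idem i)) (f (arrow a))) (arrow (star a)))"
      using split_sum_sigma[OF bal_cap_right[OF f gi[OF i]], of i] by simp
    also have "\<dots> = (\<Oplus>\<^bsub>C 1\<^esub>a\<in>{a \<in> arcs D. head D a = i}. arrow_sign a \<odot>\<^bsub>C 1\<^esub> ch 1 (ract M (g unit) (f (arrow a))) (arrow (star a)))"
    proof (rule C.finsum_cong')
      fix a assume a: "a \<in> {a \<in> arcs D. head D a = i}"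
      have "ract M (g (idem i)) (f (arrow a)) = ract M (g unit) (f (arrow a))"
        using a i aW arrow_idem(1)[of a] by (intro ract_coch_0[OF f cg]) auto
      then show "arrow_sign a \<odot>\<^bsub>C 1\<^esub> ch 1 (ract M (g (idem i)) (f (arrow a))) (arrow (star a)) =
          arrow_sign a \<odot>\<^bsub>C 1\<^esub> ch 1 (ract M (g unit) (f (arrow a))) (arrow (star a))" by simp
    qed (use fa gu aW in auto)
    finally show "1 \<odot>\<^bsub>C 1\<^esub> split_sum Q (C 1) 1 1 (\<lambda>(u, v). ch 1 (ract M (g (idem i)) (f u)) v) (\<sigma> i) =
      (\<Oplus>\<^bsub>C 1\<^esub>a\<in>{a \<in> arcs D. head D a = i}. arrow_sign a \<odot>\<^bsub>C 1\<^esub> ch 1 (ract M (g unit) (f (arrow a))) (arrow (star a)))"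
      using fa gu aW by (simp add: C.finsum_closed Pi_iff)
  qed (use fa gu aW in \<open>auto intro!: C.finsum_closed\<close>)
  also have "\<dots> = (\<Oplus>\<^bsub>C 1\<^esub>a\<in>arcs D. arrow_sign a \<odot>\<^bsub>C 1\<^esub> ch 1 (ract M (g unit) (f (arrow a))) (arrow (star a)))"
    using fa gu aW by (intro finsum_arcs_group vspace_C) auto
  also have "\<dots> = theta 1 (cup_right Q M 0 1 g f)"
    using cc fa gu aW by (simp add: theta_1) (intro C.finsum_cong', auto simp: v ch_smult_left)
  finally show ?thesis by simp
qed

lemma theta_cup_right_2_0:
  assumes f: "acoch 2 f" and g: "g \<in> carrier (cochains Q M 0)"
  shows "theta 2 (cup_right Q M 0 2 g f) = cap_right Q M 2 2 (theta 0 g) f"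
proof -
  have cg: "coch 0 g" using g by (simp add: cochains_iff)
  have cc: "coch 2 (cup_right Q M 0 2 g f)" using cup_right_closed[OF f g] by (simp add: cochains_iff)
  have val: "cup_right Q M 0 2 g f w = ((-1) powi (0 * 2)) \<odot>\<^bsub>M\<^esub> split_sum Q M 0 2 (\<lambda>(u, v). ract M (g u) (f v)) w"
    if "w \<in> W 2" for w using that by (simp add: cup_right_def)
  have fs: "f (\<sigma> i) \<in> carrier A" if "i \<in> verts Q" for i using acoch_closed[OF f] sigma_W that by simp
  have gi: "g (idem i) \<in> carrier M" if "i \<in> verts Q" for i using coch_closed[OF cg] idem_W that by simp
  have gu: "g unit \<in> carrier M" using coch_closed[OF cg] unit_W by simp
  have v: "cup_right Q M 0 2 g f (\<sigma> i) = ract M (g unit) (f (\<sigma> i))" if "i \<in> verts Q" for i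
    using split_sum_left_unit[OF bal_ract[OF f cg] _ sigma_W[OF that]] that fs gu by (simp add: val sigma_W)
  have "cap_right Q M 2 2 (theta 0 g) f = (\<Oplus>\<^bsub>C 0\<^esub>i\<in>verts Q. 1 \<odot>\<^bsub>C 0\<^esub>
     split_sum Q (C 0) 2 0 (\<lambda>(u, v). ch 0 (ract M (g (idem i)) (f u)) v) (\<sigma> i))"
    using theta_0[OF cg] cap_right_finsum[OF f, of "verts Q" "\<lambda>i. g (idem i)" \<sigma> 2] gi sigma_W by simp
  also have "\<dots> = (\<Oplus>\<^bsub>C 0\<^esub>i\<in>verts Q. ch 0 (ract M (g unit) (f (\<sigma> i))) (idem i))"
  proof (rule C.finsum_cong')
    fix i assume i: "i \<in> verts Q"
    have "split_sum Q (C 0) 2 0 (\<lambda>(u, v). ch 0 (ract M (g (idem i)) (f u)) v) (\<sigma> i) = ch 0 (ract M (g (idem i)) (f (\<sigma> i))) unit"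
      using split_sum_right_unit[OF bal_cap_right[OF f gi[OF i]] _ sigma_W[OF i]] by simp
    also have "\<dots> = ch 0 (ract M (g (idem i)) (f (\<sigma> i))) (idem i)"
      using i fs gi sigma_W sigma_idem by (intro ch_unit ract_ract_idem[OF f]) auto
    also have "ract M (g (idem i)) (f (\<sigma> i)) = ract M (g unit) (f (\<sigma> i))"
      using i sigma_W sigma_idem by (intro ract_coch_0[OF f cg]) auto
    finally show "1 \<odot>\<^bsub>C 0\<^esub> split_sum Q (C 0) 2 0 (\<lambda>(u, v). ch 0 (ract M (g (idem i)) (f u)) v) (\<sigma> i) = ch 0 (ract M (g unit) (f (\<sigma> i))) (idem i)"
      using i fs gu idem_W by simp
  qed (use fs gu idem_W in auto)
  also have "\<dots> = theta 2 (cup_right Q M 0 2 g f)"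
    using cc fs gu idem_W by (simp add: theta_2) (intro C.finsum_cong', auto simp: v)
  finally show ?thesis by simp
qed

text \<open>Both products carry the sign -1 and evaluate \<open>f\<close> at the starred arrow, so
  only the passage from \<open>idem i\<close> to \<open>unit\<close> needs an argument.\<close>

lemma theta_cup_right_1_1:
  assumes f: "acoch 1 f" and g: "g \<in> carrier (cochains Q M 1)"
  shows "theta 2 (cup_right Q M 1 1 g f) = cap_right Q M 1 1 (theta 1 g) f"
proof -
  have cg: "coch 1 g" using g by (simp add: cochains_iff)
  have cc: "coch 2 (cup_right Q M 1 1 g f)" using cup_right_closed[OF f g] by (simp add: cochains_iff)
  have val: "cup_right Q M 1 1 g f w = ((-1) powi (1 * 1)) \<odot>\<^bsub>M\<^esub> split_sum Q M 1 1 (\<lambda>(u, v). ract M (g u) (f v)) w"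
    if "w \<in> W 2" for w using that by (simp add: cup_right_def)
  have fa: "f (arrow a) \<in> carrier A" if "a \<in> arcs D" for a using acoch_closed[OF f] arrow_W that by simp
  have ga: "g (arrow a) \<in> carrier M" if "a \<in> arcs D" for a using coch_closed[OF cg] arrow_W that by simp
  have aW: "arrow a \<in> W 1" "arrow (star a) \<in> W 1" if "a \<in> arcs D" for a using arrow_W that by simp_all
  let ?X = "\<lambda>a. ract M (g (arrow a)) (f (arrow (star a)))"
  have X: "?X a \<in> carrier M" if "a \<in> arcs D" for a using fa ga that by simp
  have v: "cup_right Q M 1 1 g f (\<sigma> i) = (\<Oplus>\<^bsub>M\<^esub>a\<in>{a \<in> arcs D. head D a = i}. (- arrow_sign a) \<odot>\<^bsub>M\<^esub> ?X a)" if i: "i \<in> verts Q" for i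
  proof -
    have "cup_right Q M 1 1 g f (\<sigma> i) = (-1) \<odot>\<^bsub>M\<^esub> (\<Oplus>\<^bsub>M\<^esub>a\<in>{a \<in> arcs D. head D a = i}. arrow_sign a \<odot>\<^bsub>M\<^esub> ?X a)"
      using split_sum_sigma[OF bal_ract[OF f cg], of i] sigma_W[OF i] by (simp add: val)
    also have "\<dots> = (\<Oplus>\<^bsub>M\<^esub>a\<in>{a \<in> arcs D. head D a = i}. (-1) \<odot>\<^bsub>M\<^esub> (arrow_sign a \<odot>\<^bsub>M\<^esub> ?X a))"
      using X by (intro M.finsum_smult) auto
    also have "\<dots> = (\<Oplus>\<^bsub>M\<^esub>a\<in>{a \<in> arcs D. head D a = i}. (- arrow_sign a) \<odot>\<^bsub>M\<^esub> ?X a)"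
      using X by (intro M.finsum_cong') (auto simp: M.smult_smult)
    finally show ?thesis .
  qed
  have "theta 2 (cup_right Q M 1 1 g f) = (\<Oplus>\<^bsub>C 0\<^esub>i\<in>verts Q. \<Oplus>\<^bsub>C 0\<^esub>a\<in>{a \<in> arcs D. head D a = i}. (- arrow_sign a) \<odot>\<^bsub>C 0\<^esub> ch 0 (?X a) unit)"
  proof (simp only: theta_2[OF cc], rule C.finsum_cong')
    fix i assume i: "i \<in> verts Q"
    have "ch 0 (cup_right Q M 1 1 g f (\<sigma> i)) (idem i) = (\<Oplus>\<^bsub>C 0\<^esub>a\<in>{a \<in> arcs D. head D a = i}. ch 0 ((- arrow_sign a) \<odot>\<^bsub>M\<^esub> ?X a) (idem i))"
      unfolding v[OF i] using X idem_W[OF i] by (intro ch_finsum_left) auto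
    also have "\<dots> = (\<Oplus>\<^bsub>C 0\<^esub>a\<in>{a \<in> arcs D. head D a = i}. (- arrow_sign a) \<odot>\<^bsub>C 0\<^esub> ch 0 (?X a) unit)"
    proof (rule C.finsum_cong')
      fix a assume a: "a \<in> {a \<in> arcs D. head D a = i}"
      have "ch 0 (?X a) unit = ch 0 (?X a) (idem i)"
        using a i X aW ga arrow_idem(2)[of "star a"] by (intro ch_unit ract_ract_idem[OF f]) auto
      then show "ch 0 ((- arrow_sign a) \<odot>\<^bsub>M\<^esub> ?X a) (idem i) = (- arrow_sign a) \<odot>\<^bsub>C 0\<^esub> ch 0 (?X a) unit"
        using a X idem_W[OF i] by (simp add: ch_smult_left)
    qed (use X unit_W in auto)
    finally show "ch 0 (cup_right Q M 1 1 g f (\<sigma> i)) (idem i) = (\<Oplus>\<^bsub>C 0\<^esub>a\<in>{a \<in> arcs D. head D a = i}. (- arrow_sign a) \<odot>\<^bsub>C 0\<^esub> ch 0 (?X a) unit)" .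
  qed (use X unit_W in \<open>auto intro!: C.finsum_closed\<close>)
  also have "\<dots> = (\<Oplus>\<^bsub>C 0\<^esub>a\<in>arcs D. (- arrow_sign a) \<odot>\<^bsub>C 0\<^esub> ch 0 (?X a) unit)"
    using X unit_W by (intro finsum_arcs_group vspace_C) auto
  also have "\<dots> = (\<Oplus>\<^bsub>C 0\<^esub>a\<in>arcs D. (-1) \<odot>\<^bsub>C 0\<^esub> split_sum Q (C 0) 1 0 (\<lambda>(u, v). ch 0 (ract M (arrow_sign a \<odot>\<^bsub>M\<^esub> g (arrow a)) (f u)) v) (arrow (star a)))"
  proof (rule C.finsum_cong')
    fix a assume a: "a \<in> arcs D"
    have m: "arrow_sign a \<odot>\<^bsub>M\<^esub> g (arrow a) \<in> carrier M" using ga a by simp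
    have "split_sum Q (C 0) 1 0 (\<lambda>(u, v). ch 0 (ract M (arrow_sign a \<odot>\<^bsub>M\<^esub> g (arrow a)) (f u)) v) (arrow (star a)) =
        ch 0 (ract M (arrow_sign a \<odot>\<^bsub>M\<^esub> g (arrow a)) (f (arrow (star a)))) unit"
      using split_sum_right_unit[OF bal_cap_right[OF f m] _ aW(2)[OF a]] by simp
    then show "(- arrow_sign a) \<odot>\<^bsub>C 0\<^esub> ch 0 (?X a) unit = (-1) \<odot>\<^bsub>C 0\<^esub> split_sum Q (C 0) 1 0 (\<lambda>(u, v). ch 0 (ract M (arrow_sign a \<odot>\<^bsub>M\<^esub> g (arrow a)) (f u)) v) (arrow (star a))"
      using a fa ga unit_W by (simp add: ract_smult ch_smult_left C.smult_smult)
  next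
    have "split_sum Q (C 0) 1 0 (\<lambda>(u, v). ch 0 (ract M (arrow_sign a \<odot>\<^bsub>M\<^esub> g (arrow a)) (f u)) v) (arrow (star a)) \<in> carrier (C 0)" if a: "a \<in> arcs D" for a
    proof -
      have m: "arrow_sign a \<odot>\<^bsub>M\<^esub> g (arrow a) \<in> carrier M" using ga a by simp
      show ?thesis using linear_on_closed[OF linear_on_split_sum[OF bal_cap_right[OF f m, of 0]], of "arrow (star a)"] aW(2)[OF a] by simp
    qed
    then show "(\<lambda>a. (-1) \<odot>\<^bsub>C 0\<^esub> split_sum Q (C 0) 1 0 (\<lambda>(u, v). ch 0 (ract M (arrow_sign a \<odot>\<^bsub>M\<^esub> g (arrow a)) (f u)) v) (arrow (star a))) \<in> arcs D \<rightarrow> carrier (C 0)"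
      by auto
  qed simp
  also have "\<dots> = cap_right Q M 1 1 (theta 1 g) f"
    using theta_1[OF cg] cap_right_finsum[OF f, of "arcs D" "\<lambda>a. arrow_sign a \<odot>\<^bsub>M\<^esub> g (arrow a)" "\<lambda>a. arrow (star a)" 1] ga aW by simp
  finally show ?thesis by simp
qed

lemma theta_zero: "theta p (\<lambda>w. \<zero>\<^bsub>M\<^esub>) = \<zero>\<^bsub>C (2 - p)\<^esub>"
  using theta_smult[OF coch_zero, of p 0] theta_restrict[OF coch_zero, of p] theta_closed[OF coch_zero, of p] by simp

lemma theta_cup_right:
  assumes f: "acoch p f" and g: "g \<in> carrier (cochains Q M q)"
  shows "theta (q + p) (cup_right Q M q p g f) = cap_right Q M (2 - q) p (theta q g) f"
proof -
  have cg: "coch q g" using g by (simp add: cochains_iff)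
  note cup = cup_right_closed[OF f g]
  have cc: "coch (q + p) (cup_right Q M q p g f)" using cup by (simp add: cochains_iff)
  have cap: "cap_right Q M (2 - q) p (theta q g) f \<in> carrier (C (2 - (q + p)))"
    using cap_right_closed[OF f theta_closed[OF cg]] by (simp add: algebra_simps)
  have val: "cup_right Q M q p g f w = ((-1) powi (q * p)) \<odot>\<^bsub>M\<^esub> split_sum Q M q p (\<lambda>(u, v). ract M (g u) (f v)) w"
    if "w \<in> W (q + p)" for w using that by (simp add: cup_right_def)
  have fin: "finite (Ix q)" "\<And>\<iota>. \<iota> \<in> Ix q \<Longrightarrow> index_sign \<iota> \<odot>\<^bsub>M\<^esub> g (bas q \<iota>) \<in> carrier M"
    "\<And>\<iota>. \<iota> \<in> Ix q \<Longrightarrow> bas (2 - q) (dual \<iota>) \<in> W (2 - q)"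
    using cg by (simp_all add: bas_W dual_Ix)
  have capsum: "cap_right Q M (2 - q) p (theta q g) f = (\<Oplus>\<^bsub>C (2 - q - p)\<^esub>\<iota>\<in>Ix q. ((-1) powi (p * (2 - q))) \<odot>\<^bsub>C (2 - q - p)\<^esub>
       split_sum Q (C (2 - q - p)) p (2 - q - p) (\<lambda>(u, v). ch (2 - q - p) (ract M (index_sign \<iota> \<odot>\<^bsub>M\<^esub> g (bas q \<iota>)) (f u)) v) (bas (2 - q) (dual \<iota>)))"
    unfolding theta_def by (rule cap_right_finsum[OF f]) (use fin in auto)
  consider "q + p < 0 \<or> q + p > 2" | "p < 0 \<or> q < 0" "0 \<le> q + p" | "p = 0" "0 \<le> q" "q \<le> 2"
    | "p = 1" "q = 0" | "p = 2" "q = 0" | "p = 1" "q = 1" by linarith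
  then show ?thesis
  proof cases
    case 1
    then have "carrier (C (2 - (q + p))) = {\<zero>\<^bsub>C (2 - (q + p))\<^esub>}" by (intro chains_trivial) auto
    then show ?thesis using cap theta_closed[OF cc] by simp
  next
    case 2
    have "theta (q + p) (cup_right Q M q p g f) = theta (q + p) (\<lambda>w. \<zero>\<^bsub>M\<^esub>)"
      using 2 by (intro theta_cong coch_zero) (auto simp: val bas_W split_sum_def)
    moreover have "cap_right Q M (2 - q) p (theta q g) f = (\<Oplus>\<^bsub>C (2 - q - p)\<^esub>\<iota>\<in>Ix q. \<zero>\<^bsub>C (2 - q - p)\<^esub>)"
      unfolding capsum using 2
      by (intro C.finsum_cong') (auto simp: split_sum_def Ix_def)
    ultimately show ?thesis by (simp add: theta_zero algebra_simps)
  next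
    case 3
    then show ?thesis using theta_cup_right_0 f g by simp
  next
    case 4
    then show ?thesis using theta_cup_right_1_0 f g by simp
  next
    case 5
    then show ?thesis using theta_cup_right_2_0 f g by simp
  next
    case 6
    then show ?thesis using theta_cup_right_1_1 f g by simp
  qed
qed

section \<open>The differentials\<close>

lemma coch_cochain_d:
  assumes f: "coch p f"
  shows "coch (p + 1) (cochain_d Q M p f)"
  using cochain_d_in_cochains[OF f] by (simp add: cochains_iff)

text \<open>The cochain differential is a difference and the chain differential in degree 2 a sum.
  The terms with the right action correspond directly; in those with the left action, reindexing by
  \<open>star\<close> turns plus into minus.\<close>

lemma theta_cochain_d_0:
  assumes f: "coch 0 f"
  shows "theta 1 (cochain_d Q M 0 f) = chain_d Q M 2 (theta 0 f)"
proof -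
  have cc: "coch 1 (cochain_d Q M 0 f)" using coch_cochain_d[OF f] by simp
  have gi: "f (idem i) \<in> carrier M" if "i \<in> verts Q" for i using coch_closed[OF f] idem_W that by simp
  have gu: "f unit \<in> carrier M" using coch_closed[OF f] unit_W by simp
  have aW: "arrow a \<in> W 1" "arrow (star a) \<in> W 1" if "a \<in> arcs D" for a using arrow_W that by simp_all
  have ra: "rc (arrow a) \<in> carrier A" if "a \<in> arcs D" for a using W_PA[OF aW(1)[OF that]] by simp
  let ?X = "\<lambda>a. ract M (f unit) (rc (arrow a))" and ?Y = "\<lambda>a. lact M (rc (arrow a)) (f unit)"
  have X: "?X a \<in> carrier M" "?Y a \<in> carrier M" if "a \<in> arcs D" for a using ra gu that by simp_all
  have v: "cochain_d Q M 0 f (arrow a) = ?X a \<oplus>\<^bsub>M\<^esub> (-1) \<odot>\<^bsub>M\<^esub> ?Y a" if "a \<in> arcs D" for a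
    using split_sum_left_unit[OF bal_ract[OF acoch_rc f] _ arrow_W[OF that]]
      split_sum_right_unit[OF bal_lact[OF acoch_rc f] _ arrow_W[OF that]] aW[OF that]
    by (simp add: cochain_d_def)
  let ?S = "\<lambda>i. {a \<in> arcs D. head D a = i}"
  have "chain_d Q M 2 (theta 0 f) = (\<Oplus>\<^bsub>C 1\<^esub>i\<in>verts Q.
      split_sum Q (C 1) 1 1 (\<lambda>(x, u). ch 1 (ract M (f (idem i)) (rc x)) u) (\<sigma> i) \<oplus>\<^bsub>C 1\<^esub>
      1 \<odot>\<^bsub>C 1\<^esub> split_sum Q (C 1) 1 1 (\<lambda>(u, x). ch 1 (lact M (rc x) (f (idem i))) u) (\<sigma> i))"
    using theta_0[OF f] chain_d_finsum[of "verts Q" "\<lambda>i. f (idem i)" \<sigma> 2] gi sigma_W by simp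
  also have "\<dots> = (\<Oplus>\<^bsub>C 1\<^esub>i\<in>verts Q. (\<Oplus>\<^bsub>C 1\<^esub>a\<in>?S i. arrow_sign a \<odot>\<^bsub>C 1\<^esub> ch 1 (?X a) (arrow (star a))) \<oplus>\<^bsub>C 1\<^esub>
      (\<Oplus>\<^bsub>C 1\<^esub>a\<in>?S i. arrow_sign a \<odot>\<^bsub>C 1\<^esub> ch 1 (?Y (star a)) (arrow a)))"
  proof (rule C.finsum_cong')
    fix i assume i: "i \<in> verts Q"
    have 1: "split_sum Q (C 1) 1 1 (\<lambda>(x, u). ch 1 (ract M (f (idem i)) (rc x)) u) (\<sigma> i) = (\<Oplus>\<^bsub>C 1\<^esub>a\<in>?S i. arrow_sign a \<odot>\<^bsub>C 1\<^esub> ch 1 (?X a) (arrow (star a)))"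
    proof -
      have "split_sum Q (C 1) 1 1 (\<lambda>(x, u). ch 1 (ract M (f (idem i)) (rc x)) u) (\<sigma> i) = (\<Oplus>\<^bsub>C 1\<^esub>a\<in>?S i. arrow_sign a \<odot>\<^bsub>C 1\<^esub> ch 1 (ract M (f (idem i)) (rc (arrow a))) (arrow (star a)))"
        using split_sum_sigma[OF bal_cap_right[OF acoch_rc gi[OF i]], of i] by simp
      also have "\<dots> = (\<Oplus>\<^bsub>C 1\<^esub>a\<in>?S i. arrow_sign a \<odot>\<^bsub>C 1\<^esub> ch 1 (?X a) (arrow (star a)))"
      proof (rule C.finsum_cong')
        fix a assume a: "a \<in> ?S i"
        have "ract M (f (idem i)) (rc (arrow a)) = ?X a"
          using a i aW arrow_idem(1)[of a] by (intro ract_coch_0[OF acoch_rc[of 1] f]) auto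
        then show "arrow_sign a \<odot>\<^bsub>C 1\<^esub> ch 1 (ract M (f (idem i)) (rc (arrow a))) (arrow (star a)) = arrow_sign a \<odot>\<^bsub>C 1\<^esub> ch 1 (?X a) (arrow (star a))" by simp
      qed (use X aW in auto)
      finally show ?thesis .
    qed
    have 2: "split_sum Q (C 1) 1 1 (\<lambda>(u, x). ch 1 (lact M (rc x) (f (idem i))) u) (\<sigma> i) = (\<Oplus>\<^bsub>C 1\<^esub>a\<in>?S i. arrow_sign a \<odot>\<^bsub>C 1\<^esub> ch 1 (?Y (star a)) (arrow a))"
    proof -
      have "split_sum Q (C 1) 1 1 (\<lambda>(u, x). ch 1 (lact M (rc x) (f (idem i))) u) (\<sigma> i) = (\<Oplus>\<^bsub>C 1\<^esub>a\<in>?S i. arrow_sign a \<odot>\<^bsub>C 1\<^esub> ch 1 (lact M (rc (arrow (star a))) (f (idem i))) (arrow a))"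
        using split_sum_sigma[OF bal_cap_left[OF acoch_rc gi[OF i]], of i] by simp
      also have "\<dots> = (\<Oplus>\<^bsub>C 1\<^esub>a\<in>?S i. arrow_sign a \<odot>\<^bsub>C 1\<^esub> ch 1 (?Y (star a)) (arrow a))"
      proof (rule C.finsum_cong')
        fix a assume a: "a \<in> ?S i"
        have "lact M (rc (arrow (star a))) (f (idem i)) = ?Y (star a)"
          using a i aW arrow_idem(2)[of "star a"] by (intro lact_coch_0[OF acoch_rc[of 1] f]) auto
        then show "arrow_sign a \<odot>\<^bsub>C 1\<^esub> ch 1 (lact M (rc (arrow (star a))) (f (idem i))) (arrow a) = arrow_sign a \<odot>\<^bsub>C 1\<^esub> ch 1 (?Y (star a)) (arrow a)" by simp
      qed (use X aW in auto)
      finally show ?thesis .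
    qed
    have "(\<Oplus>\<^bsub>C 1\<^esub>a\<in>?S i. arrow_sign a \<odot>\<^bsub>C 1\<^esub> ch 1 (?Y (star a)) (arrow a)) \<in> carrier (C 1)"
      using X aW by (intro C.finsum_closed) auto
    then show "split_sum Q (C 1) 1 1 (\<lambda>(x, u). ch 1 (ract M (f (idem i)) (rc x)) u) (\<sigma> i) \<oplus>\<^bsub>C 1\<^esub>
      1 \<odot>\<^bsub>C 1\<^esub> split_sum Q (C 1) 1 1 (\<lambda>(u, x). ch 1 (lact M (rc x) (f (idem i))) u) (\<sigma> i) =
      (\<Oplus>\<^bsub>C 1\<^esub>a\<in>?S i. arrow_sign a \<odot>\<^bsub>C 1\<^esub> ch 1 (?X a) (arrow (star a))) \<oplus>\<^bsub>C 1\<^esub> (\<Oplus>\<^bsub>C 1\<^esub>a\<in>?S i. arrow_sign a \<odot>\<^bsub>C 1\<^esub> ch 1 (?Y (star a)) (arrow a))"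
      unfolding 1 2 by simp
  qed (use X aW in \<open>auto intro!: C.finsum_closed C.a_closed\<close>)
  also have "\<dots> = (\<Oplus>\<^bsub>C 1\<^esub>i\<in>verts Q. \<Oplus>\<^bsub>C 1\<^esub>a\<in>?S i. arrow_sign a \<odot>\<^bsub>C 1\<^esub> ch 1 (?X a) (arrow (star a))) \<oplus>\<^bsub>C 1\<^esub>
      (\<Oplus>\<^bsub>C 1\<^esub>i\<in>verts Q. \<Oplus>\<^bsub>C 1\<^esub>a\<in>?S i. arrow_sign a \<odot>\<^bsub>C 1\<^esub> ch 1 (?Y (star a)) (arrow a))"
    using X aW by (intro C.finsum_addf) (auto intro!: C.finsum_closed)
  also have "(\<Oplus>\<^bsub>C 1\<^esub>i\<in>verts Q. \<Oplus>\<^bsub>C 1\<^esub>a\<in>?S i. arrow_sign a \<odot>\<^bsub>C 1\<^esub> ch 1 (?X a) (arrow (star a))) =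
      (\<Oplus>\<^bsub>C 1\<^esub>a\<in>arcs D. arrow_sign a \<odot>\<^bsub>C 1\<^esub> ch 1 (?X a) (arrow (star a)))"
    using X aW by (intro finsum_arcs_group vspace_C) auto
  also have "(\<Oplus>\<^bsub>C 1\<^esub>i\<in>verts Q. \<Oplus>\<^bsub>C 1\<^esub>a\<in>?S i. arrow_sign a \<odot>\<^bsub>C 1\<^esub> ch 1 (?Y (star a)) (arrow a)) =
      (\<Oplus>\<^bsub>C 1\<^esub>a\<in>arcs D. arrow_sign a \<odot>\<^bsub>C 1\<^esub> ch 1 (?Y (star a)) (arrow a))"
    using X aW by (intro finsum_arcs_group vspace_C) auto
  also have "\<dots> = (\<Oplus>\<^bsub>C 1\<^esub>a\<in>arcs D. (- arrow_sign a) \<odot>\<^bsub>C 1\<^esub> ch 1 (?Y a) (arrow (star a)))"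
    using X aW by (subst finsum_arcs_star[OF vspace_C]) auto
  also have "(\<Oplus>\<^bsub>C 1\<^esub>a\<in>arcs D. arrow_sign a \<odot>\<^bsub>C 1\<^esub> ch 1 (?X a) (arrow (star a))) \<oplus>\<^bsub>C 1\<^esub>
      (\<Oplus>\<^bsub>C 1\<^esub>a\<in>arcs D. (- arrow_sign a) \<odot>\<^bsub>C 1\<^esub> ch 1 (?Y a) (arrow (star a))) =
      (\<Oplus>\<^bsub>C 1\<^esub>a\<in>arcs D. arrow_sign a \<odot>\<^bsub>C 1\<^esub> ch 1 (?X a) (arrow (star a)) \<oplus>\<^bsub>C 1\<^esub> (- arrow_sign a) \<odot>\<^bsub>C 1\<^esub> ch 1 (?Y a) (arrow (star a)))"
    using X aW by (intro C.finsum_addf[symmetric]) auto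
  also have "\<dots> = theta 1 (cochain_d Q M 0 f)"
    unfolding theta_1[OF cc] using X aW
    by (intro C.finsum_cong') (auto simp: v ch_smult_left ch_add_left C.smult_distr_right C.smult_smult)
  finally show ?thesis by simp
qed

text \<open>The roles of the signs are now reversed: a sum on cochains and a difference on chains of
  degree 1. Again only the terms with the left action are reindexed.\<close>

lemma theta_cochain_d_1:
  assumes f: "coch 1 f"
  shows "theta 2 (cochain_d Q M 1 f) = chain_d Q M 1 (theta 1 f)"
proof -
  have cc: "coch 2 (cochain_d Q M 1 f)" using coch_cochain_d[OF f] by simp
  have fa: "f (arrow a) \<in> carrier M" if "a \<in> arcs D" for a using coch_closed[OF f] arrow_W that by simp
  have aW: "arrow a \<in> W 1" "arrow (star a) \<in> W 1" if "a \<in> arcs D" for a using arrow_W that by simp_all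
  have ra: "rc (arrow a) \<in> carrier A" if "a \<in> arcs D" for a using W_PA[OF aW(1)[OF that]] by simp
  let ?X = "\<lambda>a. ract M (f (arrow a)) (rc (arrow (star a)))" and ?Y = "\<lambda>a. lact M (rc (arrow a)) (f (arrow (star a)))"
  have X: "?X a \<in> carrier M" "?Y a \<in> carrier M" if "a \<in> arcs D" for a using ra fa that by simp_all
  have Ys: "lact M (rc (arrow (star a))) (f (arrow a)) \<in> carrier M" if "a \<in> arcs D" for a using ra fa that by simp
  let ?S = "\<lambda>i. {a \<in> arcs D. head D a = i}"
  have v: "cochain_d Q M 1 f (\<sigma> i) = (\<Oplus>\<^bsub>M\<^esub>a\<in>?S i. arrow_sign a \<odot>\<^bsub>M\<^esub> (?X a \<oplus>\<^bsub>M\<^esub> ?Y a))" if i: "i \<in> verts Q" for i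
  proof -
    have "cochain_d Q M 1 f (\<sigma> i) = (\<Oplus>\<^bsub>M\<^esub>a\<in>?S i. arrow_sign a \<odot>\<^bsub>M\<^esub> ?X a) \<oplus>\<^bsub>M\<^esub> (\<Oplus>\<^bsub>M\<^esub>a\<in>?S i. arrow_sign a \<odot>\<^bsub>M\<^esub> ?Y a)"
    proof -
      have "(\<Oplus>\<^bsub>M\<^esub>a\<in>?S i. arrow_sign a \<odot>\<^bsub>M\<^esub> ?Y a) \<in> carrier M" using X by (intro M.finsum_closed) auto
      then show ?thesis
        using split_sum_sigma[OF bal_ract[OF acoch_rc f], of i] split_sum_sigma[OF bal_lact[OF acoch_rc f], of i] sigma_W[OF i]
        by (simp add: cochain_d_def)
    qed
    also have "\<dots> = (\<Oplus>\<^bsub>M\<^esub>a\<in>?S i. arrow_sign a \<odot>\<^bsub>M\<^esub> ?X a \<oplus>\<^bsub>M\<^esub> arrow_sign a \<odot>\<^bsub>M\<^esub> ?Y a)"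
      using X by (intro M.finsum_addf[symmetric]) auto
    also have "\<dots> = (\<Oplus>\<^bsub>M\<^esub>a\<in>?S i. arrow_sign a \<odot>\<^bsub>M\<^esub> (?X a \<oplus>\<^bsub>M\<^esub> ?Y a))"
      using X by (intro M.finsum_cong') (auto simp: M.smult_distr_right)
    finally show ?thesis .
  qed
  have "theta 2 (cochain_d Q M 1 f) = (\<Oplus>\<^bsub>C 0\<^esub>i\<in>verts Q. \<Oplus>\<^bsub>C 0\<^esub>a\<in>?S i. arrow_sign a \<odot>\<^bsub>C 0\<^esub> ch 0 (?X a \<oplus>\<^bsub>M\<^esub> ?Y a) unit)"
  proof (simp only: theta_2[OF cc], rule C.finsum_cong')
    fix i assume i: "i \<in> verts Q"
    have "ch 0 (cochain_d Q M 1 f (\<sigma> i)) (idem i) = (\<Oplus>\<^bsub>C 0\<^esub>a\<in>?S i. ch 0 (arrow_sign a \<odot>\<^bsub>M\<^esub> (?X a \<oplus>\<^bsub>M\<^esub> ?Y a)) (idem i))"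
      unfolding v[OF i] using X idem_W[OF i] by (intro ch_finsum_left) auto
    also have "\<dots> = (\<Oplus>\<^bsub>C 0\<^esub>a\<in>?S i. arrow_sign a \<odot>\<^bsub>C 0\<^esub> ch 0 (?X a \<oplus>\<^bsub>M\<^esub> ?Y a) unit)"
    proof (rule C.finsum_cong')
      fix a assume a: "a \<in> ?S i"
      have "ract M (?X a) (rc (idem i)) = ?X a"
        using a i aW fa arrow_idem(2)[of "star a"] by (intro ract_ract_idem[OF acoch_rc[of 1]]) auto
      moreover have "ract M (?Y a) (rc (idem i)) = ?Y a"
        using a i aW arrow_idem(2)[of "star a"] by (intro ract_lact_idem[OF acoch_rc[of 1] f]) auto
      ultimately have "ch 0 (?X a \<oplus>\<^bsub>M\<^esub> ?Y a) unit = ch 0 (?X a \<oplus>\<^bsub>M\<^esub> ?Y a) (idem i)"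
        using a i X by (intro ch_unit) (auto simp: ract_add)
      then show "ch 0 (arrow_sign a \<odot>\<^bsub>M\<^esub> (?X a \<oplus>\<^bsub>M\<^esub> ?Y a)) (idem i) = arrow_sign a \<odot>\<^bsub>C 0\<^esub> ch 0 (?X a \<oplus>\<^bsub>M\<^esub> ?Y a) unit"
        using a X idem_W[OF i] by (simp add: ch_smult_left)
    qed (use X unit_W in auto)
    finally show "ch 0 (cochain_d Q M 1 f (\<sigma> i)) (idem i) = (\<Oplus>\<^bsub>C 0\<^esub>a\<in>?S i. arrow_sign a \<odot>\<^bsub>C 0\<^esub> ch 0 (?X a \<oplus>\<^bsub>M\<^esub> ?Y a) unit)" .
  qed (use X unit_W in \<open>auto intro!: C.finsum_closed\<close>)
  also have "\<dots> = (\<Oplus>\<^bsub>C 0\<^esub>a\<in>arcs D. arrow_sign a \<odot>\<^bsub>C 0\<^esub> ch 0 (?X a \<oplus>\<^bsub>M\<^esub> ?Y a) unit)"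
    using X unit_W by (intro finsum_arcs_group vspace_C) auto
  also have "\<dots> = (\<Oplus>\<^bsub>C 0\<^esub>a\<in>arcs D. arrow_sign a \<odot>\<^bsub>C 0\<^esub> ch 0 (?X a) unit \<oplus>\<^bsub>C 0\<^esub> arrow_sign a \<odot>\<^bsub>C 0\<^esub> ch 0 (?Y a) unit)"
    using X unit_W by (intro C.finsum_cong') (auto simp: ch_add_left C.smult_distr_right)
  also have "\<dots> = (\<Oplus>\<^bsub>C 0\<^esub>a\<in>arcs D. arrow_sign a \<odot>\<^bsub>C 0\<^esub> ch 0 (?X a) unit) \<oplus>\<^bsub>C 0\<^esub> (\<Oplus>\<^bsub>C 0\<^esub>a\<in>arcs D. arrow_sign a \<odot>\<^bsub>C 0\<^esub> ch 0 (?Y a) unit)"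
    using X unit_W by (intro C.finsum_addf) auto
  also have "(\<Oplus>\<^bsub>C 0\<^esub>a\<in>arcs D. arrow_sign a \<odot>\<^bsub>C 0\<^esub> ch 0 (?Y a) unit) = (\<Oplus>\<^bsub>C 0\<^esub>a\<in>arcs D. (- arrow_sign a) \<odot>\<^bsub>C 0\<^esub> ch 0 (?Y (star a)) unit)"
    using X unit_W by (subst finsum_arcs_star[OF vspace_C]) auto
  also have "(\<Oplus>\<^bsub>C 0\<^esub>a\<in>arcs D. arrow_sign a \<odot>\<^bsub>C 0\<^esub> ch 0 (?X a) unit) \<oplus>\<^bsub>C 0\<^esub> \<dots> =
      (\<Oplus>\<^bsub>C 0\<^esub>a\<in>arcs D. arrow_sign a \<odot>\<^bsub>C 0\<^esub> ch 0 (?X a) unit \<oplus>\<^bsub>C 0\<^esub> (- arrow_sign a) \<odot>\<^bsub>C 0\<^esub> ch 0 (?Y (star a)) unit)"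
    using X Ys unit_W by (intro C.finsum_addf[symmetric]) auto
  also have "\<dots> = (\<Oplus>\<^bsub>C 0\<^esub>a\<in>arcs D.
      split_sum Q (C 0) 1 0 (\<lambda>(x, u). ch 0 (ract M (arrow_sign a \<odot>\<^bsub>M\<^esub> f (arrow a)) (rc x)) u) (arrow (star a)) \<oplus>\<^bsub>C 0\<^esub>
      (-1) \<odot>\<^bsub>C 0\<^esub> split_sum Q (C 0) 0 1 (\<lambda>(u, x). ch 0 (lact M (rc x) (arrow_sign a \<odot>\<^bsub>M\<^esub> f (arrow a))) u) (arrow (star a)))"
  proof (rule C.finsum_cong'[OF refl])
    have e: "split_sum Q (C 0) 1 0 (\<lambda>(x, u). ch 0 (ract M (arrow_sign a \<odot>\<^bsub>M\<^esub> f (arrow a)) (rc x)) u) (arrow (star a)) \<oplus>\<^bsub>C 0\<^esub>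
      (-1) \<odot>\<^bsub>C 0\<^esub> split_sum Q (C 0) 0 1 (\<lambda>(u, x). ch 0 (lact M (rc x) (arrow_sign a \<odot>\<^bsub>M\<^esub> f (arrow a))) u) (arrow (star a)) =
      arrow_sign a \<odot>\<^bsub>C 0\<^esub> ch 0 (?X a) unit \<oplus>\<^bsub>C 0\<^esub> (- arrow_sign a) \<odot>\<^bsub>C 0\<^esub> ch 0 (?Y (star a)) unit" if a: "a \<in> arcs D" for a
    proof -
      have m: "arrow_sign a \<odot>\<^bsub>M\<^esub> f (arrow a) \<in> carrier M" using fa a by simp
      have ra': "rc (arrow (star a)) \<in> carrier A" using ra a by simp
      have "split_sum Q (C 0) 1 0 (\<lambda>(x, u). ch 0 (ract M (arrow_sign a \<odot>\<^bsub>M\<^esub> f (arrow a)) (rc x)) u) (arrow (star a)) = ch 0 (ract M (arrow_sign a \<odot>\<^bsub>M\<^esub> f (arrow a)) (rc (arrow (star a)))) unit"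
        using split_sum_right_unit[OF bal_cap_right[OF acoch_rc m] _ aW(2)[OF a]] by simp
      moreover have "split_sum Q (C 0) 0 1 (\<lambda>(u, x). ch 0 (lact M (rc x) (arrow_sign a \<odot>\<^bsub>M\<^esub> f (arrow a))) u) (arrow (star a)) = ch 0 (lact M (rc (arrow (star a))) (arrow_sign a \<odot>\<^bsub>M\<^esub> f (arrow a))) unit"
        using split_sum_left_unit[OF bal_cap_left[OF acoch_rc m] _ aW(2)[OF a]] by simp
      ultimately show ?thesis using fa[OF a] ra' unit_W X[of a] X[of "star a"] a
        by (simp add: ract_smult lact_smult ch_smult_left C.smult_smult)
    qed
    show "arrow_sign a \<odot>\<^bsub>C 0\<^esub> ch 0 (?X a) unit \<oplus>\<^bsub>C 0\<^esub> (- arrow_sign a) \<odot>\<^bsub>C 0\<^esub> ch 0 (?Y (star a)) unit =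
      split_sum Q (C 0) 1 0 (\<lambda>(x, u). ch 0 (ract M (arrow_sign a \<odot>\<^bsub>M\<^esub> f (arrow a)) (rc x)) u) (arrow (star a)) \<oplus>\<^bsub>C 0\<^esub>
      (-1) \<odot>\<^bsub>C 0\<^esub> split_sum Q (C 0) 0 1 (\<lambda>(u, x). ch 0 (lact M (rc x) (arrow_sign a \<odot>\<^bsub>M\<^esub> f (arrow a))) u) (arrow (star a))" if "a \<in> arcs D" for a
      using e[OF that] by simp
    have cl: "arrow_sign a \<odot>\<^bsub>C 0\<^esub> ch 0 (?X a) unit \<oplus>\<^bsub>C 0\<^esub> (- arrow_sign a) \<odot>\<^bsub>C 0\<^esub> ch 0 (?Y (star a)) unit \<in> carrier (C 0)" if "a \<in> arcs D" for a
      using X[OF that] X[of "star a"] that unit_W by simp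
    show "(\<lambda>a. split_sum Q (C 0) 1 0 (\<lambda>(x, u). ch 0 (ract M (arrow_sign a \<odot>\<^bsub>M\<^esub> f (arrow a)) (rc x)) u) (arrow (star a)) \<oplus>\<^bsub>C 0\<^esub>
      (-1) \<odot>\<^bsub>C 0\<^esub> split_sum Q (C 0) 0 1 (\<lambda>(u, x). ch 0 (lact M (rc x) (arrow_sign a \<odot>\<^bsub>M\<^esub> f (arrow a))) u) (arrow (star a))) \<in> arcs D \<rightarrow> carrier (C 0)"
      by (rule Pi_I) (simp only: e cl)
  qed
  also have "\<dots> = chain_d Q M 1 (theta 1 f)"
    using theta_1[OF f] chain_d_finsum[of "arcs D" "\<lambda>a. arrow_sign a \<odot>\<^bsub>M\<^esub> f (arrow a)" "\<lambda>a. arrow (star a)" 1] fa aW by simp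
  finally show ?thesis .
qed

lemma theta_cochain_d:
  assumes f: "f \<in> carrier (cochains Q M p)"
  shows "theta (p + 1) (cochain_d Q M p f) = chain_d Q M (2 - p) (theta p f)"
proof -
  have cf: "coch p f" using f by (simp add: cochains_iff)
  have cc: "coch (p + 1) (cochain_d Q M p f)" using cochain_d_closed[OF f] by (simp add: cochains_iff)
  have d: "chain_d Q M (2 - p) (theta p f) \<in> carrier (C (2 - (p + 1)))"
    using chain_d_closed[OF theta_closed[OF cf]] by (simp add: algebra_simps)
  consider "p < -1 \<or> p > 1" | "p = -1" | "p = 0" | "p = 1" by linarith
  then show ?thesis
  proof cases
    case 1
    then have "carrier (C (2 - (p + 1))) = {\<zero>\<^bsub>C (2 - (p + 1))\<^esub>}" by (intro chains_trivial) auto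
    then show ?thesis using d theta_closed[OF cc] by simp
  next
    case 2
    \<comment> \<open>The target has degree 0 and need not vanish; the differential into it is zero
      because \<open>split_sum\<close> returns zero for the degree -1.\<close>
    have "theta (p + 1) (cochain_d Q M p f) = theta (p + 1) (\<lambda>w. \<zero>\<^bsub>M\<^esub>)"
      using 2 bas_W[of _ 0] by (intro theta_cong coch_zero) (auto simp: cochain_d_def split_sum_def)
    moreover have "theta p f = \<zero>\<^bsub>C (2 - p)\<^esub>" using 2 by (simp add: theta_def Ix_def)
    ultimately show ?thesis using 2 chain_d_zero[of 3] by (simp add: theta_zero)
  next
    case 3
    then show ?thesis using theta_cochain_d_0 cf by simp
  next
    case 4
    then show ?thesis using theta_cochain_d_1 cf by simp
  qed
qed

end

subsection \<open>Transport of structure to cosets\<close>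

text \<open>The set \<open>S\<close> is larger than the carrier, so that the induced operations on cosets can be
  transported as operations on arbitrary subsets of \<open>S\<close>; in this way the products need not be
  known to be well-defined on cohomology classes.\<close>

definition transports ::
    "'m set \<Rightarrow> ('f, 'm, 'y) module_scheme \<Rightarrow> ('f, 'n, 'z) module_scheme \<Rightarrow> ('m \<Rightarrow> 'n) \<Rightarrow> bool" where
  "transports S V W \<phi> \<longleftrightarrow> carrier V \<subseteq> S \<and> \<phi> ` carrier V = carrier W \<and> inj_on \<phi> S \<and>
     \<zero>\<^bsub>V\<^esub> \<in> S \<and> \<phi> \<zero>\<^bsub>V\<^esub> = \<zero>\<^bsub>W\<^esub> \<and>
     (\<forall>x\<in>S. \<forall>y\<in>S. x \<oplus>\<^bsub>V\<^esub> y \<in> S \<and> \<phi> (x \<oplus>\<^bsub>V\<^esub> y) = \<phi> x \<oplus>\<^bsub>W\<^esub> \<phi> y) \<and>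
     (\<forall>c. \<forall>x\<in>S. c \<odot>\<^bsub>V\<^esub> x \<in> S \<and> \<phi> (c \<odot>\<^bsub>V\<^esub> x) = c \<odot>\<^bsub>W\<^esub> \<phi> x)"

lemma transportsD:
  assumes "transports S V W \<phi>"
  shows "carrier V \<subseteq> S" "\<phi> ` carrier V = carrier W" "inj_on \<phi> S" "\<zero>\<^bsub>V\<^esub> \<in> S" "\<phi> \<zero>\<^bsub>V\<^esub> = \<zero>\<^bsub>W\<^esub>"
    "x \<in> S \<Longrightarrow> y \<in> S \<Longrightarrow> x \<oplus>\<^bsub>V\<^esub> y \<in> S" "x \<in> S \<Longrightarrow> y \<in> S \<Longrightarrow> \<phi> (x \<oplus>\<^bsub>V\<^esub> y) = \<phi> x \<oplus>\<^bsub>W\<^esub> \<phi> y"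
    "x \<in> S \<Longrightarrow> c \<odot>\<^bsub>V\<^esub> x \<in> S" "x \<in> S \<Longrightarrow> \<phi> (c \<odot>\<^bsub>V\<^esub> x) = c \<odot>\<^bsub>W\<^esub> \<phi> x"
  using assms by (simp_all add: transports_def)

lemma transports_linear_iso: assumes "transports S V W \<phi>" shows "linear_iso V W \<phi>"
proof -
  note D = transportsD[OF assms]
  have "x \<in> S" if "x \<in> carrier V" for x using D(1) that by blast
  moreover have "inj_on \<phi> (carrier V)" using D(1,3) by (metis inj_on_subset)
  ultimately show ?thesis unfolding linear_iso_def bij_betw_def using D(2,7,9) by blast
qed

lemma transports_coset:
  assumes "transports S V W \<phi>" "U \<subseteq> S" "x \<in> S"
  shows "U +>\<^bsub>V\<^esub> x \<subseteq> S" "\<phi> ` (U +>\<^bsub>V\<^esub> x) = \<phi> ` U +>\<^bsub>W\<^esub> \<phi> x"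
proof -
  note D = transportsD[OF assms(1)]
  have e: "U +>\<^bsub>V\<^esub> x = (\<lambda>h. h \<oplus>\<^bsub>V\<^esub> x) ` U" "\<phi> ` U +>\<^bsub>W\<^esub> \<phi> x = (\<lambda>h. h \<oplus>\<^bsub>W\<^esub> \<phi> x) ` \<phi> ` U"
    by (auto simp: a_r_coset_def')
  show "U +>\<^bsub>V\<^esub> x \<subseteq> S" unfolding e using D(6) assms(2,3) by blast
  have "\<phi> ` (\<lambda>h. h \<oplus>\<^bsub>V\<^esub> x) ` U = (\<lambda>h. h \<oplus>\<^bsub>W\<^esub> \<phi> x) ` \<phi> ` U"
    unfolding image_image using D(7) assms(2,3) by (intro image_cong refl) blast
  then show "\<phi> ` (U +>\<^bsub>V\<^esub> x) = \<phi> ` U +>\<^bsub>W\<^esub> \<phi> x" unfolding e .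
qed

text \<open>Taking images commutes with set addition and with unions of cosets, and stays injective
  on subsets of \<open>S\<close>. The result has the same form one level higher, so it can be
  iterated.\<close>

lemma transports_quotient:
  assumes "transports S V W \<phi>" "U \<subseteq> S"
  shows "transports (Pow S) (quotient_space V U) (quotient_space W (\<phi> ` U)) ((`) \<phi>)"
proof -
  note D = transportsD[OF assms(1)] and co = transports_coset[OF assms]
  have carr: "carrier (quotient_space X N) = (\<lambda>x. N +>\<^bsub>X\<^esub> x) ` carrier X" for X :: "('f, 'x, 'z) module_scheme" and N
    by (auto simp: quotient_space_def A_RCOSETS_def')
  have sm: "smult (quotient_space X N) = (\<lambda>c Y. \<Union>x\<in>Y. N +>\<^bsub>X\<^esub> (c \<odot>\<^bsub>X\<^esub> x))" for X :: "('f, 'x, 'z) module_scheme" and N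
    by (simp add: quotient_space_def)
  show ?thesis unfolding transports_def
  proof (intro conjI ballI allI)
    show "carrier (quotient_space V U) \<subseteq> Pow S" unfolding carr using co(1) D(1) by blast
    have "(`) \<phi> ` (\<lambda>x. U +>\<^bsub>V\<^esub> x) ` carrier V = (\<lambda>x. \<phi> ` U +>\<^bsub>W\<^esub> x) ` \<phi> ` carrier V"
      unfolding image_image using co(2) D(1) by (intro image_cong refl) blast
    then show "(`) \<phi> ` carrier (quotient_space V U) = carrier (quotient_space W (\<phi> ` U))"
      unfolding carr D(2) .
    show "inj_on ((`) \<phi>) (Pow S)" using D(3) by (rule inj_on_image_Pow)
    show "\<zero>\<^bsub>quotient_space V U\<^esub> \<in> Pow S" using assms(2) by simp
    show "\<phi> ` \<zero>\<^bsub>quotient_space V U\<^esub> = \<zero>\<^bsub>quotient_space W (\<phi> ` U)\<^esub>" by simp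
    fix X assume X: "X \<in> Pow S"
    {
      fix Y assume Y: "Y \<in> Pow S"
      have e: "X <+>\<^bsub>V\<^esub> Y = (\<lambda>(x, y). x \<oplus>\<^bsub>V\<^esub> y) ` (X \<times> Y)"
        "\<phi> ` X <+>\<^bsub>W\<^esub> \<phi> ` Y = (\<lambda>(x, y). \<phi> x \<oplus>\<^bsub>W\<^esub> \<phi> y) ` (X \<times> Y)"
        by (auto simp: set_add_def' image_def)
      have xy: "x \<oplus>\<^bsub>V\<^esub> y \<in> S" "\<phi> (x \<oplus>\<^bsub>V\<^esub> y) = \<phi> x \<oplus>\<^bsub>W\<^esub> \<phi> y" if "x \<in> X" "y \<in> Y" for x y
      proof -
        have "x \<in> S" "y \<in> S" using X Y that by auto
        then show "x \<oplus>\<^bsub>V\<^esub> y \<in> S" "\<phi> (x \<oplus>\<^bsub>V\<^esub> y) = \<phi> x \<oplus>\<^bsub>W\<^esub> \<phi> y" by (rule D(6), rule D(7))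
      qed
      show "X \<oplus>\<^bsub>quotient_space V U\<^esub> Y \<in> Pow S" unfolding quotient_simps e using xy(1) by auto
      show "\<phi> ` (X \<oplus>\<^bsub>quotient_space V U\<^esub> Y) = \<phi> ` X \<oplus>\<^bsub>quotient_space W (\<phi> ` U)\<^esub> \<phi> ` Y"
        unfolding quotient_simps e image_image by (intro image_cong refl) (auto simp: xy(2))
    }
    fix c
    have S: "c \<odot>\<^bsub>V\<^esub> x \<in> S" "\<phi> (c \<odot>\<^bsub>V\<^esub> x) = c \<odot>\<^bsub>W\<^esub> \<phi> x" if "x \<in> X" for x
    proof -
      have "x \<in> S" using X that by auto
      then show "c \<odot>\<^bsub>V\<^esub> x \<in> S" "\<phi> (c \<odot>\<^bsub>V\<^esub> x) = c \<odot>\<^bsub>W\<^esub> \<phi> x" by (rule D(8), rule D(9))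
    qed
    show "c \<odot>\<^bsub>quotient_space V U\<^esub> X \<in> Pow S" unfolding sm using co(1)[OF S(1)] by auto
    have "\<phi> ` (\<Union>x\<in>X. U +>\<^bsub>V\<^esub> (c \<odot>\<^bsub>V\<^esub> x)) = (\<Union>x\<in>X. \<phi> ` (U +>\<^bsub>V\<^esub> (c \<odot>\<^bsub>V\<^esub> x)))" by blast
    also have "\<dots> = (\<Union>x\<in>X. \<phi> ` U +>\<^bsub>W\<^esub> (c \<odot>\<^bsub>W\<^esub> \<phi> x))"
      by (intro SUP_cong refl) (simp only: co(2)[OF S(1)] S(2))
    finally show "\<phi> ` (c \<odot>\<^bsub>quotient_space V U\<^esub> X) = c \<odot>\<^bsub>quotient_space W (\<phi> ` U)\<^esub> \<phi> ` X"
      unfolding sm by simp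
  qed
qed

lemma transports_cohomology:
  assumes tr: "\<And>p. transports (S p) (V p) (W p) (\<phi> p)"
    and d: "\<And>p x. x \<in> carrier (V p) \<Longrightarrow> d p x \<in> S (p + 1)"
    and comm: "\<And>p x. x \<in> carrier (V p) \<Longrightarrow> \<phi> (p + 1) (d p x) = d' p (\<phi> p x)"
  shows "transports (Pow (S p)) (cohomology V d p) (cohomology W d' p) ((`) (\<phi> p))"
proof -
  note D = transportsD[OF tr]
  let ?V = "(V p)\<lparr>carrier := {x \<in> carrier (V p). d p x = \<zero>\<^bsub>V (p + 1)\<^esub>}\<rparr>"
  let ?W = "(W p)\<lparr>carrier := {x \<in> carrier (W p). d' p x = \<zero>\<^bsub>W (p + 1)\<^esub>}\<rparr>"
  \<comment> \<open>Injectivity on \<open>S\<close> lets the kernel condition be read on either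
    side, because both \<open>d p x\<close> and the zero of the next degree belong to
    \<open>S\<close>.\<close>
  have ker: "d p x = \<zero>\<^bsub>V (p + 1)\<^esub> \<longleftrightarrow> d' p (\<phi> p x) = \<zero>\<^bsub>W (p + 1)\<^esub>" if "x \<in> carrier (V p)" for x
    using comm[OF that] d[OF that] D(3)[of "p + 1"] D(4)[of "p + 1"] D(5)[of "p + 1"] inj_onD by metis
  have "transports (S p) ?V ?W (\<phi> p)"
    unfolding transports_def
  proof (intro conjI ballI allI)
    show "\<phi> p ` carrier ?V = carrier ?W"
      using ker D(2)[of p, symmetric] by (auto simp: image_iff)
  qed (use transportsD[OF tr[of p]] in auto)
  moreover have U: "d (p - 1) ` carrier (V (p - 1)) \<subseteq> S p" using d[of _ "p - 1"] by auto
  ultimately have "transports (Pow (S p)) (quotient_space ?V (d (p - 1) ` carrier (V (p - 1))))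
      (quotient_space ?W (\<phi> p ` d (p - 1) ` carrier (V (p - 1)))) ((`) (\<phi> p))"
    by (rule transports_quotient)
  moreover have "\<phi> p ` d (p - 1) ` carrier (V (p - 1)) = d' (p - 1) ` carrier (W (p - 1))"
    unfolding D(2)[of "p - 1", symmetric] image_image using comm[of _ "p - 1"] by (intro image_cong) auto
  ultimately show ?thesis by (simp add: cohomology_def)
qed

text \<open>An image of a union of cosets is the union of their images. With separate maps
  \<open>\<alpha>\<close> and \<open>\<beta>\<close>, the algebra argument can be kept fixed in the
  left as well as in the right action.\<close>

lemma transports_induced2:
  assumes "transports S V W \<phi>" "U \<subseteq> S"
    and "\<And>a x. a \<in> X \<Longrightarrow> x \<in> Y \<Longrightarrow> f a x \<in> S"
    and "\<And>a x. a \<in> X \<Longrightarrow> x \<in> Y \<Longrightarrow> \<phi> (f a x) = f' (\<alpha> a) (\<beta> x)"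
  shows "induced2 V U f X Y \<subseteq> S" "\<phi> ` induced2 V U f X Y = induced2 W (\<phi> ` U) f' (\<alpha> ` X) (\<beta> ` Y)"
proof -
  note co = transports_coset[OF assms(1,2)]
  show "induced2 V U f X Y \<subseteq> S" unfolding induced2_def using co(1) assms(3) by blast
  have "\<phi> ` induced2 V U f X Y = (\<Union>a\<in>X. \<Union>x\<in>Y. \<phi> ` (U +>\<^bsub>V\<^esub> f a x))" unfolding induced2_def by blast
  also have "\<dots> = (\<Union>a\<in>X. \<Union>x\<in>Y. \<phi> ` U +>\<^bsub>W\<^esub> f' (\<alpha> a) (\<beta> x))"
    using co(2) assms(3,4) by (intro SUP_cong refl) auto
  finally show "\<phi> ` induced2 V U f X Y = induced2 W (\<phi> ` U) f' (\<alpha> ` X) (\<beta> ` Y)"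
    unfolding induced2_def by simp
qed

text \<open>Compatibility with the actions is demanded on the larger sets \<open>T p\<close> and
  \<open>S q\<close>; power sets of these can then take their place in
  \<open>higher\<close>.\<close>

definition gtransports ::
    "(int \<Rightarrow> 'a set) \<Rightarrow> (int \<Rightarrow> 'h set) \<Rightarrow> ('f, 'a, 'h) gbimod \<Rightarrow> ('f, 'a, 'k) gbimod \<Rightarrow> (int \<Rightarrow> 'h \<Rightarrow> 'k) \<Rightarrow> bool" where
  "gtransports T S X Y \<phi> \<longleftrightarrow> (\<forall>p. transports (S p) (gcomp X p) (gcomp Y p) (\<phi> p)) \<and>
     (\<forall>p q. \<forall>a\<in>T p. \<forall>x\<in>S q.
        gleft X p q a x \<in> S (p + q) \<and> \<phi> (p + q) (gleft X p q a x) = gleft Y p q a (\<phi> q x) \<and>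
        gright X q p x a \<in> S (q + p) \<and> \<phi> (q + p) (gright X q p x a) = gright Y q p (\<phi> q x) a)"

lemma gtransports_isomorphic:
  assumes "gtransports T S X Y \<phi>" "\<And>p. carrier (L p) \<subseteq> T p"
  shows "gbimod_isomorphic L X Y"
proof -
  have tr: "transports (S p) (gcomp X p) (gcomp Y p) (\<phi> p)" for p using assms(1) by (simp add: gtransports_def)
  show ?thesis unfolding gbimod_isomorphic_def
  proof (intro exI[of _ \<phi>] conjI allI ballI)
    show "linear_iso (gcomp X p) (gcomp Y p) (\<phi> p)" for p by (rule transports_linear_iso[OF tr])
    fix p q a x assume "a \<in> carrier (L p)" "x \<in> carrier (gcomp X q)"
    then have "a \<in> T p" "x \<in> S q" using assms(2) transportsD(1)[OF tr] by blast+
    then show "\<phi> (p + q) (gleft X p q a x) = gleft Y p q a (\<phi> q x)" "\<phi> (q + p) (gright X q p x a) = gright Y q p (\<phi> q x) a"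
      using assms(1) by (simp_all add: gtransports_def)
  qed
qed

text \<open>The passage from a complex to its cohomology is repeated with the left action of
  \<open>E\<close> as differential. That \<open>\<phi>\<close> commutes with this differential is a
  special case of its compatibility with the left action.\<close>

lemma gtransports_higher:
  assumes g: "gtransports T S X Y \<phi>" and E: "E \<in> T 1"
  shows "gtransports (\<lambda>p. Pow (T p)) (\<lambda>p. Pow (S p)) (higher E X) (higher E Y) (\<lambda>p. (`) (\<phi> p))"
proof -
  have tr: "transports (S p) (gcomp X p) (gcomp Y p) (\<phi> p)" for p using g by (simp add: gtransports_def)
  note sub = transportsD(1)[OF tr]
  have act: "gleft X p q a x \<in> S (p + q)" "\<phi> (p + q) (gleft X p q a x) = gleft Y p q a (\<phi> q x)"
    "gright X q p x a \<in> S (q + p)" "\<phi> (q + p) (gright X q p x a) = gright Y q p (\<phi> q x) a"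
    if "a \<in> T p" "x \<in> S q" for p q a x
    using g that by (simp_all add: gtransports_def)
  have H: "transports (Pow (S p)) (gcomp (higher E X) p) (gcomp (higher E Y) p) ((`) (\<phi> p))" for p
  proof -
    have x: "x \<in> S p" if "x \<in> carrier (gcomp X p)" for p x using sub that by blast
    show ?thesis unfolding higher_def Let_def gbimod.simps
    proof (rule transports_cohomology[where d = "\<lambda>q. gleft X 1 q E" and d' = "\<lambda>q. gleft Y 1 q E", OF tr])
      fix p x assume "x \<in> carrier (gcomp X p)"
      then have "x \<in> S p" by (rule x)
      then show "gleft X 1 p E x \<in> S (p + 1)" "\<phi> (p + 1) (gleft X 1 p E x) = gleft Y 1 p E (\<phi> p x)"
        using act(1,2)[OF E, of x p] by (simp_all add: add.commute)
    qed
  qed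
  show ?thesis unfolding gtransports_def
  proof (intro conjI allI ballI)
    show "transports (Pow (S p)) (gcomp (higher E X) p) (gcomp (higher E Y) p) ((`) (\<phi> p))" for p by (rule H)
    fix p q a x assume a: "a \<in> Pow (T p)" and x: "x \<in> Pow (S q)"
    have z: "\<zero>\<^bsub>gcomp (higher E X) n\<^esub> \<subseteq> S n" "\<phi> n ` \<zero>\<^bsub>gcomp (higher E X) n\<^esub> = \<zero>\<^bsub>gcomp (higher E Y) n\<^esub>" for n
      using transportsD(4,5)[OF H] by auto
    have gl: "gleft (higher E X) p q = induced2 (gcomp X (p + q)) \<zero>\<^bsub>gcomp (higher E X) (p + q)\<^esub> (gleft X p q)"
      "gright (higher E X) q p = induced2 (gcomp X (q + p)) \<zero>\<^bsub>gcomp (higher E X) (q + p)\<^esub> (gright X q p)"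
      "gleft (higher E Y) p q = induced2 (gcomp Y (p + q)) \<zero>\<^bsub>gcomp (higher E Y) (p + q)\<^esub> (gleft Y p q)"
      "gright (higher E Y) q p = induced2 (gcomp Y (q + p)) \<zero>\<^bsub>gcomp (higher E Y) (q + p)\<^esub> (gright Y q p)"
      by (simp_all add: higher_def Let_def)
    have a': "b \<in> T p" if "b \<in> a" for b using a that by blast
    have x': "y \<in> S q" if "y \<in> x" for y using x that by blast
    note l = transports_induced2[OF tr z(1), of a x "gleft X p q" "p + q" "gleft Y p q" "\<lambda>a. a" "\<phi> q"]
    note r = transports_induced2[OF tr z(1), of x a "gright X q p" "q + p" "gright Y q p" "\<phi> q" "\<lambda>a. a"]
    show "gleft (higher E X) p q a x \<in> Pow (S (p + q))"
      unfolding gl using l(1) act(1,2) a' x' by auto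
    show "\<phi> (p + q) ` gleft (higher E X) p q a x = gleft (higher E Y) p q a (\<phi> q ` x)"
      unfolding gl using l(2) act(1,2) a' x' by (simp add: z(2))
    show "gright (higher E X) q p x a \<in> Pow (S (q + p))"
      unfolding gl using r(1) act(3,4) a' x' by auto
    show "\<phi> (q + p) ` gright (higher E X) q p x a = gright (higher E Y) q p (\<phi> q ` x) a"
      unfolding gl using r(2) act(3,4) a' x' by (simp add: z(2))
  qed
qed

section \<open>The isomorphisms on ordinary and higher Koszul (co)homology\<close>

context koszul_bimodule
begin

lemma transports_theta: "transports (carrier (cochains Q M p)) (cochains Q M p) (C (2 - p)) (theta p)"
proof -
  interpret c: vspace "cochains Q M p" by (rule vspace_cochains)
  have "theta p \<zero>\<^bsub>cochains Q M p\<^esub> = \<zero>\<^bsub>C (2 - p)\<^esub>"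
    using theta_zero[of p] theta_restrict[OF coch_zero, of p] by (simp add: cochains_simps)
  then show ?thesis
    using theta_bij[of p] c.a_closed c.smult_in c.zero_closed
    by (auto simp: transports_def bij_betw_def cochains_iff theta_add theta_smult cochains_simps)
qed

text \<open>The substitution of \<open>2 - p\<close> for \<open>p\<close> reverses the direction of
  the differential, so homology becomes cohomology literally and a single transport lemma
  serves.\<close>

lemma homology_reindex: "homology V d (2 - p) = cohomology (\<lambda>p. V (2 - p)) (\<lambda>p. d (2 - p)) p"
proof -
  have "2 - (p + 1) = 2 - p - 1" "2 - (p - 1) = 2 - p + 1" by simp_all
  then show ?thesis unfolding homology_def cohomology_def by simp
qed

lemma transports_HK:
  "transports (Pow (carrier (cochains Q M p))) (HKcoh Q M p) (HKhom Q M (2 - p)) ((`) (theta p))"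
proof -
  have "transports (Pow (carrier (cochains Q M p))) (cohomology (cochains Q M) (cochain_d Q M) p)
      (cohomology (\<lambda>p. C (2 - p)) (\<lambda>p. chain_d Q M (2 - p)) p) ((`) (theta p))"
  proof (rule transports_cohomology[where S = "\<lambda>p. carrier (cochains Q M p)" and V = "cochains Q M" and W = "\<lambda>p. C (2 - p)"
      and \<phi> = theta and d = "cochain_d Q M" and d' = "\<lambda>p. chain_d Q M (2 - p)"])
    fix p
    show "transports (carrier (cochains Q M p)) (cochains Q M p) (C (2 - p)) (theta p)" by (rule transports_theta)
    fix f assume f: "f \<in> carrier (cochains Q M p)"
    show "cochain_d Q M p f \<in> carrier (cochains Q M (p + 1))" by (rule cochain_d_closed[OF f])
    show "theta (p + 1) (cochain_d Q M p f) = chain_d Q M (2 - p) (theta p f)" by (rule theta_cochain_d[OF f])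
  qed
  then show ?thesis unfolding HKcoh_def HKhom_def homology_reindex .
qed

lemma gtransports_HK:
  "gtransports (\<lambda>p. Pow {f. acoch p f}) (\<lambda>p. Pow (carrier (cochains Q M p))) (HKcoh_gbimod Q M) (HKhom_gbimod Q M) (\<lambda>p. (`) (theta p))"
  unfolding gtransports_def
proof (intro conjI allI ballI)
  show "transports (Pow (carrier (cochains Q M p))) (gcomp (HKcoh_gbimod Q M) p) (gcomp (HKhom_gbimod Q M) p) ((`) (theta p))" for p
    using transports_HK by (simp add: HKcoh_gbimod_def HKhom_gbimod_def)
  fix p q a x assume a: "a \<in> Pow {f. acoch p f}" and x: "x \<in> Pow (carrier (cochains Q M q))"
  have z: "\<zero>\<^bsub>HKcoh Q M n\<^esub> \<subseteq> carrier (cochains Q M n)" "theta n ` \<zero>\<^bsub>HKcoh Q M n\<^esub> = \<zero>\<^bsub>HKhom Q M (2 - n)\<^esub>" for n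
    using transportsD(4,5)[OF transports_HK] by auto
  have i: "2 - q - p = 2 - (p + q)" "2 - q - p = 2 - (q + p)" by simp_all
  have a': "acoch p b" if "b \<in> a" for b using a that by blast
  have x': "y \<in> carrier (cochains Q M q)" if "y \<in> x" for y using x that by blast
  note l = transports_induced2[OF transports_theta z(1), of a x "cup_left Q M p q" "p + q" "cap_left Q M p (2 - q)" "\<lambda>a. a" "theta q"]
  note r = transports_induced2[OF transports_theta z(1), of x a "cup_right Q M q p" "q + p" "cap_right Q M (2 - q) p" "theta q" "\<lambda>a. a"]
  show "gleft (HKcoh_gbimod Q M) p q a x \<in> Pow (carrier (cochains Q M (p + q)))"
    using l(1) cup_left_closed theta_cup_left a' x' by (simp add: HKcoh_gbimod_def)
  show "theta (p + q) ` gleft (HKcoh_gbimod Q M) p q a x = gleft (HKhom_gbimod Q M) p q a (theta q ` x)"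
    using l(2) cup_left_closed theta_cup_left a' x' by (simp add: HKcoh_gbimod_def HKhom_gbimod_def z(2) i(1))
  show "gright (HKcoh_gbimod Q M) q p x a \<in> Pow (carrier (cochains Q M (q + p)))"
    using r(1) cup_right_closed theta_cup_right a' x' by (simp add: HKcoh_gbimod_def)
  show "theta (q + p) ` gright (HKcoh_gbimod Q M) q p x a = gright (HKhom_gbimod Q M) q p (theta q ` x) a"
    using r(2) cup_right_closed theta_cup_right a' x' by (simp add: HKcoh_gbimod_def HKhom_gbimod_def z(2) i(2))
qed

end

section \<open>The algebra as a bimodule over itself\<close>

context koszul_quiver
begin

lemma preproj_self_simps [simp]:
  "carrier (preproj_self Q) = carrier A" "add (preproj_self Q) = add A" "zero (preproj_self Q) = zero A"
  "smult (preproj_self Q) = smult A" "lact (preproj_self Q) = mult A" "ract (preproj_self Q) = mult A"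
  by (simp_all add: preproj_self_def module.extend_def bimod.fields_def)

lemma koszul_bimodule_self: "koszul_bimodule Q (preproj_self Q :: ('f, 'v, 'e, ('f, 'v, 'e) preproj_elt) preproj_bimod)"
  by (intro koszul_bimodule.intro koszul_bimodule_axioms.intro koszul_quiver_axioms self_bimodule)

end

context koszul_bimodule
begin

lemma cochains_self_acoch:
  assumes "f \<in> carrier (cochains Q (preproj_self Q) p)"
  shows "acoch p f"
proof -
  interpret self: koszul_bimodule Q F "preproj_self Q :: ('f, 'v, 'e, ('f, 'v, 'e) preproj_elt) preproj_bimod"
    by (rule koszul_bimodule_self)
  show ?thesis using assms A.vs by (simp add: self.cochains_iff self.coch_def acoch_def linear_on_def)
qed

text \<open>The acting classes, ordinary and higher, must be located among sets of
  \<open>A\<close>-valued cochains. These inclusions are the first component of the transport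
  statements applied to \<open>A\<close> itself as the bimodule.\<close>

lemma HK_self_subset:
  "carrier (HKcoh Q (preproj_self Q) p) \<subseteq> Pow {f. acoch p f}"
  "carrier (gcomp (HKcoh_hi_gbimod Q (preproj_self Q)) p) \<subseteq> Pow (Pow {f. acoch p f})"
  "fundamental_class Q \<in> Pow {f. acoch 1 f}"
proof -
  interpret self: koszul_bimodule Q F "preproj_self Q :: ('f, 'v, 'e, ('f, 'v, 'e) preproj_elt) preproj_bimod"
    by (rule koszul_bimodule_self)
  let ?N = "preproj_self Q :: ('f, 'v, 'e, ('f, 'v, 'e) preproj_elt) preproj_bimod"
  have sub: "Pow (carrier (cochains Q ?N p)) \<subseteq> Pow {f. acoch p f}" for p using cochains_self_acoch by blast
  show "carrier (HKcoh Q (preproj_self Q) p) \<subseteq> Pow {f. acoch p f}"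
    using transportsD(1)[OF self.transports_HK] sub by blast
  have e: "(\<lambda>x\<in>Wset Q 1. rc x) \<in> carrier (cochains Q ?N 1)"
  proof (rule self.coch_restrict)
    show "self.coch 1 rc" using acoch_rc[of 1] self.M.vs by (simp add: self.coch_def acoch_def linear_on_def)
  qed
  have "\<zero>\<^bsub>HKcoh Q ?N 1\<^esub> \<subseteq> carrier (cochains Q ?N 1)" using transportsD(4)[OF self.transports_HK] by blast
  then have F: "fundamental_class Q \<in> Pow (carrier (cochains Q ?N 1))"
    unfolding fundamental_class_def using transports_coset(1)[OF self.transports_theta _ e] by blast
  then show F': "fundamental_class Q \<in> Pow {f. acoch 1 f}" using sub by blast
  have "gtransports (\<lambda>p. Pow (Pow {f. acoch p f})) (\<lambda>p. Pow (Pow (carrier (cochains Q ?N p)))) (higher (fundamental_class Q) (HKcoh_gbimod Q ?N))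
    (higher (fundamental_class Q) (HKhom_gbimod Q ?N)) (\<lambda>p. (`) ((`) (self.theta p)))"
    by (rule gtransports_higher[OF self.gtransports_HK F'])
  then have "carrier (gcomp (HKcoh_hi_gbimod Q ?N) p) \<subseteq> Pow (Pow (carrier (cochains Q ?N p)))"
    unfolding gtransports_def HKcoh_hi_gbimod_def by (blast dest: transportsD(1))
  then show "carrier (gcomp (HKcoh_hi_gbimod Q (preproj_self Q)) p) \<subseteq> Pow (Pow {f. acoch p f})"
    using sub[of p] by blast
qed

theorem HK_duality:
  "gbimod_isomorphic (HKcoh Q (preproj_self Q)) (HKcoh_gbimod Q M) (HKhom_gbimod Q M)"
  by (rule gtransports_isomorphic[OF gtransports_HK HK_self_subset(1)])

theorem HK_hi_duality:
  "gbimod_isomorphic (gcomp (HKcoh_hi_gbimod Q (preproj_self Q))) (HKcoh_hi_gbimod Q M) (HKhom_hi_gbimod Q M)"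
  unfolding HKcoh_hi_gbimod_def[of Q M] HKhom_hi_gbimod_def[of Q M]
  by (rule gtransports_isomorphic[OF gtransports_higher[OF gtransports_HK HK_self_subset(3)] HK_self_subset(2)])

end

subsection \<open>Trivial complexes\<close>

text \<open>The span of the relations is a subspace for every \<open>r\<close> and \<open>l\<close>.
  This covers \<open>AW\<close>, \<open>koszul_space\<close> and, in all degrees,
  \<open>bimod_tensor\<close>.\<close>

lemma tensor_space_vspace: "vspace (tensor_space X S r Y l)"
  unfolding tensor_space_def tensor_rels_def
  by (rule quotient_vspace) (simp_all add: pm.subspace_span subspace_keys)

text \<open>This is one of the generating relations, the scalar relation with scalar 0.\<close>

lemma pure_zero_right:
  assumes "vspace Y" "x \<in> carrier X"
  shows "pure \<zero>\<^bsub>tensor_space X S r Y l\<^esub> x \<zero>\<^bsub>Y\<^esub> = \<zero>\<^bsub>tensor_space X S r Y l\<^esub>"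
proof -
  interpret Y: vspace Y by fact
  have "Poly_Mapping.single (x, 0 \<odot>\<^bsub>Y\<^esub> \<zero>\<^bsub>Y\<^esub>) 1 - Poly_Mapping.single (x, \<zero>\<^bsub>Y\<^esub>) 0 \<in> tensor_rels X S r Y l"
    unfolding tensor_rels_def by (rule pm.span_base) (use assms(2) Y.zero_closed in blast)
  then have "Poly_Mapping.single (x, \<zero>\<^bsub>Y\<^esub>) 1 - 0 \<in> tensor_rels X S r Y l" by simp
  moreover have "pm.subspace (tensor_rels X S r Y l)" unfolding tensor_rels_def by (rule pm.subspace_span)
  ultimately have "coset_of (tensor_rels X S r Y l) (Poly_Mapping.single (x, \<zero>\<^bsub>Y\<^esub>) 1) = coset_of (tensor_rels X S r Y l) 0"
    by (subst coset_of_eq_iff) simp_all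
  then show ?thesis unfolding pure_def by (subst r_coset_plus) (simp_all add: tensor_space_def)
qed

text \<open>A map that vanishes on all pairs is balanced for trivial reasons. This handles the maps
  on the Koszul complex in degrees with \<open>W p = {0}\<close>.\<close>

lemma (in tensor_product) tensor_lift_eq_zero:
  assumes "is_vector_space V" "\<And>x y. x \<in> carrier X \<Longrightarrow> y \<in> carrier Y \<Longrightarrow> \<phi> (x, y) = \<zero>\<^bsub>V\<^esub>" "z \<in> carrier T"
  shows "tensor_lift V \<phi> z = \<zero>\<^bsub>V\<^esub>"
proof -
  interpret V: vspace V using assms by (simp add: vspace_def)
  have bal: "balanced_map X S r Y l V \<phi>"
    unfolding balanced_map_def using assms(1,2) by (simp add: r_closed l_closed)
  show ?thesis using assms(3)
    by (induction z rule: tensor_induct) (simp_all add: tensor_lift_zero[OF bal] tensor_lift_tensor[OF bal] tensor_lift_add[OF bal] assms(2))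
qed

text \<open>An empty \<open>U\<close> is harmless: its only coset is empty, and \<open>U\<close>
  itself is the zero of the quotient.\<close>

lemma trivial_quotient:
  assumes "carrier V = {\<zero>\<^bsub>V\<^esub>}" "\<zero>\<^bsub>V\<^esub> \<oplus>\<^bsub>V\<^esub> \<zero>\<^bsub>V\<^esub> = \<zero>\<^bsub>V\<^esub>" "U \<subseteq> {\<zero>\<^bsub>V\<^esub>}"
  shows "trivial_space (quotient_space V U)"
proof -
  have "U +>\<^bsub>V\<^esub> \<zero>\<^bsub>V\<^esub> = U" using assms(2,3) by (auto simp: a_r_coset_def' subset_singleton_iff)
  then show ?thesis using assms(1) by (auto simp: trivial_space_def quotient_space_def A_RCOSETS_def')
qed

lemma trivial_cohomology:
  assumes "vspace (V p)" "carrier (V p) = {\<zero>\<^bsub>V p\<^esub>}" "d p \<zero>\<^bsub>V p\<^esub> = \<zero>\<^bsub>V (p + 1)\<^esub>"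
    "d (p - 1) ` carrier (V (p - 1)) \<subseteq> {\<zero>\<^bsub>V p\<^esub>}"
  shows "trivial_space (cohomology V d p)"
proof -
  interpret vspace "V p" by fact
  show ?thesis unfolding cohomology_def by (rule trivial_quotient) (use assms in auto)
qed

lemma trivial_homology:
  assumes "vspace (V p)" "carrier (V p) = {\<zero>\<^bsub>V p\<^esub>}" "d p \<zero>\<^bsub>V p\<^esub> = \<zero>\<^bsub>V (p - 1)\<^esub>"
    "d (p + 1) ` carrier (V (p + 1)) \<subseteq> {\<zero>\<^bsub>V p\<^esub>}"
  shows "trivial_space (homology V d p)"
proof -
  interpret vspace "V p" by fact
  show ?thesis unfolding homology_def by (rule trivial_quotient) (use assms in auto)
qed

subsection \<open>The Koszul bimodule complex\<close>

context koszul_quiver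
begin

lemma AW_tensor_product: "tensor_product A (H 0) (\<lambda>x c. x \<otimes>\<^bsub>A\<^esub> rc c) (Wspace Q p) (\<star>)"
proof -
  interpret m: monoid A by (rule ring_A)
  have "rc c \<in> carrier A" if "c \<in> H 0" for c using subsetD[OF H_subset that] by simp
  then show ?thesis
    by (intro tensor_product.intro vspace_A vspace_W tensor_product_axioms.intro) (simp_all add: W_H0_closed)
qed

abbreviation AWp :: "int \<Rightarrow> ('f, ('f, 'v, 'e) AW_elt) module" where "AWp \<equiv> AW Q"
abbreviation K :: "int \<Rightarrow> ('f, ('f, 'v, 'e) koszul_elt) module" where "K \<equiv> koszul_space Q"
abbreviation kp :: "int \<Rightarrow> ('f, 'v, 'e) preproj_elt \<Rightarrow> ('f, 'v, 'e) path_elt \<Rightarrow> ('f, 'v, 'e) preproj_elt \<Rightarrow> ('f, 'v, 'e) koszul_elt"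
  where "kp \<equiv> koszul_pure Q"

text \<open>The right action of \<open>k\<close> on \<open>A \<otimes> W\<close>, over which the
  second tensor product of \<open>koszul_space\<close> is balanced. Under this name
  \<open>koszul_space\<close> becomes an instance of \<open>tensor_product\<close>.\<close>

definition AW_right :: "int \<Rightarrow> ('f, 'v, 'e) AW_elt \<Rightarrow> ('f, 'v, 'e) path_elt \<Rightarrow> ('f, 'v, 'e) AW_elt" where
  "AW_right p X c = tensor_lift (AWp p) (\<lambda>(x, w). AW_pure Q p x (w \<star> c)) X"

lemma AW_vspace: "vspace (AWp p)"
  unfolding AW_def by (rule tensor_space_vspace)

lemma K_eq: "K p = tensor_space (AWp p) (H 0) (AW_right p) A (\<lambda>c y. rc c \<otimes>\<^bsub>A\<^esub> y)"
  by (simp add: koszul_space_def AW_right_def[abs_def])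

lemma K_vspace: "vspace (K p)"
  unfolding K_eq by (rule tensor_space_vspace)

abbreviation AWbal :: "int \<Rightarrow> ('f, 'n, 'z) module_scheme \<Rightarrow> (('f, 'v, 'e) preproj_elt \<times> ('f, 'v, 'e) path_elt \<Rightarrow> 'n) \<Rightarrow> bool" where
  "AWbal p V \<phi> \<equiv> balanced_map A (H 0) (\<lambda>x c. x \<otimes>\<^bsub>A\<^esub> rc c) (Wspace Q p) (\<star>) V \<phi>"

lemmas AW_pure_tensor = tensor_product.tensor_closed[OF AW_tensor_product, folded AW_def, folded AW_pure_def]
  tensor_product.tensor_add_left[OF AW_tensor_product, folded AW_def, folded AW_pure_def]
  tensor_product.tensor_add_right[OF AW_tensor_product, folded AW_def, folded AW_pure_def, simplified]
  tensor_product.tensor_smult_left[OF AW_tensor_product, folded AW_def, folded AW_pure_def]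
  tensor_product.tensor_smult_right[OF AW_tensor_product, folded AW_def, folded AW_pure_def, simplified]
  tensor_product.tensor_balanced[OF AW_tensor_product, folded AW_def, folded AW_pure_def]

lemma rc_in: "c \<in> H 0 \<Longrightarrow> rc c \<in> carrier A"
  by (rule rc_closed) (rule subsetD[OF H_subset])

lemma AWbal_right: assumes "c \<in> H 0" shows "AWbal p (AWp p) (\<lambda>(x, w). AW_pure Q p x (w \<star> c))"
proof -
  interpret v: vspace "AWp p" by (rule AW_vspace)
  show ?thesis unfolding balanced_map_def
    using assms v.vs by (simp add: AW_pure_tensor W_H0_closed path_mult_add_left path_mult_pscale_left path_mult_assoc)
qed

lemma AW_right_pure: "x \<in> carrier A \<Longrightarrow> w \<in> W p \<Longrightarrow> c \<in> H 0 \<Longrightarrow> AW_right p (AW_pure Q p x w) c = AW_pure Q p x (w \<star> c)"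
  unfolding AW_right_def AW_def AW_pure_def
  using tensor_product.tensor_lift_tensor[OF AW_tensor_product AWbal_right[unfolded AW_def AW_pure_def]] by simp

lemma AW_right_closed: "X \<in> carrier (AWp p) \<Longrightarrow> c \<in> H 0 \<Longrightarrow> AW_right p X c \<in> carrier (AWp p)"
  unfolding AW_right_def AW_def AW_pure_def
  using tensor_product.tensor_lift_closed[OF AW_tensor_product AWbal_right[unfolded AW_def AW_pure_def]] by simp

lemma K_tensor_product: "tensor_product (AWp p) (H 0) (AW_right p) A (\<lambda>c y. rc c \<otimes>\<^bsub>A\<^esub> y)"
proof -
  interpret m: monoid A by (rule ring_A)
  show ?thesis
    by (intro tensor_product.intro vspace_A AW_vspace tensor_product_axioms.intro) (simp_all add: AW_right_closed rc_in)
qed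

lemmas K_pure_tensor = tensor_product.tensor_closed[OF K_tensor_product, folded K_eq]
  tensor_product.tensor_add_left[OF K_tensor_product, folded K_eq]
  tensor_product.tensor_add_right[OF K_tensor_product, folded K_eq]
  tensor_product.tensor_smult_left[OF K_tensor_product, folded K_eq]
  tensor_product.tensor_smult_right[OF K_tensor_product, folded K_eq]

lemma kp_balanced:
  assumes "a \<in> carrier A" "w \<in> W p" "s \<in> H 0" "a' \<in> carrier A"
  shows "kp p (a \<otimes>\<^bsub>A\<^esub> rc s) w a' = kp p a (s \<star> w) a'" "kp p a (w \<star> s) a' = kp p a w (rc s \<otimes>\<^bsub>A\<^esub> a')"
  using tensor_product.tensor_balanced[OF K_tensor_product, folded K_eq, of "AW_pure Q p a w" p s a'] assms
  by (simp_all add: koszul_pure_def AW_pure_tensor AW_right_pure)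

lemma bal_kp_left:
  assumes "a \<in> carrier A" "a' \<in> carrier A"
  shows "bal 1 p (K p) (\<lambda>(x, w). kp p (a \<otimes>\<^bsub>A\<^esub> rc x) w a')"
proof -
  interpret m: monoid A by (rule ring_A)
  interpret v: vspace "K p" by (rule K_vspace)
  have r: "rc x \<in> carrier A" if "x \<in> W 1" for x using W_PA[OF that] by simp
  have b: "kp p (a \<otimes>\<^bsub>A\<^esub> rc (x \<star> s)) w a' = kp p (a \<otimes>\<^bsub>A\<^esub> rc x) (s \<star> w) a'" if "x \<in> W 1" "s \<in> H 0" "w \<in> W p" for x s w
  proof -
    have "a \<otimes>\<^bsub>A\<^esub> rc (x \<star> s) = (a \<otimes>\<^bsub>A\<^esub> rc x) \<otimes>\<^bsub>A\<^esub> rc s"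
      using that assms r rc_in rc_mult[OF W_PA[OF that(1)] subsetD[OF H_subset that(2)]] by (simp add: m.m_assoc)
    then show ?thesis using kp_balanced(1)[of "a \<otimes>\<^bsub>A\<^esub> rc x" w p s a'] that assms r by simp
  qed
  show ?thesis unfolding balanced_map_def split
    by (intro conjI ballI allI; (simp only: Wspace_simps)?)
      (use assms v.vs r b in \<open>simp_all add: rc_add rc_pscale ring_A(3) A_smult_mult koszul_pure_def AW_pure_tensor K_pure_tensor\<close>)
qed

lemma bal_kp_right:
  assumes "a \<in> carrier A" "a' \<in> carrier A"
  shows "bal p 1 (K p) (\<lambda>(w, x). kp p a w (rc x \<otimes>\<^bsub>A\<^esub> a'))"
proof -
  interpret m: monoid A by (rule ring_A)
  interpret v: vspace "K p" by (rule K_vspace)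
  have r: "rc x \<in> carrier A" if "x \<in> W 1" for x using W_PA[OF that] by simp
  have b: "kp p a (w \<star> s) (rc x \<otimes>\<^bsub>A\<^esub> a') = kp p a w (rc (s \<star> x) \<otimes>\<^bsub>A\<^esub> a')" if "x \<in> W 1" "s \<in> H 0" "w \<in> W p" for x s w
  proof -
    have "rc (s \<star> x) \<otimes>\<^bsub>A\<^esub> a' = rc s \<otimes>\<^bsub>A\<^esub> (rc x \<otimes>\<^bsub>A\<^esub> a')"
      using that assms r rc_in rc_mult[OF subsetD[OF H_subset that(2)] W_PA[OF that(1)]] by (simp add: m.m_assoc)
    then show ?thesis using kp_balanced(2)[of a w p s "rc x \<otimes>\<^bsub>A\<^esub> a'"] that assms r by simp
  qed
  show ?thesis unfolding balanced_map_def split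
    by (intro conjI ballI allI; (simp only: Wspace_simps)?)
      (use assms v.vs r b in \<open>simp_all add: rc_add rc_pscale ring_A(2) A_smult_mult koszul_pure_def AW_pure_tensor K_pure_tensor\<close>)
qed

lemma koszul_lift_eq_zero:
  assumes "is_vector_space V" "\<And>a w a'. a \<in> carrier A \<Longrightarrow> w \<in> W p \<Longrightarrow> a' \<in> carrier A \<Longrightarrow> \<phi> a w a' = \<zero>\<^bsub>V\<^esub>" "Z \<in> carrier (K p)"
  shows "koszul_lift V \<phi> Z = \<zero>\<^bsub>V\<^esub>"
  unfolding koszul_lift_def
proof (rule tensor_product.tensor_lift_eq_zero[OF K_tensor_product assms(1) _ assms(3)[unfolded K_eq]], simp only: split)
  fix X a' assume X: "X \<in> carrier (AWp p)" and a': "a' \<in> carrier A"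
  show "tensor_lift V (\<lambda>(a, w). \<phi> a w a') X = \<zero>\<^bsub>V\<^esub>"
    by (rule tensor_product.tensor_lift_eq_zero[OF AW_tensor_product assms(1) _ X[unfolded AW_def]]) (simp add: assms(2) a')
qed

lemma kp_zero: "a \<in> carrier A \<Longrightarrow> a' \<in> carrier A \<Longrightarrow> kp p a 0 a' = \<zero>\<^bsub>K p\<^esub>"
proof -
  assume a: "a \<in> carrier A" "a' \<in> carrier A"
  interpret v: vspace "K p" by (rule K_vspace)
  interpret w: vspace "AWp p" by (rule AW_vspace)
  have 0: "(0 :: ('f, 'v, 'e) path_elt) \<in> W p" by (rule pm.subspace_0[OF subspace_W])
  have "AW_pure Q p a 0 = 0 \<odot>\<^bsub>AWp p\<^esub> AW_pure Q p a 0" using AW_pure_tensor(5)[of a 0 p 0] a 0 by simp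
  then have "kp p a 0 a' = 0 \<odot>\<^bsub>K p\<^esub> kp p a 0 a'"
    using K_pure_tensor(4)[of "AW_pure Q p a 0" p a' 0] a 0 by (simp add: koszul_pure_def AW_pure_tensor)
  then show ?thesis using a 0 by (simp add: koszul_pure_def AW_pure_tensor K_pure_tensor)
qed

lemma K_trivial: assumes "p > 2" shows "carrier (K p) = {\<zero>\<^bsub>K p\<^esub>}"
proof -
  have "carrier (AWp p) = {\<zero>\<^bsub>AWp p\<^esub>}"
    unfolding AW_def by (rule tensor_product.trivial_tensor_right[OF AW_tensor_product]) (simp add: W_gt2 assms)
  then show ?thesis unfolding K_eq by (rule tensor_product.trivial_tensor_left[OF K_tensor_product])
qed

lemma koszul_simps [simp]:
  "carrier (koszul Q p) = carrier (K p)" "zero (koszul Q p) = zero (K p)" "add (koszul Q p) = add (K p)" "smult (koszul Q p) = smult (K p)"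
  "lact (koszul Q p) = (\<lambda>b Z. koszul_lift (K p) (\<lambda>a w a'. kp p (b \<otimes>\<^bsub>A\<^esub> a) w a') Z)"
  "ract (koszul Q p) = (\<lambda>Z b. koszul_lift (K p) (\<lambda>a w a'. kp p a w (a' \<otimes>\<^bsub>A\<^esub> b)) Z)"
  by (simp_all add: koszul_def module.extend_def bimod.fields_def)

lemma koszul_vspace: "vspace (koszul Q p :: ('f, 'v, 'e, ('f, 'v, 'e) koszul_elt) preproj_bimod)"
  by (rule vspace_cong[OF K_vspace]) simp_all

lemma koszul_d_zero:
  assumes "p > 2" "Z \<in> carrier (K p)"
  shows "koszul_d Q p Z = \<zero>\<^bsub>K (p - 1)\<^esub>"
proof -
  interpret v: vspace "K (p - 1)" by (rule K_vspace)
  show ?thesis unfolding koszul_d_def Let_def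
  proof (rule koszul_lift_eq_zero[OF v.vs _ assms(2)])
    fix a a' and w :: "('f, 'v, 'e) path_elt" assume a: "a \<in> carrier A" "a' \<in> carrier A" and "w \<in> W p"
    then have "w = 0" using W_gt2[OF assms(1)] by simp
    then show "split_sum Q (K (p - 1)) 1 (p - 1) (\<lambda>(x, w'). kp (p - 1) (a \<otimes>\<^bsub>A\<^esub> rc x) w' a') w \<oplus>\<^bsub>K (p - 1)\<^esub>
        (-1) powi p \<odot>\<^bsub>K (p - 1)\<^esub> split_sum Q (K (p - 1)) (p - 1) 1 (\<lambda>(w', x). kp (p - 1) a w' (rc x \<otimes>\<^bsub>A\<^esub> a')) w = \<zero>\<^bsub>K (p - 1)\<^esub>"
      using split_sum_zero[OF bal_kp_left[OF a, of "p - 1"]] split_sum_zero[OF bal_kp_right[OF a, of "p - 1"]] by simp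
  qed
qed

text \<open>In these degrees the two actions are lifts of zero maps. In particular the carrier is
  closed under them, as forming Hom and tensor products over \<open>A^e\<close> demands.\<close>

lemma koszul_action_trivial:
  assumes "p > 2" "a \<in> carrier A" "b \<in> carrier A" "Z \<in> carrier (K p)"
  shows "Ae_left (koszul Q p) (a, b) Z = \<zero>\<^bsub>K p\<^esub>"
proof -
  interpret m: monoid A by (rule ring_A)
  interpret v: vspace "K p" by (rule K_vspace)
  have "lact (koszul Q p) a Z = \<zero>\<^bsub>K p\<^esub>"
    unfolding koszul_simps by (rule koszul_lift_eq_zero[OF v.vs _ assms(4)]) (use assms W_gt2[OF assms(1)] in \<open>auto simp: kp_zero\<close>)
  moreover have "ract (koszul Q p) \<zero>\<^bsub>K p\<^esub> b = \<zero>\<^bsub>K p\<^esub>"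
    unfolding koszul_simps by (rule koszul_lift_eq_zero[OF v.vs _ v.zero_closed]) (use assms W_gt2[OF assms(1)] in \<open>auto simp: kp_zero\<close>)
  ultimately show ?thesis by (simp add: Ae_left_def del: koszul_simps)
qed

section \<open>The Koszul complex is nonzero in degree 2\<close>

text \<open>The ground field as a one-dimensional space: the target of a functional that detects a
  nonzero tensor.\<close>

definition field_space :: "('f, 'f) module" where
  "field_space = \<lparr>carrier = UNIV, mult = undefined, one = undefined, zero = 0, add = (+), smult = (*)\<rparr>"

lemma field_space_simps [simp]: "carrier field_space = UNIV" "zero field_space = 0" "add field_space = (+)" "smult field_space = (*)"
  by (simp_all add: field_space_def)

lemma vspace_field_space: "vspace field_space"
  by (rule vspaceI) (auto simp: algebra_simps)

text \<open>The coordinate at \<open>i\<close> of the augmentation from \<open>A\<close> to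
  \<open>k\<close>. Its independence of the chosen representative rests on
  \<open>I_lookup\<close>.\<close>

definition counit :: "'v \<Rightarrow> ('f, 'v, 'e) preproj_elt \<Rightarrow> 'f" where
  "counit i x = Poly_Mapping.lookup (SOME u. u \<in> x) (i, [], i)"

lemma counit_rc: "counit i (rc u) = Poly_Mapping.lookup u (i, [], i)"
proof -
  have "u \<in> rc u" using pm.subspace_0[OF subspace_I] by (simp add: rc_eq in_coset_of_iff)
  then have "(SOME v. v \<in> rc u) \<in> rc u" by (rule someI)
  then have "(SOME v. v \<in> rc u) - u \<in> I" by (simp add: rc_eq in_coset_of_iff)
  then have "Poly_Mapping.lookup ((SOME v. v \<in> rc u) - u) (i, [], i) = 0" by (rule I_lookup)
  then show ?thesis by (simp add: counit_def lookup_minus)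
qed

lemma counit_linear:
  assumes "x \<in> carrier A" "y \<in> carrier A" "c \<in> H 0"
  shows "counit i (x \<oplus>\<^bsub>A\<^esub> y) = counit i x + counit i y" "counit i (d \<odot>\<^bsub>A\<^esub> x) = d * counit i x"
    "counit i (x \<otimes>\<^bsub>A\<^esub> rc c) = counit i x * Poly_Mapping.lookup c (i, [], i)"
    "counit i (rc c \<otimes>\<^bsub>A\<^esub> x) = Poly_Mapping.lookup c (i, [], i) * counit i x"
proof -
  obtain u v where u: "u \<in> carrier PA" "x = rc u" and v: "v \<in> carrier PA" "y = rc v" using assms by (auto simp: carrier_A)
  have c: "c \<in> carrier PA" by (rule subsetD[OF H_subset assms(3)])
  show "counit i (x \<oplus>\<^bsub>A\<^esub> y) = counit i x + counit i y" unfolding u(2) v(2) rc_add[symmetric] counit_rc by (simp add: lookup_add)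
  show "counit i (d \<odot>\<^bsub>A\<^esub> x) = d * counit i x" unfolding u(2) rc_pscale[symmetric] counit_rc by simp
  show "counit i (x \<otimes>\<^bsub>A\<^esub> rc c) = counit i x * Poly_Mapping.lookup c (i, [], i)"
    unfolding u(2) rc_mult[OF u(1) c, symmetric] counit_rc by (simp add: lookup_mult_H0 assms(3))
  show "counit i (rc c \<otimes>\<^bsub>A\<^esub> x) = Poly_Mapping.lookup c (i, [], i) * counit i x"
    unfolding u(2) rc_mult[OF c u(1), symmetric] counit_rc by (simp add: lookup_H0_mult assms(3))
qed

text \<open>A tensor is shown to be nonzero by a functional: the product of the augmentation at
  \<open>i\<close>, the coordinate at \<open>\<sigma> i\<close> and the augmentation at
  \<open>i\<close> takes the value 1 on \<open>1 \<otimes> \<sigma> i \<otimes> 1\<close>. It is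
  balanced because \<open>\<sigma> i\<close> begins and ends at \<open>i\<close>.\<close>

lemma K_2_nontrivial: "\<not> trivial_space (K 2)"
proof -
  \<comment> \<open>Connectedness includes the existence of a vertex.\<close>
  obtain i where i: "i \<in> verts Q" using connected unfolding connected_def strongly_connected_def by auto
  interpret f: vspace field_space by (rule vspace_field_space)
  have ix: "Inl i \<in> Ix 2" using i by (simp add: Ix_def)
  let ?\<phi> = "\<lambda>(x, w). counit i x * co 2 (Inl i) w"
  let ?F = "tensor_lift field_space ?\<phi>"
  have b1: "AWbal 2 field_space ?\<phi>"
    unfolding balanced_map_def using f.vs
    by (simp add: counit_linear counit_linear(1,2)[OF _ _ unit_H] co_add co_pscale co_left algebra_simps tg_def)
  note F = tensor_product.tensor_lift_tensor[OF AW_tensor_product b1, folded AW_def, folded AW_pure_def]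
    tensor_product.tensor_lift_add[OF AW_tensor_product b1, folded AW_def]
    tensor_product.tensor_lift_smult[OF AW_tensor_product b1, folded AW_def]
    tensor_product.tensor_lift_zero[OF AW_tensor_product b1, folded AW_def]
  \<comment> \<open>Balancing over the second tensor sign requires the right action of
    \<open>k\<close> on \<open>A \<otimes> W\<close> to become multiplication by the coefficient at
    the trivial path of \<open>i\<close>; it is verified on pure tensors and extended
    additively.\<close>
  have FR: "?F (AW_right 2 X c) = ?F X * Poly_Mapping.lookup c (i, [], i)" if X: "X \<in> carrier (AWp 2)" and c: "c \<in> H 0" for X c
  proof -
    note R = tensor_product.tensor_lift_add[OF AW_tensor_product AWbal_right[OF c, unfolded AW_def AW_pure_def], folded AW_pure_def[unfolded AW_def], folded AW_def, folded AW_pure_def, folded AW_right_def]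
      tensor_product.tensor_lift_zero[OF AW_tensor_product AWbal_right[OF c, unfolded AW_def AW_pure_def], folded AW_def, folded AW_pure_def, folded AW_right_def]
    show ?thesis using X unfolding AW_def
    proof (induction X rule: tensor_product.tensor_induct[OF AW_tensor_product, consumes 1, case_names zero tensor add])
      case zero
      show ?case unfolding AW_def[symmetric] R(2) F(4) by simp
    next
      case (tensor x w)
      then have xw: "x \<in> carrier A" "w \<in> W 2" by simp_all
      have "?F (AW_right 2 (AW_pure Q 2 x w) c) = ?F (AW_pure Q 2 x w) * Poly_Mapping.lookup c (i, [], i)"
        using xw c by (simp add: AW_right_pure F(1) W_H0_closed co_right sc_def)
      then show ?case by (simp add: AW_pure_def AW_def)
    next
      case (add x y)
      then show ?case unfolding AW_def[symmetric] using AW_right_closed[OF _ c, of x 2] AW_right_closed[OF _ c, of y 2]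
        by (simp add: R(1) F(2) distrib_right)
    qed
  qed
  let ?\<psi> = "\<lambda>(X, y). ?F X * counit i y"
  have b2: "balanced_map (AWp 2) (H 0) (AW_right 2) A (\<lambda>c y. rc c \<otimes>\<^bsub>A\<^esub> y) field_space ?\<psi>"
    unfolding balanced_map_def using f.vs
    by (simp add: counit_linear counit_linear(1,2)[OF _ _ unit_H] F(2,3) FR algebra_simps)
  have one: "rc unit \<in> carrier A" using unit_PA by simp
  have s: "\<sigma> i \<in> W 2" using i by (simp add: W_2 sigma_R)
  have u: "counit i (rc unit) = 1"
  proof -
    have "Poly_Mapping.lookup unit (i, [], i) = (\<Sum>j\<in>verts Q. if j = i then 1 else 0)"
      unfolding unit_def lookup_sum by (intro sum.cong) (auto simp: lookup_single when_def)
    then show ?thesis using i by (simp add: counit_rc)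
  qed
  have c1: "co 2 (Inl i) (\<sigma> i) = 1" using co_bas[OF ix ix] by (simp add: bas_def)
  have "tensor_lift field_space ?\<psi> (kp 2 (rc unit) (\<sigma> i) (rc unit)) = 1"
    using tensor_product.tensor_lift_tensor[OF K_tensor_product b2, folded K_eq, of "AW_pure Q 2 (rc unit) (\<sigma> i)" "rc unit"] one s
    by (simp add: koszul_pure_def AW_pure_tensor F(1) u c1)
  moreover have "tensor_lift field_space ?\<psi> \<zero>\<^bsub>K 2\<^esub> = 0"
    using tensor_product.tensor_lift_zero[OF K_tensor_product b2, folded K_eq] by simp
  ultimately have "kp 2 (rc unit) (\<sigma> i) (rc unit) \<noteq> \<zero>\<^bsub>K 2\<^esub>" by auto
  moreover have "kp 2 (rc unit) (\<sigma> i) (rc unit) \<in> carrier (K 2)"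
    using one s by (simp add: koszul_pure_def AW_pure_tensor K_pure_tensor)
  ultimately show ?thesis by (auto simp: trivial_space_def)
qed

lemma koszul_length: "has_length (koszul Q :: int \<Rightarrow> ('f, 'v, 'e, ('f, 'v, 'e) koszul_elt) preproj_bimod) 2"
  using K_2_nontrivial K_trivial by (simp add: has_length_def trivial_space_def)

end

section \<open>Vanishing of (co)homology above degree 2\<close>

context koszul_bimodule
begin

lemma HKcoh_trivial: assumes "p > 2" shows "trivial_space (HKcoh Q M p)"
proof -
  have triv: "carrier (cochains Q M n) = {\<zero>\<^bsub>cochains Q M n\<^esub>}" if "n > 2" for n
  proof -
    interpret v: vspace "cochains Q M n" by (rule vspace_cochains)
    have "f = \<zero>\<^bsub>cochains Q M n\<^esub>" if "f \<in> carrier (cochains Q M n)" for f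
      using \<open>n > 2\<close> by (intro cochains_eqI[OF that v.zero_closed]) (simp add: Ix_def)
    then show ?thesis by blast
  qed
  interpret v: vspace "cochains Q M p" by (rule vspace_cochains)
  show ?thesis unfolding HKcoh_def
    using triv[of p] triv[of "p + 1"] assms cochain_d_closed[OF v.zero_closed] cochain_d_closed[of _ "p - 1"]
    by (intro trivial_cohomology vspace_cochains) auto
qed

lemma HKhom_trivial: assumes "p > 2" shows "trivial_space (HKhom Q M p)"
  unfolding HKhom_def using chains_trivial[of p] chain_d_zero[of p] chain_d_closed[of _ "p + 1"] assms
  by (intro trivial_homology vspace_C) auto

lemma lact_zero: "a \<in> carrier A \<Longrightarrow> lact M a \<zero>\<^bsub>M\<^esub> = \<zero>\<^bsub>M\<^esub>" and ract_zero: "a \<in> carrier A \<Longrightarrow> ract M \<zero>\<^bsub>M\<^esub> a = \<zero>\<^bsub>M\<^esub>"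
  using lact_smult[of a "\<zero>\<^bsub>M\<^esub>" 0] ract_smult[of a "\<zero>\<^bsub>M\<^esub>" 0] by simp_all

abbreviation bimod_hom :: "int \<Rightarrow> ('f, ('f, 'v, 'e) koszul_elt \<Rightarrow> 'm) module" where
  "bimod_hom p \<equiv> hom_space (carrier A \<times> carrier A) (koszul Q p) (Ae_left (koszul Q p)) M (Ae_left M)"

lemma bimod_hom_zero: "f \<in> carrier (bimod_hom p) \<Longrightarrow> f \<zero>\<^bsub>K p\<^esub> = \<zero>\<^bsub>M\<^esub>"
proof -
  interpret v: vspace "K p" by (rule K_vspace)
  assume f: "f \<in> carrier (bimod_hom p)"
  then have "\<forall>c. \<forall>x\<in>carrier (K p). f (c \<odot>\<^bsub>K p\<^esub> x) = c \<odot>\<^bsub>M\<^esub> f x" and "f \<zero>\<^bsub>K p\<^esub> \<in> carrier M"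
    by (auto simp: hom_space_def)
  then have "f (0 \<odot>\<^bsub>K p\<^esub> \<zero>\<^bsub>K p\<^esub>) = 0 \<odot>\<^bsub>M\<^esub> f \<zero>\<^bsub>K p\<^esub>" and "f \<zero>\<^bsub>K p\<^esub> \<in> carrier M" by blast+
  then show ?thesis by simp
qed

lemma bimod_Hom_trivial: assumes "p > 2" shows "trivial_space (bimod_Hom_cohomology Q M p)"
proof -
  have simps: "zero (bimod_hom n) = (\<lambda>x\<in>carrier (K n). \<zero>\<^bsub>M\<^esub>)" "add (bimod_hom n) = (\<lambda>f g. \<lambda>x\<in>carrier (K n). f x \<oplus>\<^bsub>M\<^esub> g x)" for n
    by (simp_all add: hom_space_def)
  have triv: "carrier (bimod_hom p) = {\<zero>\<^bsub>bimod_hom p\<^esub>}"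
  proof
    show "carrier (bimod_hom p) \<subseteq> {\<zero>\<^bsub>bimod_hom p\<^esub>}"
    proof
      fix f assume f: "f \<in> carrier (bimod_hom p)"
      then have "f \<in> extensional (carrier (K p))" by (auto simp: hom_space_def PiE_def)
      then show "f \<in> {\<zero>\<^bsub>bimod_hom p\<^esub>}"
        using bimod_hom_zero[OF f] K_trivial[OF assms] unfolding simps by (auto simp: extensional_def fun_eq_iff)
    qed
    interpret v: vspace "K p" by (rule K_vspace)
    \<comment> \<open>That the zero map commutes with the action uses that the action on the source
      does not leave its carrier.\<close>
    have "(\<lambda>x\<in>carrier (K p). \<zero>\<^bsub>M\<^esub>) \<in> carrier (bimod_hom p)"
      using koszul_action_trivial[OF assms]
      by (auto simp: hom_space_def lact_zero ract_zero, simp add: Ae_left_def lact_zero ract_zero)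
    then show "{\<zero>\<^bsub>bimod_hom p\<^esub>} \<subseteq> carrier (bimod_hom p)" unfolding simps by simp
  qed
  \<comment> \<open>The case \<open>n = 2\<close> matters: in degree 3 the incoming differential
    starts at a possibly nonzero Hom space. It vanishes because \<open>koszul_d\<close> is zero from
    degree 3 on and homomorphisms preserve zero.\<close>
  have z: "(\<lambda>Z\<in>carrier (koszul Q (n + 1)). c \<odot>\<^bsub>M\<^esub> f (koszul_d Q (n + 1) Z)) = \<zero>\<^bsub>bimod_hom (n + 1)\<^esub>"
    if "n \<ge> 2" "f \<zero>\<^bsub>K n\<^esub> = \<zero>\<^bsub>M\<^esub>" for n c f
    unfolding simps using that koszul_d_zero[of "n + 1"] by (auto simp: fun_eq_iff)
  interpret v: vspace "K p" by (rule K_vspace)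
  show ?thesis unfolding bimod_Hom_cohomology_def cohomology_def
  proof (rule trivial_quotient)
    let ?d = "\<lambda>p f. \<lambda>Z\<in>carrier (koszul Q (p + 1)). (- ((-1) powi p)) \<odot>\<^bsub>M\<^esub> f (koszul_d Q (p + 1) Z)"
    have dz: "?d p \<zero>\<^bsub>bimod_hom p\<^esub> = \<zero>\<^bsub>bimod_hom (p + 1)\<^esub>"
      using assms by (intro z) (simp_all add: simps)
    show "carrier ((bimod_hom p)\<lparr>carrier := {x \<in> carrier (bimod_hom p). ?d p x = \<zero>\<^bsub>bimod_hom (p + 1)\<^esub>}\<rparr>) =
      {\<zero>\<^bsub>(bimod_hom p)\<lparr>carrier := {x \<in> carrier (bimod_hom p). ?d p x = \<zero>\<^bsub>bimod_hom (p + 1)\<^esub>}\<rparr>\<^esub>}"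
      using triv dz by auto
    have "?d (p - 1) f = \<zero>\<^bsub>bimod_hom (p - 1 + 1)\<^esub>" if "f \<in> carrier (bimod_hom (p - 1))" for f
      using assms bimod_hom_zero[OF that] by (intro z) simp_all
    then show "?d (p - 1) ` carrier (bimod_hom (p - 1)) \<subseteq> {\<zero>\<^bsub>(bimod_hom p)\<lparr>carrier := {x \<in> carrier (bimod_hom p). ?d p x = \<zero>\<^bsub>bimod_hom (p + 1)\<^esub>}\<rparr>\<^esub>}"
      by auto
  qed (simp add: simps fun_eq_iff)
qed

lemma bimod_tensor_trivial: assumes "p > 2" shows "trivial_space (bimod_tensor_homology Q M p)"
proof -
  let ?T = "bimod_tensor Q M"
  \<comment> \<open>Above degree 2 the closure conditions of the locale follow from
    \<open>koszul_action_trivial\<close>. These degrees suffice, since the incoming differential at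
    \<open>p\<close> also starts above degree 2.\<close>
  have tp: "tensor_product M (carrier A \<times> carrier A) (Ae_right M) (koszul Q n) (Ae_left (koszul Q n))" if "n > 2" for n
  proof -
    interpret v: vspace "K n" by (rule K_vspace)
    show ?thesis using koszul_action_trivial[OF that]
      by (intro tensor_product.intro vspace_M koszul_vspace tensor_product_axioms.intro) (auto simp: Ae_right_def)
  qed
  have vs: "vspace (?T n)" for n unfolding bimod_tensor_def by (rule tensor_space_vspace)
  have triv: "carrier (?T n) = {\<zero>\<^bsub>?T n\<^esub>}" if "n > 2" for n
    unfolding bimod_tensor_def using K_trivial[OF that] by (intro tensor_product.trivial_tensor_right[OF tp[OF that]]) simp
  let ?d = "\<lambda>p. tensor_lift (?T (p - 1)) (\<lambda>(m, Z). pure \<zero>\<^bsub>?T (p - 1)\<^esub> m (koszul_d Q p Z))"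
  have d: "?d n z = \<zero>\<^bsub>?T (n - 1)\<^esub>" if n: "n > 2" and z: "z \<in> carrier (?T n)" for n z
  proof (rule tensor_product.tensor_lift_eq_zero[OF tp[OF n] _ _ z[unfolded bimod_tensor_def]])
    show "is_vector_space (?T (n - 1))" using vs by (simp add: vspace_def)
    fix m and Z :: "('f, 'v, 'e) koszul_elt" assume m: "m \<in> carrier M" and Z: "Z \<in> carrier (koszul Q n)"
    have "koszul_d Q n Z = \<zero>\<^bsub>koszul Q (n - 1)\<^esub>" using koszul_d_zero[OF n] Z by simp
    then show "(case (m, Z) of (m, Z) \<Rightarrow> pure \<zero>\<^bsub>?T (n - 1)\<^esub> m (koszul_d Q n Z)) = \<zero>\<^bsub>?T (n - 1)\<^esub>"
      unfolding bimod_tensor_def using pure_zero_right[OF koszul_vspace m] by simp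
  qed
  interpret v: vspace "?T p" by (rule vs)
  show ?thesis unfolding bimod_tensor_homology_def
    using d[OF assms v.zero_closed] d[of "p + 1"] assms by (intro trivial_homology vs triv) auto
qed

end

theorem theorem1p1:
  fixes Q :: "('v, 'e) pre_digraph"
    and M :: "('f::field, 'v, 'e, 'm) preproj_bimod"
  assumes "fin_digraph Q"
    and "Digraph_Component.connected Q"
    and "\<not> underlying_A1 Q"
    and "\<not> underlying_A2 Q"
    and "is_bimodule (preproj Q) M"
  shows
    \<comment> \<open>(i)\<close>
    "(has_length (koszul Q :: int \<Rightarrow> ('f, 'v, 'e, ('f, 'v, 'e) koszul_elt) preproj_bimod) 2 \<and>
      (\<forall>p>2. trivial_space (bimod_Hom_cohomology Q M p) \<and> trivial_space (HKcoh Q M p) \<and>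
             trivial_space (bimod_tensor_homology Q M p) \<and> trivial_space (HKhom Q M p))) \<and>
     \<comment> \<open>(ii)\<close>
     gbimod_isomorphic (HKcoh Q (preproj_self Q)) (HKcoh_gbimod Q M) (HKhom_gbimod Q M) \<and>
     \<comment> \<open>(iii)\<close>
     gbimod_isomorphic (gcomp (HKcoh_hi_gbimod Q (preproj_self Q)))
       (HKcoh_hi_gbimod Q M) (HKhom_hi_gbimod Q M)"
proof -
  interpret koszul_bimodule Q "TYPE('f)" M
    by (intro koszul_bimodule.intro koszul_quiver.intro quiver.intro koszul_quiver_axioms.intro koszul_bimodule_axioms.intro assms)
  show ?thesis
    using koszul_length bimod_Hom_trivial HKcoh_trivial bimod_tensor_trivial HKhom_trivial HK_duality HK_hi_duality by simp
qed

end
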